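(* Let $k\ge 2$ be a fixed integer. The problem of deciding, given a temporal digraph $\mathcal{G}=(G,\gamma,\lambda)$ and subsets $R_1,\dots,R_k\subseteq V_T$, whether $\mathcal{G}$ has $k$ pairwise edge-disjoint temporal-spanning branchings rooted at $R_1,\dots,R_k$ respectively, is $\mathsf{NP}$-complete, even when $\mathcal{G}$ has lifetime $3$.
   Context: A temporal digraph is a triple $\mathcal{G}=(G,\gamma,\lambda)$ where $G$ is a finite digraph, $\gamma(v)\subseteq\mathbb{N}$ for each $v\in V(G)$, and $\lambda(e)\subseteq\mathbb{N}\times\mathbb{N}$ for each $e\in E(G)$, such that if $(t,t')\in\lambda(uv)$ then $t\le t'$, $t\in\gamma(u)$, $t'\in\gamma(v)$. The lifetime is $\max\bigcup_v\gamma(v)$. Temporal vertices: $V_T=\{(v,t):t\in\gamma(v)\}$; temporal edges: $(u,t)(v,t')$ for $uv\in E(G)$, $(t,t')\in\lambda(uv)$. A temporal walk is a sequence of temporal vertices and temporal edges in which each temporal edge goes from the preceding to the following temporal vertex, and any two consecutive temporal vertices are $(v,t),(v,t+1)$. A temporal subdigraph is $(G',\gamma',\lambda')$ with $G'\subseteq G,\gamma'\subseteq\gamma,\lambda'\subseteq\lambda$. For $R\subseteq V_T$, a temporal subdigraph $\mathcal{B}$ is a temporal-spanning branching with root $R$ if every $(u,i)\in V_T$ is the end of exactly one temporal walk in $\mathcal{B}$ starting at a vertex of $R$. Branchings $(G_1,\gamma_1,\lambda_1),(G_2,\gamma_2,\lambda_2)$ are edge-disjoint if $E(G_1)\cap E(G_2)=\emptyset$.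 *)

theory Defs
  imports "Graph_Theory.Pair_Digraph" "Graph_Theory.Digraph_Component"
    "HOL-Computational_Algebra.Polynomial"
begin

section \<open>Temporal digraphs\<close>

text \<open>The values of \<open>active\<close> outside the vertex set and of \<open>links\<close> outside the arc set of the
  underlying digraph carry no information; no definition below depends on them.\<close>

record 'a temporal_digraph =
  dgraph :: "'a pair_pre_digraph"
  active :: "'a \<Rightarrow> nat set"
  links :: "'a \<times> 'a \<Rightarrow> (nat \<times> nat) set"

text \<open>Finiteness of the sets \<open>active T v\<close> is implicit in the lifetime being a maximum, and in
  temporal digraphs being inputs of a decision problem.\<close>

definition temporal_digraph :: "'a temporal_digraph \<Rightarrow> bool" where
  "temporal_digraph T \<longleftrightarrow>
     pair_fin_digraph (dgraph T) \<and>
     (\<forall>v \<in> pverts (dgraph T). finite (active T v)) \<and>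
     (\<forall>(u, v) \<in> parcs (dgraph T). \<forall>(t, t') \<in> links T (u, v).
        t \<le> t' \<and> t \<in> active T u \<and> t' \<in> active T v)"

definition tverts :: "'a temporal_digraph \<Rightarrow> ('a \<times> nat) set" where
  "tverts T = {(v, t). v \<in> pverts (dgraph T) \<and> t \<in> active T v}"

definition tedges :: "'a temporal_digraph \<Rightarrow> (('a \<times> nat) \<times> ('a \<times> nat)) set" where
  "tedges T = {((u, t), (v, t')). (u, v) \<in> parcs (dgraph T) \<and> (t, t') \<in> links T (u, v)}"

text \<open>A temporal digraph without temporal vertices has no lifetime.\<close>

definition has_lifetime :: "'a temporal_digraph \<Rightarrow> nat \<Rightarrow> bool" where
  "has_lifetime T \<tau> \<longleftrightarrow>
     (\<Union>v \<in> pverts (dgraph T). active T v) \<noteq> {} \<and>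
     Max (\<Union>v \<in> pverts (dgraph T). active T v) = \<tau>"

datatype 'a walk_item = TVert "'a \<times> nat" | TEdge "('a \<times> nat) \<times> ('a \<times> nat)"

inductive temporal_walk :: "'a temporal_digraph \<Rightarrow> 'a walk_item list \<Rightarrow> bool"
  for T :: "'a temporal_digraph" where
  single: "x \<in> tverts T \<Longrightarrow> temporal_walk T [TVert x]"
| edge: "x \<in> tverts T \<Longrightarrow> (x, y) \<in> tedges T \<Longrightarrow> temporal_walk T (TVert y # w) \<Longrightarrow>
    temporal_walk T (TVert x # TEdge (x, y) # TVert y # w)"
| wait: "(v, t) \<in> tverts T \<Longrightarrow> temporal_walk T (TVert (v, t + 1) # w) \<Longrightarrow>
    temporal_walk T (TVert (v, t) # TVert (v, t + 1) # w)"

definition temporal_subdigraph :: "'a temporal_digraph \<Rightarrow> 'a temporal_digraph \<Rightarrow> bool" where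
  "temporal_subdigraph B T \<longleftrightarrow>
     temporal_digraph B \<and>
     subgraph (with_proj (dgraph B)) (with_proj (dgraph T)) \<and>
     (\<forall>v \<in> pverts (dgraph B). active B v \<subseteq> active T v) \<and>
     (\<forall>e \<in> parcs (dgraph B). links B e \<subseteq> links T e)"

definition temporal_spanning_branching ::
    "'a temporal_digraph \<Rightarrow> ('a \<times> nat) set \<Rightarrow> 'a temporal_digraph \<Rightarrow> bool" where
  "temporal_spanning_branching T R B \<longleftrightarrow>
     temporal_subdigraph B T \<and>
     (\<forall>x \<in> tverts T. \<exists>!w. temporal_walk B w \<and> hd w \<in> TVert ` R \<and> last w = TVert x)"

definition edge_disjoint :: "'a temporal_digraph \<Rightarrow> 'a temporal_digraph \<Rightarrow> bool" where
  "edge_disjoint B B' \<longleftrightarrow> parcs (dgraph B) \<inter> parcs (dgraph B') = {}"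

definition has_disjoint_branchings ::
    "'a temporal_digraph \<Rightarrow> ('a \<times> nat) set list \<Rightarrow> bool" where
  "has_disjoint_branchings T Rs \<longleftrightarrow>
     (\<exists>Bs. length Bs = length Rs \<and>
        (\<forall>i < length Rs. temporal_spanning_branching T (Rs ! i) (Bs ! i)) \<and>
        (\<forall>i < length Rs. \<forall>j < length Rs. i \<noteq> j \<longrightarrow> edge_disjoint (Bs ! i) (Bs ! j)))"


section \<open>The class NP and NP-completeness\<close>

text \<open>Nondeterministic Turing machines with finitely many two-way infinite tapes. States and tape
  symbols are natural numbers, of which the finite transition relation mentions only finitely many.
  The symbol 0 is the blank; the input bits are written as 1 and 2. A transition
  \<open>(q, as, q', bs, ds)\<close> leads from state \<open>q\<close>, when the tapes show the symbols \<open>as\<close>, to state \<open>q'\<close>,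
  writing the symbols \<open>bs\<close> and moving the heads by \<open>ds\<close>. A machine halts when no transition
  applies.\<close>

datatype move = MLeft | MStay | MRight

fun displacement :: "move \<Rightarrow> int" where
  "displacement MLeft = - 1"
| "displacement MStay = 0"
| "displacement MRight = 1"

record tm =
  ntapes :: nat
  start :: nat
  accept :: nat
  trans :: "(nat \<times> nat list \<times> nat \<times> nat list \<times> move list) set"

definition wf_tm :: "tm \<Rightarrow> bool" where
  "wf_tm M \<longleftrightarrow> ntapes M \<ge> 1 \<and> finite (trans M) \<and>
     (\<forall>(q, as, q', bs, ds) \<in> trans M.
        length as = ntapes M \<and> length bs = ntapes M \<and> length ds = ntapes M)"

definition deterministic_tm :: "tm \<Rightarrow> bool" where
  "deterministic_tm M \<longleftrightarrow>
     (\<forall>q as r r'. (q, as, r) \<in> trans M \<longrightarrow> (q, as, r') \<in> trans M \<longrightarrow> r = r')"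

text \<open>A tape is given by its contents and the position of its head.\<close>

type_synonym tape = "(int \<Rightarrow> nat) \<times> int"
type_synonym config = "nat \<times> tape list"

definition scanned :: "tape \<Rightarrow> nat" where
  "scanned = (\<lambda>(c, h). c h)"

definition act :: "tape \<Rightarrow> nat \<times> move \<Rightarrow> tape" where
  "act = (\<lambda>(c, h) (b, d). (c(h := b), h + displacement d))"

definition tm_step :: "tm \<Rightarrow> config \<Rightarrow> config \<Rightarrow> bool" where
  "tm_step M = (\<lambda>(q, tps) (q', tps').
     \<exists>bs ds. (q, map scanned tps, q', bs, ds) \<in> trans M \<and> tps' = map2 act tps (zip bs ds))"

definition bit_symbol :: "bool \<Rightarrow> nat" where
  "bit_symbol b = (if b then 2 else 1)"

definition input_tape :: "bool list \<Rightarrow> tape" where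
  "input_tape x =
     ((\<lambda>i. if 0 \<le> i \<and> i < int (length x) then bit_symbol (x ! nat i) else 0), 0)"

definition initial_config :: "tm \<Rightarrow> bool list \<Rightarrow> config" where
  "initial_config M x = (start M, input_tape x # replicate (ntapes M - 1) (\<lambda>_. 0, 0))"

definition tm_accepts :: "tm \<Rightarrow> bool list \<Rightarrow> bool" where
  "tm_accepts M x \<longleftrightarrow>
     (\<exists>c. (tm_step M)\<^sup>*\<^sup>* (initial_config M x) c \<and> fst c = accept M)"

definition NP :: "bool list set set" where
  "NP = {L. \<exists>M (p :: nat poly). wf_tm M \<and>
     (\<forall>x n c. (tm_step M ^^ n) (initial_config M x) c \<longrightarrow> n \<le> poly p (length x)) \<and>
     (\<forall>x. x \<in> L \<longleftrightarrow> tm_accepts M x)}"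

text \<open>The output is read on the first tape, from the head rightwards up to the first blank.\<close>

definition shows_output :: "config \<Rightarrow> bool list \<Rightarrow> bool" where
  "shows_output = (\<lambda>(q, tps) y. case hd tps of (c, h) \<Rightarrow>
     (\<forall>i < length y. c (h + int i) = bit_symbol (y ! i)) \<and> c (h + int (length y)) = 0)"

definition polytime_computable :: "(bool list \<Rightarrow> bool list) \<Rightarrow> bool" where
  "polytime_computable f \<longleftrightarrow>
     (\<exists>M (p :: nat poly). wf_tm M \<and> deterministic_tm M \<and>
        (\<forall>x. \<exists>n c. n \<le> poly p (length x) \<and> (tm_step M ^^ n) (initial_config M x) c \<and>
           (\<nexists>c'. tm_step M c c') \<and> shows_output c (f x)))"

definition polytime_reducible :: "bool list set \<Rightarrow> bool list set \<Rightarrow> bool" where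
  "polytime_reducible L L' \<longleftrightarrow> (\<exists>f. polytime_computable f \<and> (\<forall>x. x \<in> L \<longleftrightarrow> f x \<in> L'))"

definition NP_complete :: "bool list set \<Rightarrow> bool" where
  "NP_complete L \<longleftrightarrow> L \<in> NP \<and> (\<forall>L' \<in> NP. polytime_reducible L' L)"


section \<open>Encoding of instances as bit strings\<close>

text \<open>Numbers are written in binary, least significant bit first, each bit \<open>b\<close> as \<open>0b\<close> and
  terminated by \<open>10\<close>; pairs are concatenated; lists are terminated by \<open>11\<close>.\<close>

fun binary_digits :: "nat \<Rightarrow> bool list" where
  "binary_digits n = (if n = 0 then [] else odd n # binary_digits (n div 2))"

declare binary_digits.simps [simp del]

definition enc_nat :: "nat \<Rightarrow> bool list" where
  "enc_nat n = concat (map (\<lambda>b. [False, b]) (binary_digits n)) @ [True, False]"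

definition enc_pair :: "('a \<Rightarrow> bool list) \<Rightarrow> ('b \<Rightarrow> bool list) \<Rightarrow> 'a \<times> 'b \<Rightarrow> bool list" where
  "enc_pair e e' = (\<lambda>(x, y). e x @ e' y)"

definition enc_list :: "('a \<Rightarrow> bool list) \<Rightarrow> 'a list \<Rightarrow> bool list" where
  "enc_list e xs = concat (map e xs) @ [True, True]"

abbreviation enc_nat2 :: "nat \<times> nat \<Rightarrow> bool list" where
  "enc_nat2 \<equiv> enc_pair enc_nat enc_nat"

text \<open>An instance is encoded by listing, in any order and without repetition, its vertices, its
  arcs, its temporal vertices, its temporal edges and, for each of its roots, the elements of that
  root. As every finite digraph is isomorphic to one whose vertices are natural numbers, only the
  latter are considered.\<close>

definition encodes :: "bool list \<Rightarrow> nat temporal_digraph \<Rightarrow> (nat \<times> nat) set list \<Rightarrow> bool" where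
  "encodes x T Rs \<longleftrightarrow>
     (\<exists>vs es tvs tes rs.
        distinct vs \<and> set vs = pverts (dgraph T) \<and>
        distinct es \<and> set es = parcs (dgraph T) \<and>
        distinct tvs \<and> set tvs = tverts T \<and>
        distinct tes \<and> set tes = tedges T \<and>
        list_all distinct rs \<and> map set rs = Rs \<and>
        x = enc_list enc_nat vs @ enc_list enc_nat2 es @ enc_list enc_nat2 tvs @
            enc_list (enc_pair enc_nat2 enc_nat2) tes @ concat (map (enc_list enc_nat2) rs))"

definition disjoint_branchings_problem :: "nat \<Rightarrow> bool list set" where
  "disjoint_branchings_problem k =
     {x. \<exists>T Rs. temporal_digraph T \<and> length Rs = k \<and> (\<forall>R \<in> set Rs. R \<subseteq> tverts T) \<and>
        encodes x T Rs \<and> has_disjoint_branchings T Rs}"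

definition disjoint_branchings_problem_lifetime :: "nat \<Rightarrow> nat \<Rightarrow> bool list set" where
  "disjoint_branchings_problem_lifetime k \<tau> =
     {x. \<exists>T Rs. temporal_digraph T \<and> has_lifetime T \<tau> \<and>
        length Rs = k \<and> (\<forall>R \<in> set Rs. R \<subseteq> tverts T) \<and>
        encodes x T Rs \<and> has_disjoint_branchings T Rs}"

text \<open>The encoding is unambiguous: a bit string determines the instance up to the irrelevant
  values of \<open>active\<close> and \<open>links\<close>.\<close>

definition prefix_code :: "('a \<Rightarrow> bool list) \<Rightarrow> bool" where
  "prefix_code e \<longleftrightarrow> (\<forall>x y s t. e x @ s = e y @ t \<longrightarrow> x = y \<and> s = t)"

lemma prefix_codeD: "prefix_code e \<Longrightarrow> e x @ s = e y @ t \<Longrightarrow> x = y \<and> s = t"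
  unfolding prefix_code_def by blast

lemma binary_digits_inj: "binary_digits m = binary_digits n \<Longrightarrow> m = n"
proof (induction m arbitrary: n rule: less_induct)
  case (less m)
  show ?case
  proof (cases "m = 0 \<or> n = 0")
    case True
    with less.prems show ?thesis
      by (auto simp: binary_digits.simps[of m] binary_digits.simps[of n] split: if_splits)
  next
    case False
    with less.prems have "odd m = odd n" "binary_digits (m div 2) = binary_digits (n div 2)"
      by (auto simp: binary_digits.simps[of m] binary_digits.simps[of n])
    moreover from this(2) have "m div 2 = n div 2" using less.IH[of "m div 2"] False by simp
    ultimately show ?thesis by (metis even_two_times_div_two odd_two_times_div_two_succ)
  qed
qed

lemma prefix_code_nat: "prefix_code enc_nat"
proof -
  have "bs = cs \<and> s = t"
    if "concat (map (\<lambda>b. [False, b]) bs) @ [True, False] @ s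
      = concat (map (\<lambda>b. [False, b]) cs) @ [True, False] @ t" for bs cs s t
    using that
  proof (induction bs arbitrary: cs)
    case Nil
    then show ?case by (cases cs) auto
  next
    case (Cons b bs)
    then show ?case by (cases cs) auto
  qed
  then show ?thesis
    unfolding prefix_code_def enc_nat_def by (metis append.assoc binary_digits_inj)
qed

lemma prefix_code_pair:
  assumes "prefix_code e" "prefix_code e'"
  shows "prefix_code (enc_pair e e')"
  unfolding prefix_code_def
proof (intro allI impI)
  fix x y s t
  assume "enc_pair e e' x @ s = enc_pair e e' y @ t"
  then have "e (fst x) @ (e' (snd x) @ s) = e (fst y) @ (e' (snd y) @ t)"
    by (simp add: enc_pair_def case_prod_beta)
  then have "fst x = fst y" "e' (snd x) @ s = e' (snd y) @ t"
    using prefix_codeD[OF assms(1)] by blast+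
  with prefix_codeD[OF assms(2)] show "x = y \<and> s = t" by (simp add: prod_eq_iff)
qed

lemma enc_nat_no_end: "enc_nat n @ s \<noteq> True # True # t"
  by (cases "binary_digits n") (auto simp: enc_nat_def)

lemma enc_pair_no_end:
  "(\<And>x s t. e x @ s \<noteq> True # True # t) \<Longrightarrow> enc_pair e e' z @ s \<noteq> True # True # t"
  by (cases z) (simp add: enc_pair_def)

lemma prefix_code_list:
  assumes "prefix_code e" and no_end: "\<And>x s t. e x @ s \<noteq> True # True # t"
  shows "prefix_code (enc_list e)"
proof -
  have "xs = ys \<and> s = t" if "enc_list e xs @ s = enc_list e ys @ t" for xs ys s t
    using that
  proof (induction xs arbitrary: ys)
    case Nil
    then show ?case
      using no_end[of "hd ys" "concat (map e (tl ys)) @ True # True # t" s]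
      by (cases ys) (simp_all add: enc_list_def)
  next
    case (Cons x xs)
    show ?case
    proof (cases ys)
      case Nil
      with Cons.prems no_end[of x "concat (map e xs) @ True # True # s" t] show ?thesis
        by (simp add: enc_list_def)
    next
      case ys: (Cons y ys')
      with Cons.prems have "e x @ (enc_list e xs @ s) = e y @ (enc_list e ys' @ t)"
        by (simp add: enc_list_def)
      then have "x = y" "enc_list e xs @ s = enc_list e ys' @ t"
        using prefix_codeD[OF assms(1)] by blast+
      then show ?thesis using Cons.IH ys by blast
    qed
  qed
  then show ?thesis unfolding prefix_code_def by blast
qed

lemma prefix_code_concat:
  assumes "prefix_code e" "length rs = length rs'" "concat (map e rs) = concat (map e rs')"
  shows "rs = rs'"
  using assms(2,3)
proof (induction rs rs' rule: list_induct2)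
  case (Cons r rs r' rs')
  from Cons.prems have "e r @ concat (map e rs) = e r' @ concat (map e rs')" by simp
  then have "r = r'" "concat (map e rs) = concat (map e rs')"
    using prefix_codeD[OF assms(1)] by blast+
  with Cons.IH show ?case by blast
qed simp

lemma encodes_unique:
  assumes "encodes x T Rs" "encodes x T' Rs'" "length Rs = length Rs'"
  shows "dgraph T = dgraph T' \<and> tverts T = tverts T' \<and> tedges T = tedges T' \<and> Rs = Rs'"
proof -
  have no_end2: "enc_nat2 z @ s \<noteq> True # True # t" for z s t
    by (rule enc_pair_no_end) (rule enc_nat_no_end)
  have no_end4: "enc_pair enc_nat2 enc_nat2 z @ s \<noteq> True # True # t" for z s t
    by (rule enc_pair_no_end) (rule no_end2)
  have pc2: "prefix_code enc_nat2"
    by (intro prefix_code_pair prefix_code_nat)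
  have pl: "prefix_code (enc_list enc_nat)" "prefix_code (enc_list enc_nat2)"
    "prefix_code (enc_list (enc_pair enc_nat2 enc_nat2))"
    by (intro prefix_code_list prefix_code_pair prefix_code_nat enc_nat_no_end no_end2 no_end4)+
  obtain vs es tvs tes rs where 1: "set vs = pverts (dgraph T)" "set es = parcs (dgraph T)"
    "set tvs = tverts T" "set tes = tedges T" "map set rs = Rs"
    "x = enc_list enc_nat vs @ enc_list enc_nat2 es @ enc_list enc_nat2 tvs @
         enc_list (enc_pair enc_nat2 enc_nat2) tes @ concat (map (enc_list enc_nat2) rs)"
    using assms(1) unfolding encodes_def by blast
  obtain vs' es' tvs' tes' rs' where 2: "set vs' = pverts (dgraph T')" "set es' = parcs (dgraph T')"
    "set tvs' = tverts T'" "set tes' = tedges T'" "map set rs' = Rs'"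
    "x = enc_list enc_nat vs' @ enc_list enc_nat2 es' @ enc_list enc_nat2 tvs' @
         enc_list (enc_pair enc_nat2 enc_nat2) tes' @ concat (map (enc_list enc_nat2) rs')"
    using assms(2) unfolding encodes_def by blast
  note eq = 1(6)[unfolded 2(6)]
  have a: "vs' = vs" using prefix_codeD[OF pl(1) eq] by blast
  note eq2 = conjunct2[OF prefix_codeD[OF pl(1) eq]]
  note eq3 = conjunct2[OF prefix_codeD[OF pl(2) eq2]]
  note eq4 = conjunct2[OF prefix_codeD[OF pl(2) eq3]]
  note eq5 = conjunct2[OF prefix_codeD[OF pl(3) eq4]]
  have b: "es' = es" "tvs' = tvs" "tes' = tes"
    using prefix_codeD[OF pl(2) eq2] prefix_codeD[OF pl(2) eq3] prefix_codeD[OF pl(3) eq4] by auto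
  have "length rs' = length rs" using 1(5) 2(5) assms(3) by (metis length_map)
  then have "rs' = rs" using prefix_code_concat[OF pl(2) _ eq5] by blast
  moreover have "dgraph T = dgraph T'"
    by (rule pair_pre_digraph.equality) (simp_all add: 1(1,2)[symmetric] 2(1,2)[symmetric] a b)
  ultimately show ?thesis
    by (simp add: 1(3-5)[symmetric] 2(3-5)[symmetric] b)
qed

end

theory Submission
  imports Defs
begin

text \<open>A property of words that is first-order over a guessed table of binary relations on positions
  is decided by loops over positions, hence lies in \<open>NP\<close>; an output generated by first-order definable
  case distinctions and loops over positions is computable in polynomial time.

  Membership: walks that reach every temporal vertex exactly once exist iff every temporal vertex
  outside the root has exactly one incoming step, every root vertex has none, and steps decrease
  some rank. So edge sets and strict orders can be guessed; parsing the encoding and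
  comparing its numbers is local, as relations defined by recursion along the word.

  Hardness: by the argument of Cook and Levin, acceptance within a polynomial bound is satisfiability
  of a formula whose clauses are first-order definable. Such a formula becomes a temporal digraph with
  times 1 and 3, where nothing can wait. The first root contains all temporal vertices of time 3, the second
  all of time 1, and further roots contain everything, so that only the first two branchings compete for arcs. At
  time 1 one has to use an arc of some literal of every clause, whereas at time 3, for each variable,
  one has to use all arcs of a literal or all arcs of its complement.\<close>

section \<open>Programs for Turing machines\<close>

text \<open>The obstacle is that the reduction has to be carried out by an actual Turing machine.
  Therefore vertices, clauses and variables are indexed by tuples of positions of one padded word
  together with constant tags: loops over positions enumerate them, and arcs as well as clause
  membership become first-order conditions. Padding the word to polynomial length turns a time bound
  into a range of positions.

  Consistency of the truth values rests on a cut. An arc from a source to an occurrence that is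
  spent at time 1 interrupts the chain of its literal at time 3. If the chains of a literal and of
  its complement were both interrupted, the parts behind the two gaps could only be entered from
  each other, hence from no root. So for each variable at most one of the two literals is spent, and
  it may be declared true.

  For membership, recursion along the word is expressible without a fixed point operator: a guessed
  relation satisfying the recursion equations must be the intended one, by well-founded
  induction.\<close>

datatype 'i com =
    Act 'i "nat option" move
  | Guess 'i "nat set"
  | Seq "'i com" "'i com"
  | If "('i \<times> nat set) list" "'i com" "'i com"
  | While "('i \<times> nat set) list" "'i com"

section \<open>While programs on tapes and their running time\<close>

type_synonym 'i tapes = "'i \<Rightarrow> tape"

definition holds :: "('i \<times> nat set) list \<Rightarrow> ('i \<Rightarrow> nat) \<Rightarrow> bool" where
  "holds b a \<longleftrightarrow> (\<forall>(i, A) \<in> set b. a i \<in> A)"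

abbreviation scan :: "'i tapes \<Rightarrow> 'i \<Rightarrow> nat" where
  "scan s \<equiv> \<lambda>i. scanned (s i)"

definition do_act :: "'i \<Rightarrow> nat option \<Rightarrow> move \<Rightarrow> 'i tapes \<Rightarrow> 'i tapes" where
  "do_act i wr d s = s(i := act (s i) (case wr of None \<Rightarrow> scanned (s i) | Some a \<Rightarrow> a, d))"

inductive exec :: "'i com \<Rightarrow> 'i tapes \<Rightarrow> nat \<Rightarrow> 'i tapes \<Rightarrow> bool" where
  Act: "exec (Act i wr d) s 1 (do_act i wr d s)"
| Guess: "a \<in> A \<Longrightarrow> exec (Guess i A) s 1 (do_act i (Some a) MStay s)"
| Seq: "exec c s m s' \<Longrightarrow> exec c' s' n s'' \<Longrightarrow> exec (Seq c c') s (m + n) s''"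
| IfT: "holds b (scan s) \<Longrightarrow> exec c s n s' \<Longrightarrow> exec (If b c c') s (Suc n) s'"
| IfF: "\<not> holds b (scan s) \<Longrightarrow> exec c' s n s' \<Longrightarrow> exec (If b c c') s (Suc n) s'"
| WhileF: "\<not> holds b (scan s) \<Longrightarrow> exec (While b c) s 1 s"
| WhileT: "holds b (scan s) \<Longrightarrow> exec c s m s' \<Longrightarrow> exec (While b c) s' n s'' \<Longrightarrow>
    exec (While b c) s (Suc (m + n)) s''"

text \<open>Total correctness for all nondeterministic choices: every run ends within the given time
  and satisfies the postcondition.\<close>

inductive tot :: "'i com \<Rightarrow> 'i tapes \<Rightarrow> nat \<Rightarrow> ('i tapes \<Rightarrow> bool) \<Rightarrow> bool" where
  Act: "Q (do_act i wr d s) \<Longrightarrow> tot (Act i wr d) s 1 Q"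
| Guess: "(\<And>a. a \<in> A \<Longrightarrow> Q (do_act i (Some a) MStay s)) \<Longrightarrow> tot (Guess i A) s 1 Q"
| Seq: "tot c s m R \<Longrightarrow> (\<And>s'. R s' \<Longrightarrow> tot c' s' n Q) \<Longrightarrow> tot (Seq c c') s (m + n) Q"
| IfT: "holds b (scan s) \<Longrightarrow> tot c s n Q \<Longrightarrow> tot (If b c c') s (Suc n) Q"
| IfF: "\<not> holds b (scan s) \<Longrightarrow> tot c' s n Q \<Longrightarrow> tot (If b c c') s (Suc n) Q"
| WhileF: "\<not> holds b (scan s) \<Longrightarrow> Q s \<Longrightarrow> tot (While b c) s 1 Q"
| WhileT: "holds b (scan s) \<Longrightarrow> tot c s m R \<Longrightarrow> (\<And>s'. R s' \<Longrightarrow> tot (While b c) s' n Q) \<Longrightarrow>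
    tot (While b c) s (Suc (m + n)) Q"
| Weaken: "tot c s n Q \<Longrightarrow> n \<le> m \<Longrightarrow> tot c s m Q"

fun guess_free :: "'i com \<Rightarrow> bool" where
  "guess_free (Act i wr d) = True"
| "guess_free (Guess i A) = False"
| "guess_free (Seq c c') = (guess_free c \<and> guess_free c')"
| "guess_free (If b c c') = (guess_free c \<and> guess_free c')"
| "guess_free (While b c) = guess_free c"

text \<open>Without guesses a run is the only run, so a single execution already gives total
  correctness. Only the guessing loop requires a direct proof of \<open>tot\<close>.\<close>

lemma exec_tot: "exec c s n s' \<Longrightarrow> guess_free c \<Longrightarrow> tot c s n (\<lambda>r. r = s')"
proof (induction rule: exec.induct)
  case (Seq c s m s' c' n s'')
  then show ?case by (auto intro!: tot.Seq)
next
  case (WhileT b s c m s' n s'')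
  then show ?case by (auto intro!: tot.WhileT)
qed (auto simp del: One_nat_def intro: tot.Act tot.IfT tot.IfF tot.WhileF)

fun tapes_of :: "'i com \<Rightarrow> 'i set" where
  "tapes_of (Act i wr d) = {i}"
| "tapes_of (Guess i A) = {i}"
| "tapes_of (Seq c c') = tapes_of c \<union> tapes_of c'"
| "tapes_of (If b c c') = fst ` set b \<union> tapes_of c \<union> tapes_of c'"
| "tapes_of (While b c) = fst ` set b \<union> tapes_of c"

fun writes_of :: "'i com \<Rightarrow> nat set" where
  "writes_of (Act i wr d) = set_option wr"
| "writes_of (Guess i A) = A"
| "writes_of (Seq c c') = writes_of c \<union> writes_of c'"
| "writes_of (If b c c') = writes_of c \<union> writes_of c'"
| "writes_of (While b c) = writes_of c"

lemma finite_tapes_of: "finite (tapes_of c)"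
  by (induction c) auto

lemma finite_writes_of: "guess_free c \<Longrightarrow> finite (writes_of c)"
  by (induction c) auto

section \<open>Compilation of programs to Turing machines\<close>

fun num_states :: "'i com \<Rightarrow> nat" where
  "num_states (Act i wr d) = 1"
| "num_states (Guess i A) = 1"
| "num_states (Seq c c') = num_states c + num_states c'"
| "num_states (If b c c') = Suc (num_states c + num_states c')"
| "num_states (While b c) = Suc (num_states c)"

lemma num_states_pos: "num_states c > 0"
  by (induction c) auto

context
  fixes ts :: "'i list" and K :: nat
begin

text \<open>Transitions are listed for every combination of scanned symbols, and tests may use
  infinite sets such as \<open>-{0}\<close>; the bound \<open>K\<close> keeps the transition
  relation finite.\<close>

definition legal :: "('i \<Rightarrow> nat) set" where
  "legal = {a. \<forall>i \<in> set ts. a i < K}"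

abbreviation (input) stay_all :: "'i \<Rightarrow> move" where
  "stay_all \<equiv> \<lambda>_. MStay"

text \<open>The program \<open>c\<close> owns the \<open>num_states c\<close> states from its entry
  \<open>q\<close> on and leaves to \<open>e\<close>; the body of a loop leaves to the test of the
  loop. A test is a step of its own that changes no tape.\<close>

fun compile :: "'i com \<Rightarrow> nat \<Rightarrow> nat \<Rightarrow> (nat \<times> nat list \<times> nat \<times> nat list \<times> move list) set" where
  "compile (Act i wr d) q e =
     {(q, map a ts, e, map (a(i := case wr of None \<Rightarrow> a i | Some x \<Rightarrow> x)) ts, map (stay_all(i := d)) ts)
       | a. a \<in> legal}"
| "compile (Guess i A) q e =
     {(q, map a ts, e, map (a(i := x)) ts, map stay_all ts) | a x. a \<in> legal \<and> x \<in> A}"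
| "compile (Seq c c') q e =
     compile c q (q + num_states c) \<union> compile c' (q + num_states c) e"
| "compile (If b c c') q e =
     {(q, map a ts, if holds b a then Suc q else Suc (q + num_states c), map a ts, map stay_all ts)
       | a. a \<in> legal}
     \<union> compile c (Suc q) e \<union> compile c' (Suc (q + num_states c)) e"
| "compile (While b c) q e =
     {(q, map a ts, if holds b a then Suc q else e, map a ts, map stay_all ts) | a. a \<in> legal}
     \<union> compile c (Suc q) q"

definition conf :: "nat \<Rightarrow> 'i tapes \<Rightarrow> config" where
  "conf q s = (q, map s ts)"

definition clean :: "'i tapes \<Rightarrow> bool" where
  "clean s \<longleftrightarrow> (\<forall>i \<in> set ts. \<forall>p. fst (s i) p < K)"

lemma clean_scan: "clean s \<Longrightarrow> scan s \<in> legal"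
  by (auto simp: clean_def legal_def scanned_def case_prod_beta)

lemma clean_do_act: "clean s \<Longrightarrow> set_option wr \<subseteq> {..<K} \<Longrightarrow> clean (do_act i wr d s)"
  by (auto simp: clean_def do_act_def act_def scanned_def case_prod_beta split: option.splits)

lemma exec_clean: "exec c s n s' \<Longrightarrow> clean s \<Longrightarrow> writes_of c \<subseteq> {..<K} \<Longrightarrow> clean s'"
  by (induction rule: exec.induct) (auto intro!: clean_do_act)

lemma compile_source: "(p, r) \<in> compile c q e \<Longrightarrow> q \<le> p \<and> p < q + num_states c"
proof (induction c arbitrary: q e)
  case (Seq c1 c2)
  then show ?case using num_states_pos[of c1] num_states_pos[of c2] by fastforce
qed (use num_states_pos in \<open>auto, fastforce+\<close>)

lemma map2_act_update:
  "map2 act (map s ts) (zip (map f ts) (map g ts)) = map (\<lambda>i. act (s i) (f i, g i)) ts"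
  by (induction ts) auto

lemma act_stay: "act t (scanned t, MStay) = t"
  by (cases t) (simp add: act_def scanned_def)

lemma tm_step_conf_iff:
  "tm_step M (conf q s) c' \<longleftrightarrow>
     (\<exists>q' bs ds. (q, map (scan s) ts, q', bs, ds) \<in> trans M \<and>
        c' = (q', map2 act (map s ts) (zip bs ds)))"
  by (cases c') (auto simp: tm_step_def conf_def comp_def)

lemma map_do_act:
  "map2 act (map s ts) (zip (map ((scan s)(i := case wr of None \<Rightarrow> scan s i | Some x \<Rightarrow> x)) ts)
     (map (stay_all(i := d)) ts)) = map (do_act i wr d s) ts"
  unfolding map2_act_update by (auto simp: do_act_def act_stay)

lemma map_do_nothing:
  "map2 act (map s ts) (zip (map (scan s) ts) (map stay_all ts)) = map s ts"
  unfolding map2_act_update by (simp add: act_stay)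

lemma map_guess:
  "map2 act (map s ts) (zip (map ((scan s)(i := x)) ts) (map stay_all ts)) =
   map (do_act i (Some x) MStay s) ts"
  using map_do_act[of s i "Some x" MStay] by (simp add: fun_upd_idem)

lemma exec_steps:
  assumes "exec c s n s'" "compile c q e \<subseteq> trans M" "clean s" "writes_of c \<subseteq> {..<K}"
  shows "(tm_step M ^^ n) (conf q s) (conf e s')"
  using assms
proof (induction arbitrary: q e rule: exec.induct)
  case (Act i wr d s)
  then have "(q, map (scan s) ts, e,
      map ((scan s)(i := case wr of None \<Rightarrow> scan s i | Some x \<Rightarrow> x)) ts, map (stay_all(i := d)) ts)
      \<in> trans M"
    using clean_scan[OF Act.prems(2)] by auto
  then have "tm_step M (conf q s) (conf e (do_act i wr d s))"
    unfolding tm_step_conf_iff using map_do_act[of s i wr d] unfolding conf_def by metis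
  then show ?case by (simp add: OO_def)
next
  case (Guess a A i s)
  then have "(q, map (scan s) ts, e, map ((scan s)(i := a)) ts, map stay_all ts) \<in> trans M"
    using clean_scan[OF Guess.prems(2)] by auto
  then have "tm_step M (conf q s) (conf e (do_act i (Some a) MStay s))"
    unfolding tm_step_conf_iff using map_guess[of s i a] unfolding conf_def by metis
  then show ?case by (simp add: OO_def)
next
  case (Seq c s m s' c' n s'')
  have "(tm_step M ^^ m) (conf q s) (conf (q + num_states c) s')"
    "(tm_step M ^^ n) (conf (q + num_states c) s') (conf e s'')"
    using Seq.IH Seq.prems exec_clean[OF Seq.hyps(1)] by auto
  then show ?case by (metis relpowp_trans)
next
  case (IfT b s c n s' c')
  then have "(q, map (scan s) ts, Suc q, map (scan s) ts, map stay_all ts) \<in> trans M"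
    using clean_scan[OF IfT.prems(2)] by auto
  then have "tm_step M (conf q s) (conf (Suc q) s)"
    unfolding tm_step_conf_iff using map_do_nothing[of s] unfolding conf_def by metis
  moreover have "(tm_step M ^^ n) (conf (Suc q) s) (conf e s')" using IfT by auto
  ultimately show ?case by (metis relpowp_Suc_I2)
next
  case (IfF b s c' n s' c)
  then have "(q, map (scan s) ts, Suc (q + num_states c), map (scan s) ts, map stay_all ts) \<in> trans M"
    using clean_scan[OF IfF.prems(2)] by auto
  then have "tm_step M (conf q s) (conf (Suc (q + num_states c)) s)"
    unfolding tm_step_conf_iff using map_do_nothing[of s] unfolding conf_def by metis
  moreover have "(tm_step M ^^ n) (conf (Suc (q + num_states c)) s) (conf e s')" using IfF by auto
  ultimately show ?case by (metis relpowp_Suc_I2)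
next
  case (WhileF b s c)
  then have "(q, map (scan s) ts, e, map (scan s) ts, map stay_all ts) \<in> trans M"
    using clean_scan[OF WhileF.prems(2)] by auto
  then have "tm_step M (conf q s) (conf e s)"
    unfolding tm_step_conf_iff using map_do_nothing[of s] unfolding conf_def by metis
  then show ?case by (simp add: OO_def)
next
  case (WhileT b s c m s' n s'')
  then have "(q, map (scan s) ts, Suc q, map (scan s) ts, map stay_all ts) \<in> trans M"
    using clean_scan[OF WhileT.prems(2)] by auto
  then have "tm_step M (conf q s) (conf (Suc q) s)"
    unfolding tm_step_conf_iff using map_do_nothing[of s] unfolding conf_def by metis
  moreover have "(tm_step M ^^ m) (conf (Suc q) s) (conf q s')"
    "(tm_step M ^^ n) (conf q s') (conf e s'')"
    using WhileT.IH WhileT.prems exec_clean[OF WhileT.hyps(2)] by auto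
  ultimately show ?case by (metis relpowp_Suc_I2 relpowp_trans)
qed

text \<open>Combines the two demands on all runs of an \<open>NP\<close> machine, the time bound and
  the soundness of acceptance, so that one backward induction proves both.\<close>

definition safe :: "tm \<Rightarrow> bool \<Rightarrow> nat \<Rightarrow> config \<Rightarrow> bool" where
  "safe M X n c \<longleftrightarrow>
     (\<forall>m c'. (tm_step M ^^ m) c c' \<longrightarrow> m \<le> n \<and> (fst c' = accept M \<longrightarrow> X))"

lemma safe_step:
  assumes "\<And>c'. tm_step M c c' \<Longrightarrow> safe M X n c'" "fst c \<noteq> accept M"
  shows "safe M X (Suc n) c"
  unfolding safe_def
proof (intro allI impI)
  fix m c'
  assume s: "(tm_step M ^^ m) c c'"
  show "m \<le> Suc n \<and> (fst c' = accept M \<longrightarrow> X)"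
  proof (cases m)
    case 0
    then show ?thesis using s assms(2) by auto
  next
    case (Suc m')
    then obtain c1 where "tm_step M c c1" "(tm_step M ^^ m') c1 c'"
      using s by (metis relpowp_Suc_D2)
    then show ?thesis using assms(1) Suc unfolding safe_def by fastforce
  qed
qed

lemma safe_halt: "(\<And>c'. \<not> tm_step M c c') \<Longrightarrow> (fst c = accept M \<Longrightarrow> X) \<Longrightarrow> safe M X n c"
  unfolding safe_def by (metis relpowp_E2 zero_le)

text \<open>For following one run it suffices that the compiled transitions are present; a claim
  about all runs also requires that the states of \<open>c\<close> have no others.\<close>

definition runs_at :: "tm \<Rightarrow> 'i com \<Rightarrow> nat \<Rightarrow> nat \<Rightarrow> bool" where
  "runs_at M c q e \<longleftrightarrow> (\<forall>p r. q \<le> p \<and> p < q + num_states c \<longrightarrow>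
     ((p, r) \<in> trans M \<longleftrightarrow> (p, r) \<in> compile c q e))"

lemma runs_at_Seq:
  assumes "runs_at M (Seq c c') q e"
  shows "runs_at M c q (q + num_states c)" "runs_at M c' (q + num_states c) e"
  using assms unfolding runs_at_def
  by (auto dest: compile_source)

lemma runs_at_If:
  assumes "runs_at M (If b c c') q e"
  shows "runs_at M c (Suc q) e" "runs_at M c' (Suc (q + num_states c)) e"
    "(q, r) \<in> trans M \<Longrightarrow> \<exists>a. a \<in> legal \<and> r = (map a ts,
       if holds b a then Suc q else Suc (q + num_states c), map a ts, map stay_all ts)"
  using assms unfolding runs_at_def
  by (auto dest: compile_source)

lemma runs_at_While:
  assumes "runs_at M (While b c) q e"
  shows "runs_at M c (Suc q) q"
    "(q, r) \<in> trans M \<Longrightarrow> \<exists>a. a \<in> legal \<and> r = (map a ts,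
       if holds b a then Suc q else e, map a ts, map stay_all ts)"
  using assms unfolding runs_at_def
  by (auto dest: compile_source)

lemma holds_cong: "fst ` set b \<subseteq> set ts \<Longrightarrow> map a ts = map a' ts \<Longrightarrow> holds b a = holds b a'"
  by (fastforce simp: holds_def)

text \<open>The remaining time \<open>m\<close> after the exit of \<open>c\<close> is arbitrary, as
  in a continuation; this lets the claim compose along sequences and loop iterations.\<close>

lemma tot_safe:
  assumes "tot c s n Q" "runs_at M c q e" "accept M \<notin> {q..<q + num_states c}"
    "tapes_of c \<subseteq> set ts" "\<And>s'. Q s' \<Longrightarrow> safe M X m (conf e s')"
  shows "safe M X (n + m) (conf q s)"
  using assms
proof (induction arbitrary: q e m rule: tot.induct)
  case (Act Q i wr d s)
  show ?case unfolding plus_1_eq_Suc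
  proof (rule safe_step)
    fix c' assume "tm_step M (conf q s) c'"
    then obtain q' bs ds where *: "(q, map (scan s) ts, q', bs, ds) \<in> trans M"
      "c' = (q', map2 act (map s ts) (zip bs ds))" unfolding tm_step_conf_iff by blast
    have "(q, map (scan s) ts, q', bs, ds) \<in> compile (Act i wr d) q e"
      using Act.prems(1) *(1) unfolding runs_at_def by (meson le_refl less_add_same_cancel1 num_states_pos)
    then obtain a where "map a ts = map (scan s) ts" "q' = e"
      "bs = map (a(i := case wr of None \<Rightarrow> a i | Some x \<Rightarrow> x)) ts" "ds = map (stay_all(i := d)) ts"
      by fastforce
    moreover have "bs = map ((scan s)(i := case wr of None \<Rightarrow> scan s i | Some x \<Rightarrow> x)) ts"
      using calculation Act.prems(3) by (auto split: option.splits)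
    ultimately have "c' = conf e (do_act i wr d s)" using *(2) map_do_act[of s i wr d] by (simp add: conf_def)
    then show "safe M X m c'" using Act by blast
  qed (use Act.prems in \<open>auto simp: conf_def\<close>)
next
  case (Guess A Q i s)
  show ?case unfolding plus_1_eq_Suc
  proof (rule safe_step)
    fix c' assume "tm_step M (conf q s) c'"
    then obtain q' bs ds where *: "(q, map (scan s) ts, q', bs, ds) \<in> trans M"
      "c' = (q', map2 act (map s ts) (zip bs ds))" unfolding tm_step_conf_iff by blast
    then obtain a x where x: "x \<in> A" "map a ts = map (scan s) ts" "q' = e"
      "bs = map (a(i := x)) ts" "ds = map stay_all ts"
      using Guess.prems(1) by (auto simp: runs_at_def)
    moreover have "bs = map ((scan s)(i := x)) ts"
      using x by auto
    ultimately have "c' = conf e (do_act i (Some x) MStay s)"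
      using *(2) map_guess[of s i x] by (simp add: conf_def)
    then show "safe M X m c'" using Guess x(1) by blast
  qed (use Guess.prems in \<open>auto simp: conf_def\<close>)
next
  case (Seq c s k R c' n Q)
  have "safe M X (k + (n + m)) (conf q s)"
    using Seq.prems runs_at_Seq[OF Seq.prems(1)]
    by (intro Seq.IH(1)[where e = "q + num_states c"]) (auto intro!: Seq.IH(2)[where e = e])
  then show ?case by (simp add: add.assoc)
next
  case (IfT b s c n Q c')
  show ?case unfolding add_Suc
  proof (rule safe_step)
    fix d assume "tm_step M (conf q s) d"
    then obtain q' bs ds where *: "(q, map (scan s) ts, q', bs, ds) \<in> trans M"
      "d = (q', map2 act (map s ts) (zip bs ds))" unfolding tm_step_conf_iff by blast
    from runs_at_If(3)[OF IfT.prems(1) *(1)] obtain a where a: "map (scan s) ts = map a ts"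
      "q' = (if holds b a then Suc q else Suc (q + num_states c))" "bs = map a ts"
      "ds = map stay_all ts" by auto
    have bs: "bs = map (scan s) ts" by (simp only: a)
    have hb: "holds b a = holds b (scan s)"
      using holds_cong[OF _ a(1), of b] IfT.prems(3) by simp
    have "d = conf (Suc q) s"
      using *(2) a(2,4) hb bs IfT.hyps(1) map_do_nothing[of s] by (simp only: conf_def if_True if_False)
    then show "safe M X (n + m) d"
      using IfT.prems runs_at_If[OF IfT.prems(1)] by (auto intro!: IfT.IH[where e = e])
  qed (use IfT.prems in \<open>auto simp: conf_def\<close>)
next
  case (IfF b s c' n Q c)
  show ?case unfolding add_Suc
  proof (rule safe_step)
    fix d assume "tm_step M (conf q s) d"
    then obtain q' bs ds where *: "(q, map (scan s) ts, q', bs, ds) \<in> trans M"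
      "d = (q', map2 act (map s ts) (zip bs ds))" unfolding tm_step_conf_iff by blast
    from runs_at_If(3)[OF IfF.prems(1) *(1)] obtain a where a: "map (scan s) ts = map a ts"
      "q' = (if holds b a then Suc q else Suc (q + num_states c))" "bs = map a ts"
      "ds = map stay_all ts" by auto
    have bs: "bs = map (scan s) ts" by (simp only: a)
    have hb: "holds b a = holds b (scan s)"
      using holds_cong[OF _ a(1), of b] IfF.prems(3) by simp
    have "d = conf (Suc (q + num_states c)) s"
      using *(2) a(2,4) hb bs IfF.hyps(1) map_do_nothing[of s] by (simp only: conf_def if_True if_False)
    then show "safe M X (n + m) d"
      using IfF.prems runs_at_If[OF IfF.prems(1)] by (auto intro!: IfF.IH[where e = e])
  qed (use IfF.prems in \<open>auto simp: conf_def\<close>)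
next
  case (WhileF b s Q c)
  show ?case unfolding plus_1_eq_Suc
  proof (rule safe_step)
    fix d assume "tm_step M (conf q s) d"
    then obtain q' bs ds where *: "(q, map (scan s) ts, q', bs, ds) \<in> trans M"
      "d = (q', map2 act (map s ts) (zip bs ds))" unfolding tm_step_conf_iff by blast
    from runs_at_While(2)[OF WhileF.prems(1) *(1)] obtain a where a: "map (scan s) ts = map a ts"
      "q' = (if holds b a then Suc q else e)" "bs = map a ts" "ds = map stay_all ts" by auto
    have bs: "bs = map (scan s) ts" by (simp only: a)
    have hb: "holds b a = holds b (scan s)"
      using holds_cong[OF _ a(1), of b] WhileF.prems(3) by simp
    have "d = conf e s"
      using *(2) a(2,4) hb bs WhileF.hyps(1) map_do_nothing[of s] by (simp only: conf_def if_True if_False)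
    then show "safe M X m d" using WhileF by blast
  qed (use WhileF.prems in \<open>auto simp: conf_def\<close>)
next
  case (WhileT b s c k R n Q)
  show ?case unfolding add_Suc
  proof (rule safe_step)
    fix d assume "tm_step M (conf q s) d"
    then obtain q' bs ds where *: "(q, map (scan s) ts, q', bs, ds) \<in> trans M"
      "d = (q', map2 act (map s ts) (zip bs ds))" unfolding tm_step_conf_iff by blast
    from runs_at_While(2)[OF WhileT.prems(1) *(1)] obtain a where a: "map (scan s) ts = map a ts"
      "q' = (if holds b a then Suc q else e)" "bs = map a ts" "ds = map stay_all ts" by auto
    have bs: "bs = map (scan s) ts" by (simp only: a)
    have hb: "holds b a = holds b (scan s)"
      using holds_cong[OF _ a(1), of b] WhileT.prems(3) by simp
    have d: "d = conf (Suc q) s"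
      using *(2) a(2,4) hb bs WhileT.hyps(1) map_do_nothing[of s] by (simp only: conf_def if_True if_False)
    have "safe M X (n + m) (conf q s')" if "R s'" for s'
      using WhileT.IH(2)[OF that WhileT.prems(1,2,3)] WhileT.prems(4) by blast
    then have "safe M X (k + (n + m)) (conf (Suc q) s)"
      using WhileT.prems(2,3) by (intro WhileT.IH(1)[OF runs_at_While(1)[OF WhileT.prems(1)]]) auto
    then show "safe M X (k + n + m) d" using d by (simp add: add.assoc)
  qed (use WhileT.prems in \<open>auto simp: conf_def\<close>)
next
  case (Weaken c s n Q k)
  have "safe M X (n + m) (conf q s)" by (rule Weaken.IH) (use Weaken.prems in auto)
  then show ?case using Weaken.hyps(2) unfolding safe_def by (meson add_le_mono1 order_trans)
qed

lemma compile_wf: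
  assumes "(q0, as, q', bs, ds) \<in> compile c q e" "writes_of c \<subseteq> {..<K}"
  shows "q0 < q + num_states c \<and> q' \<le> max e (q + num_states c) \<and>
    as \<in> {xs. set xs \<subseteq> {..<K} \<and> length xs = length ts} \<and>
    bs \<in> {xs. set xs \<subseteq> {..<K} \<and> length xs = length ts} \<and> length ds = length ts"
  using assms
proof (induction c arbitrary: q e)
  case (Act i wr d)
  then show ?case by (auto simp: legal_def split: option.splits)
next
  case (Guess i A)
  then show ?case by (auto simp: legal_def)
next
  case (Seq c1 c2)
  then show ?case by (fastforce simp: max_def)
next
  case (If b c1 c2)
  from If.prems If.IH(1)[of "Suc q" e] If.IH(2)[of "Suc (q + num_states c1)" e]
  show ?case by (auto simp: legal_def max_def split: if_splits)
next
  case (While b c)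
  from While.prems While.IH[of "Suc q" q]
  show ?case by (auto simp: legal_def max_def split: if_splits)
qed

lemma finite_compile:
  assumes "writes_of c \<subseteq> {..<K}"
  shows "finite (compile c q e)"
proof (rule finite_subset)
  let ?L = "{xs. set xs \<subseteq> {..<K} \<and> length xs = length ts}"
  let ?D = "{xs. set xs \<subseteq> {MLeft, MStay, MRight} \<and> length xs = length ts}"
  have m: "set ds \<subseteq> {MLeft, MStay, MRight}" for ds using move.exhaust by blast
  show "compile c q e \<subseteq> {..<q + num_states c} \<times> ?L \<times> {..max e (q + num_states c)} \<times> ?L \<times> ?D"
  proof
    fix x assume x: "x \<in> compile c q e"
    obtain q0 as q' bs ds where "x = (q0, as, q', bs, ds)" by (cases x) auto
    then show "x \<in> {..<q + num_states c} \<times> ?L \<times> {..max e (q + num_states c)} \<times> ?L \<times> ?D"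
      using compile_wf[of q0 as q' bs ds c q e] x assms m[of ds] by auto
  qed
  have "finite ?L" "finite ?D" by (auto intro!: finite_lists_length_eq)
  then show "finite ({..<q + num_states c} \<times> ?L \<times> {..max e (q + num_states c)} \<times> ?L \<times> ?D)"
    by (intro finite_cartesian_product) auto
qed

text \<open>The parts of a program own disjoint ranges of states, so two transitions from one state
  stem from the same part. A test depends only on symbols of the listed tapes.\<close>

lemma compile_det:
  assumes "(p, as, r) \<in> compile c q e" "(p, as, r') \<in> compile c q e" "guess_free c"
    "tapes_of c \<subseteq> set ts"
  shows "r = r'"
  using assms
proof (induction c arbitrary: q e)
  case (Act i wr d)
  then show ?case by (auto split: option.splits)
next
  case (Seq c1 c2)
  show ?case
  proof (cases "p < q + num_states c1")
    case True
    then have "(p, x) \<notin> compile c2 (q + num_states c1) e" for x using compile_source leD by blast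
    then show ?thesis using Seq.IH(1)[of q "q + num_states c1"] Seq.prems by simp
  next
    case False
    then have "(p, x) \<notin> compile c1 q (q + num_states c1)" for x using compile_source by blast
    then show ?thesis using Seq.IH(2)[of "q + num_states c1" e] Seq.prems by simp
  qed
next
  case (If b c1 c2)
  have h: "holds b a = holds b a'" if "map a ts = map a' ts" for a a'
    using holds_cong[OF _ that] If.prems by auto
  consider "p = q" | "q < p" "p < Suc (q + num_states c1)" | "Suc (q + num_states c1) \<le> p" | "p < q"
    by linarith
  then show ?case
  proof cases
    case 1
    then have "(p, x) \<notin> compile c1 (Suc q) e" "(p, x) \<notin> compile c2 (Suc (q + num_states c1)) e" for x
      using compile_source by (metis Suc_n_not_le_n, metis le_add1 not_less_eq_eq)
    with If.prems(1,2) obtain a a' where "as = map a ts" "as = map a' ts"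
      "r = (if holds b a then Suc q else Suc (q + num_states c1), map a ts, map stay_all ts)"
      "r' = (if holds b a' then Suc q else Suc (q + num_states c1), map a' ts, map stay_all ts)"
      by (simp only: compile.simps Un_iff mem_Collect_eq prod.inject simp_thms) blast
    then show ?thesis using h[of a a'] by simp
  next
    case 2
    then have "(p, x) \<notin> compile c2 (Suc (q + num_states c1)) e" for x using compile_source leD by blast
    then show ?thesis using If.IH(1)[of "Suc q" e] If.prems 2 by simp
  next
    case 3
    then have "(p, x) \<notin> compile c1 (Suc q) e" for x
      using compile_source[of p x c1 "Suc q" e] by auto
    then show ?thesis using If.IH(2)[of "Suc (q + num_states c1)" e] If.prems 3 by simp
  next
    case 4
    then have False using compile_source[OF If.prems(1)] by simp
    then show ?thesis ..
  qed
next
  case (While b c)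
  have h: "holds b a = holds b a'" if "map a ts = map a' ts" for a a'
    using holds_cong[OF _ that] While.prems by auto
  show ?case
  proof (cases "p = q")
    case True
    then have "(p, x) \<notin> compile c (Suc q) q" for x using compile_source by (metis Suc_n_not_le_n)
    with While.prems(1,2) obtain a a' where "as = map a ts" "as = map a' ts"
      "r = (if holds b a then Suc q else e, map a ts, map stay_all ts)"
      "r' = (if holds b a' then Suc q else e, map a' ts, map stay_all ts)"
      by (simp only: compile.simps Un_iff mem_Collect_eq prod.inject simp_thms) blast
    then show ?thesis using h[of a a'] by simp
  next
    case False
    then show ?thesis using While.IH[of "Suc q" q] While.prems by simp
  qed
qed auto

end

section \<open>Time-bounded programs\<close>

definition polyb :: "(nat \<Rightarrow> nat) \<Rightarrow> bool" where
  "polyb f \<longleftrightarrow> (\<exists>p :: nat poly. \<forall>n. f n \<le> poly p n)"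

lemma polybI: "(\<And>n. f n \<le> poly p n) \<Longrightarrow> polyb f"
  unfolding polyb_def by blast

lemma polyb_const [intro!]: "polyb (\<lambda>_. c)"
  by (rule polybI[of _ "[:c:]"]) simp

lemma polyb_id [intro!]: "polyb (\<lambda>n. n)"
  by (rule polybI[of _ "[:0, 1:]"]) simp

lemma polyb_add [intro!]: "polyb f \<Longrightarrow> polyb g \<Longrightarrow> polyb (\<lambda>n. f n + g n)"
  unfolding polyb_def by (metis add_mono poly_add)

lemma polyb_mult [intro!]: "polyb f \<Longrightarrow> polyb g \<Longrightarrow> polyb (\<lambda>n. f n * g n)"
  unfolding polyb_def by (metis mult_le_mono poly_mult)

lemma polyb_Suc [intro!]: "polyb f \<Longrightarrow> polyb (\<lambda>n. Suc (f n))"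
  using polyb_add[of f "\<lambda>_. 1"] polyb_const by simp

lemma polyb_power [intro!]: "polyb f \<Longrightarrow> polyb (\<lambda>n. f n ^ k)"
  by (induction k) auto

lemma poly_nat_mono: "m \<le> n \<Longrightarrow> poly (p :: nat poly) m \<le> poly p n"
  by (induction p) (auto intro: add_mono mult_le_mono)

lemma polyb_comp: "polyb f \<Longrightarrow> polyb g \<Longrightarrow> polyb (\<lambda>n. f (g n))"
  unfolding polyb_def by (metis (no_types) order_trans poly_nat_mono poly_pcompose)

lemma polyb_mono: "polyb g \<Longrightarrow> (\<And>n. f n \<le> g n) \<Longrightarrow> polyb f"
  unfolding polyb_def by (meson order_trans)

definition ex :: "'i com \<Rightarrow> 'i tapes \<Rightarrow> 'i tapes \<Rightarrow> nat \<Rightarrow> bool" where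
  "ex c s s' b \<longleftrightarrow> (\<exists>n \<le> b. exec c s n s')"

lemma ex_mono: "ex c s s' b \<Longrightarrow> b \<le> b' \<Longrightarrow> ex c s s' b'"
  unfolding ex_def by (meson order_trans)

lemma ex_Seq: "ex c s s' m \<Longrightarrow> ex c' s' s'' n \<Longrightarrow> ex (Seq c c') s s'' (m + n)"
  unfolding ex_def by (meson add_mono exec.Seq)

lemma ex_Act: "do_act i wr d s = s' \<Longrightarrow> ex (Act i wr d) s s' 1"
  unfolding ex_def by (metis exec.Act order_refl)

lemma ex_If:
  assumes "holds b (scan s) \<Longrightarrow> ex c s s' n" "\<not> holds b (scan s) \<Longrightarrow> ex c' s s' n"
  shows "ex (If b c c') s s' (Suc n)"
proof (cases "holds b (scan s)")
  case True
  with assms(1) obtain m where "m \<le> n" "exec c s m s'" unfolding ex_def by blast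
  then show ?thesis unfolding ex_def using exec.IfT[OF True] by (intro exI[of _ "Suc m"]) simp
next
  case False
  with assms(2) obtain m where "m \<le> n" "exec c' s m s'" unfolding ex_def by blast
  then show ?thesis unfolding ex_def using exec.IfF[OF False] by (intro exI[of _ "Suc m"]) simp
qed

text \<open>A loop is described by the sequence \<open>I\<close> of its states at the test; the
  induction counts the iterations that remain.\<close>

lemma ex_While:
  assumes "\<And>m. m < M \<Longrightarrow> holds b (scan (I m))" "\<And>m. m < M \<Longrightarrow> ex c (I m) (I (Suc m)) B"
    "\<not> holds b (scan (I M))"
  shows "ex (While b c) (I 0) (I M) (M * (B + 1) + 1)"
proof -
  have "ex (While b c) (I (M - k)) (I M) (k * (B + 1) + 1)" if "k \<le> M" for k
    using that
  proof (induction k)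
    case 0
    then show ?case using assms(3) by (auto simp: ex_def simp del: One_nat_def intro!: exI[of _ 1] exec.WhileF)
  next
    case (Suc k)
    then obtain n where n: "n \<le> k * (B + 1) + 1" "exec (While b c) (I (M - k)) n (I M)"
      by (auto simp: ex_def)
    have *: "Suc (M - Suc k) = M - k" "M - Suc k < M" using Suc.prems by auto
    then obtain m where m: "m \<le> B" "exec c (I (M - Suc k)) m (I (M - k))"
      using assms(2)[of "M - Suc k"] by (auto simp: ex_def)
    from exec.WhileT[OF assms(1)[OF *(2)] m(2) n(2)] show ?case
      unfolding ex_def using m(1) n(1) by (intro exI[of _ "Suc (m + n)"]) auto
  qed
  from this[of M] show ?thesis by simp
qed

definition wt :: "nat list \<Rightarrow> int \<Rightarrow> tape" where
  "wt w h = ((\<lambda>p. if 0 \<le> p \<and> p < int (length w) then w ! nat p else 0), h)"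

lemma scanned_wt: "scanned (wt w h) = (if 0 \<le> h \<and> h < int (length w) then w ! nat h else 0)"
  by (simp add: scanned_def wt_def)

lemma scanned_wt_nonblank:
  assumes "0 \<notin> set w"
  shows "scanned (wt w h) = 0 \<longleftrightarrow> \<not> (0 \<le> h \<and> h < int (length w))"
    "0 < scanned (wt w h) \<longleftrightarrow> 0 \<le> h \<and> h < int (length w)"
proof -
  have "w ! nat h \<noteq> 0" if "0 \<le> h" "h < int (length w)"
    using assms that by (metis nat_less_iff nth_mem)
  then show "scanned (wt w h) = 0 \<longleftrightarrow> \<not> (0 \<le> h \<and> h < int (length w))"
    "0 < scanned (wt w h) \<longleftrightarrow> 0 \<le> h \<and> h < int (length w)"
    by (auto simp: scanned_wt)
qed

lemma act_wt_move: "act (wt w h) (scanned (wt w h), d) = wt w (h + displacement d)"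
  by (auto simp: act_def scanned_def wt_def)

lemma act_wt_append:
  "act (wt w (int (length w))) (a, d) = wt (w @ [a]) (int (length w) + displacement d)"
  by (rule prod_eqI) (auto simp: act_def wt_def nth_append fun_eq_iff)

lemma act_wt_update:
  "0 \<le> h \<Longrightarrow> h < int (length w) \<Longrightarrow> act (wt w h) (a, d) = wt (w[nat h := a]) (h + displacement d)"
  by (rule prod_eqI) (auto simp: act_def wt_def nth_list_update fun_eq_iff nat_eq_iff)

definition mv :: "tape \<Rightarrow> move \<Rightarrow> tape" where
  "mv t d = (fst t, snd t + displacement d)"

lemma do_act_None: "do_act i None d s = s(i := mv (s i) d)"
  by (cases "s i") (simp add: do_act_def mv_def act_def scanned_def)

lemma do_act_Some: "do_act i (Some a) d s = s(i := act (s i) (a, d))"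
  by (simp add: do_act_def)

lemma mv_wt: "mv (wt w h) d = wt w (h + displacement d)"
  by (simp add: mv_def wt_def)

abbreviation right :: "'i \<Rightarrow> 'i com" where "right i \<equiv> Act i None MRight"
abbreviation left :: "'i \<Rightarrow> 'i com" where "left i \<equiv> Act i None MLeft"
abbreviation skip :: "'i \<Rightarrow> 'i com" where "skip i \<equiv> Act i None MStay"
abbreviation put :: "'i \<Rightarrow> nat \<Rightarrow> 'i com" where "put i a \<equiv> Act i (Some a) MRight"
abbreviation nonblank :: "'i \<Rightarrow> 'i \<times> nat set" where "nonblank i \<equiv> (i, -{0})"

lemma ex_ActI: "do_act i wr d s = s' \<Longrightarrow> ex (Act i wr d) s s' (Suc n)"
  using ex_Act ex_mono by fastforce

lemma ex_SeqActI: "ex c (do_act i wr d s) s' n \<Longrightarrow> ex (Seq (Act i wr d) c) s s' (Suc n)"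
  using ex_Seq[OF ex_Act[OF refl]] by fastforce

lemma ex_SkipI: "s = s' \<Longrightarrow> ex (skip i) s s' (Suc n)"
  by (rule ex_ActI) (simp add: do_act_def act_stay)

lemma ex_right: "s i = wt w h \<Longrightarrow> s' = s(i := wt w (h + 1)) \<Longrightarrow> ex (right i) s s' 1"
  by (rule ex_Act) (simp add: do_act_def act_wt_move)

lemma ex_left: "s i = wt w h \<Longrightarrow> s' = s(i := wt w (h - 1)) \<Longrightarrow> ex (left i) s s' 1"
  by (rule ex_Act) (simp add: do_act_def act_wt_move)

lemmas ex_acts = ex_SeqActI ex_ActI
lemmas do_acts = do_act_None do_act_Some mv_wt act_wt_append act_wt_update fun_eq_iff

text \<open>The head may start on the blank behind the word, hence the initial move; the loop stops
  on the blank before the word.\<close>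

definition rewind :: "'i \<Rightarrow> 'i com" where
  "rewind i = Seq (left i) (Seq (While [nonblank i] (left i)) (right i))"

lemma holds_single: "holds [(i, A)] a \<longleftrightarrow> a i \<in> A"
  by (simp add: holds_def)

lemma ex_rewind:
  assumes "s i = wt w (int h)" "h \<le> length w" "0 \<notin> set w" "s' = s(i := wt w 0)"
  shows "ex (rewind i) s s' (2 * h + 3)"
proof -
  let ?I = "\<lambda>m. s(i := wt w (int h - 1 - int m))"
  have "ex (While [nonblank i] (left i)) (?I 0) (?I h) (h * (Suc 0 + 1) + 1)"
    by (rule ex_While[where I = ?I])
       (use assms in \<open>auto simp: holds_single scanned_wt_nonblank do_acts algebra_simps intro!: ex_acts\<close>)
  moreover have "ex (left i) s (?I 0) 1"
    by (rule ex_left) (use assms(1) in auto)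
  moreover have "ex (right i) (?I h) s' 1"
    by (rule ex_right[where w = w and h = "-1"]) (use assms(4) in auto)
  ultimately have "ex (rewind i) s s' (1 + ((h * (Suc 0 + 1) + 1) + 1))"
    unfolding rewind_def by (blast intro: ex_Seq)
  then show ?thesis by (rule ex_mono) simp
qed

definition For :: "'i \<Rightarrow> 'i com \<Rightarrow> 'i com" where
  "For i c = While [nonblank i] (Seq c (right i))"

lemma ex_For:
  assumes "0 \<notin> set w"
    and "\<And>m. m < length w \<Longrightarrow>
      ex c ((J m)(i := wt w (int m))) ((J (Suc m))(i := wt w (int m))) B"
  shows "ex (For i c) ((J 0)(i := wt w 0)) ((J (length w))(i := wt w (int (length w))))
    (length w * (B + 2) + 1)"
proof -
  let ?I = "\<lambda>m. (J m)(i := wt w (int m))"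
  have "ex (Seq c (right i)) (?I m) (?I (Suc m)) (B + 1)" if "m < length w" for m
    by (rule ex_Seq[OF assms(2)[OF that] ex_right]) (auto simp: algebra_simps)
  then have "ex (For i c) (?I 0) (?I (length w)) (length w * (B + 1 + 1) + 1)"
    unfolding For_def
    by (intro ex_While[where I = ?I]) (use assms(1) in \<open>auto simp: holds_single scanned_wt_nonblank\<close>)
  then show ?thesis by simp
qed

text \<open>One-letter marker \<open>[1]\<close> at the origin of the scratch tape: the head position of that tape
  serves as a counter, and \<open>rep\<close> executes its body as often as the head position of tape \<open>i\<close>.\<close>

definition rep :: "'i \<Rightarrow> 'i \<Rightarrow> 'i com \<Rightarrow> 'i com" where
  "rep scr i c = Seq
     (While [nonblank i] (Seq (left i) (Seq (right scr) (If [nonblank i] c (skip i)))))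
     (While [(scr, {0})] (Seq (left scr) (right i)))"

lemma scanned_marker: "scanned (wt [a] h) = (if h = 0 then a else 0)"
  by (auto simp: scanned_wt)

lemma ex_rep:
  assumes "0 \<notin> set w" "p < length w" "i \<noteq> scr"
    and "\<And>m x y. m < p \<Longrightarrow>
      ex c ((J m)(i := wt w x, scr := wt [1] y)) ((J (Suc m))(i := wt w x, scr := wt [1] y)) B"
  shows "ex (rep scr i c) ((J 0)(i := wt w (int p), scr := wt [1] 0))
    ((J p)(i := wt w (int p), scr := wt [1] 0)) ((p + 1) * (B + 10) + 10)"
proof -
  \<comment> \<open>Of the \<open>p + 1\<close> rounds the last one only steps onto the blank before
    the word and skips \<open>c\<close>, hence \<open>min m p\<close>.\<close>
  let ?I = "\<lambda>m. (J (min m p))(i := wt w (int p - int m), scr := wt [1] (int m))"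
  have body: "ex (Seq (left i) (Seq (right scr) (If [nonblank i] c (skip i)))) (?I m) (?I (Suc m))
      (Suc (Suc (Suc (Suc B))))" if m: "m < Suc p" for m
  proof (rule ex_SeqActI[OF ex_SeqActI])
    let ?s = "(J (min m p))(i := wt w (int p - int (Suc m)), scr := wt [1] (int (Suc m)))"
    have "do_act scr None MRight (do_act i None MLeft (?I m)) = ?s"
      using assms(3) by (auto simp: do_acts algebra_simps)
    moreover have "ex (If [nonblank i] c (skip i)) ?s (?I (Suc m)) (Suc (Suc B))"
    proof (rule ex_If)
      assume "holds [nonblank i] (scan ?s)"
      then have "m < p" using assms(1-3)
        by (auto simp: holds_single scanned_wt_nonblank)
      then have "?s = (J m)(i := wt w (int p - int (Suc m)), scr := wt [1] (int (Suc m)))"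
        "?I (Suc m) = (J (Suc m))(i := wt w (int p - int (Suc m)), scr := wt [1] (int (Suc m)))"
        by (auto simp: min_def)
      then show "ex c ?s (?I (Suc m)) (Suc B)"
        using ex_mono[OF assms(4)[OF \<open>m < p\<close>]] by (metis le_SucI order_refl)
    next
      assume "\<not> holds [nonblank i] (scan ?s)"
      then have "m = p" using assms(1-3) m
        by (auto simp: holds_single scanned_wt_nonblank)
      then show "ex (skip i) ?s (?I (Suc m)) (Suc B)" by (intro ex_SkipI) simp
    qed
    ultimately show "ex (If [nonblank i] c (skip i))
      (do_act scr None MRight (do_act i None MLeft (?I m))) (?I (Suc m)) (Suc (Suc B))" by simp
  qed
  have 1: "ex (While [nonblank i] (Seq (left i) (Seq (right scr) (If [nonblank i] c (skip i)))))
      (?I 0) (?I (Suc p)) (Suc p * (Suc (Suc (Suc (Suc B))) + 1) + 1)"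
    by (rule ex_While[where I = ?I and M = "Suc p"])
       (use assms(1-3) body in \<open>auto simp: holds_single scanned_wt_nonblank\<close>)
  \<comment> \<open>The way back ends when the scratch head sees its marker again, which restores
    both heads.\<close>
  let ?K = "\<lambda>m. (J p)(i := wt w (int m - 1), scr := wt [1] (int (Suc p) - int m))"
  have 2: "ex (While [(scr, {0})] (Seq (left scr) (right i))) (?K 0) (?K (Suc p)) (Suc p * (Suc (Suc 0) + 1) + 1)"
    by (rule ex_While[where I = ?K and M = "Suc p"])
       (use assms(3) in \<open>auto simp: holds_single scanned_marker do_acts algebra_simps intro!: ex_acts\<close>)
  have K: "?K 0 = ?I (Suc p)" by simp
  have "ex (rep scr i c) (?I 0) (?K (Suc p))
     (Suc p * (Suc (Suc (Suc (Suc B))) + 1) + 1 + (Suc p * (Suc (Suc 0) + 1) + 1))"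
    unfolding rep_def by (rule ex_Seq[OF 1 2[unfolded K]])
  then have "ex (rep scr i c) (?I 0) (?K (Suc p)) ((p + 1) * (B + 10) + 10)"
    by (rule ex_mono) (simp add: algebra_simps)
  then show ?thesis by simp
qed

text \<open>Both heads walk left in step, and \<open>p < q\<close> iff tape \<open>i\<close> runs
  out while tape \<open>j\<close> does not. The scratch head counts the steps so that they can be
  undone. On the flag tape 2 means true and 1 means false.\<close>

definition less_com :: "'i \<Rightarrow> 'i \<Rightarrow> 'i \<Rightarrow> 'i \<Rightarrow> 'i com" where
  "less_com scr flg i j = Seq
     (While [nonblank i, nonblank j] (Seq (left i) (Seq (left j) (right scr))))
     (Seq (If [(i, {0}), nonblank j] (Act flg (Some 2) MStay) (Act flg (Some 1) MStay))
       (While [(scr, {0})] (Seq (right i) (Seq (right j) (left scr)))))"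

lemma ex_less_com:
  assumes "0 \<notin> set w" "p < length w" "q < length w" "distinct [scr, flg, i, j]"
    "s i = wt w (int p)" "s j = wt w (int q)" "s scr = wt [1] 0" "s flg = wt [b] 0"
    "s' = s(flg := wt [if p < q then 2 else 1] 0)"
  shows "ex (less_com scr flg i j) s s' (10 * length w + 10)"
proof -
  \<comment> \<open>After this many common steps the head of the smaller position has just left the
    word.\<close>
  define M where "M = Suc (min p q)"
  let ?I = "\<lambda>m. s(i := wt w (int p - int m), j := wt w (int q - int m), scr := wt [1] (int m))"
  have 1: "ex (While [nonblank i, nonblank j] (Seq (left i) (Seq (left j) (right scr))))
      (?I 0) (?I M) (M * (Suc (Suc (Suc 0)) + 1) + 1)"
    by (rule ex_While[where I = ?I and M = M])
       (use assms(1-8) in \<open>auto simp: holds_def scanned_wt_nonblank M_def do_acts algebra_simps intro!: ex_acts\<close>)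
  have *: "?I 0 = s" using assms(4-8) by (auto simp: fun_eq_iff)
  let ?f = "wt [if p < q then 2 else 1 :: nat] 0"
  have 2: "ex (If [(i, {0}), nonblank j] (Act flg (Some 2) MStay) (Act flg (Some 1) MStay))
      (?I M) ((?I M)(flg := ?f)) (Suc (Suc 0))"
    by (rule ex_If) (use assms(1-8) in \<open>auto simp: holds_def scanned_wt_nonblank M_def do_acts algebra_simps intro!: ex_acts\<close>)
  let ?K = "\<lambda>m. (?I (M - m))(flg := ?f)"
  have 3: "ex (While [(scr, {0})] (Seq (right i) (Seq (right j) (left scr))))
      (?K 0) (?K M) (M * (Suc (Suc (Suc 0)) + 1) + 1)"
    by (rule ex_While[where I = ?K and M = M])
       (use assms(4) in \<open>auto simp: holds_single scanned_marker do_acts algebra_simps intro!: ex_acts\<close>)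
  have 4: "s' = ?K M" using assms(4-9) by (auto simp: fun_eq_iff)
  have 5: "?K 0 = (?I M)(flg := ?f)" by simp
  have "ex (less_com scr flg i j) s s'
     ((M * (Suc (Suc (Suc 0)) + 1) + 1) + (Suc (Suc 0) + (M * (Suc (Suc (Suc 0)) + 1) + 1)))"
    unfolding less_com_def 4 by (rule ex_Seq[OF 1[unfolded *] ex_Seq[OF 2 3[unfolded 5]]])
  then show ?thesis by (rule ex_mono) (use assms(2,3) in \<open>simp add: M_def\<close>)
qed

text \<open>The table is stored row by row. One pass over \<open>wrd\<close> advances
  \<open>tab\<close> by a whole row, and this is done as often as the head position on
  \<open>i\<close>; the position on \<open>j\<close> then selects the column.\<close>

definition lookup_com :: "'i \<Rightarrow> 'i \<Rightarrow> 'i \<Rightarrow> 'i \<Rightarrow> nat set \<Rightarrow> 'i \<Rightarrow> 'i \<Rightarrow> 'i com" where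
  "lookup_com scr flg wrd tab A i j =
     Seq (rep scr i (Seq (For wrd (right tab)) (rewind wrd)))
    (Seq (rep scr j (right tab))
    (Seq (If [(tab, A)] (Act flg (Some 2) MStay) (Act flg (Some 1) MStay)) (rewind tab)))"

lemma ex_lookup_com:
  assumes "0 \<notin> set w" "0 \<notin> set g" "length g = length w * length w"
    "p < length w" "q < length w" "distinct [scr, flg, wrd, tab, i]" "distinct [scr, flg, wrd, tab, j]"
    "s i = wt w (int p)" "s j = wt w (int q)" "s scr = wt [1] 0" "s flg = wt [b] 0"
    "s wrd = wt w 0" "s tab = wt g 0"
    "s' = s(flg := wt [if g ! (p * length w + q) \<in> A then 2 else 1] 0)"
  shows "ex (lookup_com scr flg wrd tab A i j) s s' (100 * (length w + 1) * (length w + 1))"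
proof -
  let ?n = "length w"
  let ?J = "\<lambda>m. s(tab := wt g (int (m * ?n)))"
  have row: "ex (Seq (For wrd (right tab)) (rewind wrd)) ((?J m)(i := wt w x, scr := wt [1] y))
      ((?J (Suc m))(i := wt w x, scr := wt [1] y)) ((?n * (Suc 0 + 2) + 1) + (2 * ?n + 3))" for m x y
  proof -
    let ?H = "\<lambda>l. s(tab := wt g (int (m * ?n + l)), i := wt w x, scr := wt [1] y)"
    have "ex (For wrd (right tab)) ((?H 0)(wrd := wt w 0)) ((?H ?n)(wrd := wt w (int ?n))) (?n * (Suc 0 + 2) + 1)"
      by (rule ex_For) (use assms(1,6) in \<open>auto simp: do_acts algebra_simps intro!: ex_acts\<close>)
    moreover have "(?H 0)(wrd := wt w 0) = (?J m)(i := wt w x, scr := wt [1] y)"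
      using assms(6,12) by (auto simp: fun_eq_iff)
    moreover have "ex (rewind wrd) ((?H ?n)(wrd := wt w (int ?n)))
        ((?J (Suc m))(i := wt w x, scr := wt [1] y)) (2 * ?n + 3)"
      using assms(1,6,12) by (intro ex_rewind[where w = w]) (auto simp: fun_eq_iff algebra_simps)
    ultimately show ?thesis by (metis ex_Seq)
  qed
  have J: "?J 0 = s" using assms(13) by auto
  have 1: "ex (rep scr i (Seq (For wrd (right tab)) (rewind wrd))) s (?J p)
      ((p + 1) * (((?n * (Suc 0 + 2) + 1) + (2 * ?n + 3)) + 10) + 10)"
  proof -
    have "(?J 0)(i := wt w (int p), scr := wt [1] 0) = s"
      "(?J p)(i := wt w (int p), scr := wt [1] 0) = ?J p"
      using assms(6,8,10,13) by (auto simp: fun_eq_iff)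
    moreover have "i \<noteq> scr" using assms(6) by auto
    ultimately show ?thesis
      using ex_rep[of w p i scr "Seq (For wrd (right tab)) (rewind wrd)" ?J, OF assms(1,4) _ row] by simp
  qed
  let ?L = "\<lambda>m. s(tab := wt g (int (p * ?n + m)))"
  have 2: "ex (rep scr j (right tab)) (?J p) (?L q) ((q + 1) * (1 + 10) + 10)"
  proof -
    have a: "(?L 0)(j := wt w (int q), scr := wt [1] 0) = ?J p"
      "(?L q)(j := wt w (int q), scr := wt [1] 0) = ?L q"
      using assms(7,9,10) by (auto simp: fun_eq_iff)
    have st: "ex (right tab) ((?L m)(j := wt w x, scr := wt [1] y))
      ((?L (Suc m))(j := wt w x, scr := wt [1] y)) 1" for m x y
      by (rule ex_right) (use assms(7) in \<open>auto simp: fun_eq_iff algebra_simps\<close>)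
    have "j \<noteq> scr" using assms(7) by auto
    from ex_rep[of w q j scr "right tab" ?L 1, OF assms(1,5) this st] show ?thesis unfolding a .
  qed
  have pq: "p * ?n + q < ?n * ?n"
  proof -
    have "p * ?n + q < Suc p * ?n" using assms(5) by simp
    also have "\<dots> \<le> ?n * ?n" using assms(4) by (intro mult_le_mono) auto
    finally show ?thesis .
  qed
  let ?f = "wt [if g ! (p * ?n + q) \<in> A then 2 else 1 :: nat] 0"
  have sc: "scanned (wt g (int (p * ?n + q))) = g ! (p * ?n + q)"
    unfolding scanned_wt nat_int using pq assms(3) by (simp only: of_nat_0_le_iff of_nat_less_iff simp_thms if_True)
  have 3: "ex (If [(tab, A)] (Act flg (Some 2) MStay) (Act flg (Some 1) MStay)) (?L q)
      ((?L q)(flg := ?f)) (Suc (Suc 0))"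
    by (rule ex_If) (use assms(6,11) sc in \<open>auto simp: holds_single do_acts algebra_simps intro!: ex_acts\<close>)
  have 4: "ex (rewind tab) ((?L q)(flg := ?f)) s' (2 * (p * ?n + q) + 3)"
    using assms(2,3,6,13,14) pq by (intro ex_rewind[where w = g]) (auto simp: fun_eq_iff)
  have "(p + 1) * (?n * 5 + 14) \<le> (?n + 1) * (?n * 5 + 14)" using assms(4) by simp
  then have "((p + 1) * (((?n * (Suc 0 + 2) + 1) + (2 * ?n + 3)) + 10) + 10) +
      (((q + 1) * (1 + 10) + 10) + (Suc (Suc 0) + (2 * (p * ?n + q) + 3))) \<le> 100 * (?n + 1) * (?n + 1)"
    using pq assms(5) by (simp add: algebra_simps)
  then show ?thesis
    unfolding lookup_com_def using ex_Seq[OF 1 ex_Seq[OF 2 ex_Seq[OF 3 4]]] by (rule ex_mono[rotated])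
qed

section \<open>First-order properties of words\<close>

datatype tp = Out | Scr | Flg | Tab | Wrd | Aux nat | Var nat

text \<open>Every variable owns a copy of the word and its value is a head position: reading the
  letter at a variable is a scan, and quantification is a sweep of one head.\<close>

definition st :: "nat list \<Rightarrow> nat list \<Rightarrow> (nat \<Rightarrow> nat) \<Rightarrow> nat \<Rightarrow> nat list \<Rightarrow> (nat \<Rightarrow> tape) \<Rightarrow> tp tapes" where
  "st w g v b out R = (\<lambda>i. case i of Out \<Rightarrow> wt out (int (length out)) | Scr \<Rightarrow> wt [1] 0 | Flg \<Rightarrow> wt [b] 0
     | Tab \<Rightarrow> wt g 0 | Wrd \<Rightarrow> wt w 0 | Aux j \<Rightarrow> R j | Var l \<Rightarrow> wt w (int (v l)))"

lemma st_simps [simp]: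
  "st w g v b out R Out = wt out (int (length out))"
  "st w g v b out R Scr = wt [1] 0"
  "st w g v b out R Flg = wt [b] 0"
  "st w g v b out R Tab = wt g 0"
  "st w g v b out R Wrd = wt w 0"
  "st w g v b out R (Aux j) = R j"
  "st w g v b out R (Var l) = wt w (int (v l))"
  by (simp_all add: st_def)

lemma st_upd:
  "(st w g v b out R)(Flg := wt [b'] 0) = st w g v b' out R"
  "(st w g v b out R)(Var l := wt w (int m)) = st w g (v(l := m)) b out R"
  "(st w g v b out R)(Var l := wt w (int m + 1)) = st w g (v(l := Suc m)) b out R"
  by (auto simp: st_def fun_eq_iff split: tp.splits) (simp add: algebra_simps)

lemma st_upd_out:
  "out' = out @ ys \<Longrightarrow> h = int (length out') \<Longrightarrow>
   (st w g v b out R)(Out := wt out' h) = st w g v b out' R"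
  by (auto simp: st_def fun_eq_iff split: tp.splits)

text \<open>The value of variable \<open>i\<close> in de Bruijn notation, counted from the innermost quantifier, is
  kept on tape \<open>Var (d - Suc i)\<close> where \<open>d\<close> is the number of quantifiers in scope.\<close>

definition lev :: "nat list \<Rightarrow> nat \<Rightarrow> nat" where
  "lev e l = (if l < length e then rev e ! l else 0)"

lemma lev_Cons: "lev (x # e) = (lev e)(length e := x)"
  by (auto simp: lev_def fun_eq_iff nth_append less_Suc_eq)

lemma lev_length: "lev e (length e) = 0"
  by (simp add: lev_def)

lemma lev_nth: "i < length e \<Longrightarrow> lev e (length e - Suc i) = e ! i"
  by (simp add: lev_def rev_nth)

definition valid_env :: "nat list \<Rightarrow> nat list \<Rightarrow> nat \<Rightarrow> nat list \<Rightarrow> bool" where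
  "valid_env w g d e \<longleftrightarrow> 0 \<notin> set w \<and> 0 \<notin> set g \<and> length g = length w * length w \<and> length e = d \<and>
     (\<forall>x \<in> set e. x < length w)"

text \<open>One table cell packs the truth values of all relations at a pair of positions into the
  bits of a symbol. The shift by 1 keeps the blank 0 out of the table.\<close>

definition rel :: "nat list \<Rightarrow> nat list \<Rightarrow> nat \<Rightarrow> nat \<Rightarrow> nat \<Rightarrow> bool" where
  "rel w g a p q \<longleftrightarrow> bit (g ! (p * length w + q) - 1) a"

text \<open>\<open>FO d P\<close>: the property \<open>P\<close> of a word, a table of binary relations on its positions
  and \<open>d\<close> positions is decided by a program in polynomial time. The closure properties show that this
  includes all first-order properties.\<close>

type_synonym wprop = "nat list \<Rightarrow> (nat \<Rightarrow> nat \<Rightarrow> nat \<Rightarrow> bool) \<Rightarrow> nat list \<Rightarrow> bool"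

definition FO :: "nat \<Rightarrow> wprop \<Rightarrow> bool" where
  "FO d P \<longleftrightarrow> (\<exists>c B. guess_free c \<and> polyb B \<and> (\<forall>w g e b out R. valid_env w g d e \<longrightarrow>
     ex c (st w g (lev e) b out R) (st w g (lev e) (if P w (rel w g) e then 2 else 1) out R)
       (B (length w))))"

lemma FOI:
  assumes "guess_free c" "polyb B" "\<And>w g e b out R. valid_env w g d e \<Longrightarrow>
     ex c (st w g (lev e) b out R) (st w g (lev e) (if P w (rel w g) e then 2 else 1) out R) (B (length w))"
  shows "FO d P"
  using assms unfolding FO_def by blast

lemma FOE:
  assumes "FO d P"
  obtains c B where "guess_free c" "polyb B" "\<And>w g e b out R. valid_env w g d e \<Longrightarrow>
     ex c (st w g (lev e) b out R) (st w g (lev e) (if P w (rel w g) e then 2 else 1) out R) (B (length w))"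
  using assms unfolding FO_def by blast

lemma FO_cong:
  assumes "FO d P" "\<And>w \<rho> e. length e = d \<Longrightarrow> (\<forall>x \<in> set e. x < length w) \<Longrightarrow> P w \<rho> e = Q w \<rho> e"
  shows "FO d Q"
proof -
  from FOE[OF assms(1)] obtain c B where c: "guess_free c" "polyb B"
    "\<And>w g e b out R. valid_env w g d e \<Longrightarrow> ex c (st w g (lev e) b out R)
       (st w g (lev e) (if P w (rel w g) e then 2 else 1) out R) (B (length w))" by blast
  show ?thesis
  proof (rule FOI[OF c(1,2)])
    fix w g e b out R assume v: "valid_env w g d e"
    then have "P w (rel w g) e = Q w (rel w g) e" by (intro assms(2)) (auto simp: valid_env_def)
    then show "ex c (st w g (lev e) b out R)
       (st w g (lev e) (if Q w (rel w g) e then 2 else 1) out R) (B (length w))" using c(3)[OF v] by metis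
  qed
qed

text \<open>The terms are the variables, presented as functions of the environment:
  \<open>hd\<close> is the innermost variable and \<open>tl\<close> shifts the others. In this form
  a quantified formula is decomposed by plain rule application.\<close>

definition tm_at :: "nat \<Rightarrow> (nat list \<Rightarrow> nat) \<Rightarrow> bool" where
  "tm_at d t \<longleftrightarrow> (\<exists>i<d. \<forall>e. length e = d \<longrightarrow> t e = e ! i)"

lemma tm_nth: "i < d \<Longrightarrow> tm_at d (\<lambda>e. e ! i)"
  unfolding tm_at_def by blast

lemma tm_hd: "tm_at (Suc d) hd"
  unfolding tm_at_def by (intro exI[of _ 0]) (auto simp: length_Suc_conv)

lemma tm_tl: "tm_at d t \<Longrightarrow> tm_at (Suc d) (\<lambda>e. t (tl e))"
  unfolding tm_at_def by (elim exE, rename_tac i, rule_tac x = "Suc i" in exI) (auto simp: length_Suc_conv)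

lemma FO_less:
  assumes "tm_at d t" "tm_at d u"
  shows "FO d (\<lambda>w \<rho> e. t e < u e)"
proof -
  from assms obtain i j where ij: "i < d" "\<And>e. length e = d \<Longrightarrow> t e = e ! i"
    "j < d" "\<And>e. length e = d \<Longrightarrow> u e = e ! j" unfolding tm_at_def by metis
  let ?i = "Var (d - Suc i)" and ?j = "Var (d - Suc j)"
  show ?thesis
  \<comment> \<open>\<open>less_com\<close> moves the two heads separately and thus requires two
    distinct tapes.\<close>
  proof (cases "i = j")
    case True
    show ?thesis
      by (rule FOI[of "Act Flg (Some 1) MStay" "\<lambda>_. 1"])
         (use ij True in \<open>auto simp: valid_env_def st_upd do_act_Some act_wt_update intro!: ex_ActI\<close>)
  next
    case False
    show ?thesis
    proof (rule FOI[of "less_com Scr Flg ?i ?j" "\<lambda>n. 10 * n + 10"])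
      fix w g e b out R assume v: "valid_env w g d e"
      have "lev e (d - Suc i) = e ! i" "lev e (d - Suc j) = e ! j"
        using v ij lev_nth by (auto simp: valid_env_def)
      then show "ex (less_com Scr Flg ?i ?j) (st w g (lev e) b out R)
          (st w g (lev e) (if t e < u e then 2 else 1) out R) (10 * length w + 10)"
        using v ij False
        by (intro ex_less_com[where p = "e ! i" and q = "e ! j" and w = w and b = b])
           (auto simp: valid_env_def st_upd)
    qed (auto simp: less_com_def)
  qed
qed

lemma FO_rel:
  assumes "tm_at d t" "tm_at d u"
  shows "FO d (\<lambda>w \<rho> e. \<rho> a (t e) (u e))"
proof -
  from assms obtain i j where ij: "i < d" "\<And>e. length e = d \<Longrightarrow> t e = e ! i"
    "j < d" "\<And>e. length e = d \<Longrightarrow> u e = e ! j" unfolding tm_at_def by metis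
  let ?c = "lookup_com Scr Flg Wrd Tab {y. bit (y - 1) a} (Var (d - Suc i)) (Var (d - Suc j))"
  show ?thesis
  proof (rule FOI[of ?c "\<lambda>n. 100 * (n + 1) * (n + 1)"])
    fix w g e b out R assume v: "valid_env w g d e"
    have "lev e (d - Suc i) = e ! i" "lev e (d - Suc j) = e ! j"
      using v ij lev_nth by (auto simp: valid_env_def)
    then show "ex ?c (st w g (lev e) b out R)
        (st w g (lev e) (if rel w g a (t e) (u e) then 2 else 1) out R) (100 * (length w + 1) * (length w + 1))"
      using v ij
      by (intro ex_lookup_com[where p = "e ! i" and q = "e ! j" and w = w and g = g and b = b])
         (auto simp: valid_env_def st_upd rel_def)
  qed (auto simp: lookup_com_def rep_def rewind_def For_def)
qed

lemma FO_sym: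
  assumes "tm_at d t"
  shows "FO d (\<lambda>w \<rho> e. w ! t e \<in> A)"
proof -
  from assms obtain i where i: "i < d" "\<And>e. length e = d \<Longrightarrow> t e = e ! i"
    unfolding tm_at_def by metis
  show ?thesis
  proof (rule FOI[of "If [(Var (d - Suc i), A)] (Act Flg (Some 2) MStay) (Act Flg (Some 1) MStay)"
        "\<lambda>n. Suc (Suc 0)"])
    fix w g e b out R assume v: "valid_env w g d e"
    have "lev e (d - Suc i) = e ! i" "e ! i < length w"
      using v i lev_nth by (auto simp: valid_env_def)
    then show "ex (If [(Var (d - Suc i), A)] (Act Flg (Some 2) MStay) (Act Flg (Some 1) MStay))
        (st w g (lev e) b out R) (st w g (lev e) (if w ! t e \<in> A then 2 else 1) out R) (Suc (Suc 0))"
      using v i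
      by (intro ex_If) (auto simp: valid_env_def st_upd holds_single scanned_wt do_act_Some act_wt_update
          intro!: ex_ActI)
  qed auto
qed

lemma FO_const: "FO d (\<lambda>w \<rho> e. X)"
  by (rule FOI[of "Act Flg (Some (if X then 2 else 1)) MStay" "\<lambda>n. Suc 0"])
     (auto simp: st_upd do_act_Some act_wt_update intro!: ex_ActI)

lemma FO_not:
  assumes "FO d P"
  shows "FO d (\<lambda>w \<rho> e. \<not> P w \<rho> e)"
proof -
  from FOE[OF assms(1)] obtain c B where c: "guess_free c" "polyb B"
    "\<And>w g e b out R. valid_env w g d e \<Longrightarrow> ex c (st w g (lev e) b out R)
       (st w g (lev e) (if P w (rel w g) e then 2 else 1) out R) (B (length w))" by blast
  let ?c = "Seq c (If [(Flg, {2})] (Act Flg (Some 1) MStay) (Act Flg (Some 2) MStay))"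
  show ?thesis
  proof (rule FOI[of ?c "\<lambda>n. B n + Suc (Suc 0)"])
    fix w g e b out R assume v: "valid_env w g d e"
    show "ex ?c (st w g (lev e) b out R)
       (st w g (lev e) (if \<not> P w (rel w g) e then 2 else 1) out R) (B (length w) + Suc (Suc 0))"
      by (rule ex_Seq[OF c(3)[OF v] ex_If])
         (auto simp: st_upd holds_single scanned_wt do_act_Some act_wt_update
          intro!: ex_ActI split: if_splits)
  qed (use c in auto)
qed

lemma FO_and:
  assumes "FO d P" "FO d Q"
  shows "FO d (\<lambda>w \<rho> e. P w \<rho> e \<and> Q w \<rho> e)"
proof -
  from FOE[OF assms(1)] obtain c B where c: "guess_free c" "polyb B"
    "\<And>w g e b out R. valid_env w g d e \<Longrightarrow> ex c (st w g (lev e) b out R)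
       (st w g (lev e) (if P w (rel w g) e then 2 else 1) out R) (B (length w))" by blast
  from FOE[OF assms(2)] obtain c' B' where c': "guess_free c'" "polyb B'"
    "\<And>w g e b out R. valid_env w g d e \<Longrightarrow> ex c' (st w g (lev e) b out R)
       (st w g (lev e) (if Q w (rel w g) e then 2 else 1) out R) (B' (length w))" by blast
  let ?c = "Seq c (If [(Flg, {2})] c' (skip Flg))"
  show ?thesis
  proof (rule FOI[of ?c "\<lambda>n. B n + Suc (Suc (B' n))"])
    fix w g e b out R assume v: "valid_env w g d e"
    show "ex ?c (st w g (lev e) b out R)
       (st w g (lev e) (if P w (rel w g) e \<and> Q w (rel w g) e then 2 else 1) out R) (B (length w) + Suc (Suc (B' (length w))))"
    proof (rule ex_Seq[OF c(3)[OF v] ex_If])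
      show "ex c' (st w g (lev e) (if P w (rel w g) e then 2 else 1) out R)
       (st w g (lev e) (if P w (rel w g) e \<and> Q w (rel w g) e then 2 else 1) out R) (Suc (B' (length w)))"
        if "holds [(Flg, {2})] (scan (st w g (lev e) (if P w (rel w g) e then 2 else 1) out R))"
        using that ex_mono[OF c'(3)[OF v], of "Suc (B' (length w))"]
        by (auto simp: holds_single scanned_wt split: if_splits)
    qed (auto simp: holds_single scanned_wt intro!: ex_SkipI split: if_splits)
  qed (use c c' in auto)
qed

lemma FO_all:
  assumes "FO (Suc d) (\<lambda>w \<rho> e. P w \<rho> (hd e) (tl e))"
  shows "FO d (\<lambda>w \<rho> e. \<forall>x<length w. P w \<rho> x e)"
proof -
  from FOE[OF assms(1)] obtain c B where c: "guess_free c" "polyb B"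
    "\<And>w g e b out R. valid_env w g (Suc d) e \<Longrightarrow> ex c (st w g (lev e) b out R)
       (st w g (lev e) (if P w (rel w g) (hd e) (tl e) then 2 else 1) out R) (B (length w))" by blast
  let ?i = "Var d"
  let ?loop = "While [nonblank ?i, (Flg, {2})] (Seq c (If [(Flg, {2})] (right ?i) (skip ?i)))"
  let ?c = "Seq (Act Flg (Some 2) MStay) (Seq ?loop (rewind ?i))"
  show ?thesis
  proof (rule FOI[of ?c "\<lambda>n. Suc (((n + 1) * (B n + 3) + 1) + (2 * n + 3))"])
    fix w g e b out R assume v: "valid_env w g d e"
    let ?n = "length w"
    define Q where "Q x = P w (rel w g) x e" for x
    define al where "al = (\<forall>x<?n. Q x)"
    \<comment> \<open>The loop stops at the least counterexample, or behind the word if there is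
      none; \<open>f\<close> is this position.\<close>
    define L where "L = (LEAST x. x < ?n \<and> \<not> Q x)"
    define f where "f = (if al then ?n else L)"
    have L: "L < ?n \<and> \<not> Q L" if "\<not> al"
      using that LeastI_ex[of "\<lambda>x. x < ?n \<and> \<not> Q x"] unfolding al_def L_def by blast
    have f: "f \<le> ?n" "al \<longleftrightarrow> f = ?n" "\<not> al \<Longrightarrow> \<not> Q f"
      using L by (auto simp: f_def)
    have fQ: "Q x" if "x < f" for x
    proof (cases al)
      case True
      then show ?thesis using that by (auto simp: f_def al_def)
    next
      case False
      then have "x < L" "x < ?n" using that L by (auto simp: f_def)
      then show ?thesis using not_less_Least[of x "\<lambda>x. x < ?n \<and> \<not> Q x"] by (auto simp: L_def)
    qed
    define S where "S m a = st w g ((lev e)(d := m)) a out R" for m a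
    \<comment> \<open>The failing iteration leaves the head at \<open>f\<close> and lowers the flag,
      which gives one more state after the arrival at \<open>f\<close>.\<close>
    define I where "I m = (if m \<le> f then S m 2 else S f 1)" for m
    have d: "length e = d" using v by (simp add: valid_env_def)
    have S: "scanned (S m a (Var d)) = 0 \<longleftrightarrow> \<not> m < ?n" "scanned (S m a Flg) = a" for m a
      using v by (auto simp: S_def scanned_wt_nonblank scanned_marker valid_env_def)
    have step: "ex (Seq c (If [(Flg, {2})] (right ?i) (skip ?i))) (S m 2) (if Q m then S (Suc m) 2 else S m 1)
        (B ?n + Suc (Suc 0))" if "m < ?n" for m
    proof (rule ex_Seq[OF _ ex_If])
      have "valid_env w g (Suc d) (m # e)" using v that by (auto simp: valid_env_def)
      from c(3)[OF this, of 2 out R]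
      show "ex c (S m 2) (S m (if Q m then 2 else 1)) (B ?n)"
        by (simp add: S_def lev_Cons d Q_def)
      show "ex (right ?i) (S m (if Q m then 2 else 1)) (if Q m then S (Suc m) 2 else S m 1) (Suc 0)"
        if "holds [(Flg, {2})] (scan (S m (if Q m then 2 else 1)))"
        using that S(2)
        by (auto simp: holds_single S_def do_act_None mv_wt st_upd intro!: ex_ActI split: if_splits)
      show "ex (skip ?i) (S m (if Q m then 2 else 1)) (if Q m then S (Suc m) 2 else S m 1) (Suc 0)"
        if "\<not> holds [(Flg, {2})] (scan (S m (if Q m then 2 else 1)))"
        using that S(2) by (auto simp: holds_single intro!: ex_SkipI split: if_splits)
    qed
    define M where "M = (if al then ?n else Suc f)"
    have "ex ?loop (I 0) (I M) (M * (B ?n + Suc (Suc 0) + 1) + 1)"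
    proof (rule ex_While)
      fix m assume "m < M"
      then have m: "m \<le> f" "m < ?n" using f(1,2) by (auto simp: M_def split: if_splits)
      then show "holds [nonblank ?i, (Flg, {2})] (scan (I m))"
        using S by (auto simp: holds_def I_def)
      have "(if Q m then S (Suc m) 2 else S m 1) = I (Suc m)"
        using m f fQ[of m] by (cases "m = f") (auto simp: I_def)
      then show "ex (Seq c (If [(Flg, {2})] (right ?i) (skip ?i))) (I m) (I (Suc m)) (B ?n + Suc (Suc 0))"
        using step[OF m(2)] m(1) by (simp add: I_def)
    next
      show "\<not> holds [nonblank ?i, (Flg, {2})] (scan (I M))"
        using S f(2) by (auto simp: holds_def I_def M_def)
    qed
    moreover have "I 0 = S 0 2" by (simp add: I_def)
    moreover have "I M = S f (if al then 2 else 1)" using f(2) by (auto simp: I_def M_def)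
    ultimately have loop: "ex ?loop (S 0 2) (S f (if al then 2 else 1)) (M * (B ?n + Suc (Suc 0) + 1) + 1)" by simp
    \<comment> \<open>A variable out of scope rests at position 0, the default value in
      \<open>lev\<close>; so rewinding its tape restores the environment.\<close>
    have l0: "(lev e)(d := 0) = lev e" using lev_length[of e] d by auto
    have "(S f a)(Var d := wt w 0) = S 0 a" for a
      using st_upd(2)[where l = d and m = 0 and w = w] by (simp add: S_def)
    then have rw: "ex (rewind ?i) (S f a) (S 0 a) (2 * f + 3)" for a
      using v f(1) by (intro ex_rewind[where w = w]) (auto simp: S_def valid_env_def)
    have "ex ?c (st w g (lev e) b out R) (S 0 (if al then 2 else 1))
       (Suc ((M * (B ?n + Suc (Suc 0) + 1) + 1) + (2 * f + 3)))"
    proof (rule ex_SeqActI)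
      have "do_act Flg (Some 2) MStay (st w g (lev e) b out R) = S 0 2"
        using l0 by (simp add: do_act_Some act_wt_update st_upd S_def)
      then show "ex (Seq ?loop (rewind ?i)) (do_act Flg (Some 2) MStay (st w g (lev e) b out R))
        (S 0 (if al then 2 else 1)) ((M * (B ?n + Suc (Suc 0) + 1) + 1) + (2 * f + 3))"
        using ex_Seq[OF loop rw] by simp
    qed
    moreover have "M * (B ?n + Suc (Suc 0) + 1) \<le> (?n + 1) * (B ?n + 3)"
      using f(1,2) by (intro mult_le_mono) (auto simp: M_def)
    ultimately have "ex ?c (st w g (lev e) b out R) (S 0 (if al then 2 else 1))
       (Suc (((?n + 1) * (B ?n + 3) + 1) + (2 * ?n + 3)))"
      using f(1) by (elim ex_mono) simp
    then show "ex ?c (st w g (lev e) b out R)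
       (st w g (lev e) (if \<forall>x<?n. P w (rel w g) x e then 2 else 1) out R)
       (Suc (((?n + 1) * (B ?n + 3) + 1) + (2 * ?n + 3)))"
      unfolding S_def l0 al_def Q_def .
  qed (use c in \<open>auto simp: rewind_def\<close>)
qed

section \<open>Derived closure properties\<close>

lemma FO_or: "FO d P \<Longrightarrow> FO d Q \<Longrightarrow> FO d (\<lambda>w \<rho> e. P w \<rho> e \<or> Q w \<rho> e)"
  by (rule FO_cong[OF FO_not[OF FO_and[OF FO_not FO_not]]]) auto

lemma FO_imp: "FO d P \<Longrightarrow> FO d Q \<Longrightarrow> FO d (\<lambda>w \<rho> e. P w \<rho> e \<longrightarrow> Q w \<rho> e)"
  by (rule FO_cong[OF FO_or[OF FO_not]]) auto

lemma FO_iff: "FO d P \<Longrightarrow> FO d Q \<Longrightarrow> FO d (\<lambda>w \<rho> e. P w \<rho> e \<longleftrightarrow> Q w \<rho> e)"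
  by (rule FO_cong[OF FO_and[OF FO_imp[of d P Q] FO_imp[of d Q P]]]) auto

lemma FO_ex:
  assumes "FO (Suc d) (\<lambda>w \<rho> e. P w \<rho> (hd e) (tl e))"
  shows "FO d (\<lambda>w \<rho> e. \<exists>x<length w. P w \<rho> x e)"
  by (rule FO_cong[OF FO_not[OF FO_all[where P = "\<lambda>w \<rho> x e. \<not> P w \<rho> x e", OF FO_not[OF assms]]]]) auto

lemma FO_eq: "tm_at d t \<Longrightarrow> tm_at d u \<Longrightarrow> FO d (\<lambda>w \<rho> e. t e = u e)"
  by (rule FO_cong[OF FO_and[OF FO_not[OF FO_less[of d t u]] FO_not[OF FO_less[of d u t]]]]) auto

lemma FO_all_list: "(\<And>a. a \<in> set as \<Longrightarrow> FO d (P a)) \<Longrightarrow> FO d (\<lambda>w \<rho> e. \<forall>a \<in> set as. P a w \<rho> e)"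
proof (induction as)
  case Nil
  show ?case using FO_const[of d True] by simp
next
  case (Cons a as)
  then show ?case
    by (auto intro: FO_and[of d "P a" "\<lambda>w \<rho> e. \<forall>a \<in> set as. P a w \<rho> e"])
qed

lemma FO_all_static: "(\<And>a. a < K \<Longrightarrow> FO d (P a)) \<Longrightarrow> FO d (\<lambda>w \<rho> e. \<forall>a<(K::nat). P a w \<rho> e)"
  by (rule FO_cong[OF FO_all_list[of "[0..<K]" d P]]) auto

lemma FO_ex_list: "(\<And>a. a \<in> set as \<Longrightarrow> FO d (P a)) \<Longrightarrow> FO d (\<lambda>w \<rho> e. \<exists>a \<in> set as. P a w \<rho> e)"
  by (rule FO_cong[OF FO_not[OF FO_all_list[of as d "\<lambda>a w \<rho> e. \<not> P a w \<rho> e"]]]) (auto intro: FO_not)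

lemma FO_Suc:
  assumes "tm_at d t" "tm_at d u"
  shows "FO d (\<lambda>w \<rho> e. u e = Suc (t e))"
proof -
  have "FO d (\<lambda>w \<rho> e. t e < u e \<and> (\<forall>x<length w. \<not> (t e < x \<and> x < u e)))"
    by (intro FO_and FO_all FO_not FO_less assms tm_tl tm_hd)
  then show ?thesis
  proof (rule FO_cong)
    fix w :: "nat list" and \<rho> :: "nat \<Rightarrow> nat \<Rightarrow> nat \<Rightarrow> bool" and e :: "nat list"
    assume "length e = d" "\<forall>x \<in> set e. x < length w"
    then have "u e < length w" using assms(2) by (auto simp: tm_at_def)
    then show "(t e < u e \<and> (\<forall>x<length w. \<not> (t e < x \<and> x < u e))) = (u e = Suc (t e))"
      by (metis Suc_lessI lessI less_trans not_less_eq)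
  qed
qed

lemma FO_zero:
  assumes "tm_at d t"
  shows "FO d (\<lambda>w \<rho> e. t e = 0)"
proof -
  have "FO d (\<lambda>w \<rho> e. \<forall>x<length w. \<not> x < t e)"
    by (intro FO_all FO_not FO_less assms tm_tl tm_hd)
  then show ?thesis
  proof (rule FO_cong)
    fix w :: "nat list" and \<rho> :: "nat \<Rightarrow> nat \<Rightarrow> nat \<Rightarrow> bool" and e :: "nat list"
    assume "length e = d" "\<forall>x \<in> set e. x < length w"
    then have "t e < length w" using assms by (auto simp: tm_at_def)
    then show "(\<forall>x<length w. \<not> x < t e) = (t e = 0)" by (metis gr0I less_trans not_less0)
  qed
qed

text \<open>Analogously \<open>GEN d F\<close>: the bit string \<open>F w e\<close> can be appended to the output.\<close>

definition GEN :: "nat \<Rightarrow> (nat list \<Rightarrow> nat list \<Rightarrow> bool list) \<Rightarrow> bool" where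
  "GEN d F \<longleftrightarrow> (\<exists>c B. guess_free c \<and> polyb B \<and> (\<forall>w g e out R. valid_env w g d e \<longrightarrow>
     ex c (st w g (lev e) 1 out R) (st w g (lev e) 1 (out @ map bit_symbol (F w e)) R) (B (length w))))"

section \<open>Producing output by loops\<close>

lemma GENI:
  assumes "guess_free c" "polyb B" "\<And>w g e out R. valid_env w g d e \<Longrightarrow>
     ex c (st w g (lev e) 1 out R) (st w g (lev e) 1 (out @ map bit_symbol (F w e)) R) (B (length w))"
  shows "GEN d F"
  using assms unfolding GEN_def by blast

lemma GENE:
  assumes "GEN d F"
  obtains c B where "guess_free c" "polyb B" "\<And>w g e out R. valid_env w g d e \<Longrightarrow>
     ex c (st w g (lev e) 1 out R) (st w g (lev e) 1 (out @ map bit_symbol (F w e)) R) (B (length w))"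
  using assms unfolding GEN_def by blast

lemma GEN_cong:
  assumes "GEN d F" "\<And>w e. length e = d \<Longrightarrow> F w e = F' w e"
  shows "GEN d F'"
proof -
  from GENE[OF assms(1)] obtain c B where c: "guess_free c" "polyb B"
    "\<And>w g e out R. valid_env w g d e \<Longrightarrow> ex c (st w g (lev e) 1 out R)
       (st w g (lev e) 1 (out @ map bit_symbol (F w e)) R) (B (length w))" by blast
  show ?thesis
  proof (rule GENI[OF c(1,2)])
    fix w g e out R assume v: "valid_env w g d e"
    then have "F w e = F' w e" by (intro assms(2)) (auto simp: valid_env_def)
    then show "ex c (st w g (lev e) 1 out R) (st w g (lev e) 1 (out @ map bit_symbol (F' w e)) R) (B (length w))"
      using c(3)[OF v] by metis
  qed
qed

fun emit :: "bool list \<Rightarrow> tp com" where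
  "emit [] = skip Out"
| "emit (x # xs) = Seq (put Out (bit_symbol x)) (emit xs)"

lemma guess_free_emit: "guess_free (emit xs)"
  by (induction xs) auto

lemma ex_emit:
  "s Out = wt out (int (length out)) \<Longrightarrow>
   ex (emit xs) s (s(Out := wt (out @ map bit_symbol xs) (int (length out + length xs)))) (Suc (length xs))"
proof (induction xs arbitrary: s out)
  case Nil
  then show ?case by (auto intro!: ex_SkipI)
next
  case (Cons x xs)
  let ?s = "s(Out := wt (out @ [bit_symbol x]) (int (length out) + 1))"
  have s: "do_act Out (Some (bit_symbol x)) MRight s = ?s"
    by (simp only: do_act_Some Cons.prems act_wt_append displacement.simps)
  have "ex (emit xs) ?s (?s(Out := wt ((out @ [bit_symbol x]) @ map bit_symbol xs)
      (int (length (out @ [bit_symbol x]) + length xs)))) (Suc (length xs))"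
    by (rule Cons.IH) (simp add: algebra_simps)
  then have "ex (emit (x # xs)) s (?s(Out := wt ((out @ [bit_symbol x]) @ map bit_symbol xs)
      (int (length (out @ [bit_symbol x]) + length xs)))) (Suc (Suc (length xs)))"
    unfolding emit.simps by (intro ex_SeqActI) (simp only: s)
  moreover have "out @ map bit_symbol (x # xs) = (out @ [bit_symbol x]) @ map bit_symbol xs"
    "length out + length (x # xs) = length (out @ [bit_symbol x]) + length xs"
    "length (x # xs) = Suc (length xs)" by simp_all
  ultimately show ?case unfolding fun_upd_upd by (simp only:)
qed

lemma GEN_const: "GEN d (\<lambda>w e. xs)"
proof (rule GENI[OF guess_free_emit[of xs], where B = "\<lambda>_. Suc (length xs)"])
  fix w g e out R
  show "ex (emit xs) (st w g (lev e) 1 out R) (st w g (lev e) 1 (out @ map bit_symbol xs) R) (Suc (length xs))"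
    using ex_emit[of "st w g (lev e) 1 out R" out xs] by (simp add: st_upd_out)
qed auto

lemma GEN_append:
  assumes "GEN d F" "GEN d F'"
  shows "GEN d (\<lambda>w e. F w e @ F' w e)"
proof -
  from GENE[OF assms(1)] obtain c B where c: "guess_free c" "polyb B"
    "\<And>w g e out R. valid_env w g d e \<Longrightarrow> ex c (st w g (lev e) 1 out R)
       (st w g (lev e) 1 (out @ map bit_symbol (F w e)) R) (B (length w))" by blast
  from GENE[OF assms(2)] obtain c' B' where c': "guess_free c'" "polyb B'"
    "\<And>w g e out R. valid_env w g d e \<Longrightarrow> ex c' (st w g (lev e) 1 out R)
       (st w g (lev e) 1 (out @ map bit_symbol (F' w e)) R) (B' (length w))" by blast
  show ?thesis
    by (rule GENI[of "Seq c c'" "\<lambda>n. B n + B' n"])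
       (use c c' ex_Seq[OF c(3) c'(3)] in auto)
qed

lemma GEN_if:
  assumes "FO d (\<lambda>w \<rho> e. P w e)" "GEN d F" "GEN d F'"
  shows "GEN d (\<lambda>w e. if P w e then F w e else F' w e)"
proof -
  from FOE[OF assms(1)] obtain c0 B0 where c0: "guess_free c0" "polyb B0"
    "\<And>w g e b out R. valid_env w g d e \<Longrightarrow> ex c0 (st w g (lev e) b out R)
       (st w g (lev e) (if P w e then 2 else 1) out R) (B0 (length w))" by blast
  from GENE[OF assms(2)] obtain c B where c: "guess_free c" "polyb B"
    "\<And>w g e out R. valid_env w g d e \<Longrightarrow> ex c (st w g (lev e) 1 out R)
       (st w g (lev e) 1 (out @ map bit_symbol (F w e)) R) (B (length w))" by blast
  from GENE[OF assms(3)] obtain c' B' where c': "guess_free c'" "polyb B'"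
    "\<And>w g e out R. valid_env w g d e \<Longrightarrow> ex c' (st w g (lev e) 1 out R)
       (st w g (lev e) 1 (out @ map bit_symbol (F' w e)) R) (B' (length w))" by blast
  let ?c = "Seq c0 (If [(Flg, {2})] (Seq (Act Flg (Some 1) MStay) c) c')"
  show ?thesis
  proof (rule GENI[of ?c "\<lambda>n. B0 n + Suc (Suc (B n + B' n))"])
    fix w g e out R assume v: "valid_env w g d e"
    let ?s = "st w g (lev e) (if P w e then 2 else 1) out R"
    let ?t = "st w g (lev e) 1 (out @ map bit_symbol (if P w e then F w e else F' w e)) R"
    have h: "holds [(Flg, {2})] (scan ?s) \<longleftrightarrow> P w e"
      by (auto simp: holds_single scanned_wt)
    show "ex ?c (st w g (lev e) 1 out R) ?t (B0 (length w) + Suc (Suc (B (length w) + B' (length w))))"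
    proof (rule ex_Seq[OF c0(3)[OF v] ex_If])
      assume "holds [(Flg, {2})] (scan ?s)"
      then have "P w e" using h by simp
      then show "ex (Seq (Act Flg (Some 1) MStay) c) ?s ?t (Suc (B (length w) + B' (length w)))"
        using ex_mono[OF c(3)[OF v]] by (auto simp: do_act_Some act_wt_update st_upd intro!: ex_SeqActI)
    next
      assume "\<not> holds [(Flg, {2})] (scan ?s)"
      then have "\<not> P w e" using h by simp
      then show "ex c' ?s ?t (Suc (B (length w) + B' (length w)))"
        using ex_mono[OF c'(3)[OF v]] by auto
    qed
  qed (use c c' c0 in auto)
qed

lemma GEN_for:
  assumes "GEN (Suc d) (\<lambda>w e. F w (hd e) (tl e))"
  shows "GEN d (\<lambda>w e. concat (map (\<lambda>x. F w x e) [0..<length w]))"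
proof -
  from GENE[OF assms(1)] obtain c B where c: "guess_free c" "polyb B"
    "\<And>w g e out R. valid_env w g (Suc d) e \<Longrightarrow> ex c (st w g (lev e) 1 out R)
       (st w g (lev e) 1 (out @ map bit_symbol (F w (hd e) (tl e))) R) (B (length w))" by blast
  let ?c = "Seq (For (Var d) c) (rewind (Var d))"
  show ?thesis
  proof (rule GENI[of ?c "\<lambda>n. (n * (B n + 2) + 1) + (2 * n + 3)"])
    fix w g e out R assume v: "valid_env w g d e"
    let ?n = "length w"
    define J where "J m = st w g (lev e) 1 (out @ map bit_symbol (concat (map (\<lambda>x. F w x e) [0..<m]))) R" for m
    have d: "length e = d" using v by (simp add: valid_env_def)
    have l0: "(lev e)(d := 0) = lev e" using lev_length[of e] d by auto
    have "ex (For (Var d) c) ((J 0)(Var d := wt w 0)) ((J ?n)(Var d := wt w (int ?n))) (?n * (B ?n + 2) + 1)"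
    proof (rule ex_For)
      fix m assume m: "m < ?n"
      then have "valid_env w g (Suc d) (m # e)" using v by (auto simp: valid_env_def)
      from c(3)[OF this, where out = "out @ map bit_symbol (concat (map (\<lambda>x. F w x e) [0..<m]))" and R = R]
      show "ex c ((J m)(Var d := wt w (int m))) ((J (Suc m))(Var d := wt w (int m))) (B ?n)"
        by (simp add: J_def st_upd lev_Cons d)
    qed (use v in \<open>simp add: valid_env_def\<close>)
    moreover have "(J m)(Var d := wt w 0) = J m" for m
      using st_upd(2)[where l = d and m = 0 and w = w] l0 by (simp add: J_def)
    moreover have "ex (rewind (Var d)) ((J ?n)(Var d := wt w (int ?n))) ((J ?n)(Var d := wt w 0)) (2 * ?n + 3)"
      by (rule ex_rewind[where w = w]) (use v in \<open>auto simp: valid_env_def\<close>)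
    ultimately have "ex ?c (J 0) (J ?n) ((?n * (B ?n + 2) + 1) + (2 * ?n + 3))"
      by (metis ex_Seq)
    then show "ex ?c (st w g (lev e) 1 out R)
      (st w g (lev e) 1 (out @ map bit_symbol (concat (map (\<lambda>x. F w x e) [0..<length w]))) R)
      ((?n * (B ?n + 2) + 1) + (2 * ?n + 3))"
      by (simp add: J_def)
  qed (use c in \<open>auto simp: For_def rewind_def\<close>)
qed

lemma GEN_unary:
  assumes "tm_at d t"
  shows "GEN d (\<lambda>w e. concat (replicate (t e) xs))"
proof -
  from assms obtain i where i: "i < d" "\<And>e. length e = d \<Longrightarrow> t e = e ! i"
    unfolding tm_at_def by metis
  let ?i = "Var (d - Suc i)"
  show ?thesis
  proof (rule GENI[of "rep Scr ?i (emit xs)" "\<lambda>n. (n + 1) * (Suc (length xs) + 10) + 10"])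
    fix w g e out R assume v: "valid_env w g d e"
    define J where "J m = st w g (lev e) 1 (out @ map bit_symbol (concat (replicate m xs))) R" for m
    have l: "lev e (d - Suc i) = e ! i" "e ! i < length w"
      using v i lev_nth by (auto simp: valid_env_def)
    have body: "ex (emit xs) ((J m)(?i := wt w x, Scr := wt [1] y)) ((J (Suc m))(?i := wt w x, Scr := wt [1] y))
        (Suc (length xs))" for m x y
    proof -
      let ?o = "out @ map bit_symbol (concat (replicate m xs))"
      have "concat (replicate m xs) @ xs = concat (replicate (Suc m) xs)"
        by (induction m) auto
      then have o: "out @ map bit_symbol (concat (replicate (Suc m) xs)) = ?o @ map bit_symbol xs"
        by (metis append.assoc map_append)
      have "(J m)(?i := wt w x, Scr := wt [1] y, Out := wt (?o @ map bit_symbol xs) (int (length ?o + length xs)))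
        = (J (Suc m))(?i := wt w x, Scr := wt [1] y)"
        unfolding J_def o by (auto simp: st_def fun_eq_iff algebra_simps split: tp.splits)
      then show ?thesis
        using ex_emit[of "(J m)(?i := wt w x, Scr := wt [1] y)" ?o xs] by (simp add: J_def)
    qed
    have "ex (rep Scr ?i (emit xs)) ((J 0)(?i := wt w (int (e ! i)), Scr := wt [1] 0))
      ((J (e ! i))(?i := wt w (int (e ! i)), Scr := wt [1] 0)) ((e ! i + 1) * (Suc (length xs) + 10) + 10)"
      by (rule ex_rep[where J = J, OF _ l(2) _ body]) (use v in \<open>auto simp: valid_env_def\<close>)
    moreover have "(J m)(?i := wt w (int (e ! i)), Scr := wt [1] 0) = J m" for m
      using l(1) by (auto simp: J_def fun_eq_iff)
    ultimately have "ex (rep Scr ?i (emit xs)) (J 0) (J (e ! i)) ((e ! i + 1) * (Suc (length xs) + 10) + 10)"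
      by simp
    moreover have "(e ! i + 1) * (Suc (length xs) + 10) + 10 \<le> (length w + 1) * (Suc (length xs) + 10) + 10"
      using l(2) by simp
    ultimately have "ex (rep Scr ?i (emit xs)) (J 0) (J (e ! i)) ((length w + 1) * (Suc (length xs) + 10) + 10)"
      by (rule ex_mono)
    moreover have "t e = e ! i" using i(2) v by (simp add: valid_env_def)
    ultimately show "ex (rep Scr ?i (emit xs)) (st w g (lev e) 1 out R)
      (st w g (lev e) 1 (out @ map bit_symbol (concat (replicate (t e) xs))) R)
      ((length w + 1) * (Suc (length xs) + 10) + 10)"
      by (simp add: J_def)
  next
    show "guess_free (rep Scr ?i (emit xs))" by (simp add: rep_def guess_free_emit)
    show "polyb (\<lambda>n. (n + 1) * (Suc (length xs) + 10) + 10)"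
      by (intro polyb_add polyb_mult polyb_const polyb_id)
  qed
qed

lemma GEN_list:
  "(\<And>a. a \<in> set as \<Longrightarrow> GEN d (F a)) \<Longrightarrow> GEN d (\<lambda>w e. concat (map (\<lambda>a. F a w e) as))"
proof (induction as)
  case Nil
  show ?case using GEN_const[of d "[]"] by simp
next
  case (Cons a as)
  then show ?case using GEN_append[of d "F a"] by simp
qed

section \<open>Polynomial time and NP\<close>

definition blank_start :: "'i \<Rightarrow> bool list \<Rightarrow> 'i tapes" where
  "blank_start io x = (\<lambda>_. wt [] 0)(io := wt (map bit_symbol x) 0)"

lemma wt_Nil: "wt [] 0 = (\<lambda>_. 0, 0)"
  by (auto simp: wt_def)

lemma wt_input: "wt (map bit_symbol x) 0 = input_tape x"
  by (rule prod_eqI) (auto simp: wt_def input_tape_def nat_less_iff fun_eq_iff)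

lemma initial_conf:
  assumes "distinct (io # ts)" "\<And>i. i \<in> set (io # ts) \<Longrightarrow> s i = blank_start io x i" "ntapes M = length (io # ts)" "start M = 0"
  shows "initial_config M x = conf (io # ts) 0 s"
proof -
  have "map s ts = replicate (length ts) (\<lambda>_. 0, 0)"
  proof (rule replicate_eqI)
    fix y assume "y \<in> set (map s ts)"
    then obtain i where "i \<in> set ts" "y = s i" by auto
    then show "y = (\<lambda>_. 0, 0)" using assms(1,2) by (auto simp: blank_start_def wt_Nil)
  qed simp
  then show ?thesis
    using assms by (simp add: initial_config_def conf_def blank_start_def wt_input)
qed

lemma program_tapes:
  assumes "finite (T :: 'i set)"
  obtains ts where "distinct (io # ts)" "T \<subseteq> set (io # ts)" "set ts \<subseteq> T"
proof -
  obtain ts where "set ts = T - {io}" "distinct ts"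
    using assms finite_distinct_list[of "T - {io}"] by auto
  then show ?thesis using that[of ts] by auto
qed

lemma clean_start:
  assumes "distinct (io # ts)" "\<And>i. i \<in> set (io # ts) \<Longrightarrow> s i = blank_start io x i" "3 \<le> K"
  shows "clean (io # ts) K s"
  unfolding clean_def
proof (intro ballI allI)
  fix i p assume "i \<in> set (io # ts)"
  then have "s i = blank_start io x i" by (rule assms(2))
  then show "fst (s i) p < K"
    using assms(3) by (auto simp: blank_start_def wt_def bit_symbol_def)
qed

lemma finite_bounded:
  assumes "finite (A :: nat set)"
  obtains K where "3 \<le> K" "A \<subseteq> {..<K}"
proof -
  from assms obtain k where "\<forall>a \<in> A. a < k" by (meson finite_nat_set_iff_bounded)
  then show ?thesis using that[of "max 3 k"] by fastforce
qed

lemma wf_tmI: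
  assumes "ntapes M \<ge> 1" "finite (trans M)"
    and "\<And>q as q' bs ds. (q, as, q', bs, ds) \<in> trans M \<Longrightarrow>
      length as = ntapes M \<and> length bs = ntapes M \<and> length ds = ntapes M"
  shows "wf_tm M"
  unfolding wf_tm_def using assms by blast

text \<open>The start state is prescribed only on the tapes that the program mentions. The type of
  tapes is infinite, and the states used with \<open>st\<close> carry the word on all
  \<open>Var\<close> tapes.\<close>

lemma polytime_computableI:
  fixes c :: "'i com"
  assumes gf: "guess_free c" and pb: "polyb B"
    and run: "\<And>x. \<exists>s s'. (\<forall>i \<in> insert io (tapes_of c). s i = blank_start io x i) \<and> ex c s s' (B (length x)) \<and>
      s' io = wt (map bit_symbol (f x)) 0"
  shows "polytime_computable f"
proof -
  obtain ts where ts: "distinct (io # ts)" "tapes_of c \<subseteq> set (io # ts)" "set ts \<subseteq> tapes_of c"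
    by (rule program_tapes[OF finite_tapes_of[of c], of io])
  obtain K where K: "3 \<le> K" "writes_of c \<subseteq> {..<K}"
    using finite_bounded[OF finite_writes_of[OF gf]] by blast
  define e where "e = num_states c"
  define M where "M = \<lparr>ntapes = length (io # ts), start = 0, accept = 0, trans = compile (io # ts) K c 0 e\<rparr>"
  obtain p where p: "\<And>n. B n \<le> poly p n" using pb unfolding polyb_def by blast
  have wf: "wf_tm M"
  proof (rule wf_tmI)
    fix q as q' bs ds
    assume "(q, as, q', bs, ds) \<in> trans M"
    then have "(q, as, q', bs, ds) \<in> compile (io # ts) K c 0 e" by (simp add: M_def)
    from compile_wf[OF this K(2)]
    show "length as = ntapes M \<and> length bs = ntapes M \<and> length ds = ntapes M" by (simp add: M_def)
  qed (simp_all add: M_def finite_compile[OF K(2)])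
  have det: "deterministic_tm M"
    unfolding deterministic_tm_def M_def using compile_det[OF _ _ gf ts(2)] by auto
  show ?thesis unfolding polytime_computable_def
  proof (rule exI[of _ M], rule exI[of _ p], intro conjI allI)
    fix x
    obtain s s' where s: "\<forall>i \<in> insert io (tapes_of c). s i = blank_start io x i" "ex c s s' (B (length x))"
      "s' io = wt (map bit_symbol (f x)) 0" using run by blast
    then obtain n where n: "n \<le> B (length x)" "exec c s n s'" unfolding ex_def by blast
    have s_eq: "s i = blank_start io x i" if "i \<in> set (io # ts)" for i using s(1) that ts(3) by auto
    have steps: "(tm_step M ^^ n) (conf (io # ts) 0 s) (conf (io # ts) e s')"
      by (rule exec_steps[OF n(2) _ clean_start[OF ts(1) s_eq K(1)] K(2)]) (simp add: M_def)
    moreover have "conf (io # ts) 0 s = initial_config M x"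
      by (rule initial_conf[symmetric, OF ts(1) s_eq]) (simp_all add: M_def)
    \<comment> \<open>The exit state lies behind all states that have transitions, so the machine
      halts there.\<close>
    moreover have "\<nexists>c'. tm_step M (conf (io # ts) e s') c'"
      unfolding tm_step_conf_iff M_def using compile_source[of e _ "io # ts" K c 0 e] by (fastforce simp: e_def)
    moreover have "shows_output (conf (io # ts) e s') (f x)"
      using s(3) by (simp add: shows_output_def conf_def wt_def nat_less_iff)
    ultimately show "\<exists>n ca. n \<le> poly p (length x) \<and> (tm_step M ^^ n) (initial_config M x) ca \<and>
        (\<nexists>c'. tm_step M ca c') \<and> shows_output ca (f x)"
      using n(1) p[of "length x"] by (metis order_trans)
  qed (fact wf det)+
qed

text \<open>\<open>tot\<close> speaks of all choices and yields the time bound and soundness; one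
  execution with raised flag yields completeness.\<close>

lemma NP_I:
  fixes c :: "'i com"
  assumes fw: "finite (writes_of c)" and pb: "polyb B" and flg: "flg \<in> tapes_of c"
    and run: "\<And>x. \<exists>s. (\<forall>i \<in> insert io (tapes_of c). s i = blank_start io x i) \<and>
      tot c s (B (length x)) (\<lambda>s'. scanned (s' flg) = 2 \<longrightarrow> x \<in> L) \<and>
      (x \<in> L \<longrightarrow> (\<exists>n s'. exec c s n s' \<and> scanned (s' flg) = 2))"
  shows "L \<in> NP"
proof -
  obtain ts0 where ts0: "distinct (io # ts0)" "tapes_of c \<subseteq> set (io # ts0)" "set ts0 \<subseteq> tapes_of c"
    by (rule program_tapes[OF finite_tapes_of[of c], of io])
  define ts where "ts = io # ts0"
  note ts = ts0[folded ts_def]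
  obtain K where K: "3 \<le> K" "writes_of c \<subseteq> {..<K}"
    using finite_bounded[OF fw] by blast
  define e where "e = num_states c"
  \<comment> \<open>One further step leads from the exit state to acceptance if the flag shows 2. It
    accounts for the bound \<open>p + 1\<close>.\<close>
  define D where "D = {(e, map a ts, Suc e, map a ts, map (\<lambda>_. MStay) ts) | a. a \<in> legal ts K \<and> a flg = 2}"
  define M where "M = \<lparr>ntapes = length ts, start = 0, accept = Suc e, trans = compile ts K c 0 e \<union> D\<rparr>"
  obtain p where p: "\<And>n. B n \<le> poly p n" using pb unfolding polyb_def by blast
  have "D \<subseteq> compile ts K (Act flg None MStay) e (Suc e)"
    by (auto simp: D_def)
  then have fD: "finite D" by (rule finite_subset[OF _ finite_compile]) simp
  have wf: "wf_tm M"
  proof (rule wf_tmI)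
    fix q as q' bs ds
    assume "(q, as, q', bs, ds) \<in> trans M"
    then have "(q, as, q', bs, ds) \<in> compile ts K c 0 e \<union> D" by (simp add: M_def)
    then show "length as = ntapes M \<and> length bs = ntapes M \<and> length ds = ntapes M"
      using compile_wf[OF _ K(2), of q as q' bs ds ts 0 e] by (auto simp: M_def D_def)
  qed (simp_all add: M_def fD finite_compile[OF K(2)] ts_def)
  have at: "runs_at ts K M c 0 e"
    unfolding runs_at_def M_def D_def e_def by auto
  have halt: "\<not> tm_step M (Suc e, tps) c'" for tps c'
  proof
    assume "tm_step M (Suc e, tps) c'"
    then obtain as r where "(Suc e, as, r) \<in> compile ts K c 0 e \<union> D"
      unfolding M_def tm_step_def by (cases c') auto
    then show False using compile_source[of "Suc e" "(as, r)" ts K c 0 e] by (auto simp: D_def e_def)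
  qed
  have D_step: "(Suc e, map s ts) = c'" "scanned (s flg) = 2" if "tm_step M (conf ts e s) c'" for s c'
  proof -
    from that obtain q' bs ds where *: "(e, map (scan s) ts, q', bs, ds) \<in> trans M"
      "c' = (q', map2 act (map s ts) (zip bs ds))" unfolding tm_step_conf_iff by blast
    have "(e, map (scan s) ts, q', bs, ds) \<notin> compile ts K c 0 e"
      using compile_source[of e _ ts K c 0 e] by (fastforce simp: e_def)
    then obtain a where a: "map (scan s) ts = map a ts" "q' = Suc e" "bs = map a ts" "ds = map (\<lambda>_. MStay) ts"
      "a flg = 2" using *(1) by (auto simp: M_def D_def)
    then have "bs = map (scan s) ts" by simp
    then show "(Suc e, map s ts) = c'" using *(2) a(2,4) map_do_nothing[of s ts] by simp
    have "flg \<in> set ts" using flg ts(2) by auto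
    then show "scanned (s flg) = 2" using a(1,5) by auto
  qed
  show ?thesis unfolding NP_def
  proof (rule CollectI, rule exI[of _ M], rule exI[of _ "p + 1"], intro conjI allI impI)
    show "wf_tm M" by (fact wf)
    have main: "safe M (x \<in> L) (Suc (poly p (length x))) (initial_config M x) \<and> (x \<in> L \<longrightarrow> tm_accepts M x)" for x
    proof -
      obtain s where s: "\<forall>i \<in> insert io (tapes_of c). s i = blank_start io x i"
        "tot c s (B (length x)) (\<lambda>s'. scanned (s' flg) = 2 \<longrightarrow> x \<in> L)"
        "x \<in> L \<longrightarrow> (\<exists>n s'. exec c s n s' \<and> scanned (s' flg) = 2)" using run by blast
      have s_eq: "s i = blank_start io x i" if "i \<in> set (io # ts0)" for i
        using s(1) that ts0(3) by auto
      have init: "conf ts 0 s = initial_config M x"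
        unfolding ts_def by (rule initial_conf[symmetric, OF ts0(1) s_eq]) (simp_all add: M_def ts_def)
      have "safe M (x \<in> L) (Suc 0) (conf ts e s')" if "scanned (s' flg) = 2 \<longrightarrow> x \<in> L" for s'
      proof (rule safe_step)
        fix c' assume "tm_step M (conf ts e s') c'"
        from D_step[OF this] show "safe M (x \<in> L) 0 c'"
          using that halt by (auto intro: safe_halt)
      qed (simp add: conf_def M_def)
      then have "safe M (x \<in> L) (B (length x) + Suc 0) (conf ts 0 s)"
        by (intro tot_safe[OF s(2) at _ ts(2)]) (auto simp: M_def e_def)
      then have 1: "safe M (x \<in> L) (Suc (poly p (length x))) (conf ts 0 s)"
        using p[of "length x"] unfolding safe_def by fastforce
      have "tm_accepts M x" if x: "x \<in> L"
      proof -
        obtain n s' where e: "exec c s n s'" "scanned (s' flg) = 2" using s(3) x by blast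
        have cl: "clean ts K s" unfolding ts_def by (rule clean_start[OF ts0(1) s_eq K(1)])
        have "(tm_step M ^^ n) (conf ts 0 s) (conf ts e s')"
          by (rule exec_steps[OF e(1) _ cl K(2)]) (auto simp: M_def)
        then have r: "(tm_step M)\<^sup>*\<^sup>* (conf ts 0 s) (conf ts e s')" by (rule relpowp_imp_rtranclp)
        have "scan s' \<in> legal ts K" using clean_scan exec_clean[OF e(1) cl K(2)] by blast
        then have "(e, map (scan s') ts, Suc e, map (scan s') ts, map (\<lambda>_. MStay) ts) \<in> trans M"
          using e(2) by (auto simp: M_def D_def)
        then have "tm_step M (conf ts e s') (conf ts (Suc e) s')"
          unfolding tm_step_conf_iff using map_do_nothing[of s' ts] unfolding conf_def by metis
        then have "(tm_step M)\<^sup>*\<^sup>* (initial_config M x) (conf ts (Suc e) s')" using r init by auto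
        then show ?thesis unfolding tm_accepts_def by (auto simp: M_def conf_def)
      qed
      then show ?thesis using 1 init by simp
    qed
    show "n \<le> poly (p + 1) (length x)" if "(tm_step M ^^ n) (initial_config M x) c'" for x n c'
      using main[of x] that unfolding safe_def by fastforce
    show "x \<in> L \<longleftrightarrow> tm_accepts M x" for x
      using main[of x] unfolding safe_def tm_accepts_def by (metis rtranclp_imp_relpowp)
  qed
qed

subsection \<open>Preparing the tapes\<close>

fun transcribe :: "'i \<Rightarrow> 'i \<Rightarrow> (nat \<Rightarrow> nat) \<Rightarrow> nat list \<Rightarrow> 'i com" where
  "transcribe src dst f [] = skip dst"
| "transcribe src dst f (a # as) = If [(src, {a})] (put dst (f a)) (transcribe src dst f as)"

lemma ex_transcribe:
  assumes "scanned (s src) \<in> set as" "s dst = wt u (int (length u))"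
  shows "ex (transcribe src dst f as) s
    (s(dst := wt (u @ [f (scanned (s src))]) (int (length u) + 1))) (Suc (length as))"
  using assms(1)
proof (induction as)
  case (Cons a as)
  show ?case unfolding transcribe.simps
  proof (rule ex_If)
    show "ex (put dst (f a)) s (s(dst := wt (u @ [f (scanned (s src))]) (int (length u) + 1))) (length (a # as))"
      if "holds [(src, {a})] (scan s)"
      using that assms(2) by (auto simp: holds_single do_act_Some act_wt_append intro!: ex_ActI)
    show "ex (transcribe src dst f as) s (s(dst := wt (u @ [f (scanned (s src))]) (int (length u) + 1))) (length (a # as))"
      if "\<not> holds [(src, {a})] (scan s)"
      using that Cons by (simp add: holds_single fun_upd_def)
  qed
qed simp

lemma guess_free_transcribe: "guess_free (transcribe src dst f as)"
  by (induction as) auto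

definition copy_tape :: "'i \<Rightarrow> 'i \<Rightarrow> nat list \<Rightarrow> 'i com" where
  "copy_tape src dst as = Seq (For src (transcribe src dst id as)) (Seq (rewind src) (rewind dst))"

lemma ex_copy_tape:
  assumes "0 \<notin> set w" "set w \<subseteq> set as" "src \<noteq> dst" "s src = wt w 0" "s dst = wt [] 0"
  shows "ex (copy_tape src dst as) s (s(dst := wt w 0)) ((length as + 10) * (length w + 1))"
proof -
  let ?n = "length w"
  let ?J = "\<lambda>m. s(dst := wt (take m w) (int m))"
  have 1: "ex (For src (transcribe src dst id as)) ((?J 0)(src := wt w 0)) ((?J ?n)(src := wt w (int ?n)))
      (?n * (Suc (length as) + 2) + 1)"
  proof (rule ex_For[OF assms(1)])
    fix m assume m: "m < ?n"
    let ?s = "(?J m)(src := wt w (int m))"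
    have "scanned (?s src) = w ! m" using m by (simp add: scanned_wt)
    moreover have "w ! m \<in> set as" using m assms(2) by auto
    moreover have "?s dst = wt (take m w) (int (length (take m w)))" using m assms(3) by simp
    ultimately show "ex (transcribe src dst id as) ?s ((?J (Suc m))(src := wt w (int m))) (Suc (length as))"
      using ex_transcribe[of ?s src as dst "take m w" id] m assms(3)
      by (auto simp: take_Suc_conv_app_nth fun_upd_twist algebra_simps)
  qed
  have s0: "(?J 0)(src := wt w 0) = s" using assms by (auto simp: fun_eq_iff)
  have 2: "ex (rewind src) ((?J ?n)(src := wt w (int ?n))) (?J ?n) (2 * ?n + 3)"
    by (rule ex_rewind[where w = w]) (use assms in \<open>auto simp: fun_eq_iff\<close>)
  have 3: "ex (rewind dst) (?J ?n) (s(dst := wt w 0)) (2 * ?n + 3)"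
    by (rule ex_rewind[where w = w]) (use assms in \<open>auto simp: fun_eq_iff\<close>)
  show ?thesis unfolding copy_tape_def
    by (rule ex_mono[OF ex_Seq[OF 1[unfolded s0] ex_Seq[OF 2 3]]]) (simp add: algebra_simps)
qed

definition product_tape :: "'i \<Rightarrow> 'i \<Rightarrow> 'i \<Rightarrow> 'i com" where
  "product_tape a b c = Seq (For a (Seq (For b (put c 1)) (rewind b))) (Seq (rewind a) (rewind c))"

lemma ex_product_tape:
  assumes "0 \<notin> set u" "0 \<notin> set w" "distinct [a, b, c]" "s a = wt u 0" "s b = wt w 0" "s c = wt [] 0"
  shows "ex (product_tape a b c) s (s(c := wt (replicate (length u * length w) 1) 0))
    (20 * (length u + 1) * (length w + 1))"
proof -
  let ?m = "length u" and ?n = "length w"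
  let ?J = "\<lambda>m. s(c := wt (replicate (m * ?n) 1) (int (m * ?n)))"
  have inner: "ex (Seq (For b (put c 1)) (rewind b)) ((?J m)(a := wt u (int m))) ((?J (Suc m))(a := wt u (int m)))
      ((?n * (Suc 0 + 2) + 1) + (2 * ?n + 3))" for m
  proof -
    let ?H = "\<lambda>l. s(c := wt (replicate (m * ?n + l) 1) (int (m * ?n + l)), a := wt u (int m))"
    have "ex (For b (put c 1)) ((?H 0)(b := wt w 0)) ((?H ?n)(b := wt w (int ?n))) (?n * (Suc 0 + 2) + 1)"
    proof (rule ex_For[OF assms(2)], rule ex_ActI)
      fix l
      have "replicate (m * ?n + l) 1 @ [1] = replicate (m * ?n + Suc l) (1 :: nat)"
        by (simp add: replicate_append_same)
      moreover have "act (wt (replicate (m * ?n + l) 1) (int (m * ?n + l))) (1, MRight) =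
        wt (replicate (m * ?n + l) 1 @ [1]) (int (m * ?n + l) + 1)"
        using act_wt_append[of "replicate (m * ?n + l) 1"] by simp
      ultimately have "act (wt (replicate (m * ?n + l) 1) (int (m * ?n + l))) (1, MRight) =
        wt (replicate (m * ?n + Suc l) 1) (int (m * ?n + Suc l))"
        by (simp only: of_nat_Suc add_Suc_right) (simp add: algebra_simps)
      then show "do_act c (Some 1) MRight ((?H l)(b := wt w (int l))) = (?H (Suc l))(b := wt w (int l))"
        using assms(3) unfolding do_act_Some by (auto simp del: replicate_Suc replicate_add simp: fun_eq_iff)
    qed
    moreover have "(?H 0)(b := wt w 0) = (?J m)(a := wt u (int m))"
      using assms(3,5) by (auto simp: fun_eq_iff)
    moreover have "ex (rewind b) ((?H ?n)(b := wt w (int ?n))) ((?J (Suc m))(a := wt u (int m))) (2 * ?n + 3)"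
      by (rule ex_rewind[where w = w]) (use assms in \<open>auto simp: fun_eq_iff algebra_simps\<close>)
    ultimately show ?thesis by (metis ex_Seq)
  qed
  have 1: "ex (For a (Seq (For b (put c 1)) (rewind b))) ((?J 0)(a := wt u 0)) ((?J ?m)(a := wt u (int ?m)))
      (?m * (((?n * (Suc 0 + 2) + 1) + (2 * ?n + 3)) + 2) + 1)"
    by (rule ex_For[OF assms(1) inner])
  have s0: "(?J 0)(a := wt u 0) = s" using assms by (auto simp: fun_eq_iff)
  have 2: "ex (rewind a) ((?J ?m)(a := wt u (int ?m))) (?J ?m) (2 * ?m + 3)"
    by (rule ex_rewind[where w = u]) (use assms in \<open>auto simp: fun_eq_iff\<close>)
  have 3: "ex (rewind c) (?J ?m) (s(c := wt (replicate (?m * ?n) 1) 0)) (2 * (?m * ?n) + 3)"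
    by (rule ex_rewind[where w = "replicate (?m * ?n) 1"]) (use assms in \<open>auto simp: fun_eq_iff\<close>)
  show ?thesis unfolding product_tape_def
    by (rule ex_mono[OF ex_Seq[OF 1[unfolded s0] ex_Seq[OF 2 3]]]) (simp add: algebra_simps)
qed

section \<open>Definability implies complexity\<close>

definition letter :: "bool list \<Rightarrow> nat \<Rightarrow> nat" where
  "letter x i = (if i < length x then Suc (bit_symbol (x ! i)) else 1)"

text \<open>The input, preceded and followed by blanks (letter 1) to length \<open>2 * Z + 1\<close>; the letter at
  the central position \<open>Z\<close>, where the input starts, is raised by 3.\<close>

definition word :: "nat \<Rightarrow> bool list \<Rightarrow> nat list" where
  "word Z x = replicate Z 1 @ (letter x 0 + 3) # map (\<lambda>i. letter x (Suc i)) [0..<Z]"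

lemma length_word [simp]: "length (word Z x) = 2 * Z + 1"
  by (simp add: word_def)

lemma word_letters: "set (word Z x) \<subseteq> {1..<7}"
  by (auto simp: word_def letter_def bit_symbol_def)

lemma word_nonzero: "0 \<notin> set (word Z x)"
  using word_letters[of Z x] by auto

lemma act_unary: "act (wt (replicate k 1) (int k)) (1, MRight) = wt (replicate (Suc k) 1) (int (Suc k))"
  using act_wt_append[of "replicate k 1" 1 MRight] by (simp add: replicate_append_same algebra_simps)

fun pad :: "nat \<Rightarrow> tp com" where
  "pad 0 = skip Out"
| "pad (Suc c) = Seq (put (Aux 1) 1) (Seq (put (Aux 2) 1) (pad c))"

lemma ex_pad:
  "ex (pad c) (s(Aux 1 := wt (replicate k 1) (int k), Aux 2 := wt (replicate k 1) (int k)))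
     (s(Aux 1 := wt (replicate (k + c) 1) (int (k + c)), Aux 2 := wt (replicate (k + c) 1) (int (k + c))))
     (Suc (2 * c))"
proof (induction c arbitrary: k)
  case 0
  show ?case unfolding pad.simps by (intro ex_SkipI) simp
next
  case (Suc c)
  have *: "do_act (Aux 2) (Some 1) MRight (do_act (Aux 1) (Some 1) MRight
      (s(Aux 1 := wt (replicate k 1) (int k), Aux 2 := wt (replicate k 1) (int k)))) =
    s(Aux 1 := wt (replicate (Suc k) 1) (int (Suc k)), Aux 2 := wt (replicate (Suc k) 1) (int (Suc k)))"
    using act_unary[of k] by (auto simp: do_act_Some fun_eq_iff simp del: replicate_Suc of_nat_Suc)
  have "ex (pad (Suc c)) (s(Aux 1 := wt (replicate k 1) (int k), Aux 2 := wt (replicate k 1) (int k)))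
     (s(Aux 1 := wt (replicate (Suc k + c) 1) (int (Suc k + c)), Aux 2 := wt (replicate (Suc k + c) 1) (int (Suc k + c))))
     (Suc (Suc (Suc (2 * c))))"
    unfolding pad.simps by (rule ex_SeqActI, rule ex_SeqActI, unfold *, rule Suc.IH)
  then show ?case by (simp add: fun_upd_def)
qed

text \<open>The first tape carries the input and later the output. So its contents are moved to
  \<open>Aux 0\<close>, and it is made blank again.\<close>

definition erase :: "tp com" where
  "erase = Seq (left Out) (Seq (While [nonblank Out] (Act Out (Some 0) MLeft)) (right Out))"

lemma act_wt_erase: "act (wt (u @ [a]) (int (length u))) (0, MLeft) = wt u (int (length u) - 1)"
  by (rule prod_eqI) (auto simp: act_def wt_def fun_eq_iff nth_append)

lemma ex_erase:
  assumes "0 \<notin> set xs"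
  shows "ex erase (s(Out := wt xs (int (length xs)))) (s(Out := wt [] 0)) (2 * length xs + 3)"
proof -
  let ?n = "length xs"
  let ?I = "\<lambda>m. s(Out := wt (take (?n - m) xs) (int (?n - m) - 1))"
  have "ex (While [nonblank Out] (Act Out (Some 0) MLeft)) (?I 0) (?I ?n) (?n * (Suc 0 + 1) + 1)"
  proof (rule ex_While[where I = ?I])
    fix m assume m: "m < ?n"
    have nz: "0 \<notin> set (take (?n - m) xs)" using assms by (meson in_set_takeD)
    show "holds [nonblank Out] (scan (?I m))"
      using m by (auto simp: holds_single scanned_wt_nonblank[OF nz])
    have 1: "take (?n - m) xs = take (?n - Suc m) xs @ [xs ! (?n - Suc m)]"
      using m by (metis Suc_diff_Suc diff_less_Suc less_Suc_eq_le not_less_eq take_Suc_conv_app_nth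
          diff_less length_greater_0_conv list.size(3) not_less_zero zero_less_Suc)
    have 2: "int (?n - m) - 1 = int (length (take (?n - Suc m) xs))"
      using m by simp
    show "ex (Act Out (Some 0) MLeft) (?I m) (?I (Suc m)) (Suc 0)"
      unfolding 1 2 by (rule ex_ActI) (simp only: do_act_Some act_wt_erase fun_upd_same fun_upd_upd, simp)
  qed (simp add: holds_single scanned_wt)
  moreover have "ex (left Out) (s(Out := wt xs (int ?n))) (?I 0) 1"
    by (rule ex_left) auto
  moreover have "ex (right Out) (?I ?n) (s(Out := wt [] 0)) 1"
    by (rule ex_right[where w = "[]" and h = "-1"]) auto
  ultimately have "ex erase (s(Out := wt xs (int ?n))) (s(Out := wt [] 0)) (1 + ((?n * (Suc 0 + 1) + 1) + 1))"
    unfolding erase_def by (blast intro: ex_Seq)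
  then show ?thesis by (rule ex_mono) simp
qed

definition read_input :: "nat \<Rightarrow> tp com" where
  "read_input c =
     Seq (For Out (Seq (transcribe Out (Aux 0) id [1, 2]) (Seq (put (Aux 1) 1) (put (Aux 2) 1))))
    (Seq (pad c) (Seq erase (Seq (rewind (Aux 0)) (Seq (rewind (Aux 1)) (rewind (Aux 2))))))"

lemma ex_read_input:
  assumes "s Out = wt xs 0" "set xs \<subseteq> {1, 2}" "s (Aux 0) = wt [] 0" "s (Aux 1) = wt [] 0" "s (Aux 2) = wt [] 0"
  shows "ex (read_input c) s (s(Out := wt [] 0, Aux 0 := wt xs 0,
      Aux 1 := wt (replicate (length xs + c) 1) 0, Aux 2 := wt (replicate (length xs + c) 1) 0))
      (50 * (length xs + c + 1))"
proof -
  let ?n = "length xs"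
  let ?J = "\<lambda>k. s(Aux 0 := wt (take k xs) (int k), Aux 1 := wt (replicate k 1) (int k), Aux 2 := wt (replicate k 1) (int k))"
  have nz: "0 \<notin> set xs" using assms(2) by auto
  have 1: "ex (For Out (Seq (transcribe Out (Aux 0) id [1, 2]) (Seq (put (Aux 1) 1) (put (Aux 2) 1))))
      ((?J 0)(Out := wt xs 0)) ((?J ?n)(Out := wt xs (int ?n))) (?n * ((Suc (length [1::nat, 2]) + Suc (Suc 0)) + 2) + 1)"
  proof (rule ex_For[OF nz], rule ex_Seq)
    fix k assume k: "k < ?n"
    let ?s = "(?J k)(Out := wt xs (int k))"
    let ?t = "?s(Aux 0 := wt (take (Suc k) xs) (int k + 1))"
    have sc: "scanned (?s Out) = xs ! k" using k by (simp add: scanned_wt)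
    have "xs ! k \<in> set xs" using k by simp
    then have "xs ! k \<in> set [1, 2]" using assms(2) by auto
    moreover have "?s (Aux 0) = wt (take k xs) (int (length (take k xs)))" using k by simp
    ultimately have "ex (transcribe Out (Aux 0) id [1, 2]) ?s (?s(Aux 0 := wt (take k xs @ [id (scanned (?s Out))]) (int (length (take k xs)) + 1)))
        (Suc (length [1::nat, 2]))"
      by (intro ex_transcribe) (simp_all only: sc)
    moreover have "take k xs @ [id (scanned (?s Out))] = take (Suc k) xs"
      unfolding sc using k by (simp add: take_Suc_conv_app_nth)
    moreover have "int (length (take k xs)) + 1 = int k + 1" using k by simp
    ultimately show "ex (transcribe Out (Aux 0) id [1, 2]) ?s ?t (Suc (length [1::nat, 2]))" by (simp only:)
    have "do_act (Aux 2) (Some 1) MRight (do_act (Aux 1) (Some 1) MRight ?t) = (?J (Suc k))(Out := wt xs (int k))"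
      using act_unary[of k] by (auto simp: do_act_Some fun_eq_iff algebra_simps simp del: replicate_Suc)
    then show "ex (Seq (put (Aux 1) 1) (put (Aux 2) 1)) ?t ((?J (Suc k))(Out := wt xs (int k))) (Suc (Suc 0))"
      by (intro ex_SeqActI ex_ActI)
  qed
  have s0: "(?J 0)(Out := wt xs 0) = s" using assms by (auto simp: fun_eq_iff)
  let ?s1 = "s(Out := wt xs (int ?n), Aux 0 := wt xs (int ?n))"
  have e1: "(?J ?n)(Out := wt xs (int ?n)) =
      ?s1(Aux 1 := wt (replicate ?n 1) (int ?n), Aux 2 := wt (replicate ?n 1) (int ?n))"
    by (auto simp: fun_eq_iff)
  let ?N = "?n + c"
  let ?s2 = "s(Aux 0 := wt xs (int ?n), Aux 1 := wt (replicate ?N 1) (int ?N), Aux 2 := wt (replicate ?N 1) (int ?N))"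
  have e2: "?s1(Aux 1 := wt (replicate ?N 1) (int ?N), Aux 2 := wt (replicate ?N 1) (int ?N)) = ?s2(Out := wt xs (int ?n))"
    by (auto simp: fun_eq_iff)
  note 2 = ex_pad[of c ?s1 ?n, unfolded e2]
  note 3 = ex_erase[OF nz, of ?s2]
  let ?s3 = "?s2(Out := wt [] 0)"
  have 4: "ex (rewind (Aux 0)) ?s3 (?s3(Aux 0 := wt xs 0)) (2 * ?n + 3)"
    by (rule ex_rewind[where w = xs]) (use nz in auto)
  have 5: "ex (rewind (Aux 1)) (?s3(Aux 0 := wt xs 0)) (?s3(Aux 0 := wt xs 0, Aux 1 := wt (replicate ?N 1) 0)) (2 * ?N + 3)"
    by (rule ex_rewind[where w = "replicate ?N 1"]) auto
  have 6: "ex (rewind (Aux 2)) (?s3(Aux 0 := wt xs 0, Aux 1 := wt (replicate ?N 1) 0))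
     (?s3(Aux 0 := wt xs 0, Aux 1 := wt (replicate ?N 1) 0, Aux 2 := wt (replicate ?N 1) 0)) (2 * ?N + 3)"
    by (rule ex_rewind[where w = "replicate ?N 1"]) auto
  have e3: "?s3(Aux 0 := wt xs 0, Aux 1 := wt (replicate ?N 1) 0, Aux 2 := wt (replicate ?N 1) 0) =
    s(Out := wt [] 0, Aux 0 := wt xs 0, Aux 1 := wt (replicate ?N 1) 0, Aux 2 := wt (replicate ?N 1) 0)"
    by (auto simp: fun_eq_iff)
  show ?thesis unfolding read_input_def
    by (rule ex_mono[OF ex_Seq[OF 1[unfolded s0 e1] ex_Seq[OF 2 ex_Seq[OF 3 ex_Seq[OF 4 ex_Seq[OF 5 6[unfolded e3]]]]]]]) simp
qed

text \<open>Starting from \<open>m\<close> ones on both \<open>Aux 1\<close> and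
  \<open>Aux 2\<close>, the tape \<open>Aux (d + 2)\<close> receives \<open>m ^ (d + 1)\<close>
  ones. Two copies of \<open>m\<close> are kept because a product is taken of two distinct
  tapes.\<close>

fun powers :: "nat \<Rightarrow> tp com" where
  "powers 0 = skip Out"
| "powers (Suc d) = Seq (powers d) (product_tape (Aux 1) (Aux (d + 2)) (Aux (d + 3)))"

fun powers_time :: "nat \<Rightarrow> nat \<Rightarrow> nat" where
  "powers_time 0 m = 1"
| "powers_time (Suc d) m = powers_time d m + 20 * (m + 1) * (m ^ (d + 1) + 1)"

lemma ex_powers:
  assumes "s (Aux 1) = wt (replicate m 1) 0" "s (Aux 2) = wt (replicate m 1) 0"
    "\<And>j. j < d \<Longrightarrow> s (Aux (j + 3)) = wt [] 0"
  shows "\<exists>s'. ex (powers d) s s' (powers_time d m) \<and> s' (Aux (d + 2)) = wt (replicate (m ^ (d + 1)) 1) 0 \<and>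
    (\<forall>i. (\<forall>j. i \<noteq> Aux (j + 3)) \<longrightarrow> s' i = s i) \<and> (\<forall>j \<ge> d. s' (Aux (j + 3)) = s (Aux (j + 3)))"
  using assms(3)
proof (induction d)
  case 0
  show ?case using assms(2) by (intro exI[of _ s]) (auto simp: numeral_2_eq_2 intro!: ex_SkipI)
next
  case (Suc d)
  then obtain s' where s': "ex (powers d) s s' (powers_time d m)" "s' (Aux (d + 2)) = wt (replicate (m ^ (d + 1)) 1) 0"
    "\<forall>i. (\<forall>j. i \<noteq> Aux (j + 3)) \<longrightarrow> s' i = s i" "\<forall>j \<ge> d. s' (Aux (j + 3)) = s (Aux (j + 3))" by auto
  let ?s = "s'(Aux (d + 3) := wt (replicate (length (replicate m (1::nat)) * length (replicate (m ^ (d + 1)) (1::nat))) 1) 0)"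
  have "ex (product_tape (Aux 1) (Aux (d + 2)) (Aux (d + 3))) s' ?s
    (20 * (length (replicate m (1::nat)) + 1) * (length (replicate (m ^ (d + 1)) (1::nat)) + 1))"
    by (rule ex_product_tape) (use s' assms(1) Suc.prems[of d] in auto)
  from ex_Seq[OF s'(1) this] have "ex (powers (Suc d)) s ?s (powers_time (Suc d) m)" by simp
  moreover have "?s (Aux (Suc d + 2)) = wt (replicate (m ^ (Suc d + 1)) 1) 0" by (simp add: eval_nat_numeral)
  moreover have "\<forall>i. (\<forall>j. i \<noteq> Aux (j + 3)) \<longrightarrow> ?s i = s i" using s'(3) by auto
  moreover have "\<forall>j \<ge> Suc d. ?s (Aux (j + 3)) = s (Aux (j + 3))" using s'(4) by auto
  ultimately show ?case by blast
qed

lemma polyb_powers_time: "polyb (powers_time d)"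
  by (induction d) (auto simp: fun_eq_iff polyb_const[of 1] simp del: One_nat_def intro: polyb_mono)

text \<open>The unary tape \<open>z\<close> is traversed twice, for the padding on either side. The
  letter at the centre comes from \<open>a + 4\<close>, the successor for a letter plus the raise by
  3; for the empty input it is a raised blank.\<close>

definition build_word :: "tp \<Rightarrow> tp com" where
  "build_word z = Seq (For z (put Wrd 1)) (Seq (rewind z)
    (Seq (transcribe (Aux 0) Wrd (\<lambda>a. a + 4) [0, 1, 2]) (Seq (right (Aux 0))
    (Seq (For z (Seq (transcribe (Aux 0) Wrd Suc [0, 1, 2]) (right (Aux 0)))) (rewind Wrd)))))"

lemma ex_build_word:
  assumes "s (Aux 0) = wt (map bit_symbol x) 0" "s z = wt (replicate Z 1) 0" "s Wrd = wt [] 0" "distinct [Aux 0, z, Wrd]"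
  shows "\<exists>s'. ex (build_word z) s s' (100 * (Z + 1)) \<and> s' Wrd = wt (word Z x) 0 \<and>
    (\<forall>i. i \<noteq> Wrd \<longrightarrow> i \<noteq> z \<longrightarrow> i \<noteq> Aux 0 \<longrightarrow> s' i = s i)"
proof -
  let ?u = "replicate Z (1::nat)" and ?x = "map bit_symbol x"
  have sc: "scanned (wt ?x (int i)) \<in> set [0, 1, 2]" "Suc (scanned (wt ?x (int i))) = letter x i" for i
    by (auto simp: scanned_wt letter_def bit_symbol_def)
  have "ex (For z (put Wrd 1)) ((s(Wrd := wt (replicate 0 1) (int 0)))(z := wt ?u 0))
      ((s(Wrd := wt (replicate (length ?u) 1) (int (length ?u))))(z := wt ?u (int (length ?u)))) (length ?u * (Suc 0 + 2) + 1)"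
    by (rule ex_For[where J = "\<lambda>m. s(Wrd := wt (replicate m 1) (int m))"])
       (use assms(4) act_unary in \<open>auto simp: do_act_Some fun_eq_iff simp del: replicate_Suc of_nat_Suc intro!: ex_ActI\<close>)
  moreover have "(s(Wrd := wt (replicate 0 1) (int 0)))(z := wt ?u 0) = s" using assms by (auto simp: fun_eq_iff)
  ultimately have 1: "ex (For z (put Wrd 1)) s ((s(Wrd := wt ?u (int Z)))(z := wt ?u (int Z))) (Z * (Suc 0 + 2) + 1)"
    by simp
  let ?s2 = "s(Wrd := wt ?u (int (length ?u)))"
  have 2: "ex (rewind z) ((s(Wrd := wt ?u (int Z)))(z := wt ?u (int Z))) ?s2 (2 * Z + 3)"
    by (rule ex_rewind[where w = ?u]) (use assms in \<open>auto simp: fun_eq_iff\<close>)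
  have "scanned (?s2 (Aux 0)) \<in> set [0, 1, 2]" using sc(1)[of 0] assms(1) by simp
  from ex_transcribe[of ?s2 "Aux 0" "[0, 1, 2]" Wrd ?u "\<lambda>a. a + 4", OF this]
  have 3: "ex (transcribe (Aux 0) Wrd (\<lambda>a. a + 4) [0, 1, 2]) ?s2
      (s(Wrd := wt (?u @ [letter x 0 + 3]) (int Z + 1))) (Suc (length [0::nat, 1, 2]))"
    using sc(2)[of 0] assms(1) by (simp add: eval_nat_numeral)
  define v where "v m = ?u @ (letter x 0 + 3) # map (\<lambda>i. letter x (Suc i)) [0..<m]" for m
  have v: "v (Suc m) = v m @ [letter x (Suc m)]" "length (v m) = Z + 1 + m" "v Z = word Z x" for m
    by (simp_all add: v_def word_def)
  let ?J = "\<lambda>m. s(Wrd := wt (v m) (int (length (v m))), Aux 0 := wt ?x (int (Suc m)))"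
  have 4: "ex (right (Aux 0)) (s(Wrd := wt (?u @ [letter x 0 + 3]) (int Z + 1))) (?J 0) 1"
    by (rule ex_right[where w = ?x and h = 0]) (use assms(1) in \<open>auto simp: fun_eq_iff v_def algebra_simps\<close>)
  have "ex (For z (Seq (transcribe (Aux 0) Wrd Suc [0, 1, 2]) (right (Aux 0)))) ((?J 0)(z := wt ?u 0))
      ((?J (length ?u))(z := wt ?u (int (length ?u)))) (length ?u * ((Suc (length [0::nat, 1, 2]) + 1) + 2) + 1)"
  proof (rule ex_For, simp, rule ex_Seq)
    fix m
    let ?s = "(?J m)(z := wt ?u (int m))"
    let ?t = "?s(Wrd := wt (v (Suc m)) (int (length (v (Suc m)))))"
    have sa: "?s (Aux 0) = wt ?x (int (Suc m))" using assms(4) by simp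
    have a: "scanned (?s (Aux 0)) \<in> set [0, 1, 2]" unfolding sa by (rule sc(1))
    have b: "?s Wrd = wt (v m) (int (length (v m)))" using assms(4) by auto
    have "wt (v m @ [Suc (scanned (?s (Aux 0)))]) (int (length (v m)) + 1) = wt (v (Suc m)) (int (length (v (Suc m))))"
      unfolding sa sc(2) v(1) by (simp add: algebra_simps)
    then show "ex (transcribe (Aux 0) Wrd Suc [0, 1, 2]) ?s ?t (Suc (length [0::nat, 1, 2]))"
      using ex_transcribe[of ?s "Aux 0" "[0, 1, 2]" Wrd "v m" Suc, OF a b] by (simp only:)
    show "ex (right (Aux 0)) ?t ((?J (Suc m))(z := wt ?u (int m))) 1"
      by (rule ex_right[where w = ?x and h = "int (Suc m)"]) (use assms(4) in \<open>auto simp: fun_eq_iff algebra_simps\<close>)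
  qed
  moreover have "(?J 0)(z := wt ?u 0) = ?J 0" using assms by (auto simp: fun_eq_iff)
  ultimately have 5: "ex (For z (Seq (transcribe (Aux 0) Wrd Suc [0, 1, 2]) (right (Aux 0)))) (?J 0)
      ((?J Z)(z := wt ?u (int Z))) (Z * ((Suc (length [0::nat, 1, 2]) + 1) + 2) + 1)" by simp
  let ?s' = "((?J Z)(z := wt ?u (int Z)))(Wrd := wt (word Z x) 0)"
  have 6: "ex (rewind Wrd) ((?J Z)(z := wt ?u (int Z))) ?s' (2 * length (word Z x) + 3)"
    by (rule ex_rewind[where w = "word Z x"]) (use assms(4) v(3) word_nonzero[of Z x] in auto)
  have "ex (build_word z) s ?s' (100 * (Z + 1))"
    unfolding build_word_def
    by (rule ex_mono[OF ex_Seq[OF 1 ex_Seq[OF 2 ex_Seq[OF 3 ex_Seq[OF 4 ex_Seq[OF 5 6]]]]]]) simp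
  then show ?thesis using assms(4) by (intro exI[of _ ?s']) auto
qed

fun copies :: "nat \<Rightarrow> tp com" where
  "copies 0 = skip Out"
| "copies (Suc l) = Seq (copies l) (copy_tape Wrd (Var l) [1..<7])"

lemma ex_copies:
  assumes "0 \<notin> set w" "set w \<subseteq> {1..<7}" "s Wrd = wt w 0" "\<And>j. j < l \<Longrightarrow> s (Var j) = wt [] 0"
  shows "ex (copies l) s (\<lambda>i. case i of Var j \<Rightarrow> if j < l then wt w 0 else s i | _ \<Rightarrow> s i)
    (l * (20 * (length w + 1)) + 1)"
  using assms(4)
proof (induction l)
  case 0
  show ?case by (auto intro!: ex_SkipI split: tp.splits)
next
  case (Suc l)
  let ?S = "\<lambda>l i. case i of Var j \<Rightarrow> if j < l then wt w 0 else s i | _ \<Rightarrow> s i"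
  have 1: "ex (copies l) s (?S l) (l * (20 * (length w + 1)) + 1)" using Suc by simp
  have "ex (copy_tape Wrd (Var l) [1..<7]) (?S l) ((?S l)(Var l := wt w 0)) ((length [1..<7] + 10) * (length w + 1))"
    by (rule ex_copy_tape) (use assms(1-3) Suc.prems in auto)
  moreover have "(?S l)(Var l := wt w 0) = ?S (Suc l)"
    by (auto simp: fun_eq_iff less_Suc_eq split: tp.splits)
  ultimately have "ex (copy_tape Wrd (Var l) [1..<7]) (?S l) (?S (Suc l)) ((length [1::nat..<7] + 10) * (length w + 1))"
    by (simp only:)
  from ex_Seq[OF 1 this] have "ex (copies (Suc l)) s (?S (Suc l)) (Suc l * (20 * (length w + 1)) + 1)"
    unfolding copies.simps by (rule ex_mono) (simp add: algebra_simps)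
  then show ?case .
qed

text \<open>The table of size \<open>n * n\<close> arises as the product of the word with its copy
  on \<open>Var 0\<close>, so at least one variable tape is provided.\<close>

definition prepare :: "nat \<Rightarrow> nat \<Rightarrow> nat \<Rightarrow> tp com" where
  "prepare c d nv = Seq (read_input c) (Seq (powers d) (Seq (build_word (Aux (d + 2))) (Seq (copies nv)
    (Seq (product_tape Wrd (Var 0) Tab) (Seq (Act Scr (Some 1) MStay) (Act Flg (Some 1) MStay))))))"

definition prepare_time :: "nat \<Rightarrow> nat \<Rightarrow> nat \<Rightarrow> nat \<Rightarrow> nat" where
  "prepare_time c d nv n = 50 * (n + c + 1) + (powers_time d (n + c) + (100 * ((n + c) ^ (d + 1) + 1) +
     ((nv * (20 * (2 * (n + c) ^ (d + 1) + 1 + 1)) + 1) +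
     (20 * (2 * (n + c) ^ (d + 1) + 1 + 1) * (2 * (n + c) ^ (d + 1) + 1 + 1) + Suc (Suc 0)))))"

lemma polyb_prepare_time: "polyb (prepare_time c d nv)"
  unfolding prepare_time_def
  by (intro polyb_add polyb_mult polyb_const polyb_id polyb_power polyb_comp[OF polyb_powers_time])

text \<open>Only finitely many \<open>Var\<close> tapes can be filled by a program, whereas
  \<open>st\<close> describes all of them; the tapes beyond \<open>nv\<close>, which no program
  mentions, are taken to hold the word from the outset.\<close>

definition start_tapes :: "nat \<Rightarrow> nat \<Rightarrow> bool list \<Rightarrow> tp tapes" where
  "start_tapes Z nv x = (\<lambda>i. case i of Out \<Rightarrow> wt (map bit_symbol x) 0
     | Var l \<Rightarrow> if l < nv then wt [] 0 else wt (word Z x) 0 | _ \<Rightarrow> wt [] 0)"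

lemma ex_prepare:
  assumes "nv > 0" "Z = (length x + c) ^ (d + 1)"
  shows "\<exists>R. ex (prepare c d nv) (start_tapes Z nv x)
    (st (word Z x) (replicate (length (word Z x) * length (word Z x)) 1) (\<lambda>_. 0) 1 [] R) (prepare_time c d nv (length x))"
proof -
  let ?s0 = "start_tapes Z nv x" and ?x = "map bit_symbol x" and ?m = "length x + c" and ?w = "word Z x"
  let ?s1 = "?s0(Out := wt [] 0, Aux 0 := wt ?x 0, Aux 1 := wt (replicate ?m 1) 0, Aux 2 := wt (replicate ?m 1) 0)"
  have 1: "ex (read_input c) ?s0 ?s1 (50 * (length x + c + 1))"
    using ex_read_input[of ?s0 ?x c] by (auto simp: start_tapes_def bit_symbol_def)
  obtain s2 where s2: "ex (powers d) ?s1 s2 (powers_time d ?m)" "s2 (Aux (d + 2)) = wt (replicate Z 1) 0"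
    "\<And>i. (\<forall>j. i \<noteq> Aux (j + 3)) \<Longrightarrow> s2 i = ?s1 i"
    using ex_powers[of ?s1 ?m d] assms(2) by (auto simp: start_tapes_def)
  have "s2 (Aux 0) = wt ?x 0" "s2 Wrd = wt [] 0" using s2(3) by (auto simp: start_tapes_def)
  then obtain s3 where s3: "ex (build_word (Aux (d + 2))) s2 s3 (100 * (Z + 1))" "s3 Wrd = wt ?w 0"
    "\<And>i. i \<noteq> Wrd \<Longrightarrow> i \<noteq> Aux (d + 2) \<Longrightarrow> i \<noteq> Aux 0 \<Longrightarrow> s3 i = s2 i"
    using ex_build_word[of s2 x "Aux (d + 2)" Z] s2(2) by auto
  have s30: "s3 i = ?s0 i" if "\<forall>j. i \<noteq> Aux j" "i \<noteq> Out" "i \<noteq> Wrd" for i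
    using that s3(3)[of i] s2(3)[of i] by auto
  let ?s4 = "\<lambda>i. case i of Var j \<Rightarrow> if j < nv then wt ?w 0 else s3 i | _ \<Rightarrow> s3 i"
  have 4: "ex (copies nv) s3 ?s4 (nv * (20 * (length ?w + 1)) + 1)"
    using word_nonzero word_letters s3(2) s30 by (intro ex_copies) (auto simp: start_tapes_def)
  have "?s4 Wrd = wt ?w 0" "?s4 (Var 0) = wt ?w 0" "?s4 Tab = wt [] 0"
    using s3(2) s30[of Tab] assms(1) by (auto simp: start_tapes_def)
  then have 5: "ex (product_tape Wrd (Var 0) Tab) ?s4 (?s4(Tab := wt (replicate (length ?w * length ?w) 1) 0))
     (20 * (length ?w + 1) * (length ?w + 1))"
    using word_nonzero by (intro ex_product_tape) auto
  define R where "R j = s3 (Aux j)" for j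
  let ?s6 = "st ?w (replicate (length ?w * length ?w) 1) (\<lambda>_. 0) 1 [] R"
  have Nil: "act (wt [] 0) (a, MStay) = wt [a] 0" for a
    using act_wt_append[of "[]" a MStay] by simp
  have "s3 Out = wt [] 0" using s3(3)[of Out] s2(3)[of Out] by simp
  then have "do_act Flg (Some 1) MStay (do_act Scr (Some 1) MStay (?s4(Tab := wt (replicate (length ?w * length ?w) 1) 0))) = ?s6"
    using s3(2) s30 by (auto simp: do_act_Some fun_eq_iff st_def R_def start_tapes_def Nil split: tp.splits)
  then have 6: "ex (Seq (Act Scr (Some 1) MStay) (Act Flg (Some 1) MStay))
     (?s4(Tab := wt (replicate (length ?w * length ?w) 1) 0)) ?s6 (Suc (Suc 0))"
    by (intro ex_SeqActI ex_ActI)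
  have "ex (prepare c d nv) ?s0 ?s6 (50 * (length x + c + 1) + (powers_time d ?m + (100 * (Z + 1) +
     ((nv * (20 * (length ?w + 1)) + 1) + (20 * (length ?w + 1) * (length ?w + 1) + Suc (Suc 0))))))"
    unfolding prepare_def by (rule ex_Seq[OF 1 ex_Seq[OF s2(1) ex_Seq[OF s3(1) ex_Seq[OF 4 ex_Seq[OF 5 6]]]]])
  then show ?thesis unfolding prepare_time_def assms(2) length_word by blast
qed

lemma guess_free_prepare: "guess_free (prepare c d nv)"
proof -
  have "guess_free (pad c)" "guess_free (powers d)" "guess_free (copies nv)"
    by (induction c, auto, induction d, auto simp: product_tape_def For_def rewind_def, induction nv,
        auto simp: copy_tape_def For_def rewind_def guess_free_transcribe)
  then show ?thesis
    by (auto simp: prepare_def read_input_def erase_def build_word_def product_tape_def For_def rewind_def)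
qed

lemma tapes_of_transcribe: "tapes_of (transcribe src dst f as) \<subseteq> {src, dst}"
  by (induction as) auto

lemma prepare_vars: "nv > 0 \<Longrightarrow> Var l \<in> tapes_of (prepare c d nv) \<Longrightarrow> l < nv"
proof -
  assume nv: "nv > 0" and l: "Var l \<in> tapes_of (prepare c d nv)"
  have 1: "Var l \<notin> tapes_of (pad c)" by (induction c) auto
  have 2: "Var l \<notin> tapes_of (powers d)" by (induction d) (auto simp: product_tape_def For_def rewind_def)
  have 3: "Var l \<in> tapes_of (copies nv) \<Longrightarrow> l < nv"
    by (induction nv) (use tapes_of_transcribe in \<open>fastforce simp: copy_tape_def For_def rewind_def\<close>)+
  have 4: "Var l \<notin> tapes_of (transcribe Out (Aux 0) f as)" "Var l \<notin> tapes_of (transcribe (Aux 0) Wrd f as)" for f as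
    using tapes_of_transcribe by fastforce+
  show ?thesis using l nv 1 2 3 4
    by (auto simp del: transcribe.simps simp: prepare_def read_input_def erase_def build_word_def product_tape_def For_def rewind_def)
qed

section \<open>From definability to complexity\<close>

lemma start_tapes_blank:
  assumes "nv > 0" "\<And>l. Var l \<in> tapes_of c \<Longrightarrow> l < nv" "i \<in> insert Out (tapes_of c)"
  shows "start_tapes Z nv x i = blank_start Out x i"
  using assms by (auto simp: start_tapes_def blank_start_def split: tp.splits)

lemma var_bound: "\<exists>nv > 0. \<forall>l. Var l \<in> tapes_of (c :: tp com) \<longrightarrow> l < nv"
proof -
  have "finite (Var -` tapes_of c)" by (intro finite_vimageI finite_tapes_of) (auto simp: inj_def)
  then obtain k where "\<forall>l \<in> Var -` tapes_of c. l < k" by (meson finite_nat_set_iff_bounded)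
  then show ?thesis by (intro exI[of _ "Suc k"]) (fastforce intro: less_SucI)
qed

lemma valid_env_word: "length g = length (word Z x) * length (word Z x) \<Longrightarrow> 0 \<notin> set g \<Longrightarrow> valid_env (word Z x) g 0 []"
  using word_nonzero by (simp add: valid_env_def)

lemma lev_Nil: "lev [] = (\<lambda>_. 0)"
  by (simp add: lev_def fun_eq_iff)

lemma polyb_word_length: "polyb B \<Longrightarrow> polyb (\<lambda>n. B (2 * (n + c) ^ (d + 1) + 1))"
  by (rule polyb_comp) auto

text \<open>Bounds the length of the output by the running time, as the output head ends just behind
  the output. This makes the final rewind polynomial.\<close>

lemma exec_head: "exec c s n s' \<Longrightarrow> snd (s' i) \<le> snd (s i) + int n"
proof (induction rule: exec.induct)
  case (Act j wr d s)
  then show ?case by (cases d; cases "s j") (auto simp: do_act_def act_def)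
next
  case (Guess a A j s)
  then show ?case by (cases "s j") (auto simp: do_act_def act_def)
qed auto

theorem GEN_polytime:
  assumes "GEN 0 F"
  shows "polytime_computable (\<lambda>x. F (word ((length x + c) ^ (d + 1)) x) [])"
proof -
  from GENE[OF assms] obtain p B where p: "guess_free p" "polyb B" "\<And>w g e out R. valid_env w g 0 e \<Longrightarrow>
     ex p (st w g (lev e) 1 out R) (st w g (lev e) 1 (out @ map bit_symbol (F w e)) R) (B (length w))" by blast
  obtain nv where nv: "nv > 0" "\<And>l. Var l \<in> tapes_of p \<Longrightarrow> l < nv" using var_bound by blast
  let ?Q = "Seq (prepare c d nv) p"
  have Q: "Var l \<in> tapes_of ?Q \<Longrightarrow> l < nv" for l using prepare_vars nv by auto
  show ?thesis
  proof (rule polytime_computableI[where io = Out and c = "Seq ?Q (rewind Out)"])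
    let ?T = "\<lambda>n. prepare_time c d nv n + B (2 * (n + c) ^ (d + 1) + 1)"
    have T: "polyb ?T" using polyb_prepare_time polyb_word_length[OF p(2)] by (rule polyb_add)
    show "guess_free (Seq ?Q (rewind Out))" using p(1) guess_free_prepare by (simp add: rewind_def)
    show "polyb (\<lambda>n. 3 * ?T n + 3)" by (intro polyb_add polyb_mult polyb_const T)
    fix x :: "bool list"
    let ?Z = "(length x + c) ^ (d + 1)"
    let ?w = "word ?Z x"
    let ?g = "replicate (length ?w * length ?w) (1::nat)"
    let ?o = "map bit_symbol (F ?w [])"
    obtain R where R: "ex (prepare c d nv) (start_tapes ?Z nv x) (st ?w ?g (\<lambda>_. 0) 1 [] R) (prepare_time c d nv (length x))"
      using ex_prepare[OF nv(1) refl] by blast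
    have "ex p (st ?w ?g (\<lambda>_. 0) 1 [] R) (st ?w ?g (\<lambda>_. 0) 1 ?o R) (B (length ?w))"
      using p(3)[OF valid_env_word[of ?g ?Z x], where out = "[]" and R = R] by (simp add: lev_Nil)
    from ex_Seq[OF R this] have 1: "ex ?Q (start_tapes ?Z nv x) (st ?w ?g (\<lambda>_. 0) 1 ?o R) (?T (length x))"
      by simp
    obtain n where "n \<le> ?T (length x)" "exec ?Q (start_tapes ?Z nv x) n (st ?w ?g (\<lambda>_. 0) 1 ?o R)"
      using 1 unfolding ex_def by blast
    with exec_head[of ?Q "start_tapes ?Z nv x" n _ Out] have len: "length ?o \<le> ?T (length x)"
      by (fastforce simp: start_tapes_def wt_def)
    have "0 \<notin> set ?o" by (auto simp: bit_symbol_def)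
    then have "ex (rewind Out) (st ?w ?g (\<lambda>_. 0) 1 ?o R) ((st ?w ?g (\<lambda>_. 0) 1 ?o R)(Out := wt ?o 0)) (2 * length ?o + 3)"
      by (intro ex_rewind[where w = ?o]) auto
    from ex_Seq[OF 1 this] have 2: "ex (Seq ?Q (rewind Out)) (start_tapes ?Z nv x)
       ((st ?w ?g (\<lambda>_. 0) 1 ?o R)(Out := wt ?o 0)) (3 * ?T (length x) + 3)"
      by (rule ex_mono) (use len in simp)
    have "insert Out (tapes_of (Seq ?Q (rewind Out))) = insert Out (tapes_of ?Q)" by (auto simp: rewind_def)
    then have blank: "\<forall>i \<in> insert Out (tapes_of (Seq ?Q (rewind Out))). start_tapes ?Z nv x i = blank_start Out x i"
      using start_tapes_blank[OF nv(1) Q] by blast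
    show "\<exists>s s'. (\<forall>i \<in> insert Out (tapes_of (Seq ?Q (rewind Out))). s i = blank_start Out x i) \<and>
       ex (Seq ?Q (rewind Out)) s s' (3 * ?T (length x) + 3) \<and> s' Out = wt ?o 0"
      by (rule exI[of _ "start_tapes ?Z nv x"], rule exI[of _ "(st ?w ?g (\<lambda>_. 0) 1 ?o R)(Out := wt ?o 0)"],
          intro conjI blank 2) simp
  qed
qed

text \<open>The tape already holds a word of ones whose length is the length of the guess; its cells
  are overwritten until the blank.\<close>

definition guess_tape :: "'i \<Rightarrow> nat set \<Rightarrow> 'i com" where
  "guess_tape i A = Seq (While [nonblank i] (Seq (Guess i A) (right i))) (rewind i)"

lemma do_guess:
  assumes "length u = k"
  shows "do_act i None MRight (do_act i (Some a) MStay (s(i := wt (u @ replicate (Suc r) 1) (int k)))) =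
    s(i := wt ((u @ [a]) @ replicate r 1) (int (Suc k)))"
  using assms by (auto simp: do_act_Some do_act_None mv_wt act_wt_update list_update_append fun_eq_iff algebra_simps)

lemma ex_guess_loop:
  assumes "set v \<subseteq> A" "0 \<notin> A" "set u \<subseteq> A"
  shows "ex (While [nonblank i] (Seq (Guess i A) (right i))) (s(i := wt (u @ replicate (length v) 1) (int (length u))))
    (s(i := wt (u @ v) (int (length (u @ v))))) (3 * length v + 1)"
  using assms
proof (induction v arbitrary: u)
  case Nil
  then show ?case
    using exec.WhileF[of "[nonblank i]" "s(i := wt u (int (length u)))" "Seq (Guess i A) (right i)"]
    by (auto simp: ex_def holds_single scanned_wt fun_upd_def intro!: exI[of _ "Suc 0"])
next
  case (Cons a v)
  let ?s = "s(i := wt (u @ replicate (Suc (length v)) 1) (int (length u)))"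
  let ?t = "s(i := wt ((u @ [a]) @ replicate (length v) 1) (int (length (u @ [a]))))"
  have h: "holds [nonblank i] (scan ?s)" by (simp add: holds_single scanned_wt nth_append)
  have "exec (Seq (Guess i A) (right i)) ?s (1 + 1) ?t"
  proof (rule exec.Seq)
    show "exec (Guess i A) ?s 1 (do_act i (Some a) MStay ?s)" using Cons.prems(1) by (intro exec.Guess) auto
    have "?t = do_act i None MRight (do_act i (Some a) MStay ?s)"
      using do_guess[of u "length u" i a s "length v"] by simp
    then show "exec (right i) (do_act i (Some a) MStay ?s) 1 ?t" by (metis exec.Act)
  qed
  moreover obtain n where n: "n \<le> 3 * length v + 1"
    "exec (While [nonblank i] (Seq (Guess i A) (right i))) ?t n (s(i := wt ((u @ [a]) @ v) (int (length ((u @ [a]) @ v)))))"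
    using Cons.IH[of "u @ [a]"] Cons.prems unfolding ex_def by auto
  ultimately have "exec (While [nonblank i] (Seq (Guess i A) (right i))) ?s (Suc ((1 + 1) + n))
     (s(i := wt ((u @ [a]) @ v) (int (length ((u @ [a]) @ v)))))"
    by (intro exec.WhileT[OF h])
  then show ?case unfolding ex_def using n(1)
    by (intro exI[of _ "Suc ((1 + 1) + n)"]) (simp add: fun_upd_def)
qed

lemma tot_guess_loop:
  assumes "0 \<notin> A" "set u \<subseteq> A"
    and "\<And>v. length v = r \<Longrightarrow> set v \<subseteq> A \<Longrightarrow> Q (s(i := wt (u @ v) (int (length u + r))))"
  shows "tot (While [nonblank i] (Seq (Guess i A) (right i))) (s(i := wt (u @ replicate r 1) (int (length u))))
    (3 * r + 1) Q"
  using assms(2,3)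
proof (induction r arbitrary: u)
  case 0
  have "Q (s(i := wt u (int (length u))))" using 0(2)[of "[]"] by (simp add: fun_upd_def)
  then have "tot (While [nonblank i] (Seq (Guess i A) (right i))) (s(i := wt u (int (length u)))) 1 Q"
    by (intro tot.WhileF) (auto simp: holds_single scanned_wt fun_upd_def)
  then show ?case by (simp add: fun_upd_def)
next
  case (Suc r)
  let ?s = "s(i := wt (u @ replicate (Suc r) 1) (int (length u)))"
  let ?R = "\<lambda>t. \<exists>a \<in> A. t = s(i := wt ((u @ [a]) @ replicate r 1) (int (length (u @ [a]))))"
  have h: "holds [nonblank i] (scan ?s)" by (simp add: holds_single scanned_wt nth_append)
  have "tot (Seq (Guess i A) (right i)) ?s (1 + 1) ?R"
    by (rule tot.Seq[where R = "\<lambda>t. \<exists>a \<in> A. t = do_act i (Some a) MStay ?s", OF tot.Guess])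
       (use do_guess[of u "length u" i _ s r] in \<open>auto simp del: One_nat_def intro!: tot.Act\<close>)
  moreover have "tot (While [nonblank i] (Seq (Guess i A) (right i))) t (3 * r + 1) Q" if "?R t" for t
  proof -
    from that obtain a where a: "a \<in> A" "t = s(i := wt ((u @ [a]) @ replicate r 1) (int (length (u @ [a]))))" by blast
    show ?thesis unfolding a(2)
    proof (rule Suc.IH)
      fix v :: "nat list" assume "length v = r" "set v \<subseteq> A"
      then show "Q (s(i := wt ((u @ [a]) @ v) (int (length (u @ [a]) + r))))"
        using Suc.prems(2)[of "a # v"] a(1) by (simp add: fun_upd_def)
    qed (use a(1) Suc.prems in auto)
  qed
  ultimately have "tot (While [nonblank i] (Seq (Guess i A) (right i))) ?s (Suc ((1 + 1) + (3 * r + 1))) Q"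
    by (rule tot.WhileT[OF h])
  then show ?case by (rule tot.Weaken) simp
qed

lemma ex_tot: "ex c s s' n \<Longrightarrow> guess_free c \<Longrightarrow> Q s' \<Longrightarrow> tot c s n Q"
proof -
  assume *: "ex c s s' n" "guess_free c" "Q s'"
  have mono: "tot c s n P \<Longrightarrow> (\<And>s. P s \<Longrightarrow> P' s) \<Longrightarrow> tot c s n P'" for c :: "'a com" and s n P P'
    by (induction rule: tot.induct) (auto simp del: One_nat_def intro: tot.Act tot.Guess tot.Seq tot.IfT tot.IfF tot.WhileF tot.WhileT tot.Weaken)
  obtain m where "m \<le> n" "exec c s m s'" using *(1) unfolding ex_def by blast
  then show ?thesis using mono[OF exec_tot[OF _ *(2)], of s m s' Q] *(3) by (auto intro: tot.Weaken)
qed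

text \<open>All nondeterminism lies in filling the table, and the check that follows is guess-free.
  So the choices of the machine amount to the quantifier over \<open>g\<close>.\<close>

theorem FO_NP:
  assumes "FO 0 P"
    and L: "\<And>x. x \<in> L \<longleftrightarrow> (\<exists>g. length g = length (W x) * length (W x) \<and> set g \<subseteq> {1..<G} \<and> P (W x) (rel (W x) g) [])"
    and W: "\<And>x. W x = word ((length x + c) ^ (d + 1)) x"
  shows "L \<in> NP"
proof -
  from FOE[OF assms(1)] obtain p B where p: "guess_free p" "polyb B" "\<And>w g e b out R. valid_env w g 0 e \<Longrightarrow>
     ex p (st w g (lev e) b out R) (st w g (lev e) (if P w (rel w g) e then 2 else 1) out R) (B (length w))" by blast
  obtain nv where nv: "nv > 0" "\<And>l. Var l \<in> tapes_of p \<Longrightarrow> l < nv" using var_bound by blast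
  define A where "A = {1..<G}"
  \<comment> \<open>The skip exhibits \<open>Flg\<close> as a tape of the program, as
    \<open>NP_I\<close> demands, for every \<open>p\<close>.\<close>
  let ?Q = "Seq (prepare c d nv) (Seq (guess_tape Tab A) (Seq (skip Flg) p))"
  have Q: "Var l \<in> tapes_of ?Q \<Longrightarrow> l < nv" for l
    using prepare_vars nv by (auto simp: guess_tape_def rewind_def)
  let ?N = "\<lambda>n. 2 * (n + c) ^ (d + 1) + 1"
  let ?T = "\<lambda>n. prepare_time c d nv n + (((3 * (?N n * ?N n) + 1) + (2 * (?N n * ?N n) + 3)) + (Suc 0 + B (?N n)))"
  show ?thesis
  proof (rule NP_I[where io = Out and c = ?Q and flg = Flg and B = ?T])
    show "finite (writes_of ?Q)"
      using finite_writes_of[OF p(1)] finite_writes_of[OF guess_free_prepare]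
      by (auto simp: guess_tape_def rewind_def A_def)
    show "polyb ?T"
      by (intro polyb_add polyb_mult polyb_const polyb_id polyb_power polyb_prepare_time polyb_word_length p(2))
    show "Flg \<in> tapes_of ?Q" by simp
    fix x :: "bool list"
    let ?Z = "(length x + c) ^ (d + 1)"
    let ?w = "word ?Z x"
    let ?n = "length ?w * length ?w"
    let ?g = "replicate ?n (1::nat)"
    obtain R where R: "ex (prepare c d nv) (start_tapes ?Z nv x) (st ?w ?g (\<lambda>_. 0) 1 [] R) (prepare_time c d nv (length x))"
      using ex_prepare[OF nv(1) refl] by blast
    let ?s = "st ?w ?g (\<lambda>_. 0) 1 [] R"
    have upd: "?s(Tab := wt g 0) = st ?w g (\<lambda>_. 0) 1 [] R" for g
      by (auto simp: st_def fun_eq_iff split: tp.splits)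
    have s: "?s = ?s(Tab := wt ([] @ replicate ?n 1) (int (length ([] :: nat list))))"
      by (simp add: fun_eq_iff)
    have A0: "0 \<notin> A" by (simp add: A_def)
    have eval: "ex (Seq (skip Flg) p) (st ?w g (\<lambda>_. 0) 1 [] R) (st ?w g (\<lambda>_. 0) (if P ?w (rel ?w g) [] then 2 else 1) [] R)
        (Suc 0 + B (length ?w))" if "length g = ?n" "set g \<subseteq> A" for g
    proof -
      have "valid_env ?w g 0 []" using that A0 by (intro valid_env_word) auto
      from p(3)[OF this, where b = 1 and out = "[]" and R = R]
      have "ex p (st ?w g (\<lambda>_. 0) 1 [] R) (st ?w g (\<lambda>_. 0) (if P ?w (rel ?w g) [] then 2 else 1) [] R) (B (length ?w))"
        unfolding lev_Nil .
      then show ?thesis by (rule ex_Seq[OF ex_SkipI[OF refl]])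
    qed
    have rw: "ex (rewind Tab) (?s(Tab := wt g (int ?n))) (st ?w g (\<lambda>_. 0) 1 [] R) (2 * ?n + 3)" if "length g = ?n" "set g \<subseteq> A" for g
      by (rule ex_rewind[where w = g]) (use that A0 upd in auto)
    have tot1: "tot (guess_tape Tab A) ?s ((3 * ?n + 1) + (2 * ?n + 3)) (\<lambda>t. \<exists>g. length g = ?n \<and> set g \<subseteq> A \<and> t = st ?w g (\<lambda>_. 0) 1 [] R)"
      unfolding guess_tape_def
    proof (rule tot.Seq)
      show "tot (While [nonblank Tab] (Seq (Guess Tab A) (right Tab))) ?s (3 * ?n + 1)
          (\<lambda>t. \<exists>g. length g = ?n \<and> set g \<subseteq> A \<and> t = ?s(Tab := wt g (int ?n)))"
        by (subst s, rule tot_guess_loop[OF A0]) auto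
      show "tot (rewind Tab) t (2 * ?n + 3) (\<lambda>t. \<exists>g. length g = ?n \<and> set g \<subseteq> A \<and> t = st ?w g (\<lambda>_. 0) 1 [] R)"
        if "\<exists>g. length g = ?n \<and> set g \<subseteq> A \<and> t = ?s(Tab := wt g (int ?n))" for t
      proof -
        from that obtain g where g: "length g = ?n" "set g \<subseteq> A" "t = ?s(Tab := wt g (int ?n))" by blast
        show ?thesis unfolding g(3) by (rule ex_tot[OF rw[OF g(1,2)]]) (use g in \<open>auto simp: rewind_def\<close>)
      qed
    qed
    have tot2: "tot (Seq (skip Flg) p) t (Suc 0 + B (length ?w)) (\<lambda>s'. scanned (s' Flg) = 2 \<longrightarrow> x \<in> L)"
      if "\<exists>g. length g = ?n \<and> set g \<subseteq> A \<and> t = st ?w g (\<lambda>_. 0) 1 [] R" for t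
    proof -
      from that obtain g where g: "length g = ?n" "set g \<subseteq> A" "t = st ?w g (\<lambda>_. 0) 1 [] R" by blast
      show ?thesis unfolding g(3)
        by (rule ex_tot[OF eval[OF g(1,2)]]) (use p(1) g L[of x] W[of x] in \<open>auto simp: scanned_wt A_def\<close>)
    qed
    have "tot ?Q (start_tapes ?Z nv x) (?T (length x)) (\<lambda>s'. scanned (s' Flg) = 2 \<longrightarrow> x \<in> L)"
    proof (rule tot.Seq[where R = "\<lambda>t. t = ?s"])
      show "tot (prepare c d nv) (start_tapes ?Z nv x) (prepare_time c d nv (length x)) (\<lambda>t. t = ?s)"
        by (rule ex_tot[OF R guess_free_prepare refl])
      show "tot (Seq (guess_tape Tab A) (Seq (skip Flg) p)) t
         (((3 * (?N (length x) * ?N (length x)) + 1) + (2 * (?N (length x) * ?N (length x)) + 3)) + (Suc 0 + B (?N (length x))))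
         (\<lambda>s'. scanned (s' Flg) = 2 \<longrightarrow> x \<in> L)" if "t = ?s" for t
        using tot.Seq[OF tot1 tot2] that unfolding length_word by blast
    qed
    moreover have "\<exists>n s'. exec ?Q (start_tapes ?Z nv x) n s' \<and> scanned (s' Flg) = 2" if "x \<in> L"
    proof -
      from that L[of x] W[of x] obtain g where g: "length g = ?n" "set g \<subseteq> A" "P ?w (rel ?w g) []" by (auto simp: A_def)
      have "ex (While [nonblank Tab] (Seq (Guess Tab A) (right Tab))) ?s (?s(Tab := wt g (int ?n))) (3 * length g + 1)"
        using ex_guess_loop[OF g(2) A0, of "[]" Tab ?s] g(1) s by simp
      from ex_Seq[OF this rw[OF g(1,2)]] have "ex (guess_tape Tab A) ?s (st ?w g (\<lambda>_. 0) 1 [] R) (3 * length g + 1 + (2 * ?n + 3))"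
        unfolding guess_tape_def .
      from ex_Seq[OF R ex_Seq[OF this eval[OF g(1,2)]]] g(3) show ?thesis
        unfolding ex_def by (auto simp: scanned_wt) (metis st_simps(3) scanned_marker)
    qed
    ultimately show "\<exists>s. (\<forall>i \<in> insert Out (tapes_of ?Q). s i = blank_start Out x i) \<and>
      tot ?Q s (?T (length x)) (\<lambda>s'. scanned (s' Flg) = 2 \<longrightarrow> x \<in> L) \<and>
      (x \<in> L \<longrightarrow> (\<exists>n s'. exec ?Q s n s' \<and> scanned (s' Flg) = 2))"
      using start_tapes_blank[OF nv(1) Q] by (intro exI[of _ "start_tapes ?Z nv x"]) blast
  qed
qed

section \<open>Branchings and in-steps\<close>

type_synonym 'a tv = "'a \<times> nat"

text \<open>The last step of a walk ending in \<open>x\<close> either traverses a temporal edge (left summand) or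
  waits (right summand).\<close>

definition in_steps :: "'a tv set \<Rightarrow> ('a tv \<times> 'a tv) set \<Rightarrow> 'a tv \<Rightarrow> ('a tv + 'a tv) set" where
  "in_steps X F x = Inl ` {y. (y, x) \<in> F} \<union> Inr ` {y \<in> X. fst y = fst x \<and> snd x = Suc (snd y)}"

definition src :: "'a tv + 'a tv \<Rightarrow> 'a tv" where
  "src = case_sum id id"

lemma src_simps [simp]: "src (Inl y) = y" "src (Inr y) = y"
  by (simp_all add: src_def)

text \<open>The rank excludes cycles, in which every temporal vertex has exactly one in-step
  although no walk from the root arrives.\<close>

definition branch :: "'a tv set \<Rightarrow> ('a tv \<times> 'a tv) set \<Rightarrow> 'a tv set \<Rightarrow> bool" where
  "branch X F R \<longleftrightarrow> (\<exists>rk :: 'a tv \<Rightarrow> nat. \<forall>x \<in> X.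
     if x \<in> R then in_steps X F x = {} else \<exists>z. in_steps X F x = {z} \<and> rk (src z) < rk x)"

definition extend :: "'a tv + 'a tv \<Rightarrow> 'a tv \<Rightarrow> 'a walk_item list" where
  "extend z x = (case z of Inl y \<Rightarrow> [TEdge (y, x), TVert x] | Inr y \<Rightarrow> [TVert x])"

lemma extend_simps [simp]: "extend (Inl y) x = [TEdge (y, x), TVert x]" "extend (Inr y) x = [TVert x]"
  by (simp_all add: extend_def)

lemma walk_nonempty: "temporal_walk B w \<Longrightarrow> w \<noteq> []"
  by (cases rule: temporal_walk.cases) auto

lemma walk_append:
  assumes "temporal_walk B w" "last w = TVert (src z)" "z \<in> in_steps (tverts B) (tedges B) x" "x \<in> tverts B"
  shows "temporal_walk B (w @ extend z x)"
  using assms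
proof (induction rule: temporal_walk.induct)
  case (single y)
  then have y: "y = src z" by simp
  show ?case
  proof (cases z)
    case (Inl u)
    then show ?thesis using single y by (auto simp: in_steps_def intro!: temporal_walk.intros)
  next
    case (Inr u)
    then show ?thesis using single y
      using temporal_walk.wait[of "fst u" "snd u" B "[]"] temporal_walk.single[of x B]
      by (cases x; cases u) (auto simp: in_steps_def)
  qed
next
  case (edge u y w)
  then show ?case by (auto intro: temporal_walk.edge)
next
  case (wait v t w)
  then show ?case using temporal_walk.wait[of v t B "w @ extend z x"] by auto
qed

text \<open>\<open>temporal_walk\<close> grows at the front, whereas in-steps concern the end of a
  walk; this is the case distinction at the other end.\<close>

lemma walk_last_step:
  assumes "temporal_walk B w" "last w = TVert x"
  shows "x \<in> tverts B \<and> (w = [TVert x] \<or> (\<exists>z w'. z \<in> in_steps (tverts B) (tedges B) x \<and>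
    temporal_walk B w' \<and> last w' = TVert (src z) \<and> w = w' @ extend z x))"
  using assms
proof (induction rule: temporal_walk.induct)
  case (single y)
  then show ?case by simp
next
  case (edge u y w)
  then have IH: "x \<in> tverts B \<and> (TVert y # w = [TVert x] \<or> (\<exists>z w'. z \<in> in_steps (tverts B) (tedges B) x \<and>
    temporal_walk B w' \<and> last w' = TVert (src z) \<and> TVert y # w = w' @ extend z x))" by simp
  then consider "x = y" "w = []" | z w' where "z \<in> in_steps (tverts B) (tedges B) x" "temporal_walk B w'"
    "last w' = TVert (src z)" "TVert y # w = w' @ extend z x" by auto
  then show ?case
  proof cases
    case 1
    then have "Inl u \<in> in_steps (tverts B) (tedges B) x" "temporal_walk B [TVert u]"
      using edge by (auto simp: in_steps_def intro: temporal_walk.single)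
    then show ?thesis using 1 IH by (intro conjI disjI2 exI[of _ "Inl u"] exI[of _ "[TVert u]"]) auto
  next
    case 2
    then obtain w1 where w1: "w' = TVert y # w1" using walk_nonempty[OF 2(2)] by (cases w') auto
    then have "temporal_walk B (TVert u # TEdge (u, y) # w')" using edge 2 by (auto intro: temporal_walk.edge)
    then show ?thesis using 2 IH w1
      by (intro conjI disjI2 exI[of _ z] exI[of _ "TVert u # TEdge (u, y) # w'"]) auto
  qed
next
  case (wait v t w)
  let ?y = "(v, t + 1)"
  from wait have IH: "x \<in> tverts B \<and> (TVert ?y # w = [TVert x] \<or> (\<exists>z w'. z \<in> in_steps (tverts B) (tedges B) x \<and>
    temporal_walk B w' \<and> last w' = TVert (src z) \<and> TVert ?y # w = w' @ extend z x))" by simp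
  then consider "x = ?y" "w = []" | z w' where "z \<in> in_steps (tverts B) (tedges B) x" "temporal_walk B w'"
    "last w' = TVert (src z)" "TVert ?y # w = w' @ extend z x" by auto
  then show ?case
  proof cases
    case 1
    then have "Inr (v, t) \<in> in_steps (tverts B) (tedges B) x" "temporal_walk B [TVert (v, t)]"
      using wait by (auto simp: in_steps_def intro: temporal_walk.single)
    then show ?thesis using 1 IH by (intro conjI disjI2 exI[of _ "Inr (v, t)"] exI[of _ "[TVert (v, t)]"]) auto
  next
    case 2
    then obtain w1 where w1: "w' = TVert ?y # w1" using walk_nonempty[OF 2(2)] by (cases w') auto
    then have "temporal_walk B (TVert (v, t) # w')" using wait 2 by (auto intro: temporal_walk.wait[simplified])
    then show ?thesis using 2 IH w1
      by (intro conjI disjI2 exI[of _ z] exI[of _ "TVert (v, t) # w'"]) auto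
  qed
qed

definition walks_to :: "'a temporal_digraph \<Rightarrow> 'a tv set \<Rightarrow> 'a tv \<Rightarrow> 'a walk_item list set" where
  "walks_to B R x = {w. temporal_walk B w \<and> hd w \<in> TVert ` R \<and> last w = TVert x}"

text \<open>A recursion for the set of walks ending in \<open>x\<close>, by which uniqueness of
  walks is traced back to uniqueness of in-steps.\<close>

lemma walks_to_eq:
  assumes "x \<in> tverts B"
  shows "walks_to B R x = (if x \<in> R then {[TVert x]} else {}) \<union>
    (\<Union>z \<in> in_steps (tverts B) (tedges B) x. (\<lambda>w. w @ extend z x) ` walks_to B R (src z))" (is "_ = ?r")
proof (intro subset_antisym subsetI)
  fix w assume "w \<in> walks_to B R x"
  then have w: "temporal_walk B w" "hd w \<in> TVert ` R" "last w = TVert x" by (auto simp: walks_to_def)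
  from walk_last_step[OF w(1,3)] consider "w = [TVert x]" | z w' where
    "z \<in> in_steps (tverts B) (tedges B) x" "temporal_walk B w'" "last w' = TVert (src z)" "w = w' @ extend z x"
    by blast
  then show "w \<in> ?r"
  proof cases
    case 1
    then show ?thesis using w by auto
  next
    case 2
    then have "w' \<in> walks_to B R (src z)"
      using w walk_nonempty[OF 2(2)] by (auto simp: walks_to_def)
    then show ?thesis using 2 by blast
  qed
next
  fix w assume "w \<in> ?r"
  then consider "x \<in> R" "w = [TVert x]" | z w' where "z \<in> in_steps (tverts B) (tedges B) x" "w' \<in> walks_to B R (src z)"
    "w = w' @ extend z x" by (auto split: if_splits)
  then show "w \<in> walks_to B R x"
  proof cases
    case 1
    then show ?thesis using assms by (auto simp: walks_to_def intro: temporal_walk.single)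
  next
    case 2
    then have w': "temporal_walk B w'" "last w' = TVert (src z)" "hd w' \<in> TVert ` R" by (auto simp: walks_to_def)
    have "temporal_walk B w" unfolding 2(3) by (rule walk_append[OF w'(1,2) 2(1) assms])
    moreover have "last w = TVert x" using 2(3) by (cases z) auto
    moreover have "hd w = hd w'" using 2(3) walk_nonempty[OF w'(1)] by simp
    ultimately show ?thesis using w'(3) by (simp add: walks_to_def)
  qed
qed

text \<open>A walk records its temporal edges. So waiting from \<open>(v, t)\<close> to
  \<open>(v, t + 1)\<close> and a temporal edge of a loop between the same temporal vertices give
  different walks.\<close>

lemma extend_inj:
  assumes "w @ extend z x = w' @ extend z' x" "last w = TVert (src z)" "last w' = TVert (src z')" "w \<noteq> []" "w' \<noteq> []"
  shows "z = z'"
proof (cases z; cases z')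
  fix y y' assume z: "z = Inl y" "z' = Inr y'"
  then have "w @ [TEdge (y, x)] = w'" using assms(1) by simp
  then show ?thesis using assms(3) by auto
next
  fix y y' assume z: "z = Inr y" "z' = Inl y'"
  then have "w = w' @ [TEdge (y', x)]" using assms(1) by simp
  then show ?thesis using assms(2) by auto
qed (use assms in auto)

lemma in_steps_src: "F \<subseteq> X \<times> X \<Longrightarrow> z \<in> in_steps X F x \<Longrightarrow> src z \<in> X"
  by (auto simp: in_steps_def)

text \<open>An in-step of \<open>x\<close> extends the unique walk to its source. Two in-steps, or
  an in-step next to the trivial walk at a root, would therefore give two walks to \<open>x\<close>.
  The length of the unique walk serves as rank.\<close>

lemma branchD:
  assumes "tedges B \<subseteq> tverts B \<times> tverts B"
    and uniq: "\<And>x. x \<in> tverts B \<Longrightarrow> \<exists>!w. temporal_walk B w \<and> hd w \<in> TVert ` R \<and> last w = TVert x"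
  shows "branch (tverts B) (tedges B) R"
proof -
  let ?I = "in_steps (tverts B) (tedges B)"
  have "\<exists>w. walks_to B R x = {w}" if "x \<in> tverts B" for x
    using uniq[OF that] by (auto simp: walks_to_def)
  then obtain f where f: "\<And>x. x \<in> tverts B \<Longrightarrow> walks_to B R x = {f x}" by metis
  have ext: "f x = f (src z) @ extend z x" "f (src z) \<noteq> []" "last (f (src z)) = TVert (src z)"
    if x: "x \<in> tverts B" and z: "z \<in> ?I x" for x z
  proof -
    have s: "walks_to B R (src z) = {f (src z)}" using f in_steps_src[OF assms(1) z] by blast
    then have "f (src z) @ extend z x \<in> walks_to B R x" unfolding walks_to_eq[OF x] using z by auto
    then show "f x = f (src z) @ extend z x" using f[OF x] by auto
    have "f (src z) \<in> walks_to B R (src z)" using s by simp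
    then show "f (src z) \<noteq> []" "last (f (src z)) = TVert (src z)"
      using walk_nonempty by (auto simp: walks_to_def)
  qed
  show ?thesis unfolding branch_def
  proof (intro exI[of _ "\<lambda>x. length (f x)"] ballI)
    fix x assume x: "x \<in> tverts B"
    show "if x \<in> R then ?I x = {} else \<exists>z. ?I x = {z} \<and> length (f (src z)) < length (f x)"
    proof (cases "x \<in> R")
      case True
      then have "f x = [TVert x]" using f[OF x] walks_to_eq[OF x, of R] by auto
      then have "z \<notin> ?I x" for z using ext(1,2)[OF x, of z] by (cases z) (auto simp: append_eq_Cons_conv)
      then have "?I x = {}" by blast
      then show ?thesis using True by simp
    next
      case False
      have "f x \<in> walks_to B R x" using f[OF x] by simp
      then obtain z where z: "z \<in> ?I x" unfolding walks_to_eq[OF x] using False by auto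
      have "z' = z" if "z' \<in> ?I x" for z'
        using extend_inj[of "f (src z')" z' x "f (src z)" z] ext[OF x z] ext[OF x that] by simp
      then have "?I x = {z}" using z by blast
      moreover have "length (f (src z)) < length (f x)" using ext(1)[OF x z] by (cases z) auto
      ultimately show ?thesis using False by auto
    qed
  qed
qed

text \<open>By induction on the rank: outside the root every walk to \<open>x\<close> extends a walk
  to the source of the only in-step, and that source has smaller rank.\<close>

lemma branchI:
  assumes "tedges B \<subseteq> tverts B \<times> tverts B" "branch (tverts B) (tedges B) R" "x \<in> tverts B"
  shows "\<exists>!w. temporal_walk B w \<and> hd w \<in> TVert ` R \<and> last w = TVert x"
proof -
  obtain rk :: "_ \<Rightarrow> nat" where rk: "\<And>x. x \<in> tverts B \<Longrightarrow> if x \<in> R then in_steps (tverts B) (tedges B) x = {}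
    else \<exists>z. in_steps (tverts B) (tedges B) x = {z} \<and> rk (src z) < rk x"
    using assms(2) unfolding branch_def by blast
  have "\<exists>w. walks_to B R x = {w}"
    using assms(3)
  proof (induction "rk x" arbitrary: x rule: less_induct)
    case less
    show ?case
    proof (cases "x \<in> R")
      case True
      then show ?thesis using rk[OF less.prems] walks_to_eq[OF less.prems, of R] by auto
    next
      case False
      then obtain z where z: "in_steps (tverts B) (tedges B) x = {z}" "rk (src z) < rk x" using rk[OF less.prems] by auto
      then have "src z \<in> tverts B" using in_steps_src[OF assms(1), of z x] by auto
      with less.hyps[OF z(2)] obtain w where "walks_to B R (src z) = {w}" by blast
      then show ?thesis using walks_to_eq[OF less.prems, of R] z False by auto
    qed
  qed
  then obtain w where "walks_to B R x = {w}" by blast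
  then have "temporal_walk B w' \<and> hd w' \<in> TVert ` R \<and> last w' = TVert x \<longleftrightarrow> w' = w" for w'
    unfolding walks_to_def by (simp add: set_eq_iff)
  then show ?thesis by simp
qed

definition arcs_of :: "('a tv \<times> 'a tv) set \<Rightarrow> ('a \<times> 'a) set" where
  "arcs_of F = (\<lambda>(x, y). (fst x, fst y)) ` F"

lemma tedges_tverts: "temporal_digraph T \<Longrightarrow> tedges T \<subseteq> tverts T \<times> tverts T"
  unfolding temporal_digraph_def tedges_def tverts_def
  by (fastforce dest: pair_fin_digraph.axioms(1) pair_wf_digraph.arc_fst_in_verts pair_wf_digraph.arc_snd_in_verts)

definition restrict_edges :: "'a temporal_digraph \<Rightarrow> ('a tv \<times> 'a tv) set \<Rightarrow> 'a temporal_digraph" where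
  "restrict_edges T F = \<lparr>dgraph = \<lparr>pverts = pverts (dgraph T), parcs = arcs_of F\<rparr>, active = active T,
     links = \<lambda>e. {(t, t'). ((fst e, t), (snd e, t')) \<in> F}\<rparr>"

lemma tverts_restrict_edges: "tverts (restrict_edges T F) = tverts T"
  by (simp add: tverts_def restrict_edges_def)

lemma tedges_restrict_edges: "tedges (restrict_edges T F) = F"
  by (auto simp: tedges_def restrict_edges_def arcs_of_def image_iff) force

lemma restrict_edges_subdigraph:
  assumes "temporal_digraph T" "F \<subseteq> tedges T"
  shows "temporal_subdigraph (restrict_edges T F) T"
proof -
  have T: "pair_fin_digraph (dgraph T)" using assms(1) by (simp add: temporal_digraph_def)
  then have wfT: "pair_wf_digraph (dgraph T)" by (rule pair_fin_digraph.axioms(1))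
  have sub: "arcs_of F \<subseteq> parcs (dgraph T)" using assms(2) by (auto simp: arcs_of_def tedges_def)
  have "pair_fin_digraph (dgraph (restrict_edges T F))"
    using sub T wfT finite_subset[OF sub]
    by unfold_locales (auto simp: restrict_edges_def pair_fin_digraph.pair_finite_verts pair_fin_digraph.pair_finite_arcs
       dest: subsetD pair_wf_digraph.arc_fst_in_verts pair_wf_digraph.arc_snd_in_verts)
  moreover from this have "wf_digraph (with_proj (dgraph (restrict_edges T F)))"
    using pair_fin_digraph.axioms(1) by (metis pair_wf_digraph.arc_fst_in_verts pair_wf_digraph.arc_snd_in_verts wf_digraph.intro with_proj_simps)
  moreover have "wf_digraph (with_proj (dgraph T))"
    using wfT by (metis pair_wf_digraph.arc_fst_in_verts pair_wf_digraph.arc_snd_in_verts wf_digraph.intro with_proj_simps)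
  moreover have "temporal_digraph (restrict_edges T F)"
    using calculation(1) assms unfolding temporal_digraph_def
    by (auto simp: restrict_edges_def tedges_def split: prod.splits)
  ultimately show ?thesis
    unfolding temporal_subdigraph_def subgraph_def using sub assms(2)
    by (auto simp: restrict_edges_def compatible_def tedges_def)
qed

text \<open>A spanning branching reaches all temporal vertices, so it contains them all and is
  determined by its temporal edges. Keeping only the arcs that carry such edges preserves
  disjointness.\<close>

theorem has_disjoint_branchings_iff:
  assumes T: "temporal_digraph T"
  shows "has_disjoint_branchings T Rs \<longleftrightarrow>
    (\<exists>F. (\<forall>i < length Rs. F i \<subseteq> tedges T \<and> branch (tverts T) (F i) (Rs ! i)) \<and>
      (\<forall>i < length Rs. \<forall>j < length Rs. i \<noteq> j \<longrightarrow> arcs_of (F i) \<inter> arcs_of (F j) = {}))" (is "?l \<longleftrightarrow> ?r")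
proof
  assume ?l
  then obtain Bs where Bs: "length Bs = length Rs"
    "\<And>i. i < length Rs \<Longrightarrow> temporal_spanning_branching T (Rs ! i) (Bs ! i)"
    "\<And>i j. i < length Rs \<Longrightarrow> j < length Rs \<Longrightarrow> i \<noteq> j \<Longrightarrow> edge_disjoint (Bs ! i) (Bs ! j)"
    unfolding has_disjoint_branchings_def by blast
  have 1: "tedges (Bs ! i) \<subseteq> tedges T \<and> branch (tverts T) (tedges (Bs ! i)) (Rs ! i)" if i: "i < length Rs" for i
  proof -
    let ?B = "Bs ! i"
    have B: "temporal_subdigraph ?B T"
      "\<And>x. x \<in> tverts T \<Longrightarrow> \<exists>!w. temporal_walk ?B w \<and> hd w \<in> TVert ` (Rs ! i) \<and> last w = TVert x"
      using Bs(2)[OF i] by (auto simp: temporal_spanning_branching_def)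
    have "tverts T \<subseteq> tverts ?B" using B(2) walk_last_step by blast
    moreover have "tverts ?B \<subseteq> tverts T"
      using B(1) by (auto simp: temporal_subdigraph_def tverts_def subgraph_def)
    ultimately have eq: "tverts ?B = tverts T" by blast
    have "tedges ?B \<subseteq> tverts ?B \<times> tverts ?B" using B(1) tedges_tverts by (auto simp: temporal_subdigraph_def)
    then have "branch (tverts ?B) (tedges ?B) (Rs ! i)" using B(2) eq by (intro branchD) auto
    moreover have "tedges ?B \<subseteq> tedges T"
      using B(1) by (auto simp: temporal_subdigraph_def tedges_def subgraph_def)
    ultimately show ?thesis using eq by simp
  qed
  have "arcs_of (tedges (Bs ! i)) \<inter> arcs_of (tedges (Bs ! j)) = {}" if "i < length Rs" "j < length Rs" "i \<noteq> j" for i j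
  proof -
    have "arcs_of (tedges B) \<subseteq> parcs (dgraph B)" for B :: "'a temporal_digraph" by (auto simp: arcs_of_def tedges_def)
    then show ?thesis using Bs(3)[OF that] unfolding edge_disjoint_def by blast
  qed
  with 1 show ?r by (intro exI[of _ "\<lambda>i. tedges (Bs ! i)"]) blast
next
  assume ?r
  then obtain F where "\<forall>i < length Rs. F i \<subseteq> tedges T \<and> branch (tverts T) (F i) (Rs ! i)"
    "\<forall>i < length Rs. \<forall>j < length Rs. i \<noteq> j \<longrightarrow> arcs_of (F i) \<inter> arcs_of (F j) = {}" by (elim exE conjE)
  note F = this[rule_format]
  have "temporal_spanning_branching T (Rs ! i) (restrict_edges T (F i))" if i: "i < length Rs" for i
  proof -
    have "F i \<subseteq> tverts T \<times> tverts T" using F(1)[OF i] tedges_tverts[OF T] by blast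
    then show ?thesis unfolding temporal_spanning_branching_def
      using F(1)[OF i] restrict_edges_subdigraph[OF T, of "F i"] branchI[of "restrict_edges T (F i)" "Rs ! i"]
      by (simp add: tverts_restrict_edges tedges_restrict_edges)
  qed
  then show ?l unfolding has_disjoint_branchings_def edge_disjoint_def
    by (intro exI[of _ "map (\<lambda>i. restrict_edges T (F i)) [0..<length Rs]"]) (use F(2) in \<open>auto simp: restrict_edges_def\<close>)
qed

section \<open>Temporal digraphs with two layers\<close>

fun num :: "bool list \<Rightarrow> nat" where
  "num [] = 0"
| "num (b # bs) = of_bool b + 2 * num bs"

definition canonical :: "bool list \<Rightarrow> bool" where
  "canonical bs \<longleftrightarrow> bs = [] \<or> last bs"

lemma num_zero: "canonical bs \<Longrightarrow> num bs = 0 \<longleftrightarrow> bs = []"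
proof (induction bs)
  case (Cons b bs)
  then show ?case by (cases bs) (auto simp: canonical_def split: if_splits)
qed simp

lemma canonical_tl: "canonical (b # bs) \<Longrightarrow> canonical bs"
  by (auto simp: canonical_def split: if_splits)

lemma binary_digits_num: "canonical bs \<Longrightarrow> binary_digits (num bs) = bs"
proof (induction bs)
  case Nil
  show ?case by (simp add: binary_digits.simps)
next
  case (Cons b bs)
  then have "num (b # bs) \<noteq> 0" using num_zero by blast
  moreover have "odd (num (b # bs)) = b" "num (b # bs) div 2 = num bs" by (cases b; simp)+
  ultimately show ?case using Cons canonical_tl
    by (simp add: binary_digits.simps[of "num (b # bs)"] del: num.simps)
qed

text \<open>Vertices are tuples of natural numbers, named by numbers whose binary digits encode the tuple
  in unary; the leading digit 1 makes the digit sequence canonical.\<close>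

definition digits_of :: "nat list \<Rightarrow> bool list" where
  "digits_of v = concat (map (\<lambda>x. replicate x True @ [False]) v) @ [True]"

definition name :: "nat list \<Rightarrow> nat" where
  "name v = num (digits_of v)"

lemma replicate_True_inj:
  "replicate x True @ False # s = replicate y True @ False # t \<Longrightarrow> x = y \<and> s = t"
proof (induction x arbitrary: y)
  case 0
  then show ?case by (cases y) auto
next
  case (Suc x)
  then show ?case by (cases y) auto
qed

lemma replicate_True_neq: "replicate x True @ False # s \<noteq> [True]"
  by (cases x) auto

lemma digits_of_inj: "digits_of v = digits_of v' \<Longrightarrow> v = v'"
proof (induction v arbitrary: v')
  case Nil
  then show ?case by (cases v') (auto simp: digits_of_def Cons_eq_append_conv replicate_True_neq dest: arg_cong[of _ _ length])
next
  case (Cons x v)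
  show ?case
  proof (cases v')
    case Nil
    then show ?thesis using Cons.prems replicate_True_neq by (fastforce simp: digits_of_def)
  next
    case (Cons y u)
    then have "replicate x True @ False # digits_of v = replicate y True @ False # digits_of u"
      using Cons.prems by (simp add: digits_of_def)
    then show ?thesis using replicate_True_inj Cons.IH Cons by blast
  qed
qed

lemma binary_digits_name: "binary_digits (name v) = digits_of v"
  unfolding name_def by (rule binary_digits_num) (simp add: canonical_def digits_of_def)

lemma name_inj: "name v = name v' \<longleftrightarrow> v = v'"
  using digits_of_inj binary_digits_name by metis

subsection \<open>Two digraphs on a common vertex set\<close>

definition reach :: "('v \<times> 'v) set \<Rightarrow> ('v \<Rightarrow> bool) \<Rightarrow> 'v \<Rightarrow> bool" where
  "reach A Z v \<longleftrightarrow> (\<exists>u. Z u \<and> (u, v) \<in> A\<^sup>*)"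

lemma reach_root: "Z v \<Longrightarrow> reach A Z v"
  by (auto simp: reach_def)

lemma reach_step: "reach A Z u \<Longrightarrow> (u, v) \<in> A \<Longrightarrow> reach A Z v"
  unfolding reach_def by (meson rtrancl.rtrancl_into_rtrancl)

text \<open>Breadth-first search: \<open>d\<close> is the distance from the roots and
  \<open>par\<close> the predecessor on a shortest path.\<close>

lemma reach_tree:
  assumes "\<And>v. v \<in> V \<Longrightarrow> reach A Z v"
  shows "\<exists>par (d :: 'v \<Rightarrow> nat). \<forall>v \<in> V. \<not> Z v \<longrightarrow> (par v, v) \<in> A \<and> d (par v) < d v"
proof -
  define Q where "Q v n \<longleftrightarrow> (\<exists>u. Z u \<and> (u, v) \<in> A ^^ n)" for v n
  define d where "d v = (LEAST n. Q v n)" for v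
  have "\<exists>u. (u, v) \<in> A \<and> d u < d v" if "v \<in> V" "\<not> Z v" for v
  proof -
    have "\<exists>n. Q v n" using assms[OF that(1)] rtrancl_power unfolding Q_def reach_def by metis
    then have "Q v (d v)" unfolding d_def by (rule LeastI_ex)
    then obtain r where r: "Z r" "(r, v) \<in> A ^^ d v" unfolding Q_def by blast
    then have "d v \<noteq> 0" using that(2) by (metis pair_in_Id_conv relpow.simps(1))
    then obtain n u where n: "d v = Suc n" "(r, u) \<in> A ^^ n" "(u, v) \<in> A"
      using r(2) by (metis not0_implies_Suc relpow_Suc_E)
    then have "d u \<le> n" unfolding d_def using r(1) by (intro Least_le) (auto simp: Q_def)
    then show ?thesis using n by auto
  qed
  then show ?thesis by metis
qed

text \<open>Temporal edges keep their time, and 1 and 3 are not consecutive, so no step leads from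
  one layer to the other. The layers interact only through the arcs of the underlying digraph that
  carry edges of both.\<close>

definition two_layer :: "nat list set \<Rightarrow> (nat \<Rightarrow> nat list \<Rightarrow> nat list \<Rightarrow> bool) \<Rightarrow> nat temporal_digraph" where
  "two_layer V E = \<lparr>dgraph = \<lparr>pverts = name ` V,
      parcs = {(name u, name v) | u v. u \<in> V \<and> v \<in> V \<and> (E 1 u v \<or> E 3 u v)}\<rparr>,
    active = \<lambda>_. {1, 3},
    links = \<lambda>e. {(t, t) | t. t \<in> {1, 3} \<and> (\<exists>u v. e = (name u, name v) \<and> E t u v)}\<rparr>"

lemma two_layer_tverts: "tverts (two_layer V E) = {(name v, t) | v t. v \<in> V \<and> t \<in> {1, 3}}"
  by (auto simp: tverts_def two_layer_def)

lemma two_layer_tedges: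
  "tedges (two_layer V E) = {((name u, t), (name v, t)) | u v t. u \<in> V \<and> v \<in> V \<and> t \<in> {1, 3} \<and> E t u v}"
  by (auto simp: tedges_def two_layer_def name_inj)

lemma two_layer_temporal_digraph:
  assumes "finite V"
  shows "temporal_digraph (two_layer V E)"
proof -
  have sub: "parcs (dgraph (two_layer V E)) \<subseteq> name ` V \<times> name ` V" by (auto simp: two_layer_def)
  then have "finite (parcs (dgraph (two_layer V E)))" by (rule finite_subset) (simp add: assms)
  then have "pair_fin_digraph (dgraph (two_layer V E))"
    using sub assms by unfold_locales (auto simp: two_layer_def)
  then show ?thesis unfolding temporal_digraph_def by (auto simp: two_layer_def)
qed

definition layer_roots :: "nat list set \<Rightarrow> (nat \<Rightarrow> nat list \<Rightarrow> bool) \<Rightarrow> nat \<Rightarrow> (nat \<times> nat) set" where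
  "layer_roots V Z i = {(name v, t) | v t. v \<in> V \<and> t \<in> {1, 3} \<and>
     (if i = 0 then t = 3 \<or> Z 1 v else if i = 1 then t = 1 \<or> Z 3 v else True)}"

lemma layer_branch:
  assumes t: "t \<in> {1, 3}" and R: "R = {(name v, t') | v t'. v \<in> V \<and> t' \<in> {1, 3} \<and> (t' \<noteq> t \<or> Z v)}"
    and par: "\<And>v. v \<in> V \<Longrightarrow> \<not> Z v \<Longrightarrow> par v \<in> V \<and> (d (par v) :: nat) < d v"
  shows "branch (tverts (two_layer V E)) {((name (par v), t), (name v, t)) | v. v \<in> V \<and> \<not> Z v} R"
proof -
  let ?X = "tverts (two_layer V E)" and ?F = "{((name (par v), t), (name v, t)) | v. v \<in> V \<and> \<not> Z v}"
  define rk where "rk x = d (inv name (fst x))" for x :: "nat \<times> nat"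
  have inv: "inv name (name v) = v" for v using name_inj by (intro inv_f_f) (auto simp: inj_def)
  show ?thesis unfolding branch_def
  proof (intro exI[of _ rk] ballI)
    fix x assume "x \<in> ?X"
    then obtain v t' where x: "x = (name v, t')" "v \<in> V" "t' \<in> {1, 3}" by (auto simp: two_layer_tverts)
    have I: "in_steps ?X ?F x = (if t' = t \<and> \<not> Z v then {Inl (name (par v), t)} else {})"
      using x by (auto simp: in_steps_def two_layer_tverts name_inj)
    show "if x \<in> R then in_steps ?X ?F x = {} else \<exists>z. in_steps ?X ?F x = {z} \<and> rk (src z) < rk x"
      unfolding I using x par[of v] by (auto simp: R rk_def inv name_inj)
  qed
qed

lemma branch_reach:
  assumes t: "t \<in> {1, 3}" and F: "F \<subseteq> tedges (two_layer V E)" and b: "branch (tverts (two_layer V E)) F R"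
    and R: "\<And>v. (name v, t) \<in> R \<Longrightarrow> Z v" and v: "v \<in> V"
  shows "reach {(u, v). ((name u, t), (name v, t)) \<in> F} Z v"
proof -
  let ?X = "tverts (two_layer V E)" and ?A = "{(u, v). ((name u, t), (name v, t)) \<in> F}"
  obtain rk :: "_ \<Rightarrow> nat" where rk: "\<And>x. x \<in> ?X \<Longrightarrow>
     if x \<in> R then in_steps ?X F x = {} else \<exists>z. in_steps ?X F x = {z} \<and> rk (src z) < rk x"
    using b unfolding branch_def by blast
  show ?thesis using v
  proof (induction "rk (name v, t)" arbitrary: v rule: less_induct)
    case less
    have x: "(name v, t) \<in> ?X" using less.prems t by (auto simp: two_layer_tverts)
    show ?case
    proof (cases "(name v, t) \<in> R")
      case True
      then show ?thesis by (intro reach_root R)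
    next
      case False
      then obtain z where z: "in_steps ?X F (name v, t) = {z}" "rk (src z) < rk (name v, t)" using rk[OF x] by auto
      then have "z \<in> in_steps ?X F (name v, t)" by simp
      then consider y where "z = Inl y" "(y, (name v, t)) \<in> F" | y where "y \<in> ?X" "t = Suc (snd y)"
        by (auto simp: in_steps_def)
      then show ?thesis
      proof cases
        case 1
        then obtain u where u: "y = (name u, t)" "u \<in> V" using F by (auto simp: two_layer_tedges)
        then have "reach ?A Z u" using less.hyps[of u] z(2) 1(1) by simp
        then show ?thesis using 1(2) u(1) by (auto intro: reach_step)
      next
        case 2
        then show ?thesis using t by (auto simp: two_layer_tverts)
      qed
    qed
  qed
qed

theorem two_layer_branchings:
  assumes fin: "finite V" and k: "k \<ge> 2"
  shows "has_disjoint_branchings (two_layer V E) (map (layer_roots V Z) [0..<k]) \<longleftrightarrow>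
    (\<exists>A1 A3. A1 \<subseteq> {(u, v). u \<in> V \<and> v \<in> V \<and> E 1 u v} \<and> A3 \<subseteq> {(u, v). u \<in> V \<and> v \<in> V \<and> E 3 u v} \<and>
      A1 \<inter> A3 = {} \<and> (\<forall>v \<in> V. reach A1 (Z 1) v \<and> reach A3 (Z 3) v))" (is "_ \<longleftrightarrow> ?r")
proof -
  let ?T = "two_layer V E" and ?R = "layer_roots V Z"
  note iff = has_disjoint_branchings_iff[OF two_layer_temporal_digraph[OF fin]]
  show ?thesis
  proof
    assume "has_disjoint_branchings ?T (map ?R [0..<k])"
    then have "\<exists>F. (\<forall>i < k. F i \<subseteq> tedges ?T \<and> branch (tverts ?T) (F i) (?R i)) \<and>
      (\<forall>i < k. \<forall>j < k. i \<noteq> j \<longrightarrow> arcs_of (F i) \<inter> arcs_of (F j) = {})" unfolding iff by simp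
    then obtain F where "\<forall>i < k. F i \<subseteq> tedges ?T \<and> branch (tverts ?T) (F i) (?R i)"
      "\<forall>i < k. \<forall>j < k. i \<noteq> j \<longrightarrow> arcs_of (F i) \<inter> arcs_of (F j) = {}" by (elim exE conjE)
    note F = this[rule_format]
    have F01: "F 0 \<subseteq> tedges ?T" "branch (tverts ?T) (F 0) (?R 0)" "F 1 \<subseteq> tedges ?T" "branch (tverts ?T) (F 1) (?R 1)"
      "arcs_of (F 0) \<inter> arcs_of (F 1) = {}" using F k by auto
    let ?A1 = "{(u, v). ((name u, 1), (name v, 1)) \<in> F 0}" and ?A3 = "{(u, v). ((name u, 3), (name v, 3)) \<in> F 1}"
    have "?A1 \<subseteq> {(u, v). u \<in> V \<and> v \<in> V \<and> E 1 u v}" "?A3 \<subseteq> {(u, v). u \<in> V \<and> v \<in> V \<and> E 3 u v}"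
      using F01(1,3) by (auto simp: two_layer_tedges name_inj)
    moreover have "?A1 \<inter> ?A3 = {}"
    proof -
      have "(name u, name v) \<in> arcs_of (F 0)" "(name u, name v) \<in> arcs_of (F 1)"
        if "(u, v) \<in> ?A1 \<inter> ?A3" for u v using that unfolding arcs_of_def by force+
      then show ?thesis using F01(5) by blast
    qed
    moreover have "reach ?A1 (Z 1) v" if "v \<in> V" for v
      by (rule branch_reach[OF _ F01(1,2) _ that]) (auto simp: layer_roots_def name_inj)
    moreover have "reach ?A3 (Z 3) v" if "v \<in> V" for v
      by (rule branch_reach[OF _ F01(3,4) _ that]) (auto simp: layer_roots_def name_inj)
    ultimately show ?r by (intro exI[of _ ?A1] exI[of _ ?A3]) simp
  next
    assume ?r
    then obtain A1 A3 where A: "A1 \<subseteq> {(u, v). u \<in> V \<and> v \<in> V \<and> E 1 u v}" "A3 \<subseteq> {(u, v). u \<in> V \<and> v \<in> V \<and> E 3 u v}"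
      "A1 \<inter> A3 = {}" "\<And>v. v \<in> V \<Longrightarrow> reach A1 (Z 1) v" "\<And>v. v \<in> V \<Longrightarrow> reach A3 (Z 3) v" by blast
    obtain p1 and d1 :: "nat list \<Rightarrow> nat" where p1: "\<And>v. v \<in> V \<Longrightarrow> \<not> Z 1 v \<Longrightarrow> (p1 v, v) \<in> A1 \<and> d1 (p1 v) < d1 v"
      using reach_tree[OF A(4)] by metis
    obtain p3 and d3 :: "nat list \<Rightarrow> nat" where p3: "\<And>v. v \<in> V \<Longrightarrow> \<not> Z 3 v \<Longrightarrow> (p3 v, v) \<in> A3 \<and> d3 (p3 v) < d3 v"
      using reach_tree[OF A(5)] by metis
    let ?F0 = "{((name (p1 v), 1), (name v, 1)) | v. v \<in> V \<and> \<not> Z 1 v}"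
    let ?F1 = "{((name (p3 v), 3), (name v, 3)) | v. v \<in> V \<and> \<not> Z 3 v}"
    have b0: "branch (tverts ?T) ?F0 (?R 0)"
      by (rule layer_branch[where d = d1]) (use p1 A(1) in \<open>auto simp: layer_roots_def\<close>)
    have b1: "branch (tverts ?T) ?F1 (?R 1)"
      by (rule layer_branch[where d = d3]) (use p3 A(2) in \<open>auto simp: layer_roots_def\<close>)
    have b2: "branch (tverts ?T) {} (?R i)" if "i \<ge> 2" for i
      unfolding branch_def using that by (auto simp: layer_roots_def in_steps_def two_layer_tverts)
    have sub: "?F0 \<subseteq> tedges ?T" "?F1 \<subseteq> tedges ?T"
      using p1 p3 A(1,2) by (fastforce simp: two_layer_tedges)+
    have "arcs_of ?F0 \<inter> arcs_of ?F1 = {}"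
    proof -
      have "arcs_of ?F0 \<subseteq> (\<lambda>(u, v). (name u, name v)) ` A1" "arcs_of ?F1 \<subseteq> (\<lambda>(u, v). (name u, name v)) ` A3"
        using p1 p3 by (force simp: arcs_of_def)+
      then show ?thesis using A(3) by (fastforce simp: name_inj)
    qed
    then have disj: "arcs_of ?F0 \<inter> arcs_of ?F1 = {}" "arcs_of ?F1 \<inter> arcs_of ?F0 = {}" by blast+
    let ?F = "\<lambda>i. if i = 0 then ?F0 else if i = 1 then ?F1 else {}"
    have 1: "?F i \<subseteq> tedges ?T \<and> branch (tverts ?T) (?F i) (?R i)" for i :: nat
    proof -
      consider "i = 0" | "i = 1" | "i \<ge> 2" by linarith
      then show ?thesis using b0 b1 b2[of i] sub by cases simp_all
    qed
    have 2: "arcs_of (?F i) \<inter> arcs_of (?F j) = {}" if "i \<noteq> j" for i j :: nat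
    proof -
      have "arcs_of {} = ({} :: (nat \<times> nat) set)" by (simp add: arcs_of_def)
      then show ?thesis using that disj by simp
    qed
    show "has_disjoint_branchings ?T (map ?R [0..<k])" unfolding iff
      by (rule exI[of _ ?F]) (use 1 2 in simp)
  qed
qed

section \<open>The instance string and its correctness\<close>

definition instance_string :: "nat \<Rightarrow> nat list list \<Rightarrow> (nat \<Rightarrow> nat list \<Rightarrow> nat list \<Rightarrow> bool) \<Rightarrow>
    (nat \<Rightarrow> nat list \<Rightarrow> bool) \<Rightarrow> bool list" where
  "instance_string k vs E Z =
     enc_list enc_nat (map name vs) @
     enc_list enc_nat2 (map (\<lambda>(u, v). (name u, name v)) (filter (\<lambda>(u, v). E 1 u v \<or> E 3 u v) (List.product vs vs))) @
     enc_list enc_nat2 (map (\<lambda>(v, t). (name v, t)) (List.product vs [1, 3])) @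
     enc_list (enc_pair enc_nat2 enc_nat2) (map (\<lambda>((u, v), t). ((name u, t), (name v, t)))
       (filter (\<lambda>((u, v), t). E t u v) (List.product (List.product vs vs) [1, 3]))) @
     concat (map (\<lambda>i. enc_list enc_nat2 (map (\<lambda>(v, t). (name v, t)) (filter (\<lambda>(v, t).
       if i = 0 then t = 3 \<or> Z 1 v else if i = 1 then t = 1 \<or> Z 3 v else True) (List.product vs [1, 3])))) [0..<k])"

lemma instance_string_encodes:
  assumes "distinct vs"
  shows "encodes (instance_string k vs E Z) (two_layer (set vs) E) (map (layer_roots (set vs) Z) [0..<k])"
proof -
  let ?es = "map (\<lambda>(u, v). (name u, name v)) (filter (\<lambda>(u, v). E 1 u v \<or> E 3 u v) (List.product vs vs))"
  let ?ts = "map (\<lambda>(v, t). (name v, t)) (List.product vs [1, 3 :: nat])"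
  let ?te = "map (\<lambda>((u, v), t). ((name u, t), (name v, t)))
       (filter (\<lambda>((u, v), t). E t u v) (List.product (List.product vs vs) [1, 3 :: nat]))"
  let ?r = "\<lambda>i. map (\<lambda>(v, t). (name v, t)) (filter (\<lambda>(v, t).
       if i = 0 then t = 3 \<or> Z 1 v else if i = 1 then t = 1 \<or> Z 3 v else True) (List.product vs [1, 3 :: nat]))"
  have inj: "inj_on name A" "inj_on (\<lambda>(u, v). (name u, name v)) B" "inj_on (\<lambda>(v, t :: nat). (name v, t)) C"
    "inj_on (\<lambda>((u, v), t :: nat). ((name u, t), (name v, t))) D" for A B C D
    by (auto simp: inj_on_def name_inj)
  show ?thesis unfolding encodes_def
  proof (rule exI[of _ "map name vs"], rule exI[of _ ?es], rule exI[of _ ?ts], rule exI[of _ ?te],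
      rule exI[of _ "map ?r [0..<k]"], intro conjI)
    show "set (map name vs) = pverts (dgraph (two_layer (set vs) E))" by (simp add: two_layer_def)
    show "set ?es = parcs (dgraph (two_layer (set vs) E))" by (auto simp: two_layer_def)
    show "set ?ts = tverts (two_layer (set vs) E)" by (auto simp: two_layer_tverts)
    have "x \<in> set ?te \<longleftrightarrow> x \<in> tedges (two_layer (set vs) E)" for x
      unfolding two_layer_tedges by (simp add: image_iff Bex_def split_paired_Ex) blast
    then show "set ?te = tedges (two_layer (set vs) E)" by blast
    show "distinct (map name vs)" "distinct ?es" "distinct ?ts" "distinct ?te" "list_all distinct (map ?r [0..<k])"
      using assms by (auto simp: distinct_map inj distinct_product list_all_iff)
    show "map set (map ?r [0..<k]) = map (layer_roots (set vs) Z) [0..<k]"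
      by (auto simp: layer_roots_def split: if_splits)
    show "instance_string k vs E Z = enc_list enc_nat (map name vs) @ enc_list enc_nat2 ?es @ enc_list enc_nat2 ?ts @
      enc_list (enc_pair enc_nat2 enc_nat2) ?te @ concat (map (enc_list enc_nat2) (map ?r [0..<k]))"
      by (simp add: instance_string_def comp_def)
  qed
qed

text \<open>One reduction serves both problems, since the instance has lifetime 3 and the restricted
  language lies in the general one. Membership may be witnessed by a different temporal digraph, but
  by \<open>encodes_unique\<close> it has the same temporal vertices, temporal edges and roots,
  which determine the answer.\<close>

theorem instance_string_correct:
  assumes vs: "distinct vs" "vs \<noteq> []" and k: "k \<ge> 2"
    and P: "P \<longleftrightarrow> (\<exists>A1 A3. A1 \<subseteq> {(u, v). u \<in> set vs \<and> v \<in> set vs \<and> E 1 u v} \<and>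
      A3 \<subseteq> {(u, v). u \<in> set vs \<and> v \<in> set vs \<and> E 3 u v} \<and>
      A1 \<inter> A3 = {} \<and> (\<forall>v \<in> set vs. reach A1 (Z 1) v \<and> reach A3 (Z 3) v))"
  shows "instance_string k vs E Z \<in> disjoint_branchings_problem k \<longleftrightarrow> P"
    "instance_string k vs E Z \<in> disjoint_branchings_problem_lifetime k 3 \<longleftrightarrow> P"
proof -
  let ?x = "instance_string k vs E Z" and ?T = "two_layer (set vs) E" and ?Rs = "map (layer_roots (set vs) Z) [0..<k]"
  have T: "temporal_digraph ?T" by (rule two_layer_temporal_digraph) simp
  have P': "has_disjoint_branchings ?T ?Rs \<longleftrightarrow> P" unfolding P by (rule two_layer_branchings) (simp_all add: k)
  have enc: "encodes ?x ?T ?Rs" by (rule instance_string_encodes[OF vs(1)])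
  have "(\<Union>v \<in> pverts (dgraph ?T). active ?T v) = {1, 3}" using vs(2) by (auto simp: two_layer_def)
  then have life: "has_lifetime ?T 3" by (simp add: has_lifetime_def)
  have R: "\<forall>R \<in> set ?Rs. R \<subseteq> tverts ?T" by (auto simp: layer_roots_def two_layer_tverts)
  have 1: P if "?x \<in> disjoint_branchings_problem k"
  proof -
    from that obtain T' Rs' where T': "temporal_digraph T'" "length Rs' = k" "encodes ?x T' Rs'"
      "has_disjoint_branchings T' Rs'" by (auto simp: disjoint_branchings_problem_def)
    have eq: "tverts ?T = tverts T'" "tedges ?T = tedges T'" "?Rs = Rs'"
      using encodes_unique[OF enc T'(3)] T'(2) by auto
    have "has_disjoint_branchings ?T ?Rs"
      using T'(4) unfolding has_disjoint_branchings_iff[OF T] has_disjoint_branchings_iff[OF T'(1)] eq .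
    then show ?thesis using P' by simp
  qed
  have 2: "?x \<in> disjoint_branchings_problem_lifetime k 3" if P
    unfolding disjoint_branchings_problem_lifetime_def
    using that T life R enc P' by (intro CollectI exI[of _ ?T] exI[of _ ?Rs]) simp
  have "disjoint_branchings_problem_lifetime k 3 \<subseteq> disjoint_branchings_problem k"
    by (auto simp: disjoint_branchings_problem_lifetime_def disjoint_branchings_problem_def)
  then show "?x \<in> disjoint_branchings_problem k \<longleftrightarrow> P" "?x \<in> disjoint_branchings_problem_lifetime k 3 \<longleftrightarrow> P"
    using 1 2 by blast+
qed

subsection \<open>Generating the instance\<close>

text \<open>The last component varies slowest. This is the order of nested loops: an inner loop puts
  its variable in front of the environment, so the innermost \<open>n\<close> variables form the
  tuple.\<close>

fun tuples :: "nat \<Rightarrow> nat \<Rightarrow> nat list list" where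
  "tuples U 0 = [[]]"
| "tuples U (Suc n) = concat (map (\<lambda>x. map (\<lambda>e. e @ [x]) (tuples U n)) [0..<U])"

lemma set_tuples: "set (tuples U n) = {e. length e = n \<and> (\<forall>x \<in> set e. x < U)}"
proof (induction n)
  case (Suc n)
  show ?case
  proof (intro subset_antisym subsetI)
    fix e assume "e \<in> set (tuples U (Suc n))"
    then show "e \<in> {e. length e = Suc n \<and> (\<forall>x \<in> set e. x < U)}" using Suc by auto
  next
    fix e assume e: "e \<in> {e. length e = Suc n \<and> (\<forall>x \<in> set e. x < U)}"
    then have "e \<noteq> []" by auto
    then have "e = butlast e @ [last e]" "butlast e \<in> set (tuples U n)" "last e < U"
      using e Suc by (auto dest: in_set_butlastD)
    then have "e \<in> set (map (\<lambda>e'. e' @ [last e]) (tuples U n))" by (metis image_eqI set_map)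
    then show "e \<in> set (tuples U (Suc n))" using \<open>last e < U\<close> by auto
  qed
qed auto

lemma distinct_tuples: "distinct (tuples U n)"
proof (induction n)
  case (Suc n)
  have "distinct (concat (map (\<lambda>x. map (\<lambda>e. e @ [x]) (tuples U n)) xs))" if "distinct xs" for xs
    using that
  proof (induction xs)
    case (Cons x xs)
    then show ?case using \<open>distinct (tuples U n)\<close> by (auto simp: distinct_map inj_on_def)
  qed simp
  then show ?case by simp
qed simp

text \<open>Positions come before the tag: the positions are ranged over by loops at run time,
  whereas the program contains a copy of the loop body for each of the finitely many tags.\<close>

definition verts_of :: "nat list list \<Rightarrow> nat \<Rightarrow> nat \<Rightarrow> nat list list" where
  "verts_of tags n U = concat (map (\<lambda>g. map (\<lambda>e. e @ g) (tuples U n)) tags)"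

lemma set_verts_of: "set (verts_of tags n U) = {e @ g | e g. g \<in> set tags \<and> length e = n \<and> (\<forall>x \<in> set e. x < U)}"
  by (auto simp: verts_of_def set_tuples)

lemma distinct_verts_of: "distinct tags \<Longrightarrow> distinct (verts_of tags n U)"
proof (induction tags)
  case (Cons g tags)
  have "set (map (\<lambda>e. e @ g) (tuples U n)) \<inter> set (verts_of tags n U) = {}"
    using Cons.prems by (auto simp: set_tuples set_verts_of)
  then show ?case using Cons distinct_tuples by (auto simp: verts_of_def distinct_map inj_on_def)
qed (simp add: verts_of_def)

lemma concat_map_tuples_Suc:
  "concat (map F (tuples U (Suc n))) = concat (map (\<lambda>x. concat (map (\<lambda>e. F (e @ [x])) (tuples U n))) [0..<U])"
proof -
  have "concat (map F (concat (map (\<lambda>x. map (\<lambda>e. e @ [x]) (tuples U n)) xs))) =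
    concat (map (\<lambda>x. concat (map (\<lambda>e. F (e @ [x])) (tuples U n))) xs)" for xs
    by (induction xs) (auto simp: comp_def)
  then show ?thesis by simp
qed

lemma GEN_tuples:
  assumes "GEN (n + d) (\<lambda>w e. F w (take n e) (drop n e))"
  shows "GEN d (\<lambda>w e. concat (map (\<lambda>e'. F w e' e) (tuples (length w) n)))"
  using assms
proof (induction n arbitrary: d F)
  case 0
  then show ?case by simp
next
  case (Suc n)
  have "GEN (Suc d) (\<lambda>w e. concat (map (\<lambda>e'. F w (e' @ [hd e]) (tl e)) (tuples (length w) n)))"
  proof (rule Suc.IH)
    show "GEN (n + Suc d) (\<lambda>w e. F w (take n e @ [hd (drop n e)]) (tl (drop n e)))"
    proof (rule GEN_cong)
      show "GEN (n + Suc d) (\<lambda>w e. F w (take (Suc n) e) (drop (Suc n) e))" using Suc.prems by simp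
      fix w e :: "nat list"
      assume "length e = n + Suc d"
      then show "F w (take (Suc n) e) (drop (Suc n) e) = F w (take n e @ [hd (drop n e)]) (tl (drop n e))"
        by (simp add: take_hd_drop drop_Suc tl_drop)
    qed
  qed
  from GEN_for[OF this] show ?case by (rule GEN_cong) (simp only: concat_map_tuples_Suc)
qed

lemma GEN_map_list:
  assumes "\<And>t. t \<in> set ts \<Longrightarrow> tm_at d t"
  shows "GEN d (\<lambda>w e. concat (map (\<lambda>t. concat (replicate (t e) xs) @ ys) ts))"
  by (rule GEN_list, rule GEN_append, rule GEN_unary, erule assms, rule GEN_const)

text \<open>The reason for unary digits in names: the code of a vertex consists of blocks repeated
  as often as a head position says, which a program emits without arithmetic.\<close>

lemma enc_nat_name: "enc_nat (name v) = concat (map (\<lambda>x. concat (replicate x [False, True]) @ [False, False]) v) @ [False, True, True, False]"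
proof -
  have "concat (map (\<lambda>b. [False, b]) (replicate x True @ [False])) = concat (replicate x [False, True]) @ [False, False]" for x
    by (induction x) auto
  then have "concat (map (\<lambda>b. [False, b]) (concat (map (\<lambda>x. replicate x True @ [False]) v))) =
    concat (map (\<lambda>x. concat (replicate x [False, True]) @ [False, False]) v)"
    by (induction v) auto
  then show ?thesis unfolding enc_nat_def binary_digits_name digits_of_def by simp
qed

lemma GEN_name:
  assumes "\<And>i. i < n \<Longrightarrow> tm_at d (\<lambda>e. f e ! i)" "\<And>e. length e = d \<Longrightarrow> length (f e) = n"
  shows "GEN d (\<lambda>w e. enc_nat (name (f e @ g)))"
proof -
  have "GEN d (\<lambda>w e. concat (map (\<lambda>t. concat (replicate (t e) [False, True]) @ [False, False]) (map (\<lambda>i e. f e ! i) [0..<n])) @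
      (concat (map (\<lambda>x. concat (replicate x [False, True]) @ [False, False]) g) @ [False, True, True, False]))"
    using assms(1) by (intro GEN_append GEN_const GEN_map_list) auto
  then show ?thesis
  proof (rule GEN_cong)
    fix w e :: "nat list"
    assume "length e = d"
    then have "map H (f e) = map (\<lambda>i. H (f e ! i)) [0..<n]" for H :: "nat \<Rightarrow> bool list"
      using assms(2) by (intro nth_equalityI) auto
    then show "concat (map (\<lambda>t. concat (replicate (t e) [False, True]) @ [False, False]) (map (\<lambda>i e. f e ! i) [0..<n])) @
      (concat (map (\<lambda>x. concat (replicate x [False, True]) @ [False, False]) g) @ [False, True, True, False]) =
      enc_nat (name (f e @ g))"
      by (simp add: enc_nat_name comp_def)
  qed
qed

lemma concat_map_verts_of:
  "concat (map F (verts_of tags n U)) = concat (map (\<lambda>g. concat (map (\<lambda>e. F (e @ g)) (tuples U n))) tags)"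
  by (induction tags) (auto simp: verts_of_def comp_def)

lemma GEN_verts:
  assumes "\<And>g. g \<in> set tags \<Longrightarrow> GEN (n + d) (\<lambda>w e. F w (take n e @ g) (drop n e))"
  shows "GEN d (\<lambda>w e. concat (map (\<lambda>v. F w v e) (verts_of tags n (length w))))"
  unfolding concat_map_verts_of
  by (rule GEN_list, rule GEN_tuples[where F = "\<lambda>w e' e. F w (e' @ _) e"], rule assms)

lemma concat_map_filter: "concat (map F (filter P xs)) = concat (map (\<lambda>x. if P x then F x else []) xs)"
  by (induction xs) auto

lemma concat_map_product:
  "concat (map F (List.product xs ys)) = concat (map (\<lambda>x. concat (map (\<lambda>y. F (x, y)) ys)) xs)"
  by (induction xs) (auto simp: comp_def)

text \<open>In the nested loops over pairs of vertices the tail is chosen by the outer loop, so its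
  positions are \<open>drop n e\<close>, and those of the head of the arc are
  \<open>take n e\<close>.\<close>

theorem GEN_instance_string:
  assumes E: "\<And>t g g'. t \<in> {1, 3} \<Longrightarrow> g \<in> set tags \<Longrightarrow> g' \<in> set tags \<Longrightarrow>
      FO (n + n) (\<lambda>w \<rho> e. E w t (drop n e @ g) (take n e @ g'))"
    and Z: "\<And>t e g. length e = n \<Longrightarrow> Z t (e @ g) = Z' t g"
  shows "GEN 0 (\<lambda>w e. instance_string k (verts_of tags n (length w)) (E w) Z)"
proof -
  have nth1: "tm_at (n + d) (\<lambda>e. take n e ! i)" if "i < n" for i d
    unfolding tm_at_def using that by (intro exI[of _ i]) auto
  have nth2: "tm_at (n + n) (\<lambda>e. drop n e ! i)" if "i < n" for i
    unfolding tm_at_def using that by (intro exI[of _ "n + i"]) auto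
  have name1: "GEN (n + d) (\<lambda>w e. enc_nat (name (take n e @ g)))" for g d
    by (rule GEN_name[OF nth1]) auto
  have name2: "GEN (n + n) (\<lambda>w e. enc_nat (name (drop n e @ g)))" for g
    by (rule GEN_name[OF nth2]) auto
  have name0: "GEN (n + 0) (\<lambda>w e. enc_nat (name (take n e @ g)))" for g
    by (rule name1)
  let ?vs = "\<lambda>w. verts_of tags n (length w)"
  have vs: "GEN 0 (\<lambda>w e. enc_list enc_nat (map name (?vs w)))"
    unfolding enc_list_def map_map comp_def by (intro GEN_append GEN_const GEN_verts name0)
  have es: "GEN 0 (\<lambda>w e. enc_list enc_nat2 (map (\<lambda>(u, v). (name u, name v)) (filter (\<lambda>(u, v). E w 1 u v \<or> E w 3 u v) (List.product (?vs w) (?vs w)))))"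
  proof -
    have "GEN 0 (\<lambda>w e. concat (map (\<lambda>u. concat (map (\<lambda>v. if E w 1 u v \<or> E w 3 u v then enc_nat (name u) @ enc_nat (name v) else []) (?vs w))) (?vs w)) @ [True, True])"
    proof (intro GEN_append GEN_const GEN_verts)
      fix g g' assume "g \<in> set tags" "g' \<in> set tags"
      then show "GEN (n + (n + 0)) (\<lambda>w e. if E w 1 (take n (drop n e) @ g) (take n e @ g') \<or> E w 3 (take n (drop n e) @ g) (take n e @ g')
         then enc_nat (name (take n (drop n e) @ g)) @ enc_nat (name (take n e @ g')) else [])"
        using GEN_if[OF FO_or[OF E[of 1 g g'] E[of 3 g g']] GEN_append[OF name2[of g] name1[of n g']] GEN_const[of "n + n" "[]"]]
        by (auto elim!: GEN_cong)
    qed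
    then show ?thesis
      by (rule GEN_cong) (auto simp: enc_list_def concat_map_filter concat_map_product enc_pair_def comp_def case_prod_beta if_distrib cong: if_cong)
  qed
  have tvs: "GEN 0 (\<lambda>w e. enc_list enc_nat2 (map (\<lambda>(v, t). (name v, t)) (filter (\<lambda>(v, t). Q v t) (List.product (?vs w) [1, 3]))))"
    if Q: "\<And>e g t. length e = n \<Longrightarrow> Q (e @ g) t = Q' g t" for Q Q'
  proof -
    have "GEN 0 (\<lambda>w e. concat (map (\<lambda>v. concat (map (\<lambda>t. if Q v t then enc_nat (name v) @ enc_nat t else []) [1, 3])) (?vs w)) @ [True, True])"
    proof (intro GEN_append GEN_const GEN_verts GEN_list)
      fix g :: "nat list" and t :: nat
      have "GEN (n + 0) (\<lambda>w e. if Q' g t then enc_nat (name (take n e @ g)) @ enc_nat t else [])"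
        by (intro GEN_if FO_const GEN_append name0 GEN_const)
      then show "GEN (n + 0) (\<lambda>w e. if Q (take n e @ g) t then enc_nat (name (take n e @ g)) @ enc_nat t else [])"
        by (rule GEN_cong) (simp add: Q)
    qed
    then show ?thesis
      by (rule GEN_cong) (auto simp: enc_list_def concat_map_filter concat_map_product enc_pair_def comp_def case_prod_beta if_distrib cong: if_cong)
  qed
  have te: "GEN 0 (\<lambda>w e. enc_list (enc_pair enc_nat2 enc_nat2) (map (\<lambda>((u, v), t). ((name u, t), (name v, t)))
       (filter (\<lambda>((u, v), t). E w t u v) (List.product (List.product (?vs w) (?vs w)) [1, 3]))))"
  proof -
    have "GEN 0 (\<lambda>w e. concat (map (\<lambda>u. concat (map (\<lambda>v. concat (map (\<lambda>t. if E w t u v then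
        enc_nat (name u) @ enc_nat t @ enc_nat (name v) @ enc_nat t else []) [1, 3])) (?vs w))) (?vs w)) @ [True, True])"
    proof (intro GEN_append GEN_const GEN_verts GEN_list)
      fix g g' t assume "g \<in> set tags" "g' \<in> set tags" "t \<in> set [1, 3 :: nat]"
      then have "GEN (n + n) (\<lambda>w e. if E w t (drop n e @ g) (take n e @ g') then
        enc_nat (name (drop n e @ g)) @ enc_nat t @ enc_nat (name (take n e @ g')) @ enc_nat t else [])"
        by (intro GEN_if E GEN_append name1 name2 GEN_const) auto
      then show "GEN (n + (n + 0)) (\<lambda>w e. if E w t (take n (drop n e) @ g) (take n e @ g') then
        enc_nat (name (take n (drop n e) @ g)) @ enc_nat t @ enc_nat (name (take n e @ g')) @ enc_nat t else [])"
        by (auto elim!: GEN_cong)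
    qed
    then show ?thesis
      by (rule GEN_cong) (auto simp: enc_list_def concat_map_filter concat_map_product enc_pair_def comp_def case_prod_beta if_distrib cong: if_cong)
  qed
  have tv: "GEN 0 (\<lambda>w e. enc_list enc_nat2 (map (\<lambda>(v, t). (name v, t)) (List.product (?vs w) [1, 3])))"
    using tvs[of "\<lambda>v t. True" "\<lambda>v t. True"] by simp
  have rs: "GEN 0 (\<lambda>w e. concat (map (\<lambda>i. enc_list enc_nat2 (map (\<lambda>(v, t). (name v, t)) (filter (\<lambda>(v, t).
       if i = 0 then t = 3 \<or> Z 1 v else if i = 1 then t = 1 \<or> Z 3 v else True) (List.product (?vs w) [1, 3])))) [0..<k]))"
  proof (rule GEN_list)
    fix i
    show "GEN 0 (\<lambda>w e. enc_list enc_nat2 (map (\<lambda>(v, t). (name v, t)) (filter (\<lambda>(v, t).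
       if i = 0 then t = 3 \<or> Z 1 v else if i = 1 then t = 1 \<or> Z 3 v else True) (List.product (?vs w) [1, 3]))))"
      by (rule tvs[of "\<lambda>v t. if i = 0 then t = 3 \<or> Z 1 v else if i = 1 then t = 1 \<or> Z 3 v else True"
            "\<lambda>g t. if i = 0 then t = 3 \<or> Z' 1 g else if i = 1 then t = 1 \<or> Z' 3 g else True"]) (simp add: Z)
  qed
  show ?thesis unfolding instance_string_def by (intro GEN_append vs es tv te rs)
qed

section \<open>Reducing satisfiability\<close>

declare One_nat_def [simp del]

text \<open>Both impossibility arguments for the formula graph single out a set \<open>Y\<close>
  without roots and inspect an arc that enters it.\<close>

lemma reach_entered:
  assumes "reach A Z v" "v \<in> Y" "\<And>u. u \<in> Y \<Longrightarrow> \<not> Z u"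
  obtains u u' where "(u, u') \<in> A" "u' \<in> Y" "u \<notin> Y"
proof -
  from assms(1) obtain r where r: "Z r" "(r, v) \<in> A\<^sup>*" unfolding reach_def by blast
  have "\<exists>u u'. (u, u') \<in> A \<and> u' \<in> Y \<and> u \<notin> Y"
    using r(2) assms(2)
  proof (induction rule: rtrancl_induct)
    case base
    then show ?case using r(1) assms(3) by blast
  next
    case (step y z)
    then show ?case by blast
  qed
  then show ?thesis using that by blast
qed

subsection \<open>The graph of a uniform formula in conjunctive normal form\<close>

text \<open>Clauses are indexed by a kind \<open>\<kappa>\<close> and two positions \<open>t, p\<close>; variables by a kind \<open>j\<close> and two positions
  \<open>c, d\<close>; literals have in addition a sign \<open>s\<close>, where 1 is positive. The tuples
  \<open>[t, p, c, d, 0, \<kappa>, j, s]\<close> and \<open>[t, p, c, d, 1, \<kappa>, j, s]\<close> are the source and the occurrence vertex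
  of a literal in a clause, \<open>[t, p, _, _, 2, \<kappa>, 0, 0]\<close> are the hubs of a clause and
  \<open>[_, _, _, _, 3, 0, 0, 0]\<close> are roots. In the first layer, a hub is reached through an arc from a source
  to an occurrence of one of the literals of the clause. In the second layer the sources and
  occurrences of a literal form a chain, with all occurrences accessible also from the end of the chain of
  the complementary literal. Only the arcs from sources to occurrences belong to both layers.\<close>

inductive arc1 :: "(nat \<Rightarrow> nat \<Rightarrow> nat \<Rightarrow> nat \<Rightarrow> nat \<Rightarrow> nat \<Rightarrow> nat \<Rightarrow> bool) \<Rightarrow> nat list \<Rightarrow> nat list \<Rightarrow> bool"
  for mem where
  use_literal: "mem \<kappa> j s t p c d \<Longrightarrow> arc1 mem [t, p, c, d, 0, \<kappa>, j, s] [t, p, c, d, 1, \<kappa>, j, s]"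
| to_hub: "arc1 mem [t, p, c, d, 1, \<kappa>, j, s] [t, p, c', d', 2, \<kappa>, 0, 0]"
| from_hub: "arc1 mem [t, p, c', d', 2, \<kappa>, 0, 0] [t, p, c, d, 1, \<kappa>, j, s]"

inductive arc3 :: "nat \<Rightarrow> nat \<Rightarrow> nat list \<Rightarrow> nat list \<Rightarrow> bool" for U nK where
  chain: "\<kappa> < nK \<Longrightarrow> arc3 U nK [t, p, c, d, 0, \<kappa>, j, s] [t, p, c, d, 1, \<kappa>, j, s]"
| next_kind: "\<kappa> < nK \<Longrightarrow> arc3 U nK [t, p, c, d, 1, \<kappa>, j, s] [t, p, c, d, 0, Suc \<kappa>, j, s]"
| next_p: "arc3 U nK [t, p, c, d, 0, nK, j, s] [t, Suc p, c, d, 0, 0, j, s]"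
| next_t: "Suc p = U \<Longrightarrow> arc3 U nK [t, p, c, d, 0, nK, j, s] [Suc t, 0, c, d, 0, 0, j, s]"
| complement: "Suc t' = U \<Longrightarrow> Suc p' = U \<Longrightarrow> \<kappa> < nK \<Longrightarrow> s' = 1 - s \<Longrightarrow>
    arc3 U nK [t', p', c, d, 0, nK, j, s] [t, p, c, d, 1, \<kappa>, j, s']"
| begin_chain: "arc3 U nK [t, p, c', d', 3, 0, 0, 0] [0, 0, c, d, 0, 0, j, s]"

text \<open>Conditions on tags, which are constants for the program, are separated from equations
  between positions. In this form, as in \<open>arc3_iff\<close>, the closure rules for
  \<open>FO\<close> apply.\<close>

lemma arc1_iff:
  "arc1 mem [t, p, c, d, k, \<kappa>, j, s] [t', p', c', d', k', \<kappa>', j', s'] \<longleftrightarrow>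
     (k = 0 \<and> \<kappa> = \<kappa>' \<and> j = j' \<and> s = s') \<and> t' = t \<and> p' = p \<and> c' = c \<and> d' = d \<and> (k' = 1 \<and> mem \<kappa>' j' s' t' p' c' d') \<or>
     (k = 1 \<and> k' = 2 \<and> \<kappa> = \<kappa>' \<and> j' = 0 \<and> s' = 0) \<and> t' = t \<and> p' = p \<or>
     (k = 2 \<and> k' = 1 \<and> \<kappa> = \<kappa>' \<and> j = 0 \<and> s = 0) \<and> t' = t \<and> p' = p"
  unfolding arc1.simps by (simp cong: conj_cong; blast)

lemma arc3_iff:
  "arc3 U nK [t', p', c', d', k, \<kappa>, j, s] [t, p, c, d, k', \<kappa>', j', s'] \<longleftrightarrow>
     (k = 0 \<and> k' = 1 \<and> \<kappa> < nK \<and> \<kappa> = \<kappa>' \<and> j = j' \<and> s = s') \<and> t' = t \<and> p' = p \<and> c' = c \<and> d' = d \<or>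
     (k = 1 \<and> k' = 0 \<and> \<kappa> < nK \<and> \<kappa>' = Suc \<kappa> \<and> j = j' \<and> s = s') \<and> t' = t \<and> p' = p \<and> c' = c \<and> d' = d \<or>
     (k = 0 \<and> k' = 0 \<and> \<kappa> = nK \<and> \<kappa>' = 0 \<and> j = j' \<and> s = s') \<and> t' = t \<and> p = Suc p' \<and> c' = c \<and> d' = d \<or>
     (k = 0 \<and> k' = 0 \<and> \<kappa> = nK \<and> \<kappa>' = 0 \<and> j = j' \<and> s = s') \<and> t = Suc t' \<and> p = 0 \<and> Suc p' = U \<and> c' = c \<and> d' = d \<or>
     (k = 0 \<and> k' = 1 \<and> \<kappa> = nK \<and> \<kappa>' < nK \<and> j = j' \<and> s' = 1 - s) \<and> Suc t' = U \<and> Suc p' = U \<and> c' = c \<and> d' = d \<or>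
     (k = 3 \<and> k' = 0 \<and> \<kappa> = 0 \<and> j = 0 \<and> s = 0 \<and> \<kappa>' = 0) \<and> t = 0 \<and> p = 0"
    (is "?l \<longleftrightarrow> ?r")
proof
  show "?l \<Longrightarrow> ?r" by (erule arc3.cases) simp_all
  show "?r \<Longrightarrow> ?l" by (elim disjE conjE) (simp_all add: arc3.intros)
qed

text \<open>Sources exist also for \<open>\<kappa> = nK\<close>: such a vertex ends the segment of a
  pair \<open>t, p\<close> in a chain, and at the last pair it leads to the occurrences of the
  complementary literal.\<close>

definition sat_tags :: "nat \<Rightarrow> nat \<Rightarrow> nat list list" where
  "sat_tags nK nJ =
     map (\<lambda>(\<kappa>, j, s). [0, \<kappa>, j, s]) (List.product [0..<Suc nK] (List.product [0..<nJ] [0, 1])) @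
     map (\<lambda>(\<kappa>, j, s). [1, \<kappa>, j, s]) (List.product [0..<nK] (List.product [0..<nJ] [0, 1])) @
     map (\<lambda>\<kappa>. [2, \<kappa>, 0, 0]) [0..<nK] @ [[3, 0, 0, 0]]"

lemma set_sat_tags: "set (sat_tags nK nJ) = {[0, \<kappa>, j, s] | \<kappa> j s. \<kappa> \<le> nK \<and> j < nJ \<and> s \<le> 1} \<union>
    {[1, \<kappa>, j, s] | \<kappa> j s. \<kappa> < nK \<and> j < nJ \<and> s \<le> 1} \<union> {[2, \<kappa>, 0, 0] | \<kappa>. \<kappa> < nK} \<union> {[3, 0, 0, 0]}"
proof -
  have "s \<le> 1 \<longleftrightarrow> s = 0 \<or> s = 1" for s :: nat by auto
  then show ?thesis unfolding sat_tags_def by (auto simp: less_Suc_eq_le image_iff)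
qed

lemma distinct_sat_tags: "distinct (sat_tags nK nJ)"
proof -
  have d: "distinct (List.product [0..<n] (List.product [0..<m] [0::nat, 1]))" for n m :: nat
    by (intro distinct_product distinct_upt) simp
  have i: "inj_on (\<lambda>(\<kappa>, j, s). [l, \<kappa>, j, s]) A" "inj_on (\<lambda>\<kappa>. [l, \<kappa>, 0, 0]) B" for l :: nat and A B
    by (auto simp: inj_on_def)
  have h: "hd ` set (map (\<lambda>(\<kappa>, j, s). [l, \<kappa>, j, s]) xs) \<subseteq> {l}" "hd ` set (map (\<lambda>\<kappa>. [l, \<kappa>, 0, 0]) ys) \<subseteq> {l}"
    for l :: nat and xs ys by auto
  have append: "distinct (xs @ ys) \<and> hd ` set (xs @ ys) \<subseteq> insert l K"
    if "distinct xs" "distinct ys \<and> hd ` set ys \<subseteq> K" "hd ` set xs \<subseteq> {l}" "l \<notin> K" for xs ys and l :: nat and K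
    using that by (force simp: image_subset_iff)
  have "distinct (sat_tags nK nJ) \<and> hd ` set (sat_tags nK nJ) \<subseteq> {0, 1, 2, 3}"
    unfolding sat_tags_def by (intro append h iffD2[OF distinct_map] conjI d i distinct_upt) simp_all
  then show ?thesis by blast
qed

definition sat_arc :: "nat \<Rightarrow> nat \<Rightarrow> (nat \<Rightarrow> nat \<Rightarrow> nat \<Rightarrow> nat \<Rightarrow> nat \<Rightarrow> nat \<Rightarrow> nat \<Rightarrow> bool) \<Rightarrow>
    nat \<Rightarrow> nat list \<Rightarrow> nat list \<Rightarrow> bool" where
  "sat_arc U nK mem l u v \<longleftrightarrow> (if l = 1 then arc1 mem u v else arc3 U nK u v)"

definition sat_root :: "nat \<Rightarrow> nat list \<Rightarrow> bool" where
  "sat_root l v \<longleftrightarrow> v ! 4 \<in> (if l = 1 then {0, 3} else {2, 3})"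

definition cnf_satisfiable :: "nat \<Rightarrow> nat \<Rightarrow> nat \<Rightarrow> (nat \<Rightarrow> nat \<Rightarrow> nat \<Rightarrow> nat \<Rightarrow> nat \<Rightarrow> nat \<Rightarrow> nat \<Rightarrow> bool) \<Rightarrow> bool" where
  "cnf_satisfiable U nK nJ mem \<longleftrightarrow> (\<exists>\<alpha>. \<forall>\<kappa> < nK. \<forall>t < U. \<forall>p < U. \<exists>j < nJ. \<exists>s \<le> 1. \<exists>c < U. \<exists>d < U.
     mem \<kappa> j s t p c d \<and> (\<alpha> j c d \<longleftrightarrow> s = 1))"

locale sat_graph =
  fixes U nK nJ :: nat and mem :: "nat \<Rightarrow> nat \<Rightarrow> nat \<Rightarrow> nat \<Rightarrow> nat \<Rightarrow> nat \<Rightarrow> nat \<Rightarrow> bool"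
  assumes U: "U > 0"
begin

section \<open>The two layers of the formula graph\<close>

definition V :: "nat list set" where
  "V = set (verts_of (sat_tags nK nJ) 4 U)"

lemma len4: "length e = 4 \<and> (\<forall>x \<in> set e. x < U) \<longleftrightarrow> (\<exists>t p c d. e = [t, p, c, d] \<and> t < U \<and> p < U \<and> c < U \<and> d < U)"
  by (auto simp: numeral_eq_Suc length_Suc_conv)

lemma V_eq: "V = {[t, p, c, d, k, \<kappa>, j, s] | t p c d k \<kappa> j s. t < U \<and> p < U \<and> c < U \<and> d < U \<and> [k, \<kappa>, j, s] \<in> set (sat_tags nK nJ)}"
proof -
  have "\<exists>k \<kappa> j s. g = [k, \<kappa>, j, s]" if "g \<in> set (sat_tags nK nJ)" for g
    using that by (auto simp: set_sat_tags)
  then show ?thesis unfolding V_def set_verts_of len4 by (auto; metis append_Cons append_Nil)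
qed

lemma V_iff: "[t, p, c, d, k, \<kappa>, j, s] \<in> V \<longleftrightarrow> t < U \<and> p < U \<and> c < U \<and> d < U \<and>
   (k = 0 \<and> \<kappa> \<le> nK \<and> j < nJ \<and> s \<le> 1 \<or> k = 1 \<and> \<kappa> < nK \<and> j < nJ \<and> s \<le> 1 \<or> k = 2 \<and> \<kappa> < nK \<and> j = 0 \<and> s = 0 \<or>
    k = 3 \<and> \<kappa> = 0 \<and> j = 0 \<and> s = 0)"
  unfolding V_eq by (auto simp: set_sat_tags)

lemma V_cases:
  assumes "v \<in> V"
  obtains t p c d \<kappa> j s where "v = [t, p, c, d, 0, \<kappa>, j, s]" "t < U" "p < U" "c < U" "d < U" "\<kappa> \<le> nK" "j < nJ" "s \<le> 1"
  | t p c d \<kappa> j s where "v = [t, p, c, d, 1, \<kappa>, j, s]" "t < U" "p < U" "c < U" "d < U" "\<kappa> < nK" "j < nJ" "s \<le> 1"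
  | t p c d \<kappa> where "v = [t, p, c, d, 2, \<kappa>, 0, 0]" "t < U" "p < U" "c < U" "d < U" "\<kappa> < nK"
  | t p c d where "v = [t, p, c, d, 3, 0, 0, 0]" "t < U" "p < U" "c < U" "d < U"
proof -
  from assms obtain t p c d k \<kappa> j s where v: "v = [t, p, c, d, k, \<kappa>, j, s]" unfolding V_eq by blast
  with assms have "[t, p, c, d, k, \<kappa>, j, s] \<in> V" by simp
  then have b: "t < U" "p < U" "c < U" "d < U" and
    "k = 0 \<and> \<kappa> \<le> nK \<and> j < nJ \<and> s \<le> 1 \<or> k = 1 \<and> \<kappa> < nK \<and> j < nJ \<and> s \<le> 1 \<or> k = 2 \<and> \<kappa> < nK \<and> j = 0 \<and> s = 0 \<or>
    k = 3 \<and> \<kappa> = 0 \<and> j = 0 \<and> s = 0" unfolding V_iff by blast+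
  from this(5) show ?thesis
  proof (elim disjE conjE)
    assume "k = 0" "\<kappa> \<le> nK" "j < nJ" "s \<le> 1"
    then show ?thesis using that(1) v b by blast
  next
    assume "k = 1" "\<kappa> < nK" "j < nJ" "s \<le> 1"
    then show ?thesis using that(2) v b by blast
  next
    assume "k = 2" "\<kappa> < nK" "j = 0" "s = 0"
    then show ?thesis using that(3) v b by blast
  next
    assume "k = 3" "\<kappa> = 0" "j = 0" "s = 0"
    then show ?thesis using that(4) v b by blast
  qed
qed

abbreviation E :: "nat \<Rightarrow> nat list \<Rightarrow> nat list \<Rightarrow> bool" where
  "E \<equiv> sat_arc U nK mem"

abbreviation Z :: "nat \<Rightarrow> nat list \<Rightarrow> bool" where
  "Z \<equiv> sat_root"

abbreviation satisfiable :: bool where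
  "satisfiable \<equiv> cnf_satisfiable U nK nJ mem"

lemmas E_def = sat_arc_def and Z_def = sat_root_def and satisfiable_def = cnf_satisfiable_def

text \<open>Position of a vertex in the chain of its literal.\<close>

definition pos :: "nat \<Rightarrow> nat \<Rightarrow> nat \<Rightarrow> nat \<Rightarrow> nat" where
  "pos t p k \<kappa> = (t * U + p) * (2 * nK + 1) + (2 * \<kappa> + k)"

text \<open>\<open>pos\<close> is a mixed-radix numeral with digits \<open>t\<close>,
  \<open>p\<close> and \<open>2 * \<kappa> + k\<close>; the last digit is at most
  \<open>2 * nK\<close>, attained at the end of a segment.\<close>

lemma pos_inj:
  assumes "pos t p k \<kappa> = pos t' p' k' \<kappa>'" "p < U" "p' < U" "2 * \<kappa> + k \<le> 2 * nK" "2 * \<kappa>' + k' \<le> 2 * nK" "k \<le> 1" "k' \<le> 1"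
  shows "t = t' \<and> p = p' \<and> k = k' \<and> \<kappa> = \<kappa>'"
proof -
  have mix: "a = a' \<and> r = r'" if "a * N + r = a' * N + r'" "r < N" "r' < N" for a a' r r' N :: nat
    using that by (metis div_less div_mult_self3 less_nat_zero_code mod_less mod_mult_self3 add_0_right)
  have "t * U + p = t' * U + p' \<and> 2 * \<kappa> + k = 2 * \<kappa>' + k'"
    by (rule mix[where N = "2 * nK + 1"]) (use assms in \<open>auto simp: pos_def\<close>)
  moreover from this have "t = t' \<and> p = p'" by (intro mix[where N = U]) (use assms in auto)
  ultimately show ?thesis using assms(6,7) by presburger
qed

lemma pos_Suc:
  "pos t p 1 \<kappa> = Suc (pos t p 0 \<kappa>)" "pos t p 0 (Suc \<kappa>) = Suc (pos t p 1 \<kappa>)"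
  "pos t (Suc p) 0 0 = Suc (pos t p 0 nK)" "Suc p = U \<Longrightarrow> pos (Suc t) 0 0 0 = Suc (pos t p 0 nK)"
  by (auto simp: pos_def algebra_simps)

lemma pos_max:
  assumes "t < U" "p < U" "2 * \<kappa> + k \<le> 2 * nK" "Suc t' = U" "Suc p' = U"
  shows "pos t p k \<kappa> \<le> pos t' p' 0 nK"
proof -
  have "t * U + p \<le> t' * U + p'" using assms by (intro add_mono mult_le_mono1) auto
  then have "(t * U + p) * (2 * nK + 1) \<le> (t' * U + p') * (2 * nK + 1)" by (rule mult_le_mono1)
  then show ?thesis unfolding pos_def using assms(3) by linarith
qed

text \<open>Induction along the chain. The only possible gaps are the arcs from sources to
  occurrences, and assumption \<open>o\<close> provides either this arc or another access to the
  occurrence.\<close>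

lemma chain_reached:
  assumes A: "\<And>u v. arc3 U nK u v \<Longrightarrow> u \<in> V \<Longrightarrow> v \<in> V \<Longrightarrow> u ! 4 \<noteq> 0 \<or> v ! 4 \<noteq> 1 \<Longrightarrow> (u, v) \<in> A"
    and o: "\<And>t p \<kappa>. t < U \<Longrightarrow> p < U \<Longrightarrow> \<kappa> < nK \<Longrightarrow>
      ([t, p, c, d, 0, \<kappa>, j, s], [t, p, c, d, 1, \<kappa>, j, s]) \<in> A \<or> reach A (Z 3) [t, p, c, d, 1, \<kappa>, j, s]"
    and v: "[t, p, c, d, k, \<kappa>, j, s] \<in> V" "k \<le> 1"
  shows "reach A (Z 3) [t, p, c, d, k, \<kappa>, j, s]"
  using v
proof (induction "pos t p k \<kappa>" arbitrary: t p k \<kappa> rule: less_induct)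
  case less
  have b: "t < U" "p < U" "c < U" "d < U" "j < nJ" "s \<le> 1" using less.prems V_iff by auto
  show ?case
  proof (cases "k = 1")
    case True
    then have \<kappa>: "\<kappa> < nK" using less.prems V_iff by auto
    have "reach A (Z 3) [t, p, c, d, 0, \<kappa>, j, s]"
      using less.hyps[of t p 0 \<kappa>] \<kappa> b True by (simp add: pos_Suc V_iff)
    then show ?thesis using o[OF b(1,2) \<kappa>] True by (auto intro: reach_step)
  next
    case False
    then have k: "k = 0" "\<kappa> \<le> nK" using less.prems V_iff by auto
    show ?thesis
    proof (cases \<kappa>)
      case (Suc \<kappa>')
      then have "reach A (Z 3) [t, p, c, d, 1, \<kappa>', j, s]"
        using less.hyps[of t p 1 \<kappa>'] b k by (simp add: pos_Suc V_iff)
      moreover have "([t, p, c, d, 1, \<kappa>', j, s], [t, p, c, d, 0, \<kappa>, j, s]) \<in> A"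
        using Suc k b by (intro A) (auto simp: V_iff intro: arc3.intros)
      ultimately show ?thesis using k by (auto intro: reach_step)
    next
      case 0
      show ?thesis
      proof (cases p)
        case (Suc p')
        then have "reach A (Z 3) [t, p', c, d, 0, nK, j, s]"
          using less.hyps[of t p' 0 nK] b k 0 by (simp add: pos_Suc V_iff)
        moreover have "([t, p', c, d, 0, nK, j, s], [t, p, c, d, 0, \<kappa>, j, s]) \<in> A"
          using Suc 0 b by (intro A) (auto simp: V_iff intro: arc3.intros)
        ultimately show ?thesis using k by (auto intro: reach_step)
      next
        case p: 0
        show ?thesis
        proof (cases t)
          case (Suc t')
          obtain q where q: "Suc q = U" using U by (metis gr0_implies_Suc)
          then have "reach A (Z 3) [t', q, c, d, 0, nK, j, s]"
            using less.hyps[of t' q 0 nK] b k 0 Suc p by (simp add: pos_Suc V_iff)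
          moreover have "([t', q, c, d, 0, nK, j, s], [t, p, c, d, 0, \<kappa>, j, s]) \<in> A"
            using Suc 0 b p q by (intro A) (auto simp: V_iff intro: arc3.intros)
          ultimately show ?thesis using k by (auto intro: reach_step)
        next
          case t: 0
          have "([0, 0, 0, 0, 3, 0, 0, 0], [t, p, c, d, 0, \<kappa>, j, s]) \<in> A"
            unfolding t p 0 using b U by (intro A arc3.begin_chain) (auto simp: V_iff)
          moreover have "reach A (Z 3) [0, 0, 0, 0, 3, 0, 0, 0]" by (rule reach_root) (simp add: Z_def)
          ultimately show ?thesis using k by (auto intro: reach_step)
        qed
      qed
    qed
  qed
qed

text \<open>Shared arcs of true literals go to the first layer and those of false literals to the
  second. So a clause is entered through a true literal. The chain of a false literal is complete,
  and from its end all occurrences of the complementary true literal are accessible, which closes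
  the gaps in the chain of the latter.\<close>

lemma satisfiable_imp_layers:
  assumes satisfiable
  shows "\<exists>A1 A3. A1 \<subseteq> {(u, v). u \<in> V \<and> v \<in> V \<and> E 1 u v} \<and> A3 \<subseteq> {(u, v). u \<in> V \<and> v \<in> V \<and> E 3 u v} \<and>
    A1 \<inter> A3 = {} \<and> (\<forall>v \<in> V. reach A1 (Z 1) v \<and> reach A3 (Z 3) v)"
proof -
  from assms obtain \<alpha> where \<alpha>: "\<And>\<kappa> t p. \<kappa> < nK \<Longrightarrow> t < U \<Longrightarrow> p < U \<Longrightarrow> \<exists>j < nJ. \<exists>s \<le> 1. \<exists>c < U. \<exists>d < U.
     mem \<kappa> j s t p c d \<and> (\<alpha> j c d \<longleftrightarrow> s = 1)" unfolding satisfiable_def by blast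
  define tr where "tr u \<longleftrightarrow> (\<alpha> (u ! 6) (u ! 2) (u ! 3) \<longleftrightarrow> u ! 7 = 1)" for u :: "nat list"
  \<comment> \<open>Equality of the clause kinds tells the shared arcs apart from the arcs of
    \<open>complement\<close>, which also lead from a source to an occurrence but start at kind
    \<open>nK\<close>.\<close>
  define sh where "sh u v \<longleftrightarrow> u ! 4 = 0 \<and> v ! 4 = 1 \<and> u ! 5 = v ! 5" for u v :: "nat list"
  define A1 where "A1 = {(u, v). u \<in> V \<and> v \<in> V \<and> E 1 u v \<and> (sh u v \<longrightarrow> tr u)}"
  define A3 where "A3 = {(u, v). u \<in> V \<and> v \<in> V \<and> E 3 u v \<and> (sh u v \<longrightarrow> \<not> tr u)}"
  have "\<not> E 3 u v \<or> sh u v" if "E 1 u v" "u \<in> V" "v \<in> V" for u v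
  proof -
    from that(1) have "arc1 mem u v" by (simp add: E_def)
    then show ?thesis
    proof cases
      case from_hub
      then show ?thesis by (simp add: E_def arc3_iff)
    qed (simp_all add: E_def sh_def arc3_iff)
  qed
  then have disj: "A1 \<inter> A3 = {}" unfolding A1_def A3_def by blast
  have hub: "reach A1 (Z 1) [t, p, c', d', 2, \<kappa>, 0, 0]" if b: "\<kappa> < nK" "t < U" "p < U" "c' < U" "d' < U" for \<kappa> t p c' d'
  proof -
    obtain j s c d where m: "j < nJ" "s \<le> 1" "c < U" "d < U" "mem \<kappa> j s t p c d" "\<alpha> j c d \<longleftrightarrow> s = 1"
      using \<alpha>[OF b(1-3)] by blast
    have "reach A1 (Z 1) [t, p, c, d, 0, \<kappa>, j, s]" by (rule reach_root) (simp add: Z_def)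
    moreover have "([t, p, c, d, 0, \<kappa>, j, s], [t, p, c, d, 1, \<kappa>, j, s]) \<in> A1"
      using m b by (auto simp: A1_def E_def V_iff tr_def intro: arc1.intros)
    moreover have "([t, p, c, d, 1, \<kappa>, j, s], [t, p, c', d', 2, \<kappa>, 0, 0]) \<in> A1"
      using m b by (auto simp: A1_def E_def V_iff sh_def intro: arc1.intros)
    ultimately show ?thesis using reach_step by metis
  qed
  have r1: "reach A1 (Z 1) v" if "v \<in> V" for v
    using that
  proof (cases rule: V_cases)
    case (2 t p c d \<kappa> j s)
    \<comment> \<open>Occurrences whose own arc belongs to the other layer are reached back from a
      hub of the clause.\<close>
    have "([t, p, 0, 0, 2, \<kappa>, 0, 0], v) \<in> A1"
      using 2 U by (auto simp: A1_def E_def V_iff sh_def intro: arc1.intros)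
    then show ?thesis using hub[of \<kappa> t p 0 0] 2 U by (auto intro: reach_step)
  next
    case (3 t p c d \<kappa>)
    then show ?thesis using hub by auto
  qed (auto intro!: reach_root simp: Z_def)
  have A: "(u, v) \<in> A3" if "arc3 U nK u v" "u \<in> V" "v \<in> V" "u ! 4 \<noteq> 0 \<or> v ! 4 \<noteq> 1" for u v
    using that by (auto simp: A3_def E_def sh_def)
  have false: "reach A3 (Z 3) [t, p, c, d, k, \<kappa>, j, s]"
    if "[t, p, c, d, k, \<kappa>, j, s] \<in> V" "k \<le> 1" "(\<alpha> j c d) \<noteq> (s = 1)" for t p c d k \<kappa> j s
  proof (rule chain_reached[OF A _ that(1,2)])
    fix t p \<kappa> assume "t < U" "p < U" "\<kappa> < nK"
    moreover have "c < U" "d < U" "j < nJ" "s \<le> 1" using that(1,2) V_iff by auto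
    ultimately have "([t, p, c, d, 0, \<kappa>, j, s], [t, p, c, d, 1, \<kappa>, j, s]) \<in> A3"
      using that(3) by (auto simp: A3_def E_def V_iff tr_def intro: arc3.intros)
    then show "([t, p, c, d, 0, \<kappa>, j, s], [t, p, c, d, 1, \<kappa>, j, s]) \<in> A3 \<or> reach A3 (Z 3) [t, p, c, d, 1, \<kappa>, j, s]" ..
  qed
  have chain: "reach A3 (Z 3) [t, p, c, d, k, \<kappa>, j, s]" if v: "[t, p, c, d, k, \<kappa>, j, s] \<in> V" "k \<le> 1" for t p c d k \<kappa> j s
  proof (cases "\<alpha> j c d \<longleftrightarrow> s = 1")
    case True
    show ?thesis
    proof (rule chain_reached[OF A _ v])
      fix t p \<kappa> assume *: "t < U" "p < U" "\<kappa> < nK"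
      obtain q where q: "Suc q = U" using U by (metis gr0_implies_Suc)
      have b: "c < U" "d < U" "j < nJ" "s \<le> 1" using v V_iff by auto
      then have s: "1 - s = 1 \<longleftrightarrow> s \<noteq> 1" "s = 1 - (1 - s)" by auto
      have q': "[q, q, c, d, 0, nK, j, 1 - s] \<in> V" using b q by (auto simp: V_iff)
      moreover have "\<alpha> j c d \<noteq> (1 - s = 1)" using True s by auto
      ultimately have "reach A3 (Z 3) [q, q, c, d, 0, nK, j, 1 - s]" by (intro false) auto
      moreover have "([q, q, c, d, 0, nK, j, 1 - s], [t, p, c, d, 1, \<kappa>, j, s]) \<in> A3"
        using q' q * b s(2) by (auto simp: A3_def E_def V_iff sh_def intro!: arc3.complement)
      ultimately show "([t, p, c, d, 0, \<kappa>, j, s], [t, p, c, d, 1, \<kappa>, j, s]) \<in> A3 \<or> reach A3 (Z 3) [t, p, c, d, 1, \<kappa>, j, s]"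
        by (blast intro: reach_step)
    qed
  next
    case False
    then show ?thesis using false v by blast
  qed
  have r3: "reach A3 (Z 3) v" if "v \<in> V" for v
    using that
  proof (cases rule: V_cases)
    case (1 t p c d \<kappa> j s)
    then show ?thesis using chain that by auto
  next
    case (2 t p c d \<kappa> j s)
    then show ?thesis using chain that by auto
  qed (auto intro!: reach_root simp: Z_def)
  show ?thesis
    using disj r1 r3 by (intro exI[of _ A1] exI[of _ A3]) (auto simp: A1_def A3_def)
qed

text \<open>Every clause must be entered through a shared arc of one of its literals, which is then
  missing in the second layer. By the cut argument this never happens to both literals of a
  variable.\<close>

lemma layers_imp_satisfiable:
  assumes A1: "A1 \<subseteq> {(u, v). u \<in> V \<and> v \<in> V \<and> E 1 u v}" and A3: "A3 \<subseteq> {(u, v). u \<in> V \<and> v \<in> V \<and> E 3 u v}"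
    and disj: "A1 \<inter> A3 = {}" and r1: "\<And>v. v \<in> V \<Longrightarrow> reach A1 (Z 1) v" and r3: "\<And>v. v \<in> V \<Longrightarrow> reach A3 (Z 3) v"
  shows satisfiable
proof -
  define cut where "cut j s c d t p \<kappa> \<longleftrightarrow> mem \<kappa> j s t p c d \<and> ([t, p, c, d, 0, \<kappa>, j, s], [t, p, c, d, 1, \<kappa>, j, s]) \<in> A1"
    for j s c d t p \<kappa>
  have cutV: "t < U \<and> p < U \<and> c < U \<and> d < U \<and> \<kappa> < nK \<and> j < nJ \<and> s \<le> 1" if "cut j s c d t p \<kappa>" for j s c d t p \<kappa>
    using that A1 unfolding cut_def by (auto simp: V_iff)
  have no_both: False if c0: "cut j 0 c d t0 p0 k0" and c1: "cut j 1 c d t1 p1 k1" for j c d t0 p0 k0 t1 p1 k1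
  proof -
    define tt pp kk where "tt s = (if s = 0 then t0 else t1)" and "pp s = (if s = 0 then p0 else p1)"
      and "kk s = (if s = 0 then k0 else k1)" for s :: nat
    have cut: "cut j s c d (tt s) (pp s) (kk s)" if "s \<le> 1" for s
    proof -
      from that consider "s = 0" | "s = 1" by linarith
      then show ?thesis using c0 c1 by cases (simp_all add: tt_def pp_def kk_def)
    qed
    define I where "I s = pos (tt s) (pp s) 1 (kk s)" for s
    \<comment> \<open>The parts of both chains from the occurrence behind the respective gap
      onwards.\<close>
    define Y where "Y = {[t, p, c, d, k, \<kappa>, j, s] | t p k \<kappa> s. [t, p, c, d, k, \<kappa>, j, s] \<in> V \<and> k \<le> 1 \<and> I s \<le> pos t p k \<kappa>}"
    have Yi: "[t, p, c, d, k, \<kappa>, j, s] \<in> Y \<longleftrightarrow> [t, p, c, d, k, \<kappa>, j, s] \<in> V \<and> k \<le> 1 \<and> I s \<le> pos t p k \<kappa>" for t p k \<kappa> s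
      unfolding Y_def by auto
    have YZ: "\<not> Z 3 u" if "u \<in> Y" for u using that by (auto simp: Y_def Z_def)
    let ?v = "[tt 0, pp 0, c, d, 1, kk 0, j, 0]"
    have v: "?v \<in> V" "?v \<in> Y" using cutV[OF cut[of 0]] by (auto simp: Yi V_iff I_def)
    obtain u u' where u: "(u, u') \<in> A3" "u' \<in> Y" "u \<notin> Y"
      using reach_entered[OF r3[OF v(1)] v(2) YZ] by blast
    have uV: "u \<in> V" "u' \<in> V" "arc3 U nK u u'" using u(1) A3 by (auto simp: E_def)
    from u(2) obtain t p k \<kappa> s where u': "u' = [t, p, c, d, k, \<kappa>, j, s]" "k \<le> 1" "I s \<le> pos t p k \<kappa>"
      unfolding Y_def by blast
    have b: "t < U" "p < U" "s \<le> 1" "2 * \<kappa> + k \<le> 2 * nK" using uV(2) u'(2) unfolding u'(1) V_iff by auto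
    have cb: "pp s < U" "kk s < nK" "tt s < U" using cutV[OF cut[OF b(3)]] by auto
    \<comment> \<open>A gap lies directly before an occurrence, whereas the arcs between segments
      and kinds end in sources. So such an arc cannot be the one across the gap.\<close>
    have ne: "I s \<noteq> pos t p 0 \<kappa>'" if "\<kappa>' \<le> nK" for \<kappa>'
      using pos_inj[of "tt s" "pp s" 1 "kk s" t p 0 \<kappa>'] that b cb by (auto simp: I_def)
    have step: "u \<in> Y" if "u = [t', p', c, d, k', \<kappa>', j, s]" "pos t p k \<kappa> = Suc (pos t' p' k' \<kappa>')" "I s \<noteq> pos t p k \<kappa>" "k' \<le> 1"
      for t' p' k' \<kappa>' using that u'(3) uV(1) by (auto simp: Yi)
    from uV(3) show False
    proof (cases rule: arc3.cases)
      case (chain \<kappa>' t' p' c' d' j' s')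
      show False
      proof (cases "I s = pos t p k \<kappa>")
        case True
        then have "tt s = t \<and> pp s = p \<and> 1 = k \<and> kk s = \<kappa>"
          unfolding I_def by (rule pos_inj) (use b cb chain u' in auto)
        then have "(u, u') \<in> A1" using cut[OF b(3)] chain u'(1) by (auto simp: cut_def)
        then show ?thesis using u(1) disj by blast
      next
        case False
        then show ?thesis using step[of t p 0 \<kappa>] chain u' u(3) by (auto simp: pos_Suc)
      qed
    next
      case (next_kind \<kappa>' t' p' c' d' j' s')
      then show False using step[of t p 1 \<kappa>'] u' u(3) ne[of \<kappa>] by (auto simp: pos_Suc)
    next
      case (next_p t' p' c' d' j' s')
      then show False using step[of t p' 0 nK] u' u(3) ne[of \<kappa>] by (auto simp: pos_Suc)
    next
      case (next_t p' t' c' d' j' s')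
      then show False using step[of t' p' 0 nK] u' u(3) ne[of \<kappa>] by (auto simp: pos_Suc)
    next
      case (complement t' p' \<kappa>' s' s'' c' d' j' t'' p'')
      then have "s'' \<le> 1" using uV(1) by (auto simp: V_iff)
      \<comment> \<open>An arc between the chains starts at the end of one of them. As this chain
        has a gap too, its end already belongs to \<open>Y\<close>.\<close>
      then have "I s'' \<le> pos t' p' 0 nK"
        unfolding I_def using cutV[OF cut[of s'']] complement(3,4) by (intro pos_max) auto
      moreover have "u = [t', p', c, d, 0, nK, j, s'']" using complement(1,2) u'(1) by simp
      ultimately have "u \<in> Y" using uV(1) by (simp add: Yi)
      then show False using u(3) by blast
    next
      case (begin_chain t' p' c' d' c'' d'' j' s')
      then have "pos t p k \<kappa> = 0" using u'(1) by (simp add: pos_def)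
      moreover have "0 < I s" by (simp add: I_def pos_def)
      ultimately show False using u'(3) by simp
    qed
  qed
  have clause: "\<exists>j s c d. cut j s c d t p \<kappa>" if b: "\<kappa> < nK" "t < U" "p < U" for \<kappa> t p
  proof -
    \<comment> \<open>The occurrences and hubs of one clause; arcs to and from hubs stay inside, so
      only an arc from a source enters.\<close>
    define Y where "Y = {v \<in> V. v ! 0 = t \<and> v ! 1 = p \<and> v ! 5 = \<kappa> \<and> v ! 4 \<in> {1, 2}}"
    let ?v = "[t, p, 0, 0, 2, \<kappa>, 0, 0]"
    have v: "?v \<in> V" "?v \<in> Y" using b U by (auto simp: V_iff Y_def)
    have YZ: "\<not> Z 1 u" if "u \<in> Y" for u using that by (auto simp: Y_def Z_def)
    obtain u u' where u: "(u, u') \<in> A1" "u' \<in> Y" "u \<notin> Y"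
      using reach_entered[OF r1[OF v(1)] v(2) YZ] by blast
    have uV: "u \<in> V" "u' \<in> V" "arc1 mem u u'" using u(1) A1 by (auto simp: E_def)
    from uV(3) show ?thesis
    proof (cases rule: arc1.cases)
      case (use_literal \<kappa>' j s t' p' c d)
      then have "cut j s c d t p \<kappa>" using u(1,2) by (auto simp: cut_def Y_def)
      then show ?thesis by blast
    qed (use u(2,3) uV(1) in \<open>auto simp: Y_def\<close>)
  qed
  \<comment> \<open>A variable is true if its positive literal is cut somewhere; then
    \<open>no_both\<close> makes every cut literal true.\<close>
  define \<alpha> where "\<alpha> j c d \<longleftrightarrow> (\<exists>t p \<kappa>. cut j 1 c d t p \<kappa>)" for j c d
  show ?thesis unfolding satisfiable_def
  proof (intro exI[of _ \<alpha>] allI impI)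
    fix \<kappa> t p assume b: "\<kappa> < nK" "t < U" "p < U"
    then obtain j s c d where c: "cut j s c d t p \<kappa>" using clause by blast
    have "s = 0 \<or> s = 1" using cutV[OF c] by auto
    then have "\<alpha> j c d \<longleftrightarrow> s = 1" using no_both c unfolding \<alpha>_def by fastforce
    then show "\<exists>j < nJ. \<exists>s \<le> 1. \<exists>c < U. \<exists>d < U. mem \<kappa> j s t p c d \<and> (\<alpha> j c d \<longleftrightarrow> s = 1)"
      using cutV[OF c] c unfolding cut_def by blast
  qed
qed

theorem instance_iff_satisfiable:
  assumes "k \<ge> 2"
  shows "instance_string k (verts_of (sat_tags nK nJ) 4 U) E Z \<in> disjoint_branchings_problem k \<longleftrightarrow> satisfiable"
    "instance_string k (verts_of (sat_tags nK nJ) 4 U) E Z \<in> disjoint_branchings_problem_lifetime k 3 \<longleftrightarrow> satisfiable"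
proof -
  have P: "satisfiable \<longleftrightarrow> (\<exists>A1 A3. A1 \<subseteq> {(u, v). u \<in> V \<and> v \<in> V \<and> E 1 u v} \<and> A3 \<subseteq> {(u, v). u \<in> V \<and> v \<in> V \<and> E 3 u v} \<and>
    A1 \<inter> A3 = {} \<and> (\<forall>v \<in> V. reach A1 (Z 1) v \<and> reach A3 (Z 3) v))"
    using satisfiable_imp_layers layers_imp_satisfiable by blast
  have "[0, 0, 0, 0, 3, 0, 0, 0] \<in> V" using U by (simp add: V_iff)
  then have ne: "verts_of (sat_tags nK nJ) 4 U \<noteq> []" unfolding V_def by auto
  note * = instance_string_correct[OF distinct_verts_of[OF distinct_sat_tags] ne assms P[unfolded V_def]]
  show "instance_string k (verts_of (sat_tags nK nJ) 4 U) E Z \<in> disjoint_branchings_problem k \<longleftrightarrow> satisfiable"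
    "instance_string k (verts_of (sat_tags nK nJ) 4 U) E Z \<in> disjoint_branchings_problem_lifetime k 3 \<longleftrightarrow> satisfiable"
    by (fact *)+
qed

end

theorem cnf_satisfiable_reducible:
  assumes mem: "\<And>\<kappa> j s d t p c c'. \<kappa> < nK \<Longrightarrow> j < nJ \<Longrightarrow> s \<le> 1 \<Longrightarrow> tm_at d t \<Longrightarrow> tm_at d p \<Longrightarrow> tm_at d c \<Longrightarrow> tm_at d c' \<Longrightarrow>
      FO d (\<lambda>w \<rho> e. mem w \<kappa> j s (t e) (p e) (c e) (c' e))"
    and L: "\<And>x. x \<in> L \<longleftrightarrow> cnf_satisfiable (length (W x)) nK nJ (mem (W x))"
    and W: "\<And>x. W x = word ((length x + c0) ^ (d0 + 1)) x" and k: "k \<ge> 2"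
  shows "polytime_reducible L (disjoint_branchings_problem k)" "polytime_reducible L (disjoint_branchings_problem_lifetime k 3)"
proof -
  let ?E = "\<lambda>w. sat_arc (length w) nK (mem w)"
  let ?tags = "sat_tags nK nJ"
  let ?F = "\<lambda>w. instance_string k (verts_of ?tags 4 (length w)) (?E w) sat_root"
  have g: "sat_graph (length (word Z x))" for Z x by unfold_locales simp
  have len8: "length e = 4 + 4 \<Longrightarrow> \<exists>a b c d a' b' c' d'. e = [a, b, c, d, a', b', c', d']" for e :: "nat list"
    by (auto simp: numeral_eq_Suc length_Suc_conv)
  have nth: "tm_at (4 + 4) (\<lambda>e. e ! i)" if "i < 8" for i using that by (intro tm_nth) simp
  have "GEN 0 (\<lambda>w e. ?F w)"
  proof (rule GEN_instance_string[where n = 4])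
    fix l :: nat and g g' assume l: "l \<in> {1, 3}" and gg: "g \<in> set ?tags" "g' \<in> set ?tags"
    obtain k1 \<kappa> j s where ge: "g = [k1, \<kappa>, j, s]" using gg(1) by (auto simp: set_sat_tags)
    obtain k2 \<kappa>' j' s' where ge': "g' = [k2, \<kappa>', j', s']" using gg(2) by (auto simp: set_sat_tags)
    have b: "k2 = 1 \<Longrightarrow> \<kappa>' < nK \<and> j' < nJ \<and> s' \<le> 1" using gg(2) ge' by (auto simp: set_sat_tags)
    \<comment> \<open>Definability of \<open>mem\<close> is assumed for proper indices only, and
      these are guaranteed by the tag of an occurrence vertex; the other tags make the condition
      false.\<close>
    have m: "FO (4 + 4) (\<lambda>w \<rho> e. k2 = 1 \<and> mem w \<kappa>' j' s' (e ! 0) (e ! 1) (e ! 2) (e ! 3))"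
    proof (cases "k2 = 1")
      case True
      then show ?thesis using b by (intro FO_and FO_const mem nth) auto
    next
      case False
      then show ?thesis using FO_const[of "4 + 4" False] by simp
    qed
    have eqs: "FO (4 + 4) (\<lambda>w \<rho> e. e ! i = e ! i')" if "i < 8" "i' < 8" for i i' using that by (intro FO_eq nth)
    have Sucs: "FO (4 + 4) (\<lambda>w \<rho> e. e ! i = Suc (e ! i'))" if "i < 8" "i' < 8" for i i'
      using that by (intro FO_Suc nth)
    have zeros: "FO (4 + 4) (\<lambda>w \<rho> e. e ! i = 0)" if "i < 8" for i using that by (intro FO_zero nth)
    have last: "FO (4 + 4) (\<lambda>w \<rho> e. Suc (e ! i) = length w)" if "i < 8" for i
    proof (rule FO_cong)
      show "FO (4 + 4) (\<lambda>w \<rho> e. \<forall>x<length w. \<not> e ! i < x)"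
        using that by (intro FO_all FO_not FO_less tm_tl tm_hd nth)
      fix w e :: "nat list" and \<rho> :: "nat \<Rightarrow> nat \<Rightarrow> nat \<Rightarrow> bool"
      assume "length e = 4 + 4" "\<forall>x \<in> set e. x < length w"
      then have "e ! i < length w" using that by auto
      then show "(\<forall>x<length w. \<not> e ! i < x) = (Suc (e ! i) = length w)" by (metis Suc_lessI lessI less_trans_Suc not_less_eq)
    qed
    have split: "drop 4 e = [e ! 4, e ! 5, e ! 6, e ! 7]" "take 4 e = [e ! 0, e ! 1, e ! 2, e ! 3]" if "length e = 4 + 4" for e :: "nat list"
      using len8[OF that] by auto
    have "FO (4 + 4) (\<lambda>w \<rho> e. arc1 (mem w) [e ! 4, e ! 5, e ! 6, e ! 7, k1, \<kappa>, j, s] [e ! 0, e ! 1, e ! 2, e ! 3, k2, \<kappa>', j', s'])"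
      unfolding arc1_iff by (intro FO_or FO_and FO_const eqs m) simp_all
    then have 1: "FO (4 + 4) (\<lambda>w \<rho> e. arc1 (mem w) (drop 4 e @ g) (take 4 e @ g'))"
      by (rule FO_cong) (simp add: split ge ge')
    have "FO (4 + 4) (\<lambda>w \<rho> e. arc3 (length w) nK [e ! 4, e ! 5, e ! 6, e ! 7, k1, \<kappa>, j, s] [e ! 0, e ! 1, e ! 2, e ! 3, k2, \<kappa>', j', s'])"
      unfolding arc3_iff by (intro FO_or FO_and FO_const eqs Sucs zeros last) simp_all
    then have 3: "FO (4 + 4) (\<lambda>w \<rho> e. arc3 (length w) nK (drop 4 e @ g) (take 4 e @ g'))"
      by (rule FO_cong) (simp add: split ge ge')
    show "FO (4 + 4) (\<lambda>w \<rho> e. ?E w l (drop 4 e @ g) (take 4 e @ g'))"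
    proof (cases "l = 1")
      case True
      show ?thesis using 1 by (rule FO_cong) (simp add: True sat_arc_def)
    next
      case False
      show ?thesis using 3 by (rule FO_cong) (simp add: False sat_arc_def)
    qed
  next
    fix l :: nat and e g :: "nat list"
    assume "length e = 4"
    then show "sat_root l (e @ g) = (\<lambda>l g. g ! 0 \<in> (if l = 1 then {0, 3} else {2, 3})) l g"
      by (simp add: sat_root_def nth_append)
  qed
  from GEN_polytime[OF this]
  have "polytime_computable (\<lambda>x. ?F (word ((length x + c0) ^ (d0 + 1)) x))" .
  moreover have "x \<in> L \<longleftrightarrow> ?F (word ((length x + c0) ^ (d0 + 1)) x) \<in> disjoint_branchings_problem k"
    "x \<in> L \<longleftrightarrow> ?F (word ((length x + c0) ^ (d0 + 1)) x) \<in> disjoint_branchings_problem_lifetime k 3" for x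
    unfolding L W using sat_graph.instance_iff_satisfiable[OF g k] by blast+
  ultimately show "polytime_reducible L (disjoint_branchings_problem k)" "polytime_reducible L (disjoint_branchings_problem_lifetime k 3)"
    unfolding polytime_reducible_def by blast+
qed

section \<open>Reducing computations to satisfiability\<close>

text \<open>Bounds of this shape can be written down in unary by repeated multiplication, which
  \<open>powers\<close> does.\<close>

lemma poly_le_power: "\<exists>c d. c \<ge> 1 \<and> (\<forall>n. poly (p :: nat poly) n \<le> (n + c) ^ d)"
proof (induction p)
  case 0
  show ?case by (intro exI[of _ 1]) simp
next
  case (pCons a p)
  then obtain c d where cd: "c \<ge> 1" "\<And>n. poly p n \<le> (n + c) ^ d" by blast
  have "poly (pCons a p) n \<le> (n + (c + a)) ^ Suc d" for n
  proof -
    have "(n + c) ^ d \<ge> 1" using cd(1) by simp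
    have "poly (pCons a p) n \<le> a + n * (n + c) ^ d" using cd(2) by simp
    also have "\<dots> \<le> a * (n + c) ^ d + n * (n + c) ^ d"
      using \<open>(n + c) ^ d \<ge> 1\<close> by simp
    also have "\<dots> = (n + a) * (n + c) ^ d" by (simp add: algebra_simps)
    also have "\<dots> \<le> (n + (c + a)) * (n + (c + a)) ^ d" by (intro mult_le_mono power_mono) auto
    finally show ?thesis by simp
  qed
  then show ?case using cd(1) by (intro exI[of _ "c + a"] exI[of _ "Suc d"]) simp
qed

subsection \<open>Formulas from clause schemes\<close>

text \<open>A scheme consists of a condition on the two positions of the clause and a list of literals. The first
  position of a literal is that of the clause or its successor; the second is the centre of the word or the second
  position of the clause, moved by at most one.\<close>

type_synonym 'v literal = "'v \<times> nat \<times> nat \<times> bool \<times> move"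
type_synonym 'v scheme = "(nat list \<Rightarrow> nat \<Rightarrow> nat \<Rightarrow> bool) \<times> 'v literal list"

definition centre :: "nat list \<Rightarrow> nat \<Rightarrow> bool" where
  "centre w q \<longleftrightarrow> w ! q \<in> {4, 5, 6}"

definition moved :: "move \<Rightarrow> nat \<Rightarrow> nat \<Rightarrow> bool" where
  "moved m q d \<longleftrightarrow> (case m of MLeft \<Rightarrow> q = Suc d | MStay \<Rightarrow> d = q | MRight \<Rightarrow> d = Suc q)"

lemma moved_iff: "moved m q d \<longleftrightarrow> int d = int q + displacement m"
  by (cases m) (auto simp: moved_def)

definition placed :: "nat list \<Rightarrow> 'v literal \<Rightarrow> nat \<Rightarrow> nat \<Rightarrow> nat \<Rightarrow> nat \<Rightarrow> bool" where
  "placed w l t p c d \<longleftrightarrow> (case l of (v, s, dt, b, m) \<Rightarrow>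
     c = (if dt = 0 then t else Suc t) \<and> (\<exists>q<length w. (if b then centre w q else q = p) \<and> moved m q d))"

text \<open>A clause whose condition fails contains all literals and is thus satisfied by any
  assignment. In this way every kind has a clause at every pair of positions.\<close>

definition scheme_mem :: "'v scheme list \<Rightarrow> 'v list \<Rightarrow> nat list \<Rightarrow> nat \<Rightarrow> nat \<Rightarrow> nat \<Rightarrow> nat \<Rightarrow> nat \<Rightarrow> nat \<Rightarrow> nat \<Rightarrow> bool" where
  "scheme_mem cs vs w \<kappa> j s t p c d \<longleftrightarrow> \<not> fst (cs ! \<kappa>) w t p \<or>
     (\<exists>l \<in> set (snd (cs ! \<kappa>)). fst l = vs ! j \<and> fst (snd l) = s \<and> placed w l t p c d)"

lemma FO_centre: "tm_at d t \<Longrightarrow> FO d (\<lambda>w \<rho> e. centre w (t e))"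
  unfolding centre_def by (rule FO_sym)

lemma FO_moved: "tm_at d t \<Longrightarrow> tm_at d u \<Longrightarrow> FO d (\<lambda>w \<rho> e. moved m (t e) (u e))"
  by (cases m) (auto simp: moved_def intro: FO_Suc FO_eq)

lemma FO_placed:
  assumes "tm_at d t" "tm_at d p" "tm_at d c" "tm_at d c'"
  shows "FO d (\<lambda>w \<rho> e. placed w l (t e) (p e) (c e) (c' e))"
proof -
  obtain v s dt b m where l: "l = (v, s, dt, b, m)" by (cases l) auto
  have 1: "FO d (\<lambda>w \<rho> e. c e = (if dt = 0 then t e else Suc (t e)))"
    by (cases "dt = 0") (auto intro: FO_eq FO_Suc assms)
  have 2: "FO (Suc d) (\<lambda>w \<rho> e. if b then centre w (hd e) else hd e = p (tl e))"
  proof (cases b)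
    case True
    then show ?thesis using FO_centre[OF tm_hd] by simp
  next
    case False
    then show ?thesis using FO_eq[OF tm_hd tm_tl[OF assms(2)]] by simp
  qed
  show ?thesis unfolding placed_def l prod.case
    by (intro FO_and 1 FO_ex 2 FO_moved tm_hd tm_tl assms)
qed

lemma FO_scheme_mem:
  assumes "\<And>A ls d t p. (A, ls) \<in> set cs \<Longrightarrow> tm_at d t \<Longrightarrow> tm_at d p \<Longrightarrow> FO d (\<lambda>w \<rho> e. A w (t e) (p e))"
    and "\<kappa> < length cs" and t: "tm_at d t" "tm_at d p" "tm_at d c" "tm_at d c'"
  shows "FO d (\<lambda>w \<rho> e. scheme_mem cs vs w \<kappa> j s (t e) (p e) (c e) (c' e))"
proof -
  have "(fst (cs ! \<kappa>), snd (cs ! \<kappa>)) \<in> set cs" using assms(2) by simp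
  from assms(1)[OF this t(1,2)] show ?thesis
    unfolding scheme_mem_def by (intro FO_or FO_not FO_ex_list FO_and FO_const FO_placed t)
qed

definition scheme_satisfiable :: "'v scheme list \<Rightarrow> nat list \<Rightarrow> bool" where
  "scheme_satisfiable cs w \<longleftrightarrow> (\<exists>\<beta>. \<forall>(A, ls) \<in> set cs. \<forall>t < length w. \<forall>p < length w. A w t p \<longrightarrow>
     (\<exists>l \<in> set ls. \<exists>c < length w. \<exists>d < length w. placed w l t p c d \<and> (\<beta> (fst l) c d \<longleftrightarrow> fst (snd l) = 1)))"

lemma scheme_satisfiable_iff:
  assumes vs: "distinct vs" "vs \<noteq> []" and w: "w \<noteq> []"
    and ls: "\<And>A ls l. (A, ls) \<in> set cs \<Longrightarrow> l \<in> set ls \<Longrightarrow> fst l \<in> set vs \<and> fst (snd l) \<le> 1"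
  shows "cnf_satisfiable (length w) (length cs) (length vs) (scheme_mem cs vs w) \<longleftrightarrow> scheme_satisfiable cs w"
proof
  assume "cnf_satisfiable (length w) (length cs) (length vs) (scheme_mem cs vs w)"
  then obtain \<alpha> where \<alpha>: "\<And>\<kappa> t p. \<kappa> < length cs \<Longrightarrow> t < length w \<Longrightarrow> p < length w \<Longrightarrow>
    \<exists>j < length vs. \<exists>s \<le> 1. \<exists>c < length w. \<exists>d < length w. scheme_mem cs vs w \<kappa> j s t p c d \<and> (\<alpha> j c d \<longleftrightarrow> s = 1)"
    unfolding cnf_satisfiable_def by blast
  define ix where "ix v = (SOME j. j < length vs \<and> vs ! j = v)" for v
  have ix: "ix (vs ! j) = j" if "j < length vs" for j
  proof -
    have "ix (vs ! j) < length vs \<and> vs ! ix (vs ! j) = vs ! j"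
      unfolding ix_def by (rule someI[of _ j]) (use that in simp)
    then show ?thesis using nth_eq_iff_index_eq[OF vs(1)] that by blast
  qed
  show "scheme_satisfiable cs w" unfolding scheme_satisfiable_def
  proof (intro exI[of _ "\<lambda>v. \<alpha> (ix v)"] ballI, clarify)
    fix A ls t p assume c: "(A, ls) \<in> set cs" "t < length w" "p < length w" "A w t p"
    then obtain \<kappa> where \<kappa>: "\<kappa> < length cs" "cs ! \<kappa> = (A, ls)" by (metis in_set_conv_nth)
    from \<alpha>[OF \<kappa>(1) c(2,3)] obtain j s c1 d1 where j: "j < length vs" "c1 < length w" "d1 < length w"
      "scheme_mem cs vs w \<kappa> j s t p c1 d1" "\<alpha> j c1 d1 \<longleftrightarrow> s = 1" by blast
    from j(4) c(4) obtain l where l: "l \<in> set ls" "fst l = vs ! j" "fst (snd l) = s" "placed w l t p c1 d1"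
      unfolding scheme_mem_def \<kappa>(2) by auto
    then show "\<exists>l \<in> set ls. \<exists>c < length w. \<exists>d < length w. placed w l t p c d \<and> (\<alpha> (ix (fst l)) c d \<longleftrightarrow> fst (snd l) = 1)"
      using j(2,3,5) l ix[OF j(1)] by (intro bexI[of _ l] exI[of _ c1] conjI exI[of _ d1]) simp_all
  qed
next
  assume "scheme_satisfiable cs w"
  then obtain \<beta> where *: "\<forall>(A, ls) \<in> set cs. \<forall>t < length w. \<forall>p < length w. A w t p \<longrightarrow>
     (\<exists>l \<in> set ls. \<exists>c < length w. \<exists>d < length w. placed w l t p c d \<and> (\<beta> (fst l) c d \<longleftrightarrow> fst (snd l) = 1))"
    unfolding scheme_satisfiable_def by (rule exE)
  have \<beta>: "\<exists>l \<in> set ls. \<exists>c < length w. \<exists>d < length w. placed w l t p c d \<and> (\<beta> (fst l) c d \<longleftrightarrow> fst (snd l) = 1)"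
    if "(A, ls) \<in> set cs" "t < length w" "p < length w" "A w t p" for A ls t p
    using bspec[OF * that(1)] that(2-) by simp
  show "cnf_satisfiable (length w) (length cs) (length vs) (scheme_mem cs vs w)" unfolding cnf_satisfiable_def
  proof (intro exI[of _ "\<lambda>j. \<beta> (vs ! j)"] allI impI)
    fix \<kappa> t p assume b: "\<kappa> < length cs" "t < length w" "p < length w"
    let ?A = "fst (cs ! \<kappa>)" and ?ls = "snd (cs ! \<kappa>)"
    have in_cs: "(?A, ?ls) \<in> set cs" using b(1) by simp
    show "\<exists>j < length vs. \<exists>s \<le> 1. \<exists>c < length w. \<exists>d < length w. scheme_mem cs vs w \<kappa> j s t p c d \<and> (\<beta> (vs ! j) c d \<longleftrightarrow> s = 1)"
    proof (cases "?A w t p")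
      case True
      then obtain l c d where l: "l \<in> set ?ls" "c < length w" "d < length w" "placed w l t p c d"
        "\<beta> (fst l) c d \<longleftrightarrow> fst (snd l) = 1" using \<beta>[OF in_cs b(2,3)] by blast
      obtain j where "j < length vs" "vs ! j = fst l" using ls[OF in_cs l(1)] by (metis in_set_conv_nth)
      then show ?thesis using l ls[OF in_cs l(1)] unfolding scheme_mem_def
        by (intro exI[of _ j] exI[of _ "fst (snd l)"] exI[of _ c] exI[of _ d] conjI) auto
    next
      case False
      then have m: "scheme_mem cs vs w \<kappa> j s t p c d" for j s c d by (simp add: scheme_mem_def)
      have "\<exists>s \<le> (1::nat). X \<longleftrightarrow> s = 1" for X by (cases X) auto
      then show ?thesis using m vs(2) w by (metis length_greater_0_conv)
    qed
  qed
qed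

subsection \<open>Encoding computations\<close>

type_synonym transition = "nat \<times> nat list \<times> nat \<times> nat list \<times> move list"

datatype tm_var = Fires transition | Holds nat nat

fun reverse :: "move \<Rightarrow> move" where
  "reverse MLeft = MRight" | "reverse MStay = MStay" | "reverse MRight = MLeft"

lemma displacement_reverse: "displacement (reverse m) = - displacement m"
  by (cases m) auto

definition before :: "nat list \<Rightarrow> nat \<Rightarrow> bool" where
  "before w t \<longleftrightarrow> (\<exists>q<length w. centre w q \<and> t < q)"

definition letter_symbol :: "nat list \<Rightarrow> nat \<Rightarrow> nat \<Rightarrow> bool" where
  "letter_symbol w p a \<longleftrightarrow> a \<le> 2 \<and> w ! p \<in> {a + 1, a + 4}"

definition initially :: "nat list \<Rightarrow> nat \<Rightarrow> nat \<Rightarrow> nat \<Rightarrow> bool" where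
  "initially w i a p \<longleftrightarrow> (if i = 0 then letter_symbol w p a else a = 0)"

definition source :: "transition \<Rightarrow> nat" where "source \<delta> = fst \<delta>"
definition target :: "transition \<Rightarrow> nat" where "target \<delta> = fst (snd (snd \<delta>))"
definition reads :: "transition \<Rightarrow> nat list" where "reads \<delta> = fst (snd \<delta>)"
definition writes :: "transition \<Rightarrow> nat list" where "writes \<delta> = fst (snd (snd (snd \<delta>)))"
definition moves :: "transition \<Rightarrow> move list" where "moves \<delta> = snd (snd (snd (snd \<delta>)))"

lemmas transition_parts = source_def target_def reads_def writes_def moves_def

text \<open>The variable \<open>Fires \<delta>\<close> at time \<open>t\<close> and the centre states that the \<open>t\<close>-th step is \<open>\<delta>\<close>; \<open>Holds i a\<close> at time
  \<open>t\<close> and position \<open>p\<close> that tape \<open>i\<close> then holds symbol \<open>a\<close>, where positions are relative to the head, which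
  is at the centre. The clauses are Horn clauses deriving the contents of the tapes from the transitions,
  except for the existence of a transition.\<close>

definition tm_schemes :: "nat \<Rightarrow> nat \<Rightarrow> nat \<Rightarrow> nat list \<Rightarrow> transition list \<Rightarrow> tm_var scheme list" where
  "tm_schemes q0 qa n syms ds =
     [(\<lambda>w t p. before w t, map (\<lambda>\<delta>. (Fires \<delta>, 1, 0, True, MStay)) ds)] @
     [(\<lambda>w t p. t = 0, [(Fires \<delta>, 0, 0, True, MStay)]). \<delta> \<leftarrow> ds, source \<delta> \<noteq> q0] @
     [(\<lambda>w t p. \<exists>q<length w. centre w q \<and> q = Suc t, [(Fires \<delta>, 0, 0, True, MStay)]). \<delta> \<leftarrow> ds, target \<delta> \<noteq> qa] @
     [(\<lambda>w t p. \<exists>u<length w. u = Suc t \<and> before w u, [(Fires \<delta>, 0, 0, True, MStay), (Fires \<delta>', 0, 1, True, MStay)]).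
        \<delta> \<leftarrow> ds, \<delta>' \<leftarrow> ds, target \<delta> \<noteq> source \<delta>'] @
     [(\<lambda>w t p. before w t, [(Fires \<delta>, 0, 0, True, MStay), (Holds i a, 0, 0, True, MStay)]).
        \<delta> \<leftarrow> ds, i \<leftarrow> [0..<n], a \<leftarrow> syms, a \<noteq> reads \<delta> ! i] @
     [(\<lambda>w t p. t = 0 \<and> initially w i a p, [(Holds i a, 1, 0, False, MStay)]).
        i \<leftarrow> [0..<n], a \<leftarrow> syms] @
     [(\<lambda>w t p. before w t, [(Fires \<delta>, 0, 0, True, MStay), (Holds i (writes \<delta> ! i), 1, 1, True, reverse (moves \<delta> ! i))]).
        \<delta> \<leftarrow> ds, i \<leftarrow> [0..<n]] @
     [(\<lambda>w t p. before w t \<and> \<not> centre w p \<and> (\<exists>d<length w. moved (reverse (moves \<delta> ! i)) p d),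
        [(Fires \<delta>, 0, 0, True, MStay), (Holds i a, 0, 0, False, MStay), (Holds i a, 1, 1, False, reverse (moves \<delta> ! i))]).
        \<delta> \<leftarrow> ds, i \<leftarrow> [0..<n], a \<leftarrow> syms]"

lemma FO_before: "tm_at d t \<Longrightarrow> FO d (\<lambda>w \<rho> e. before w (t e))"
  unfolding before_def by (intro FO_ex FO_and FO_centre FO_less tm_hd tm_tl)

lemma FO_tm_schemes:
  assumes "(A, ls) \<in> set (tm_schemes q0 qa n syms ds)" "tm_at d t" "tm_at d p"
  shows "FO d (\<lambda>w \<rho> e. A w (t e) (p e))"
proof -
  have 1: "FO d (\<lambda>w \<rho> e. \<exists>q<length w. centre w q \<and> q = Suc (t e))"
    "FO d (\<lambda>w \<rho> e. \<exists>u<length w. u = Suc (t e) \<and> before w u)"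
    by (intro FO_ex FO_and FO_centre FO_Suc FO_before tm_hd tm_tl assms)+
  have l: "FO d (\<lambda>w \<rho> e. letter_symbol w (p e) a)" for a
    unfolding letter_symbol_def by (intro FO_and FO_const FO_sym assms)
  have "FO d (\<lambda>w \<rho> e. initially w i a (p e))" for i a
    unfolding initially_def using l by (cases "i = 0") (simp_all add: FO_const)
  then have 2: "FO d (\<lambda>w \<rho> e. t e = 0 \<and> initially w i a (p e))" for i a
    by (intro FO_and FO_zero assms)
  have 3: "FO d (\<lambda>w \<rho> e. before w (t e) \<and> \<not> centre w (p e) \<and> (\<exists>d<length w. moved m (p e) d))" for m
    by (intro FO_ex FO_and FO_not FO_centre FO_moved FO_before tm_hd tm_tl assms)
  have 4: "FO d (\<lambda>w \<rho> e. Suc (t e) < length w \<and> centre w (Suc (t e)))"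
    "FO d (\<lambda>w \<rho> e. Suc (t e) < length w \<and> before w (Suc (t e)))"
    by (rule FO_cong[OF 1(1)], simp) (rule FO_cong[OF 1(2)], simp)
  show ?thesis using assms(1) unfolding tm_schemes_def
    by (auto intro: 2 3 4 FO_before assms FO_zero split: if_splits)
qed

text \<open>The tape as seen from its head. A move of the head shifts this view in the opposite
  direction, which explains \<open>reverse\<close> in the clauses.\<close>

definition offset_content :: "tape list \<Rightarrow> nat \<Rightarrow> int \<Rightarrow> nat" where
  "offset_content tps i z = fst (tps ! i) (snd (tps ! i) + z)"

definition fires :: "transition \<Rightarrow> config \<Rightarrow> config \<Rightarrow> bool" where
  "fires \<delta> c c' \<longleftrightarrow> source \<delta> = fst c \<and> reads \<delta> = map scanned (snd c) \<and>
     c' = (target \<delta>, map2 act (snd c) (zip (writes \<delta>) (moves \<delta>)))"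

lemma offset_content_act:
  assumes "i < length tps" "length bs = length tps" "length ms = length tps"
  shows "offset_content (map2 act tps (zip bs ms)) i z = (if z = - displacement (ms ! i) then bs ! i
    else offset_content tps i (z + displacement (ms ! i)))"
proof (cases "tps ! i")
  case (Pair f h)
  have "map2 act tps (zip bs ms) ! i = act (f, h) (bs ! i, ms ! i)" using assms Pair by simp
  moreover have "h + displacement (ms ! i) + z = h \<longleftrightarrow> z = - displacement (ms ! i)" by linarith
  ultimately show ?thesis using Pair by (simp add: offset_content_def act_def algebra_simps)
qed

lemma scanned_offset: "i < length tps \<Longrightarrow> scanned (tps ! i) = offset_content tps i 0"
  by (simp add: offset_content_def scanned_def case_prod_beta)

lemma word_nth:
  assumes "p < 2 * Z + 1"
  shows "word Z x ! p = (if p < Z then 1 else letter x (p - Z) + (if p = Z then 3 else 0))"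
proof -
  have "Suc (p - (Z + 1)) = p - Z" if "Z < p" using that by simp
  then show ?thesis using assms by (auto simp: word_def nth_append nth_Cons')
qed

lemma letter_range: "letter x i \<in> {1, 2, 3}"
  by (simp add: letter_def bit_symbol_def)

lemma centre_word: "q < 2 * Z + 1 \<Longrightarrow> centre (word Z x) q \<longleftrightarrow> q = Z"
  using letter_range[of x "q - Z"] by (auto simp: centre_def word_nth)

lemma before_word: "before (word Z x) t \<longleftrightarrow> t < Z"
  unfolding before_def by (auto simp: centre_word intro!: exI[of _ Z])

lemma letter_symbol_word:
  assumes "p < 2 * Z + 1"
  shows "letter_symbol (word Z x) p a \<longleftrightarrow> fst (input_tape x) (int p - int Z) = a"
proof -
  have 1: "fst (input_tape x) (int p - int Z) = (if p < Z then 0 else letter x (p - Z) - 1)"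
    by (auto simp: input_tape_def letter_def nat_diff_distrib)
  show ?thesis using letter_range[of x "p - Z"] assms
    unfolding letter_symbol_def 1 word_nth[OF assms] by auto
qed

definition shifted :: "nat \<Rightarrow> move \<Rightarrow> nat" where
  "shifted q m = nat (int q + displacement m)"

definition literal_true :: "nat list \<Rightarrow> ('v \<Rightarrow> nat \<Rightarrow> nat \<Rightarrow> bool) \<Rightarrow> 'v literal \<Rightarrow> nat \<Rightarrow> nat \<Rightarrow> bool" where
  "literal_true w \<beta> l t p \<longleftrightarrow>
     (\<exists>c < length w. \<exists>d < length w. placed w l t p c d \<and> (\<beta> (fst l) c d \<longleftrightarrow> fst (snd l) = 1))"

lemma moved_shifted: "moved m q d \<Longrightarrow> d = shifted q m"
  by (auto simp: moved_iff shifted_def)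

lemma literal_true_centre:
  assumes "t < Z" "dt \<le> 1"
  shows "literal_true (word Z x) \<beta> (v, s, dt, True, m) t p \<longleftrightarrow> (\<beta> v (t + dt) (shifted Z m) \<longleftrightarrow> s = 1)"
proof -
  have "moved m Z (shifted Z m)" "shifted Z m < 2 * Z + 1"
    using assms by (cases m; simp add: moved_iff shifted_def)+
  moreover have "(if dt = 0 then t else Suc t) = t + dt" "t + dt < 2 * Z + 1" using assms by auto
  ultimately have "c < length (word Z x) \<and> d < length (word Z x) \<and> placed (word Z x) (v, s, dt, True, m) t p c d \<longleftrightarrow>
      c = t + dt \<and> d = shifted Z m" for c d
  proof -
    have "(\<exists>q<length (word Z x). centre (word Z x) q \<and> moved m q d) \<longleftrightarrow> moved m Z d"
      using centre_word[of _ Z x] by (auto intro!: exI[of _ Z])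
    moreover have "moved m Z d \<longleftrightarrow> d = shifted Z m"
      using moved_shifted[of m Z d] \<open>moved m Z (shifted Z m)\<close> by blast
    ultimately show ?thesis
      using \<open>shifted Z m < 2 * Z + 1\<close> \<open>(if dt = 0 then t else Suc t) = t + dt\<close> \<open>t + dt < 2 * Z + 1\<close>
      unfolding placed_def prod.case if_True length_word by metis
  qed
  then have "literal_true (word Z x) \<beta> (v, s, dt, True, m) t p \<longleftrightarrow>
      (\<exists>c d. (c = t + dt \<and> d = shifted Z m) \<and> (\<beta> v c d \<longleftrightarrow> s = 1))"
    unfolding literal_true_def fst_conv snd_conv by blast
  then show ?thesis by simp
qed

lemma literal_true_self:
  assumes "t < Z" "dt \<le> 1" "p < 2 * Z + 1" "moved m p d" "d < 2 * Z + 1"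
  shows "literal_true (word Z x) \<beta> (v, s, dt, False, m) t p \<longleftrightarrow> (\<beta> v (t + dt) d \<longleftrightarrow> s = 1)"
proof -
  have "(if dt = 0 then t else Suc t) = t + dt" "t + dt < 2 * Z + 1" using assms by auto
  then show ?thesis using moved_shifted[of m p] assms(3-5)
    by (auto simp: literal_true_def placed_def)
qed

text \<open>The schemes interpreted on a word with centre \<open>Z\<close>, group by group in the
  order of \<open>tm_schemes\<close>: conditions on positions have become times below
  \<open>Z\<close> and offsets from \<open>Z\<close>.\<close>

definition describes :: "nat \<Rightarrow> nat \<Rightarrow> nat \<Rightarrow> nat set \<Rightarrow> transition set \<Rightarrow> nat \<Rightarrow> bool list \<Rightarrow>
    (tm_var \<Rightarrow> nat \<Rightarrow> nat \<Rightarrow> bool) \<Rightarrow> bool" where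
  "describes q0 qa n S D Z x \<beta> \<longleftrightarrow>
     (\<forall>t. t < Z \<longrightarrow> (\<exists>\<delta> \<in> D. \<beta> (Fires \<delta>) t Z)) \<and>
     (\<forall>\<delta> \<in> D. source \<delta> \<noteq> q0 \<longrightarrow> \<not> \<beta> (Fires \<delta>) 0 Z) \<and>
     (\<forall>\<delta> \<in> D. target \<delta> \<noteq> qa \<longrightarrow> (\<forall>t. Suc t = Z \<longrightarrow> \<not> \<beta> (Fires \<delta>) t Z)) \<and>
     (\<forall>\<delta> \<in> D. \<forall>\<delta>' \<in> D. target \<delta> \<noteq> source \<delta>' \<longrightarrow>
        (\<forall>t. Suc t < Z \<longrightarrow> \<not> \<beta> (Fires \<delta>) t Z \<or> \<not> \<beta> (Fires \<delta>') (Suc t) Z)) \<and>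
     (\<forall>\<delta> \<in> D. \<forall>i < n. \<forall>a \<in> S. a \<noteq> reads \<delta> ! i \<longrightarrow>
        (\<forall>t. t < Z \<longrightarrow> \<not> \<beta> (Fires \<delta>) t Z \<or> \<not> \<beta> (Holds i a) t Z)) \<and>
     (\<forall>i < n. \<forall>a \<in> S. \<forall>p < 2 * Z + 1.
        (if i = 0 then fst (input_tape x) (int p - int Z) = a else a = 0) \<longrightarrow> \<beta> (Holds i a) 0 p) \<and>
     (\<forall>\<delta> \<in> D. \<forall>i < n. \<forall>t. t < Z \<longrightarrow> \<beta> (Fires \<delta>) t Z \<longrightarrow>
        \<beta> (Holds i (writes \<delta> ! i)) (Suc t) (shifted Z (reverse (moves \<delta> ! i)))) \<and>
     (\<forall>\<delta> \<in> D. \<forall>i < n. \<forall>a \<in> S. \<forall>t < Z. \<forall>p < 2 * Z + 1. \<forall>d < 2 * Z + 1. p \<noteq> Z \<longrightarrow>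
        moved (reverse (moves \<delta> ! i)) p d \<longrightarrow> \<beta> (Fires \<delta>) t Z \<longrightarrow> \<beta> (Holds i a) t p \<longrightarrow> \<beta> (Holds i a) (Suc t) d)"

lemma ball_list_simps:
  "(\<forall>x \<in> set (concat xss). P x) \<longleftrightarrow> (\<forall>xs \<in> set xss. \<forall>x \<in> set xs. P x)"
  "(\<forall>x \<in> set (map f ys). P x) \<longleftrightarrow> (\<forall>y \<in> set ys. P (f y))"
  "(\<forall>x \<in> set (if b then [z] else []). P x) \<longleftrightarrow> (b \<longrightarrow> P z)"
  "(\<forall>x \<in> set [z]. P x) \<longleftrightarrow> P z" "(\<forall>i \<in> set [0..<n]. Q i) \<longleftrightarrow> (\<forall>i < n. Q i)"
  by auto

lemma shifted_stay [simp]: "shifted q MStay = q"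
  by (simp add: shifted_def)

lemma scheme_satisfiable_literals:
  "scheme_satisfiable cs w \<longleftrightarrow> (\<exists>\<beta>. \<forall>(A, ls) \<in> set cs. \<forall>t < length w. \<forall>p < length w. A w t p \<longrightarrow>
     (\<exists>l \<in> set ls. literal_true w \<beta> l t p))"
  by (simp add: scheme_satisfiable_def literal_true_def)

lemma before_word_Suc: "(\<exists>u<length (word Z x). u = Suc t \<and> before (word Z x) u) \<longleftrightarrow> Suc t < Z"
  unfolding before_word by auto

lemma centre_word_Suc: "(\<exists>q<length (word Z x). centre (word Z x) q \<and> q = Suc t) \<longleftrightarrow> Suc t = Z"
  using centre_word[of Z Z x] centre_word[of "Suc t" Z x] by auto

lemma tm_schemes_describe:
  assumes "Z \<ge> 1"
  shows "scheme_satisfiable (tm_schemes q0 qa n syms ds) (word Z x) \<longleftrightarrow>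
    (\<exists>\<beta>. describes q0 qa n (set syms) (set ds) Z x \<beta>)"
proof -
  let ?w = "word Z x"
  have "(\<forall>(A, ls) \<in> set (tm_schemes q0 qa n syms ds). \<forall>t < length ?w. \<forall>p < length ?w. A ?w t p \<longrightarrow>
     (\<exists>l \<in> set ls. literal_true ?w \<beta> l t p)) \<longleftrightarrow> describes q0 qa n (set syms) (set ds) Z x \<beta>" for \<beta>
  proof -
    let ?T = "\<lambda>A ls. \<forall>t < length ?w. \<forall>p < length ?w. A ?w t p \<longrightarrow> (\<exists>l \<in> set ls. literal_true ?w \<beta> l t p)"
    have C: "literal_true ?w \<beta> (v, s, 0, True, m) t p \<longleftrightarrow> (\<beta> v t (shifted Z m) \<longleftrightarrow> s = 1)"
      "literal_true ?w \<beta> (v, s, 1, True, m) t p \<longleftrightarrow> (\<beta> v (Suc t) (shifted Z m) \<longleftrightarrow> s = 1)" if "t < Z" for v s m t p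
      using literal_true_centre[OF that, of 0 x \<beta> v s m p] literal_true_centre[OF that, of 1 x \<beta> v s m p]
      by (simp_all add: Suc_eq_plus1)
    have S: "literal_true ?w \<beta> (v, s, 0, False, MStay) t p \<longleftrightarrow> (\<beta> v t p \<longleftrightarrow> s = 1)" if "t < Z" "p < 2 * Z + 1" for v s t p
      using literal_true_self[OF that(1) _ that(2), of 0 MStay p x \<beta> v s] that(2) by (simp add: moved_iff)
    have S1: "literal_true ?w \<beta> (v, s, 1, False, m) t p \<longleftrightarrow> (\<beta> v (Suc t) d \<longleftrightarrow> s = 1)"
      if "t < Z" "p < 2 * Z + 1" "moved m p d" "d < 2 * Z + 1" for v s t p m d
      using literal_true_self[OF that(1) _ that(2,3,4), of 1 x \<beta> v s] by (simp add: Suc_eq_plus1)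
    \<comment> \<open>For schemes about the time and the centre alone, the clauses for different
      \<open>p\<close> coincide.\<close>
    have T: "?T (\<lambda>w t p. P w t) ls \<longleftrightarrow> (\<forall>t. P ?w t \<longrightarrow> Q t)"
      if "\<And>t p. P ?w t \<Longrightarrow> t < Z \<and> ((\<exists>l \<in> set ls. literal_true ?w \<beta> l t p) \<longleftrightarrow> Q t)" for P Q ls
    proof -
      have "t < length ?w" if "t < Z" for t using that by simp
      moreover have "0 < length ?w" by simp
      ultimately show ?thesis using that by blast
    qed
    have 1: "?T (\<lambda>w t p. before w t) (map (\<lambda>\<delta>. (Fires \<delta>, 1, 0, True, MStay)) ds) \<longleftrightarrow>
      (\<forall>t. t < Z \<longrightarrow> (\<exists>\<delta> \<in> set ds. \<beta> (Fires \<delta>) t Z))"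
      unfolding before_word[of Z x, symmetric] by (rule T) (simp add: before_word C)
    have 2: "?T (\<lambda>w t p. t = 0) [(Fires \<delta>, 0, 0, True, MStay)] \<longleftrightarrow> \<not> \<beta> (Fires \<delta>) 0 Z" for \<delta>
      by (subst T[where Q = "\<lambda>t. \<not> \<beta> (Fires \<delta>) t Z"]) (use assms in \<open>simp_all add: C\<close>)
    have 3: "?T (\<lambda>w t p. \<exists>q<length w. centre w q \<and> q = Suc t) [(Fires \<delta>, 0, 0, True, MStay)] \<longleftrightarrow>
      (\<forall>t. Suc t = Z \<longrightarrow> \<not> \<beta> (Fires \<delta>) t Z)" for \<delta>
      unfolding centre_word_Suc[of Z x, symmetric] by (rule T) (auto simp: centre_word_Suc C simp del: length_word)
    have 4: "?T (\<lambda>w t p. \<exists>u<length w. u = Suc t \<and> before w u) [(Fires \<delta>, 0, 0, True, MStay), (Fires \<delta>', 0, 1, True, MStay)] \<longleftrightarrow>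
      (\<forall>t. Suc t < Z \<longrightarrow> \<not> \<beta> (Fires \<delta>) t Z \<or> \<not> \<beta> (Fires \<delta>') (Suc t) Z)" for \<delta> \<delta>'
      unfolding before_word_Suc[of Z x, symmetric] by (rule T) (auto simp: before_word_Suc C simp del: length_word)
    have 5: "?T (\<lambda>w t p. before w t) [(Fires \<delta>, 0, 0, True, MStay), (Holds i a, 0, 0, True, MStay)] \<longleftrightarrow>
      (\<forall>t. t < Z \<longrightarrow> \<not> \<beta> (Fires \<delta>) t Z \<or> \<not> \<beta> (Holds i a) t Z)" for \<delta> i a
      unfolding before_word[of Z x, symmetric] by (rule T) (simp add: before_word C)
    have 6: "?T (\<lambda>w t p. t = 0 \<and> initially w i a p) [(Holds i a, 1, 0, False, MStay)] \<longleftrightarrow>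
      (\<forall>p < 2 * Z + 1. (if i = 0 then fst (input_tape x) (int p - int Z) = a else a = 0) \<longrightarrow> \<beta> (Holds i a) 0 p)" for i a
    proof -
      have "0 < length ?w" "0 < Z" using assms by auto
      then have "?T (\<lambda>w t p. t = 0 \<and> initially w i a p) [(Holds i a, 1, 0, False, MStay)] \<longleftrightarrow>
        (\<forall>p < length ?w. initially ?w i a p \<longrightarrow> (\<exists>l \<in> set [(Holds i a, 1, 0, False, MStay)]. literal_true ?w \<beta> l 0 p))" by blast
      with \<open>0 < Z\<close> show ?thesis by (simp add: initially_def letter_symbol_word S)
    qed
    have 7: "?T (\<lambda>w t p. before w t) [(Fires \<delta>, 0, 0, True, MStay), (Holds i b, 1, 1, True, m)] \<longleftrightarrow>
      (\<forall>t. t < Z \<longrightarrow> \<beta> (Fires \<delta>) t Z \<longrightarrow> \<beta> (Holds i b) (Suc t) (shifted Z m))" for \<delta> i b m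
      unfolding before_word[of Z x, symmetric] by (rule T) (auto simp: before_word C)
    have 8: "?T (\<lambda>w t p. before w t \<and> \<not> centre w p \<and> (\<exists>d<length w. moved m p d))
      [(Fires \<delta>, 0, 0, True, MStay), (Holds i a, 0, 0, False, MStay), (Holds i a, 1, 1, False, m)] \<longleftrightarrow>
      (\<forall>t < Z. \<forall>p < 2 * Z + 1. \<forall>d < 2 * Z + 1. p \<noteq> Z \<longrightarrow> moved m p d \<longrightarrow>
        \<beta> (Fires \<delta>) t Z \<longrightarrow> \<beta> (Holds i a) t p \<longrightarrow> \<beta> (Holds i a) (Suc t) d)" (is "?l \<longleftrightarrow> ?r") for \<delta> i a m
    proof -
      have b: "t < length ?w" if "t < Z" for t using that by simp
      have "?l \<longleftrightarrow> (\<forall>t < Z. \<forall>p < length ?w. p \<noteq> Z \<longrightarrow> (\<exists>d < length ?w. moved m p d) \<longrightarrow>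
        (\<exists>l \<in> set [(Fires \<delta>, 0, 0, True, MStay), (Holds i a, 0, 0, False, MStay), (Holds i a, 1, 1, False, m)]. literal_true ?w \<beta> l t p))"
        using b centre_word[of _ Z x] unfolding before_word length_word by blast
      also have "\<dots> \<longleftrightarrow> ?r"
      proof -
        have "((\<exists>d < 2 * Z + 1. moved m p d) \<longrightarrow>
          (\<exists>l \<in> set [(Fires \<delta>, 0, 0, True, MStay), (Holds i a, 0, 0, False, MStay), (Holds i a, 1, 1, False, m)]. literal_true ?w \<beta> l t p)) \<longleftrightarrow>
          (\<forall>d < 2 * Z + 1. moved m p d \<longrightarrow> \<beta> (Fires \<delta>) t Z \<longrightarrow> \<beta> (Holds i a) t p \<longrightarrow> \<beta> (Holds i a) (Suc t) d)"
          if t: "t < Z" "p < 2 * Z + 1" for t p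
        proof (cases "\<exists>d < 2 * Z + 1. moved m p d")
          case True
          then obtain d where d: "d < 2 * Z + 1" "moved m p d" by blast
          then have "d' = d" if "moved m p d'" for d' using moved_shifted that by blast
          then have "(\<forall>d < 2 * Z + 1. moved m p d \<longrightarrow> Q d) \<longleftrightarrow> Q d" for Q using d by blast
          moreover have "(\<exists>l \<in> set [(Fires \<delta>, 0, 0, True, MStay), (Holds i a, 0, 0, False, MStay), (Holds i a, 1, 1, False, m)]. literal_true ?w \<beta> l t p) \<longleftrightarrow>
            (\<beta> (Fires \<delta>) t Z \<longrightarrow> \<beta> (Holds i a) t p \<longrightarrow> \<beta> (Holds i a) (Suc t) d)"
            using C[OF t(1), of "Fires \<delta>" 0 MStay p] S[OF t, of "Holds i a" 0] S1[OF t d(2,1), of "Holds i a" 1]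
            by simp blast
          ultimately show ?thesis using True by simp
        qed blast
        then show ?thesis unfolding length_word by blast
      qed
      finally show ?thesis .
    qed
    show ?thesis unfolding tm_schemes_def describes_def set_append ball_Un
      by (simp only: ball_list_simps prod.case 1 2 3 4 5 6 7 8)
  qed
  then show ?thesis unfolding scheme_satisfiable_literals by simp
qed

definition step_by :: "transition set \<Rightarrow> config \<Rightarrow> config \<Rightarrow> bool" where
  "step_by D c c' \<longleftrightarrow> (\<exists>\<delta> \<in> D. fires \<delta> c c')"

lemma input_tape_symbols: "fst (input_tape x) z \<in> {0, 1, 2}"
  by (simp add: input_tape_def bit_symbol_def)

definition initial_tapes :: "nat \<Rightarrow> bool list \<Rightarrow> tape list" where
  "initial_tapes n x = input_tape x # replicate (n - 1) (\<lambda>_. 0, 0)"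

lemma offset_content_start:
  "i < n \<Longrightarrow> offset_content (initial_tapes n x) i z = (if i = 0 then fst (input_tape x) z else 0)"
  by (auto simp: offset_content_def initial_tapes_def input_tape_def nth_Cons')

text \<open>From an assignment, the tape contents are derived as true facts by the Horn clauses, and
  the clauses on reading forbid a transition whose symbols disagree with them. Conversely a run
  makes exactly its own transitions and contents true.\<close>

lemma describes_iff_run:
  assumes Z: "Z \<ge> 1" and n: "n \<ge> 1" and S: "{0, 1, 2} \<subseteq> S"
    and D: "\<And>\<delta>. \<delta> \<in> D \<Longrightarrow> length (writes \<delta>) = n \<and> length (moves \<delta>) = n \<and> length (reads \<delta>) = n \<and> set (writes \<delta>) \<subseteq> S"
  shows "(\<exists>\<beta>. describes q0 qa n S D Z x \<beta>) \<longleftrightarrow>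
    (\<exists>c. c 0 = (q0, initial_tapes n x) \<and> (\<forall>t < Z. step_by D (c t) (c (Suc t))) \<and> fst (c Z) = qa)"
proof
  assume "\<exists>\<beta>. describes q0 qa n S D Z x \<beta>"
  then obtain \<beta> where B: "describes q0 qa n S D Z x \<beta>" by blast
  note B' = B[unfolded describes_def]
  note B1 = B'[THEN conjunct1, rule_format] and B2 = B'[THEN conjunct2, THEN conjunct1, rule_format]
    and B3 = B'[THEN conjunct2, THEN conjunct2, THEN conjunct1, rule_format]
  note B'' = B'[THEN conjunct2, THEN conjunct2, THEN conjunct2]
  note B4 = B''[THEN conjunct1, rule_format] and B5 = B''[THEN conjunct2, THEN conjunct1, rule_format]
    and B6 = B''[THEN conjunct2, THEN conjunct2, THEN conjunct1, rule_format]
  note Bq = B''[THEN conjunct2, THEN conjunct2, THEN conjunct2]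
  note B7 = Bq[THEN conjunct1, rule_format] and B8 = Bq[THEN conjunct2, rule_format]
  have sym: "fst (input_tape x) z \<in> S" for z using S input_tape_symbols[of x z] by blast
  \<comment> \<open>The clauses allow several transitions to fire at the same time; one of them is
    selected for the run.\<close>
  have "\<forall>t. \<exists>\<delta>. t < Z \<longrightarrow> \<delta> \<in> D \<and> \<beta> (Fires \<delta>) t Z" using B1 by blast
  then obtain \<delta> where \<delta>: "\<And>t. t < Z \<Longrightarrow> \<delta> t \<in> D \<and> \<beta> (Fires (\<delta> t)) t Z" by metis
  define c where "c = rec_nat (q0, initial_tapes n x)
    (\<lambda>t c. (target (\<delta> t), map2 act (snd c) (zip (writes (\<delta> t)) (moves (\<delta> t)))))"
  have c0: "c 0 = (q0, initial_tapes n x)" and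
    cS: "c (Suc t) = (target (\<delta> t), map2 act (snd (c t)) (zip (writes (\<delta> t)) (moves (\<delta> t))))" for t
    by (simp_all add: c_def)
  let ?C = "\<lambda>t. offset_content (snd (c t))"
  have content: "?C (Suc t) i z = (if z = - displacement (moves (\<delta> t) ! i) then writes (\<delta> t) ! i
      else ?C t i (z + displacement (moves (\<delta> t) ! i)))" if "t < Z" "length (snd (c t)) = n" "i < n" for t i z
    unfolding cS snd_conv using that D[of "\<delta> t"] \<delta>[of t] by (intro offset_content_act) auto
  \<comment> \<open>A shift of the tape brings in cells from outside the word, about which nothing
    is known. The contents are therefore derived only within distance \<open>Z - t\<close> of the
    head, a region that shrinks by one cell per step and still contains the head at all times in
    question.\<close>
  have inv: "length (snd (c t)) = n \<and> (t < Z \<longrightarrow> fst (c t) = source (\<delta> t)) \<and> (\<forall>i < n. \<forall>z. ?C t i z \<in> S) \<and>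
    (\<forall>i < n. \<forall>p. \<bar>int p - int Z\<bar> \<le> int Z - int t \<longrightarrow> \<beta> (Holds i (?C t i (int p - int Z))) t p)" if "t \<le> Z" for t
    using that
  proof (induction t)
    case 0
    have "source (\<delta> 0) = q0" using B2 \<delta>[of 0] Z by fastforce
    moreover have "\<beta> (Holds i (if i = 0 then fst (input_tape x) (int p - int Z) else 0)) 0 p"
      if "i < n" "p < 2 * Z + 1" for i p
      by (rule B6) (use that S sym in auto)
    moreover have "p < 2 * Z + 1" if "\<bar>int p - int Z\<bar> \<le> int Z - int 0" for p using that by linarith
    moreover have "length (initial_tapes n x) = n" using n by (simp add: initial_tapes_def)
    ultimately show ?case using S sym by (auto simp: c0 offset_content_start)
  next
    case (Suc t)
    then have t: "t < Z" and IH: "length (snd (c t)) = n" "\<And>i z. i < n \<Longrightarrow> ?C t i z \<in> S"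
      "\<And>i p. i < n \<Longrightarrow> \<bar>int p - int Z\<bar> \<le> int Z - int t \<Longrightarrow> \<beta> (Holds i (?C t i (int p - int Z))) t p" by auto
    note Dt = D[OF conjunct1[OF \<delta>[OF t]]]
    have "fst (c (Suc t)) = source (\<delta> (Suc t))" if "Suc t < Z"
      using B4[of "\<delta> t" "\<delta> (Suc t)" t] \<delta>[OF t] \<delta>[OF that] that unfolding cS fst_conv by blast
    moreover have "length (snd (c (Suc t))) = n" using IH(1) Dt by (simp add: cS)
    moreover have "?C (Suc t) i z \<in> S" if "i < n" for i z
      using IH(2) Dt that nth_mem[of i "writes (\<delta> t)"] by (auto simp: content[OF t IH(1) that])
    moreover have "\<beta> (Holds i (?C (Suc t) i (int p - int Z))) (Suc t) p"
      if i: "i < n" and p: "\<bar>int p - int Z\<bar> \<le> int Z - int (Suc t)" for i p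
    proof (cases "int p - int Z = - displacement (moves (\<delta> t) ! i)")
      case True
      then have "p = shifted Z (reverse (moves (\<delta> t) ! i))"
        by (simp add: shifted_def displacement_reverse)
      then show ?thesis using B7[of "\<delta> t" i t] \<delta>[OF t] t i True by (simp add: content[OF t IH(1) i])
    next
      case False
      define p' where "p' = nat (int p + displacement (moves (\<delta> t) ! i))"
      have "displacement (moves (\<delta> t) ! i) \<in> {-1, 0, 1}" by (cases "moves (\<delta> t) ! i") auto
      then have p': "int p' = int p + displacement (moves (\<delta> t) ! i)" "\<bar>int p' - int Z\<bar> \<le> int Z - int t"
        using p t unfolding p'_def by auto
      then have "moved (reverse (moves (\<delta> t) ! i)) p' p" "p' < 2 * Z + 1" "p < 2 * Z + 1" "p' \<noteq> Z"
        using p False by (auto simp: moved_iff displacement_reverse)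
      then have "\<beta> (Holds i (?C t i (int p' - int Z))) (Suc t) p"
        by (intro B8[where \<delta> = "\<delta> t" and p = p']) (use \<delta>[OF t] t i IH(2)[OF i] IH(3)[OF i p'(2)] in auto)
      moreover have "int p' - int Z = int p - int Z + displacement (moves (\<delta> t) ! i)" using p'(1) by simp
      ultimately show ?thesis using False by (simp add: content[OF t IH(1) i])
    qed
    ultimately show ?case by blast
  qed
  have "step_by D (c t) (c (Suc t))" if t: "t < Z" for t
  proof -
    note I = inv[of t]
    have "reads (\<delta> t) ! i = scanned (snd (c t) ! i)" if i: "i < n" for i
    proof -
      have "\<bar>int p - int Z\<bar> \<le> int Z - int t \<Longrightarrow> \<beta> (Holds i (?C t i (int p - int Z))) t p" for p using I t i by auto
      from this[of Z] have "\<beta> (Holds i (?C t i 0)) t Z" using t by simp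
      moreover have "?C t i 0 \<in> S" using I t i by simp
      ultimately have "?C t i 0 = reads (\<delta> t) ! i" using B5[of "\<delta> t" i "?C t i 0" t] \<delta>[OF t] t i by blast
      then show ?thesis using I t i by (simp add: scanned_offset)
    qed
    then have "reads (\<delta> t) = map scanned (snd (c t))"
      using D[OF conjunct1[OF \<delta>[OF t]]] I t by (intro nth_equalityI) auto
    then have "fires (\<delta> t) (c t) (c (Suc t))" using I t unfolding fires_def cS by simp
    then show ?thesis using \<delta>[OF t] unfolding step_by_def by blast
  qed
  moreover have "fst (c Z) = qa"
  proof -
    obtain Z' where Z': "Suc Z' = Z" using Z by (cases Z) auto
    then have "target (\<delta> Z') = qa" using B3[of "\<delta> Z'" Z'] \<delta>[of Z'] by blast
    then show ?thesis using cS[of Z'] Z' by simp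
  qed
  ultimately show "\<exists>c. c 0 = (q0, initial_tapes n x) \<and> (\<forall>t < Z. step_by D (c t) (c (Suc t))) \<and> fst (c Z) = qa"
    using c0 by blast
next
  assume "\<exists>c. c 0 = (q0, initial_tapes n x) \<and> (\<forall>t < Z. step_by D (c t) (c (Suc t))) \<and> fst (c Z) = qa"
  then obtain c where c: "c 0 = (q0, initial_tapes n x)" "\<And>t. t < Z \<Longrightarrow> step_by D (c t) (c (Suc t))" "fst (c Z) = qa"
    by blast
  have "\<forall>t. \<exists>\<delta>. t < Z \<longrightarrow> \<delta> \<in> D \<and> fires \<delta> (c t) (c (Suc t))" using c(2) unfolding step_by_def by blast
  then obtain \<delta> where \<delta>: "\<And>t. t < Z \<Longrightarrow> \<delta> t \<in> D \<and> fires (\<delta> t) (c t) (c (Suc t))" by metis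
  let ?C = "\<lambda>t. offset_content (snd (c t))"
  have len: "length (snd (c t)) = n" if "t \<le> Z" for t
    using that
  proof (induction t)
    case 0
    then show ?case using n by (simp add: c(1) initial_tapes_def)
  next
    case (Suc t)
    then show ?case using \<delta>[of t] D[of "\<delta> t"] by (simp add: fires_def)
  qed
  have content: "?C (Suc t) i z = (if z = - displacement (moves (\<delta> t) ! i) then writes (\<delta> t) ! i
      else ?C t i (z + displacement (moves (\<delta> t) ! i)))" if "t < Z" "i < n" for t i z
    using that offset_content_act[of i "snd (c t)" "writes (\<delta> t)" "moves (\<delta> t)" z] D[of "\<delta> t"] \<delta>[of t] len[of t]
    by (simp add: fires_def)
  have reads: "reads (\<delta> t) ! i = ?C t i 0" if "t < Z" "i < n" for t i
    using \<delta>[OF that(1)] len[of t] that by (simp add: fires_def scanned_offset)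
  have states: "source (\<delta> t) = fst (c t)" "target (\<delta> t) = fst (c (Suc t))" if "t < Z" for t
    using \<delta>[OF that] by (simp_all add: fires_def)
  define \<beta> where "\<beta> v t p \<longleftrightarrow> (case v of Fires d \<Rightarrow> t < Z \<and> d = \<delta> t | Holds i a \<Rightarrow> ?C t i (int p - int Z) = a)" for v t p
  have [simp]: "\<beta> (Fires d) t p \<longleftrightarrow> t < Z \<and> d = \<delta> t" "\<beta> (Holds i a) t p \<longleftrightarrow> ?C t i (int p - int Z) = a" for d i a t p
    by (simp_all add: \<beta>_def)
  have "describes q0 qa n S D Z x \<beta>" unfolding describes_def
  proof (intro conjI allI ballI impI)
    fix t assume "t < Z"
    then show "\<exists>d \<in> D. \<beta> (Fires d) t Z" using \<delta> by simp
  next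
    fix d assume "source d \<noteq> q0"
    then show "\<not> \<beta> (Fires d) 0 Z" using states(1)[of 0] c(1) by auto
  next
    fix t d assume "target d \<noteq> qa" "Suc t = Z"
    then show "\<not> \<beta> (Fires d) t Z" using states(2)[of t] c(3) by auto
  next
    fix t d d' assume "target d \<noteq> source d'" "Suc t < Z"
    then show "\<not> \<beta> (Fires d) t Z \<or> \<not> \<beta> (Fires d') (Suc t) Z" using states(2)[of t] states(1)[of "Suc t"] by auto
  next
    fix t d i a assume "t < Z" "i < n" "a \<noteq> reads d ! i"
    then show "\<not> \<beta> (Fires d) t Z \<or> \<not> \<beta> (Holds i a) t Z" using reads by auto
  next
    fix p i a assume "i < n" "if i = 0 then fst (input_tape x) (int p - int Z) = a else a = 0"
    then show "\<beta> (Holds i a) 0 p" by (simp add: c(1) offset_content_start split: if_splits)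
  next
    fix t d i assume "t < Z" "i < n" "\<beta> (Fires d) t Z"
    moreover have "int (shifted Z (reverse m)) = int Z - displacement m" for m
      using Z by (cases m) (auto simp: shifted_def)
    ultimately show "\<beta> (Holds i (writes d ! i)) (Suc t) (shifted Z (reverse (moves d ! i)))"
      by (simp add: content)
  next
    fix t p p' d i a assume "t < Z" "i < n" "p \<noteq> Z" "moved (reverse (moves d ! i)) p p'" "\<beta> (Fires d) t Z" "\<beta> (Holds i a) t p"
    then show "\<beta> (Holds i a) (Suc t) p'"
      by (simp add: content moved_iff displacement_reverse algebra_simps)
  qed
  then show "\<exists>\<beta>. describes q0 qa n S D Z x \<beta>" by blast
qed

lemma tm_step_iff: "tm_step M c c' \<longleftrightarrow> step_by (trans M) c c'"
  by (cases c; cases c') (auto simp: tm_step_def step_by_def fires_def transition_parts Bex_def)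

text \<open>The restriction to states in \<open>Q\<close> and symbols in \<open>S\<close> makes this
  a finite set of transitions.\<close>

definition idle :: "nat \<Rightarrow> nat set \<Rightarrow> nat set \<Rightarrow> transition set" where
  "idle n Q S = {(q, as, q, as, replicate n MStay) | q as. q \<in> Q \<and> as \<in> lists S \<and> length as = n}"

lemma finite_idle: "finite Q \<Longrightarrow> finite S \<Longrightarrow> finite (idle n Q S)"
proof -
  assume "finite Q" "finite S"
  moreover have "idle n Q S = (\<lambda>(q, as). (q, as, q, as, replicate n MStay)) ` (Q \<times> {as. set as \<subseteq> S \<and> length as = n})"
    by (auto simp: idle_def image_iff lists_eq_set)
  ultimately show ?thesis by (simp add: finite_lists_length_eq)
qed

lemma map2_act_stay: "length tps = n \<Longrightarrow> map2 act tps (zip (map scanned tps) (replicate n MStay)) = tps"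
  by (intro nth_equalityI) (auto simp: act_def scanned_def split: prod.splits)

lemma idle_fires:
  assumes "\<delta> \<in> idle n Q S" "fires \<delta> c c'" "length (snd c) = n"
  shows "c' = c"
  using assms by (auto simp: idle_def fires_def transition_parts map2_act_stay prod_eq_iff)

text \<open>Idle steps make accepting runs as long as the time bound.\<close>

lemma accepts_iff_padded_run:
  assumes M: "wf_tm M" and Z: "\<And>n c. (tm_step M ^^ n) (initial_config M x) c \<Longrightarrow> n \<le> Z"
    and S: "{0, 1, 2} \<subseteq> S" "\<And>\<delta>. \<delta> \<in> trans M \<Longrightarrow> set (writes \<delta>) \<subseteq> S"
    and Q: "start M \<in> Q" "\<And>\<delta>. \<delta> \<in> trans M \<Longrightarrow> target \<delta> \<in> Q"
  shows "tm_accepts M x \<longleftrightarrow> (\<exists>c. c 0 = (start M, initial_tapes (ntapes M) x) \<and>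
    (\<forall>t < Z. step_by (trans M \<union> idle (ntapes M) Q S) (c t) (c (Suc t))) \<and> fst (c Z) = accept M)" (is "_ \<longleftrightarrow> ?r")
proof
  have init: "initial_config M x = (start M, initial_tapes (ntapes M) x)" by (simp add: initial_config_def initial_tapes_def)
  have len: "length (writes \<delta>) = ntapes M \<and> length (moves \<delta>) = ntapes M" if "\<delta> \<in> trans M" for \<delta>
    using M that unfolding wf_tm_def by (cases \<delta>) (auto simp: transition_parts)
  assume "tm_accepts M x"
  then obtain c0 where c0: "(tm_step M)\<^sup>*\<^sup>* (initial_config M x) c0" "fst c0 = accept M" unfolding tm_accepts_def by blast
  then obtain n where n: "(tm_step M ^^ n) (initial_config M x) c0" using rtranclp_imp_relpowp by fast
  then obtain f where f: "f 0 = initial_config M x" "f n = c0" "\<And>i. i < n \<Longrightarrow> tm_step M (f i) (f (Suc i))"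
    unfolding relpowp_fun_conv by blast
  have inv: "fst (f i) \<in> Q \<and> length (snd (f i)) = ntapes M \<and> (\<forall>tp \<in> set (snd (f i)). \<forall>z. fst tp z \<in> S)" if "i \<le> n" for i
    using that
  proof (induction i)
    case 0
    have "fst (input_tape x) z \<in> S" for z using S(1) input_tape_symbols[of x z] by blast
    then show ?case using Q(1) S(1) M by (auto simp: f(1) init initial_tapes_def wf_tm_def)
  next
    case (Suc i)
    then obtain \<delta> where \<delta>: "\<delta> \<in> trans M" "fires \<delta> (f i) (f (Suc i))" using f(3)[of i] unfolding tm_step_iff step_by_def by auto
    have "fst (act tp (b, m)) z \<in> S" if "tp \<in> set (snd (f i))" "b \<in> set (writes \<delta>)" for tp b m z
      using Suc that S(2)[OF \<delta>(1)] by (cases tp) (auto simp: act_def)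
    then show ?case using \<delta> Q(2) len[OF \<delta>(1)] Suc by (auto simp: fires_def dest!: set_zip_leftD set_zip_rightD elim!: in_set_zipE)
  qed
  have "n \<le> Z" using Z n by blast
  have "step_by (trans M \<union> idle (ntapes M) Q S) c0 c0"
  proof -
    let ?\<delta> = "(fst c0, map scanned (snd c0), fst c0, map scanned (snd c0), replicate (ntapes M) MStay)"
    have I: "fst c0 \<in> Q" "length (snd c0) = ntapes M" "\<forall>tp \<in> set (snd c0). \<forall>z. fst tp z \<in> S"
      using inv[of n] f(2) by auto
    have "scanned tp \<in> S" if "tp \<in> set (snd c0)" for tp
      using I(3) that by (simp add: scanned_def case_prod_beta)
    then have "?\<delta> \<in> idle (ntapes M) Q S" using I by (auto simp: idle_def)
    moreover have "fires ?\<delta> c0 c0" using map2_act_stay[OF I(2)] by (simp add: fires_def transition_parts prod_eq_iff)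
    ultimately show ?thesis unfolding step_by_def by blast
  qed
  moreover have "step_by (trans M \<union> idle (ntapes M) Q S) (f i) (f (Suc i))" if "i < n" for i
    using f(3)[OF that] unfolding tm_step_iff step_by_def by blast
  ultimately show ?r using f(1,2) c0(2) \<open>n \<le> Z\<close> init
    by (intro exI[of _ "\<lambda>t. f (min t n)"]) (auto simp: min_def not_le less_Suc_eq_le Suc_le_eq; metis le_antisym not_less_eq_eq Suc_leI)
next
  have init: "initial_config M x = (start M, initial_tapes (ntapes M) x)" by (simp add: initial_config_def initial_tapes_def)
  have len: "length (writes \<delta>) = ntapes M \<and> length (moves \<delta>) = ntapes M" if "\<delta> \<in> trans M" for \<delta>
    using M that unfolding wf_tm_def by (cases \<delta>) (auto simp: transition_parts)
  assume ?r
  then obtain c where c: "c 0 = (start M, initial_tapes (ntapes M) x)"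
    "\<And>t. t < Z \<Longrightarrow> step_by (trans M \<union> idle (ntapes M) Q S) (c t) (c (Suc t))" "fst (c Z) = accept M" by blast
  have "length (snd (c t)) = ntapes M \<and> (tm_step M)\<^sup>*\<^sup>* (initial_config M x) (c t)" if "t \<le> Z" for t
    using that
  proof (induction t)
    case 0
    show ?case using M by (simp add: c(1) init initial_tapes_def wf_tm_def)
  next
    case (Suc t)
    then have IH: "length (snd (c t)) = ntapes M" "(tm_step M)\<^sup>*\<^sup>* (initial_config M x) (c t)" by auto
    have "t < Z" using Suc.prems by simp
    from c(2)[OF this] obtain \<delta> where \<delta>: "\<delta> \<in> trans M \<or> \<delta> \<in> idle (ntapes M) Q S" "fires \<delta> (c t) (c (Suc t))"
      unfolding step_by_def by blast
    from \<delta>(1) show ?case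
    proof
      assume d: "\<delta> \<in> trans M"
      then have "tm_step M (c t) (c (Suc t))" using \<delta>(2) unfolding tm_step_iff step_by_def by blast
      then show ?thesis using IH \<delta>(2) len[OF d] by (auto simp: fires_def)
    next
      assume "\<delta> \<in> idle (ntapes M) Q S"
      then show ?thesis using idle_fires[OF _ \<delta>(2) IH(1)] IH by simp
    qed
  qed
  then show "tm_accepts M x" using c(3) unfolding tm_accepts_def by blast
qed

theorem NP_reducible:
  assumes "L \<in> NP" "k \<ge> 2"
  shows "polytime_reducible L (disjoint_branchings_problem k)" "polytime_reducible L (disjoint_branchings_problem_lifetime k 3)"
proof -
  from assms(1) obtain M and p :: "nat poly" where M: "wf_tm M"
    and p: "\<And>x n c. (tm_step M ^^ n) (initial_config M x) c \<Longrightarrow> n \<le> poly p (length x)"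
    and L: "\<And>x. x \<in> L \<longleftrightarrow> tm_accepts M x" unfolding NP_def by blast
  obtain c0 d0 where c0: "c0 \<ge> 1" "\<And>n. poly p n \<le> (n + c0) ^ d0" using poly_le_power[of p] by blast
  \<comment> \<open>The exponent is increased by one since \<open>powers\<close> produces positive
    powers.\<close>
  define W where "W x = word ((length x + c0) ^ (d0 + 1)) x" for x
  let ?n = "ntapes M"
  have fin: "finite (trans M)" and n: "?n \<ge> 1" using M by (auto simp: wf_tm_def)
  define S where "S = {0, 1, 2} \<union> (\<Union>\<delta> \<in> trans M. set (writes \<delta>))"
  define Q where "Q = insert (start M) (target ` trans M)"
  define D where "D = trans M \<union> idle ?n Q S"
  have finS: "finite S" "finite Q" "finite D" using fin by (auto simp: S_def Q_def D_def intro!: finite_idle)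
  obtain syms where syms: "set syms = S" using finite_list[OF finS(1)] by blast
  obtain ds where ds: "set ds = D" using finite_list[OF finS(3)] by blast
  define VS where "VS = Fires ` D \<union> (\<Union>i < ?n. Holds i ` S)"
  have "finite VS" using finS by (simp add: VS_def)
  then obtain vs where vs: "set vs = VS" "distinct vs" using finite_distinct_list by blast
  let ?cs = "tm_schemes (start M) (accept M) ?n syms ds"
  have D: "length (writes \<delta>) = ?n \<and> length (moves \<delta>) = ?n \<and> length (reads \<delta>) = ?n \<and> set (writes \<delta>) \<subseteq> S" if "\<delta> \<in> D" for \<delta>
    using that M unfolding D_def wf_tm_def by (cases \<delta>) (auto simp: transition_parts idle_def S_def lists_eq_set; fastforce)
  have ls: "fst l \<in> set vs \<and> fst (snd l) \<le> 1" if "(A, ls) \<in> set ?cs" "l \<in> set ls" for A ls l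
  proof -
    have "writes \<delta> ! i \<in> S" if "\<delta> \<in> D" "i < ?n" for \<delta> i
      using D[OF that(1)] that(2) by (metis nth_mem subsetD)
    moreover have "\<delta> \<in> D \<Longrightarrow> Fires \<delta> \<in> VS" "i < ?n \<Longrightarrow> a \<in> S \<Longrightarrow> Holds i a \<in> VS" for \<delta> i a by (auto simp: VS_def)
    ultimately show ?thesis using that unfolding vs(1) tm_schemes_def by (auto simp: syms ds)
  qed
  have "Holds 0 0 \<in> VS" using n by (force simp: VS_def S_def)
  then have "vs \<noteq> []" using vs(1) by auto
  have sat: "x \<in> L \<longleftrightarrow> cnf_satisfiable (length (W x)) (length ?cs) (length vs) (scheme_mem ?cs vs (W x))" for x
  proof -
    let ?Z = "(length x + c0) ^ (d0 + 1)"
    have Z1: "?Z \<ge> 1" using c0(1) by simp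
    have "(length x + c0) ^ d0 \<le> ?Z" using c0(1) by (intro power_increasing) auto
    then have bound: "m \<le> ?Z" if "(tm_step M ^^ m) (initial_config M x) c" for m c
      using p[OF that] c0(2)[of "length x"] by linarith
    have "x \<in> L \<longleftrightarrow> (\<exists>c. c 0 = (start M, initial_tapes ?n x) \<and> (\<forall>t < ?Z. step_by D (c t) (c (Suc t))) \<and> fst (c ?Z) = accept M)"
      unfolding L D_def using M by (rule accepts_iff_padded_run) (use bound in \<open>auto simp: S_def Q_def\<close>)
    also have "\<dots> \<longleftrightarrow> (\<exists>\<beta>. describes (start M) (accept M) ?n S D ?Z x \<beta>)"
      by (rule describes_iff_run[symmetric]) (use Z1 n D in \<open>auto simp: S_def\<close>)
    also have "\<dots> \<longleftrightarrow> scheme_satisfiable ?cs (W x)" unfolding W_def tm_schemes_describe[OF Z1] syms ds ..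
    also have "\<dots> \<longleftrightarrow> cnf_satisfiable (length (W x)) (length ?cs) (length vs) (scheme_mem ?cs vs (W x))"
    proof -
      have "W x \<noteq> []" by (simp add: W_def word_def)
      show ?thesis
        by (rule scheme_satisfiable_iff[symmetric], fact vs(2), fact \<open>vs \<noteq> []\<close>, fact \<open>W x \<noteq> []\<close>, fact ls)
    qed
    finally show ?thesis .
  qed
  have FO: "FO d (\<lambda>w \<rho> e. scheme_mem ?cs vs w \<kappa> j s (t e) (p e) (c e) (c' e))"
    if "\<kappa> < length ?cs" "tm_at d t" "tm_at d p" "tm_at d c" "tm_at d c'" for \<kappa> j s d t p c c'
    by (rule FO_scheme_mem) (use FO_tm_schemes that in blast)+
  note R = cnf_satisfiable_reducible[where mem = "scheme_mem ?cs vs" and W = W and nK = "length ?cs" and nJ = "length vs",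
      OF _ sat W_def assms(2)]
  show "polytime_reducible L (disjoint_branchings_problem k)" by (rule R(1), rule FO)
  show "polytime_reducible L (disjoint_branchings_problem_lifetime k 3)" by (rule R(2), rule FO)
qed

section \<open>Membership in NP\<close>

subsection \<open>Instances as lists of number lists\<close>

definition enc_tuple :: "nat list \<Rightarrow> bool list" where
  "enc_tuple e = concat (map enc_nat e)"

definition enc_lists :: "nat list list list \<Rightarrow> bool list" where
  "enc_lists LL = concat (map (enc_list enc_tuple) LL)"

definition pair_list :: "nat \<times> nat \<Rightarrow> nat list" where
  "pair_list = (\<lambda>(a, b). [a, b])"

text \<open>Vertices, arcs, temporal vertices, temporal edges and roots all become lists of number
  tuples of a fixed length per list, so that one parser covers them.\<close>

definition lists_of where
  "lists_of vs es tvs tes rs = [map (\<lambda>v. [v]) vs, map pair_list es, map pair_list tvs,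
     map (\<lambda>(a, b). pair_list a @ pair_list b) tes] @ map (map pair_list) rs"

lemma enc_lists_of: "enc_lists (lists_of vs es tvs tes rs) =
  enc_list enc_nat vs @ enc_list enc_nat2 es @ enc_list enc_nat2 tvs @
    enc_list (enc_pair enc_nat2 enc_nat2) tes @ concat (map (enc_list enc_nat2) rs)"
proof -
  have m: "enc_list e (map f xs) = enc_list (e \<circ> f) xs" for e :: "nat list \<Rightarrow> _" and f :: "'b \<Rightarrow> _" and xs
    by (simp add: enc_list_def)
  have "enc_tuple \<circ> (\<lambda>v. [v]) = enc_nat" "enc_tuple \<circ> pair_list = enc_nat2"
    "enc_tuple \<circ> (\<lambda>(a, b). pair_list a @ pair_list b) = enc_pair enc_nat2 enc_nat2"
    by (auto simp: fun_eq_iff enc_tuple_def pair_list_def enc_pair_def)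
  then show ?thesis by (simp add: enc_lists_def lists_of_def m comp_def[of "enc_list enc_tuple"])
qed

definition arity :: "nat \<Rightarrow> nat" where
  "arity l = (if l = 0 then 1 else if l = 3 then 4 else 2)"

definition well_shaped :: "nat list list list \<Rightarrow> bool" where
  "well_shaped LL \<longleftrightarrow> (\<forall>l < length LL. \<forall>e \<in> set (LL ! l). length e = arity l)"

definition to_pair :: "nat list \<Rightarrow> nat \<times> nat" where
  "to_pair e = (e ! 0, e ! 1)"

lemma pair_list_to_pair: "length e = 2 \<Longrightarrow> pair_list (to_pair e) = e"
  by (auto simp: pair_list_def to_pair_def numeral_2_eq_2 length_Suc_conv)

lemma map_inverse: "(\<And>e. e \<in> set xs \<Longrightarrow> f (g e) = e) \<Longrightarrow> \<exists>ys. xs = map f ys"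
  by (rule exI[of _ "map g xs"]) (simp add: map_idI comp_def)

lemma well_shaped_lists_of:
  assumes "well_shaped LL" "length LL = k + 4"
  shows "\<exists>vs es tvs tes rs. length rs = k \<and> LL = lists_of vs es tvs tes rs"
proof -
  obtain l0 l1 l2 l3 ls where LL: "LL = l0 # l1 # l2 # l3 # ls" "length ls = k"
    using assms(2) by (auto simp: length_Suc_conv numeral_eq_Suc)
  have len: "length e = arity l" if "l < k + 4" "e \<in> set (LL ! l)" for l e
    using assms that unfolding well_shaped_def by simp
  have "\<exists>vs. l0 = map (\<lambda>v. [v]) vs"
  proof (rule map_inverse[where g = hd])
    fix e assume "e \<in> set l0"
    then have "length e = 1" using len[of 0 e] by (simp add: LL arity_def)
    then show "[hd e] = e" by (cases e) auto
  qed
  moreover have "\<exists>es. l1 = map pair_list es" "\<exists>es. l2 = map pair_list es"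
    using len[of 1] len[of 2] by (intro map_inverse[where g = to_pair] pair_list_to_pair; simp add: LL arity_def)+
  moreover have "\<exists>tes. l3 = map (\<lambda>(a, b). pair_list a @ pair_list b) tes"
  proof (rule map_inverse[where g = "\<lambda>e. (to_pair e, to_pair (drop 2 e))"])
    fix e assume "e \<in> set l3"
    then have "length e = 4" using len[of 3 e] by (simp add: LL arity_def)
    then obtain a b c d where "e = [a, b, c, d]" by (auto simp: length_Suc_conv numeral_eq_Suc)
    then show "(case (to_pair e, to_pair (drop 2 e)) of (a, b) \<Rightarrow> pair_list a @ pair_list b) = e"
      by (simp add: pair_list_def to_pair_def)
  qed
  moreover have "\<exists>rs. ls = map (map pair_list) rs"
  proof (rule map_inverse)
    fix l assume "l \<in> set ls"
    then obtain i where i: "i < k" "l = ls ! i" using LL(2) by (metis in_set_conv_nth)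
    have "\<forall>e \<in> set l. length e = 2" using len[of "i + 4"] i by (auto simp: LL arity_def)
    then show "map pair_list (map to_pair l) = l" by (simp add: map_idI pair_list_to_pair)
  qed
  ultimately show ?thesis unfolding LL(1) lists_of_def using LL(2) by force
qed

definition consistent :: "nat \<Rightarrow> bool \<Rightarrow> nat set \<Rightarrow> (nat \<times> nat) set \<Rightarrow> nat tv set \<Rightarrow> (nat tv \<times> nat tv) set \<Rightarrow>
    (nat \<Rightarrow> nat tv set) \<Rightarrow> bool" where
  "consistent k life V E X Y R \<longleftrightarrow> E \<subseteq> V \<times> V \<and> (\<forall>x \<in> X. fst x \<in> V) \<and>
     (\<forall>(a, b) \<in> Y. (fst a, fst b) \<in> E \<and> snd a \<le> snd b \<and> a \<in> X \<and> b \<in> X) \<and> (\<forall>i < k. R i \<subseteq> X) \<and>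
     (life \<longrightarrow> (\<exists>x \<in> X. snd x = 3) \<and> (\<forall>x \<in> X. snd x \<le> 3)) \<and>
     (\<exists>F. (\<forall>i < k. F i \<subseteq> Y \<and> branch X (F i) (R i)) \<and>
       (\<forall>i < k. \<forall>j < k. i \<noteq> j \<longrightarrow> arcs_of (F i) \<inter> arcs_of (F j) = {}))"

text \<open>The two languages as one family, so that membership is proved once.\<close>

definition problem :: "nat \<Rightarrow> bool \<Rightarrow> bool list set" where
  "problem k life = {x. \<exists>T Rs. temporal_digraph T \<and> (life \<longrightarrow> has_lifetime T 3) \<and>
        length Rs = k \<and> (\<forall>R \<in> set Rs. R \<subseteq> tverts T) \<and> encodes x T Rs \<and> has_disjoint_branchings T Rs}"

lemma has_lifetime_iff:
  assumes "temporal_digraph T"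
  shows "has_lifetime T m \<longleftrightarrow> (\<exists>x \<in> tverts T. snd x = m) \<and> (\<forall>x \<in> tverts T. snd x \<le> m)"
proof -
  let ?A = "\<Union>v \<in> pverts (dgraph T). active T v"
  have A: "?A = snd ` tverts T" by (force simp: tverts_def)
  have "finite ?A" using assms by (auto simp: temporal_digraph_def dest: pair_fin_digraph.pair_finite_verts)
  then have "has_lifetime T m \<longleftrightarrow> m \<in> ?A \<and> (\<forall>t \<in> ?A. t \<le> m)"
    unfolding has_lifetime_def using Max_eq_iff[of ?A m] by auto
  then show ?thesis unfolding A by auto
qed

theorem problem_iff_lists:
  "x \<in> problem k life \<longleftrightarrow> (\<exists>vs es tvs tes rs. length rs = k \<and> distinct vs \<and> distinct es \<and> distinct tvs \<and> distinct tes \<and>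
     list_all distinct rs \<and> consistent k life (set vs) (set es) (set tvs) (set tes) (\<lambda>i. set (rs ! i)) \<and>
     x = enc_lists (lists_of vs es tvs tes rs))" (is "_ \<longleftrightarrow> ?r")
proof
  assume "x \<in> problem k life"
  then obtain T Rs where T: "temporal_digraph T" "life \<longrightarrow> has_lifetime T 3" "length Rs = k"
    "\<forall>R \<in> set Rs. R \<subseteq> tverts T" "encodes x T Rs" "has_disjoint_branchings T Rs" unfolding problem_def by blast
  from T(5) obtain vs es tvs tes rs where l: "distinct vs" "set vs = pverts (dgraph T)" "distinct es" "set es = parcs (dgraph T)"
    "distinct tvs" "set tvs = tverts T" "distinct tes" "set tes = tedges T" "list_all distinct rs" "map set rs = Rs"
    "x = enc_list enc_nat vs @ enc_list enc_nat2 es @ enc_list enc_nat2 tvs @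
            enc_list (enc_pair enc_nat2 enc_nat2) tes @ concat (map (enc_list enc_nat2) rs)"
    unfolding encodes_def by (elim exE conjE) (rule that; assumption)
  have rs: "length rs = k" "\<And>i. i < k \<Longrightarrow> set (rs ! i) = Rs ! i" using l(10) T(3) by auto
  have wf: "pair_wf_digraph (dgraph T)" using T(1) by (simp add: temporal_digraph_def pair_fin_digraph_def)
  obtain F where F: "(\<forall>i<k. F i \<subseteq> tedges T \<and> branch (tverts T) (F i) (Rs ! i)) \<and>
      (\<forall>i<k. \<forall>j<k. i \<noteq> j \<longrightarrow> arcs_of (F i) \<inter> arcs_of (F j) = {})"
    using T(6) unfolding has_disjoint_branchings_iff[OF T(1)] T(3) by (rule exE)
  have "consistent k life (set vs) (set es) (set tvs) (set tes) (\<lambda>i. set (rs ! i))"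
    unfolding consistent_def
  proof (intro conjI)
    show "set es \<subseteq> set vs \<times> set vs"
      unfolding l using pair_wf_digraph.arc_fst_in_verts[OF wf] pair_wf_digraph.arc_snd_in_verts[OF wf] by fastforce
    show "\<forall>x \<in> set tvs. fst x \<in> set vs" unfolding l by (auto simp: tverts_def)
    show "\<forall>(a, b) \<in> set tes. (fst a, fst b) \<in> set es \<and> snd a \<le> snd b \<and> a \<in> set tvs \<and> b \<in> set tvs"
      unfolding l using T(1) tedges_tverts[OF T(1)] by (fastforce simp: tedges_def temporal_digraph_def)
    show "\<forall>i<k. set (rs ! i) \<subseteq> set tvs" unfolding l(6) using T(3,4) rs by simp
    show "life \<longrightarrow> (\<exists>x \<in> set tvs. snd x = 3) \<and> (\<forall>x \<in> set tvs. snd x \<le> 3)"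
      unfolding l using T(2) has_lifetime_iff[OF T(1)] by simp
    show "\<exists>F. (\<forall>i < k. F i \<subseteq> set tes \<and> branch (set tvs) (F i) (set (rs ! i))) \<and>
       (\<forall>i < k. \<forall>j < k. i \<noteq> j \<longrightarrow> arcs_of (F i) \<inter> arcs_of (F j) = {})"
      unfolding l(6,8) using F rs by (intro exI[of _ F]) simp
  qed
  with l rs(1) show ?r unfolding enc_lists_of by blast
next
  assume ?r
  then obtain vs es tvs tes rs where l: "length rs = k" "distinct vs" "distinct es" "distinct tvs" "distinct tes"
     "list_all distinct rs" "consistent k life (set vs) (set es) (set tvs) (set tes) (\<lambda>i. set (rs ! i))"
     "x = enc_lists (lists_of vs es tvs tes rs)" by blast
  define T where "T = \<lparr>dgraph = \<lparr>pverts = set vs, parcs = set es\<rparr>, active = \<lambda>v. {t. (v, t) \<in> set tvs},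
    links = \<lambda>e. {(t, t'). ((fst e, t), (snd e, t')) \<in> set tes}\<rparr>"
  note c = l(7)[unfolded consistent_def]
  from c have c1: "set es \<subseteq> set vs \<times> set vs" "\<And>v t. (v, t) \<in> set tvs \<Longrightarrow> v \<in> set vs"
    "\<And>u t v t'. ((u, t), (v, t')) \<in> set tes \<Longrightarrow> (u, v) \<in> set es \<and> t \<le> t' \<and> (u, t) \<in> set tvs \<and> (v, t') \<in> set tvs"
    "\<And>i. i < k \<Longrightarrow> set (rs ! i) \<subseteq> set tvs" by fastforce+
  have X: "tverts T = set tvs" using c1(2) by (auto simp: tverts_def T_def)
  have Y: "tedges T = set tes" using c1(3) by (auto simp: tedges_def T_def)
  have fin: "finite {t. (v, t) \<in> set tvs}" for v
    by (rule finite_subset[of _ "snd ` set tvs"]) force+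
  have T: "temporal_digraph T"
    unfolding temporal_digraph_def
  proof (intro conjI)
    show "pair_fin_digraph (dgraph T)" using c1(1) by unfold_locales (auto simp: T_def)
  qed (use fin c1(3) in \<open>auto simp: T_def\<close>)
  have "encodes x T (map set rs)" unfolding encodes_def
    by (intro exI[of _ vs] exI[of _ es] exI[of _ tvs] exI[of _ tes] exI[of _ rs] conjI l(2-6) X[symmetric] Y[symmetric] l(8)[unfolded enc_lists_of])
      (simp_all add: T_def)
  moreover have "has_disjoint_branchings T (map set rs)"
    unfolding has_disjoint_branchings_iff[OF T] X Y using c l(1) by simp
  moreover have "life \<longrightarrow> has_lifetime T 3" unfolding has_lifetime_iff[OF T] X using c by (elim conjE)
  moreover have "\<forall>R \<in> set (map set rs). R \<subseteq> tverts T" unfolding X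
  proof
    fix R assume "R \<in> set (map set rs)"
    then obtain i where "i < k" "R = set (rs ! i)" using l(1) by (auto simp: in_set_conv_nth)
    then show "R \<subseteq> set tvs" using c1(4) by simp
  qed
  ultimately have "temporal_digraph T \<and> (life \<longrightarrow> has_lifetime T 3) \<and> length (map set rs) = k \<and>
    (\<forall>R \<in> set (map set rs). R \<subseteq> tverts T) \<and> encodes x T (map set rs) \<and> has_disjoint_branchings T (map set rs)"
    using T l(1) by simp
  then show "x \<in> problem k life" unfolding problem_def mem_Collect_eq
    by (rule exI[of _ T, OF exI[of _ "map set rs"]])
qed

subsection \<open>Instances as relations on positions\<close>

text \<open>An order is a binary relation and can be guessed, unlike a rank with numerical values.
  Conversely, on a finite set the number of smaller elements is a rank.\<close>

lemma branch_iff_order: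
  assumes "finite X" "F \<subseteq> X \<times> X"
  shows "branch X F R \<longleftrightarrow> (\<exists>Q. (\<forall>a b c. Q a b \<longrightarrow> Q b c \<longrightarrow> Q a c) \<and> (\<forall>a. \<not> Q a a) \<and>
    (\<forall>x \<in> X. if x \<in> R then in_steps X F x = {} else \<exists>z. in_steps X F x = {z} \<and> Q (src z) x))"
proof
  assume "branch X F R"
  then obtain rk :: "_ \<Rightarrow> nat" where rk: "\<forall>x \<in> X. if x \<in> R then in_steps X F x = {} else \<exists>z. in_steps X F x = {z} \<and> rk (src z) < rk x"
    unfolding branch_def by blast
  then show "\<exists>Q. (\<forall>a b c. Q a b \<longrightarrow> Q b c \<longrightarrow> Q a c) \<and> (\<forall>a. \<not> Q a a) \<and>
    (\<forall>x \<in> X. if x \<in> R then in_steps X F x = {} else \<exists>z. in_steps X F x = {z} \<and> Q (src z) x)"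
    by (intro exI[of _ "\<lambda>a b. rk a < rk b"]) auto
next
  assume "\<exists>Q. (\<forall>a b c. Q a b \<longrightarrow> Q b c \<longrightarrow> Q a c) \<and> (\<forall>a. \<not> Q a a) \<and>
    (\<forall>x \<in> X. if x \<in> R then in_steps X F x = {} else \<exists>z. in_steps X F x = {z} \<and> Q (src z) x)"
  then obtain Q where Q: "\<And>a b c. Q a b \<Longrightarrow> Q b c \<Longrightarrow> Q a c" "\<And>a. \<not> Q a a"
    "\<And>x. x \<in> X \<Longrightarrow> if x \<in> R then in_steps X F x = {} else \<exists>z. in_steps X F x = {z} \<and> Q (src z) x" by blast
  have "card {y \<in> X. Q y a} < card {y \<in> X. Q y b}" if "Q a b" "a \<in> X" for a b
  proof (rule psubset_card_mono)
    show "{y \<in> X. Q y a} \<subset> {y \<in> X. Q y b}" using that Q(1)[OF _ that(1)] Q(2)[of a] by blast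
  qed (use assms(1) in simp)
  then have rank: "card {y \<in> X. Q y a} < card {y \<in> X. Q y b}" if "Q a b" "a \<in> X" for a b using that by blast
  have X: "src z \<in> X" if "z \<in> in_steps X F x" for x z
    using that assms(2) by (auto simp: in_steps_def)
  show "branch X F R" unfolding branch_def
  proof (intro exI[of _ "\<lambda>x. card {y \<in> X. Q y x}"] ballI)
    fix x assume x: "x \<in> X"
    show "if x \<in> R then in_steps X F x = {} else \<exists>z. in_steps X F x = {z} \<and> card {y \<in> X. Q y (src z)} < card {y \<in> X. Q y x}"
    proof (cases "x \<in> R")
      case False
      then obtain z where z: "in_steps X F x = {z}" "Q (src z) x" using Q(3)[OF x] by auto
      then have "src z \<in> X" using X by blast
      then show ?thesis using False z rank by auto
    qed (use Q(3)[OF x] in simp)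
  qed
qed

text \<open>Serves for temporal edges, whose first two components are their start, and for entries
  of roots, which are temporal vertices themselves.\<close>

definition leaves :: "(nat \<Rightarrow> nat \<Rightarrow> nat \<Rightarrow> nat \<Rightarrow> nat \<Rightarrow> bool) \<Rightarrow> nat \<Rightarrow> nat \<Rightarrow> bool" where
  "leaves C p q \<longleftrightarrow> C 1 0 p 0 q \<and> C 1 1 p 1 q"

definition into :: "(nat \<Rightarrow> nat \<Rightarrow> nat \<Rightarrow> nat \<Rightarrow> nat \<Rightarrow> bool) \<Rightarrow> nat \<Rightarrow> nat \<Rightarrow> bool" where
  "into C p q \<longleftrightarrow> C 1 2 p 0 q \<and> C 1 3 p 1 q"

definition waits :: "(nat \<Rightarrow> nat \<Rightarrow> nat \<Rightarrow> nat \<Rightarrow> nat \<Rightarrow> bool) \<Rightarrow> nat \<Rightarrow> nat \<Rightarrow> bool" where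
  "waits C p q \<longleftrightarrow> C 1 0 p 0 q \<and> C 2 1 p 1 q"

text \<open>\<open>I l p\<close>: an item of the \<open>l\<close>-th list starts at position \<open>p\<close>. \<open>C a j p j' q\<close> compares component \<open>j\<close> at \<open>p\<close> with
  component \<open>j'\<close> at \<open>q\<close>, for equality, succession and order according to \<open>a\<close>.\<close>

definition valid :: "nat \<Rightarrow> bool \<Rightarrow> nat \<Rightarrow> (nat \<Rightarrow> nat \<Rightarrow> bool) \<Rightarrow> (nat \<Rightarrow> nat \<Rightarrow> nat \<Rightarrow> nat \<Rightarrow> nat \<Rightarrow> bool) \<Rightarrow>
    (bool \<Rightarrow> nat \<Rightarrow> bool) \<Rightarrow> (nat \<Rightarrow> nat \<Rightarrow> bool) \<Rightarrow> (nat \<Rightarrow> nat \<Rightarrow> nat \<Rightarrow> bool) \<Rightarrow> bool" where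
  "valid k life U I C B F J \<longleftrightarrow>
   (\<forall>l<k + 4. \<forall>p<U. \<forall>q<U. I l p \<longrightarrow> I l q \<longrightarrow> (\<forall>j<arity l. C 1 j p j q) \<longrightarrow> p = q) \<and>
   (\<forall>p<U. I 1 p \<longrightarrow> (\<exists>q<U. I 0 q \<and> C 1 0 p 0 q) \<and> (\<exists>q<U. I 0 q \<and> C 1 1 p 0 q)) \<and>
   (\<forall>p<U. I 2 p \<longrightarrow> (\<exists>q<U. I 0 q \<and> C 1 0 p 0 q)) \<and>
   (\<forall>p<U. I 3 p \<longrightarrow> (\<exists>q<U. I 1 q \<and> C 1 0 p 0 q \<and> C 1 2 p 1 q) \<and> C 3 1 p 3 p \<and>
     (\<exists>q<U. I 2 q \<and> leaves C p q) \<and> (\<exists>q<U. I 2 q \<and> into C p q)) \<and>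
   (\<forall>i<k. \<forall>p<U. I (i + 4) p \<longrightarrow> (\<exists>q<U. I 2 q \<and> leaves C p q)) \<and>
   (life \<longrightarrow> (\<exists>p<U. I 2 p \<and> B True p) \<and> (\<forall>p<U. I 2 p \<longrightarrow> B False p)) \<and>
   (\<forall>i<k. (\<forall>p<U. \<forall>q<U. \<forall>r<U. J i p q \<longrightarrow> J i q r \<longrightarrow> J i p r) \<and> (\<forall>p<U. \<not> J i p p) \<and>
     (\<forall>x<U. I 2 x \<longrightarrow>
       (\<exists>r<U. I (i + 4) r \<and> leaves C r x) \<and> (\<forall>e<U. I 3 e \<longrightarrow> F i e \<longrightarrow> \<not> into C e x) \<and> (\<forall>y<U. I 2 y \<longrightarrow> \<not> waits C y x) \<or>
       \<not> (\<exists>r<U. I (i + 4) r \<and> leaves C r x) \<and>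
         ((\<exists>e<U. (I 3 e \<and> F i e \<and> into C e x) \<and> (\<forall>e'<U. I 3 e' \<longrightarrow> F i e' \<longrightarrow> into C e' x \<longrightarrow> e' = e) \<and>
            (\<exists>y<U. I 2 y \<and> leaves C e y \<and> J i y x)) \<and> (\<forall>y<U. I 2 y \<longrightarrow> \<not> waits C y x) \<or>
          (\<forall>e<U. I 3 e \<longrightarrow> F i e \<longrightarrow> \<not> into C e x) \<and> (\<exists>y<U. I 2 y \<and> waits C y x \<and> J i y x)))) \<and>
   (\<forall>i<k. \<forall>j<k. i \<noteq> j \<longrightarrow> (\<forall>p<U. \<forall>q<U. I 3 p \<longrightarrow> F i p \<longrightarrow> I 3 q \<longrightarrow> F j q \<longrightarrow> \<not> (C 1 0 p 0 q \<and> C 1 2 p 2 q)))"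

locale item_positions =
  fixes k U :: nat and life :: bool and I :: "nat \<Rightarrow> nat \<Rightarrow> bool" and C :: "nat \<Rightarrow> nat \<Rightarrow> nat \<Rightarrow> nat \<Rightarrow> nat \<Rightarrow> bool"
    and B :: "bool \<Rightarrow> nat \<Rightarrow> bool" and val :: "nat \<Rightarrow> nat \<Rightarrow> nat \<Rightarrow> nat"
  assumes I: "I l p \<Longrightarrow> p < U"
    and C1: "\<lbrakk>I l p; I l' q; l < k + 4; l' < k + 4; j < arity l; j' < arity l'\<rbrakk> \<Longrightarrow> C 1 j p j' q \<longleftrightarrow> val l p j = val l' q j'"
    and C2: "\<lbrakk>I l p; I l' q; l < k + 4; l' < k + 4; j < arity l; j' < arity l'\<rbrakk> \<Longrightarrow> C 2 j p j' q \<longleftrightarrow> val l' q j' = Suc (val l p j)"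
    and C3: "\<lbrakk>I l p; I l' q; l < k + 4; l' < k + 4; j < arity l; j' < arity l'\<rbrakk> \<Longrightarrow> C 3 j p j' q \<longleftrightarrow> val l p j \<le> val l' q j'"
    and B: "I 2 p \<Longrightarrow> B True p \<longleftrightarrow> val 2 p 1 = 3" "I 2 p \<Longrightarrow> B False p \<longleftrightarrow> val 2 p 1 \<le> 3"
begin

section \<open>Validity of an instance in terms of positions\<close>

definition pr :: "nat \<Rightarrow> nat \<Rightarrow> nat \<times> nat" where
  "pr l p = (val l p 0, val l p 1)"

definition ed :: "nat \<Rightarrow> (nat \<times> nat) \<times> (nat \<times> nat)" where
  "ed p = ((val 3 p 0, val 3 p 1), (val 3 p 2, val 3 p 3))"

abbreviation "X \<equiv> pr 2 ` {p. I 2 p}"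

lemma ar: "arity 0 = 1" "arity 1 = 2" "arity 2 = 2" "arity 3 = 4" "arity (i + 4) = 2"
  by (simp_all add: arity_def)

lemma cmp:
  "I 1 p \<Longrightarrow> I 0 q \<Longrightarrow> C 1 0 p 0 q \<longleftrightarrow> fst (pr 1 p) = val 0 q 0"
  "I 1 p \<Longrightarrow> I 0 q \<Longrightarrow> C 1 1 p 0 q \<longleftrightarrow> snd (pr 1 p) = val 0 q 0"
  "I 2 p \<Longrightarrow> I 0 q \<Longrightarrow> C 1 0 p 0 q \<longleftrightarrow> fst (pr 2 p) = val 0 q 0"
  "I 3 p \<Longrightarrow> I 1 q \<Longrightarrow> C 1 0 p 0 q \<and> C 1 2 p 1 q \<longleftrightarrow> (fst (fst (ed p)), fst (snd (ed p))) = pr 1 q"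
  "I 3 p \<Longrightarrow> C 3 1 p 3 p \<longleftrightarrow> snd (fst (ed p)) \<le> snd (snd (ed p))"
  "I 3 p \<Longrightarrow> I 2 q \<Longrightarrow> leaves C p q \<longleftrightarrow> pr 2 q = fst (ed p)"
  "I 3 p \<Longrightarrow> I 2 q \<Longrightarrow> into C p q \<longleftrightarrow> pr 2 q = snd (ed p)"
  "i < k \<Longrightarrow> I (i + 4) p \<Longrightarrow> I 2 q \<Longrightarrow> leaves C p q \<longleftrightarrow> pr 2 q = pr (i + 4) p"
  "I 2 p \<Longrightarrow> I 2 q \<Longrightarrow> waits C p q \<longleftrightarrow> fst (pr 2 p) = fst (pr 2 q) \<and> snd (pr 2 q) = Suc (snd (pr 2 p))"
  "I 3 p \<Longrightarrow> I 3 q \<Longrightarrow> C 1 0 p 0 q \<and> C 1 2 p 2 q \<longleftrightarrow> fst (fst (ed p)) = fst (fst (ed q)) \<and> fst (snd (ed p)) = fst (snd (ed q))"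
  by (auto simp: leaves_def into_def waits_def pr_def ed_def C1[of 1 _ 0] C1[of 2 _ 0] C1[of 3 _ 1] C1[of 3 _ 2] C1[of "i + 4" _ 2] C1[of 2 _ 2] C2[of 2 _ 2]
    C3[of 3 _ 3] C1[of 3 _ 3] ar)

text \<open>The condition of \<open>branch_iff_order\<close> at one temporal vertex. All waiting
  steps into \<open>x\<close> have the same source, so uniqueness is expressed by a single edge or a
  wait, but not both.\<close>

definition step_condition :: "(nat \<Rightarrow> bool) \<Rightarrow> (nat \<Rightarrow> nat \<Rightarrow> bool) \<Rightarrow> nat \<Rightarrow> nat \<Rightarrow> bool" where
  "step_condition F J i x \<longleftrightarrow>
       (\<exists>r<U. I (i + 4) r \<and> leaves C r x) \<and> (\<forall>e<U. I 3 e \<longrightarrow> F e \<longrightarrow> \<not> into C e x) \<and> (\<forall>y<U. I 2 y \<longrightarrow> \<not> waits C y x) \<or>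
       \<not> (\<exists>r<U. I (i + 4) r \<and> leaves C r x) \<and>
         ((\<exists>e<U. (I 3 e \<and> F e \<and> into C e x) \<and> (\<forall>e'<U. I 3 e' \<longrightarrow> F e' \<longrightarrow> into C e' x \<longrightarrow> e' = e) \<and>
            (\<exists>y<U. I 2 y \<and> leaves C e y \<and> J y x)) \<and> (\<forall>y<U. I 2 y \<longrightarrow> \<not> waits C y x) \<or>
          (\<forall>e<U. I 3 e \<longrightarrow> F e \<longrightarrow> \<not> into C e x) \<and> (\<exists>y<U. I 2 y \<and> waits C y x \<and> J y x))"

lemma singleton_union_iff:
  "Inl ` S \<union> Inr ` S' = {z} \<longleftrightarrow> (\<exists>a. z = Inl a \<and> S = {a} \<and> S' = {}) \<or> (\<exists>b. z = Inr b \<and> S = {} \<and> S' = {b})"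
  (is "?l \<longleftrightarrow> ?r")
proof
  assume l: ?l
  show ?r
  proof (cases z)
    case (Inl a)
    then have "S \<subseteq> {a}" "S' = {}" "S \<noteq> {}" using l by auto
    then show ?thesis using Inl by auto
  next
    case (Inr b)
    then have "S' \<subseteq> {b}" "S = {}" "S' \<noteq> {}" using l by auto
    then show ?thesis using Inr by auto
  qed
qed auto

lemma step_condition_iff:
  assumes inj: "inj_on (pr 2) {p. I 2 p}" "inj_on ed {p. I 3 p}" and i: "i < k" and x: "I 2 x"
    and Q: "\<And>y. I 2 y \<Longrightarrow> J y x \<longleftrightarrow> Q (pr 2 y) (pr 2 x)"
    and E: "\<And>e. I 3 e \<Longrightarrow> fst (ed e) \<in> X"
  shows "step_condition F J i x \<longleftrightarrow> (if pr 2 x \<in> pr (i + 4) ` {p. I (i + 4) p} then in_steps X (ed ` {e. I 3 e \<and> F e}) (pr 2 x) = {}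
    else \<exists>z. in_steps X (ed ` {e. I 3 e \<and> F e}) (pr 2 x) = {z} \<and> Q (src z) (pr 2 x))"
proof -
  define S where "S = {y. (y, pr 2 x) \<in> ed ` {e. I 3 e \<and> F e}}"
  define S' where "S' = {y \<in> X. fst y = fst (pr 2 x) \<and> snd (pr 2 x) = Suc (snd y)}"
  have st: "in_steps X (ed ` {e. I 3 e \<and> F e}) (pr 2 x) = Inl ` S \<union> Inr ` S'"
    by (simp add: in_steps_def S_def S'_def)
  have r: "(\<exists>r<U. I (i + 4) r \<and> leaves C r x) \<longleftrightarrow> pr 2 x \<in> pr (i + 4) ` {p. I (i + 4) p}"
    using I cmp(8)[OF i _ x] by auto
  have S: "y \<in> S \<longleftrightarrow> (\<exists>e<U. (I 3 e \<and> F e \<and> into C e x) \<and> fst (ed e) = y)" for y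
    unfolding S_def using I cmp(7)[OF _ x] by (auto simp: image_iff prod_eq_iff; metis)
  have S': "y \<in> S' \<longleftrightarrow> (\<exists>p<U. I 2 p \<and> waits C p x \<and> pr 2 p = y)" for y
    unfolding S'_def using I cmp(9)[OF _ x] by auto
  have S'1: "S' = {b}" if "b \<in> S'" for b
    using that unfolding S'_def by (auto simp: prod_eq_iff)
  have nS: "(\<forall>e<U. I 3 e \<longrightarrow> F e \<longrightarrow> \<not> into C e x) \<longleftrightarrow> S = {}" using S by blast
  have nS': "(\<forall>y<U. I 2 y \<longrightarrow> \<not> waits C y x) \<longleftrightarrow> S' = {}" using S' by blast
  have w: "(\<exists>y<U. I 2 y \<and> waits C y x \<and> J y x) \<longleftrightarrow> (\<exists>b. S' = {b} \<and> Q b (pr 2 x))"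
  proof
    assume "\<exists>y<U. I 2 y \<and> waits C y x \<and> J y x"
    then obtain y where y: "y < U" "I 2 y" "waits C y x" "J y x" by blast
    then have "pr 2 y \<in> S'" using S' by blast
    then show "\<exists>b. S' = {b} \<and> Q b (pr 2 x)" using S'1 Q y by blast
  next
    assume "\<exists>b. S' = {b} \<and> Q b (pr 2 x)"
    then obtain b where b: "S' = {b}" "Q b (pr 2 x)" by blast
    then have "b \<in> S'" by simp
    then obtain p where "p < U" "I 2 p" "waits C p x" "pr 2 p = b" using S' by blast
    then show "\<exists>y<U. I 2 y \<and> waits C y x \<and> J y x" using Q b by blast
  qed
  have e: "(\<exists>e<U. (I 3 e \<and> F e \<and> into C e x) \<and> (\<forall>e'<U. I 3 e' \<longrightarrow> F e' \<longrightarrow> into C e' x \<longrightarrow> e' = e) \<and>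
            (\<exists>y<U. I 2 y \<and> leaves C e y \<and> J y x)) \<longleftrightarrow> (\<exists>a. S = {a} \<and> Q a (pr 2 x))" (is "?l \<longleftrightarrow> ?r")
  proof
    assume ?l
    then obtain e y where e: "e < U" "I 3 e" "F e" "into C e x" "\<forall>e'<U. I 3 e' \<longrightarrow> F e' \<longrightarrow> into C e' x \<longrightarrow> e' = e"
      "I 2 y" "leaves C e y" "J y x" by blast
    have "S = {fst (ed e)}"
    proof
      show "S \<subseteq> {fst (ed e)}"
      proof
        fix y assume "y \<in> S"
        then obtain e' where "e' < U" "I 3 e'" "F e'" "into C e' x" "fst (ed e') = y" using S by blast
        then show "y \<in> {fst (ed e)}" using e(5) by blast
      qed
      show "{fst (ed e)} \<subseteq> S" using S e(1-4) by blast
    qed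
    moreover have "Q (fst (ed e)) (pr 2 x)" using Q[OF e(6)] e(8) cmp(6)[OF e(2,6)] e(7) by simp
    ultimately show ?r by blast
  next
    assume ?r
    then obtain a where a: "S = {a}" "Q a (pr 2 x)" by blast
    then have "a \<in> S" by blast
    then obtain e where e: "e < U" "I 3 e" "F e" "into C e x" "fst (ed e) = a" using S by blast
    have "e' = e" if "e' < U" "I 3 e'" "F e'" "into C e' x" for e'
    proof -
      have "fst (ed e') \<in> S" using S that by blast
      then have "fst (ed e') = fst (ed e)" using a(1) e(5) by simp
      moreover have "snd (ed e') = snd (ed e)" using cmp(7)[OF _ x] that(2,4) e(2,4) by metis
      ultimately show ?thesis using inj(2) that(2) e(2) by (metis (mono_tags) inj_onD mem_Collect_eq prod_eqI)
    qed
    moreover obtain y where "I 2 y" "pr 2 y = fst (ed e)" using E[OF e(2)] by auto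
    moreover from this have "J y x" "leaves C e y" using Q a e cmp(6)[OF e(2)] by auto
    ultimately show ?l using e I by blast
  qed
  show ?thesis unfolding step_condition_def r nS nS' w e st singleton_union_iff
    by (simp only: Inl_not_Inr image_is_empty Un_empty if_split) auto
qed

definition consistent_positions :: bool where
  "consistent_positions \<longleftrightarrow> inj_on (\<lambda>p. val 0 p 0) {p. I 0 p} \<and> inj_on (pr 1) {p. I 1 p} \<and> inj_on (pr 2) {p. I 2 p} \<and>
     inj_on ed {p. I 3 p} \<and> (\<forall>i<k. inj_on (pr (i + 4)) {p. I (i + 4) p}) \<and>
     consistent k life ((\<lambda>p. val 0 p 0) ` {p. I 0 p}) (pr 1 ` {p. I 1 p}) X (ed ` {p. I 3 p}) (\<lambda>i. pr (i + 4) ` {p. I (i + 4) p})"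

lemma distinct_items_iff:
  "(\<forall>l<k + 4. \<forall>p<U. \<forall>q<U. I l p \<longrightarrow> I l q \<longrightarrow> (\<forall>j<arity l. C 1 j p j q) \<longrightarrow> p = q) \<longleftrightarrow>
     inj_on (\<lambda>p. val 0 p 0) {p. I 0 p} \<and> inj_on (pr 1) {p. I 1 p} \<and> inj_on (pr 2) {p. I 2 p} \<and>
     inj_on ed {p. I 3 p} \<and> (\<forall>i<k. inj_on (pr (i + 4)) {p. I (i + 4) p})" (is "?l \<longleftrightarrow> _")
proof -
  define G where "G l \<longleftrightarrow> (\<forall>p q. I l p \<longrightarrow> I l q \<longrightarrow> (\<forall>j<arity l. val l p j = val l q j) \<longrightarrow> p = q)" for l
  have "?l \<longleftrightarrow> (\<forall>l<k + 4. G l)" unfolding G_def using I C1 by meson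
  also have "\<dots> \<longleftrightarrow> G 0 \<and> G 1 \<and> G 2 \<and> G 3 \<and> (\<forall>i<k. G (i + 4))"
  proof (intro iffI conjI allI impI)
    fix l assume G: "G 0 \<and> G 1 \<and> G 2 \<and> G 3 \<and> (\<forall>i<k. G (i + 4))" and l: "l < k + 4"
    have "l = 0 \<or> l = 1 \<or> l = 2 \<or> l = 3 \<or> l = (l - 4) + 4 \<and> l - 4 < k" using l by linarith
    then show "G l" using G by metis
  qed auto
  finally have l: "?l \<longleftrightarrow> G 0 \<and> G 1 \<and> G 2 \<and> G 3 \<and> (\<forall>i<k. G (i + 4))" .
  have 0: "G 0 \<longleftrightarrow> inj_on (\<lambda>p. val 0 p 0) {p. I 0 p}" by (auto simp: G_def inj_on_def ar)
  have 2: "G l \<longleftrightarrow> inj_on (pr l) {p. I l p}" if "arity l = 2" for l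
  proof -
    have "(\<forall>j<2. P j) \<longleftrightarrow> P 0 \<and> P (1::nat)" for P by (auto simp: less_2_cases_iff One_nat_def)
    then show ?thesis using that by (auto simp: G_def inj_on_def pr_def)
  qed
  have "(\<forall>j<4. P j) \<longleftrightarrow> P 0 \<and> P 1 \<and> P 2 \<and> P (3::nat)" for P
    by (auto simp: numeral_eq_Suc less_Suc_eq One_nat_def)
  then have 3: "G 3 \<longleftrightarrow> inj_on ed {p. I 3 p}" by (auto simp: G_def inj_on_def ed_def ar)
  show ?thesis unfolding l 0 3 by (simp add: 2 ar)
qed

lemma branching_positions_iff:
  assumes inj: "inj_on (pr 2) {p. I 2 p}" "inj_on ed {p. I 3 p}" and i: "i < k"
    and E: "\<And>e. I 3 e \<Longrightarrow> fst (ed e) \<in> X \<and> snd (ed e) \<in> X"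
  shows "(\<exists>J. (\<forall>p<U. \<forall>q<U. \<forall>r<U. J p q \<longrightarrow> J q r \<longrightarrow> J p r) \<and> (\<forall>p<U. \<not> J p p) \<and>
      (\<forall>x<U. I 2 x \<longrightarrow> step_condition F J i x)) \<longleftrightarrow>
    branch X (ed ` {e. I 3 e \<and> F e}) (pr (i + 4) ` {p. I (i + 4) p})" (is "?l \<longleftrightarrow> branch X ?F ?R")
proof -
  have "finite {p. I 2 p}" by (rule finite_subset[of _ "{..<U}"]) (use I in auto)
  then have fin: "finite X" by simp
  have sub: "?F \<subseteq> X \<times> X"
  proof (rule image_subsetI)
    fix e assume "e \<in> {e. I 3 e \<and> F e}"
    then show "ed e \<in> X \<times> X" using E[of e] by (simp only: mem_Times_iff mem_Collect_eq)
  qed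
  have "?l \<longleftrightarrow> (\<exists>Q. (\<forall>a b c. Q a b \<longrightarrow> Q b c \<longrightarrow> Q a c) \<and> (\<forall>a. \<not> Q a a) \<and>
    (\<forall>x \<in> X. if x \<in> ?R then in_steps X ?F x = {} else \<exists>z. in_steps X ?F x = {z} \<and> Q (src z) x))"
  proof
    assume ?l
    then obtain J where J: "\<forall>p<U. \<forall>q<U. \<forall>r<U. J p q \<longrightarrow> J q r \<longrightarrow> J p r" "\<forall>p<U. \<not> J p p"
      "\<And>x. I 2 x \<Longrightarrow> step_condition F J i x" using I by blast
    \<comment> \<open>The order is carried from positions over to temporal vertices; injectivity of
      \<open>pr 2\<close> makes this faithful.\<close>
    define Q where "Q a b \<longleftrightarrow> (\<exists>p q. I 2 p \<and> I 2 q \<and> pr 2 p = a \<and> pr 2 q = b \<and> J p q)" for a b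
    have Q: "J p q \<longleftrightarrow> Q (pr 2 p) (pr 2 q)" if "I 2 p" "I 2 q" for p q
      unfolding Q_def using that inj(1) by (auto simp: inj_on_def)
    have "Q a c" if ab: "Q a b" and bc: "Q b c" for a b c
    proof -
      obtain p q where p: "I 2 p" "I 2 q" "pr 2 p = a" "pr 2 q = b" "J p q" using ab unfolding Q_def by blast
      obtain q' r where q: "I 2 q'" "I 2 r" "pr 2 q' = b" "pr 2 r = c" "J q' r" using bc unfolding Q_def by blast
      have "q' = q" using inj_onD[OF inj(1), of q' q] p q by simp
      then have "J p r" using J(1) I[OF p(1)] I[OF p(2)] I[OF q(2)] p(5) q(5) by blast
      then show ?thesis unfolding Q_def using p(1,3) q(2,4) by blast
    qed
    moreover have "\<not> Q a a" for a
    proof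
      assume "Q a a"
      then obtain p q where p: "I 2 p" "I 2 q" "pr 2 p = a" "pr 2 q = a" "J p q" unfolding Q_def by blast
      have "q = p" using inj_onD[OF inj(1), of q p] p by simp
      then show False using J(2) I[OF p(1)] p(5) by blast
    qed
    moreover have "if x \<in> ?R then in_steps X ?F x = {} else \<exists>z. in_steps X ?F x = {z} \<and> Q (src z) x" if x: "x \<in> X" for x
    proof -
      obtain p where p: "I 2 p" "x = pr 2 p" using x by blast
      have "step_condition F J i p \<longleftrightarrow> (if pr 2 p \<in> ?R then in_steps X ?F (pr 2 p) = {}
        else \<exists>z. in_steps X ?F (pr 2 p) = {z} \<and> Q (src z) (pr 2 p))"
        by (rule step_condition_iff[OF inj i p(1)]) (simp add: Q p(1), rule conjunct1[OF E])
      then show ?thesis using J(3)[OF p(1)] unfolding p(2) by blast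
    qed
    ultimately show "\<exists>Q. (\<forall>a b c. Q a b \<longrightarrow> Q b c \<longrightarrow> Q a c) \<and> (\<forall>a. \<not> Q a a) \<and>
      (\<forall>x \<in> X. if x \<in> ?R then in_steps X ?F x = {} else \<exists>z. in_steps X ?F x = {z} \<and> Q (src z) x)" by (intro exI[of _ Q]) blast
  next
    assume "\<exists>Q. (\<forall>a b c. Q a b \<longrightarrow> Q b c \<longrightarrow> Q a c) \<and> (\<forall>a. \<not> Q a a) \<and>
      (\<forall>x \<in> X. if x \<in> ?R then in_steps X ?F x = {} else \<exists>z. in_steps X ?F x = {z} \<and> Q (src z) x)"
    then obtain Q where "(\<forall>a b c. Q a b \<longrightarrow> Q b c \<longrightarrow> Q a c) \<and> (\<forall>a. \<not> Q a a) \<and>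
      (\<forall>x \<in> X. if x \<in> ?R then in_steps X ?F x = {} else \<exists>z. in_steps X ?F x = {z} \<and> Q (src z) x)" by (rule exE)
    note Q = this[THEN conjunct1, rule_format] this[THEN conjunct2, THEN conjunct1, rule_format]
      this[THEN conjunct2, THEN conjunct2, THEN bspec]
    define J where "J p q \<longleftrightarrow> I 2 p \<and> I 2 q \<and> Q (pr 2 p) (pr 2 q)" for p q
    have "step_condition F J i x" if "I 2 x" for x
    proof -
      have "step_condition F J i x \<longleftrightarrow> (if pr 2 x \<in> ?R then in_steps X ?F (pr 2 x) = {}
        else \<exists>z. in_steps X ?F (pr 2 x) = {z} \<and> Q (src z) (pr 2 x))"
        by (rule step_condition_iff[OF inj i that]) (simp add: J_def that, rule conjunct1[OF E])
      moreover have "pr 2 x \<in> X" using that by blast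
      ultimately show ?thesis using Q(3)[of "pr 2 x"] by simp
    qed
    moreover have "J p r" if "J p q" "J q r" for p q r
      using that Q(1)[of "pr 2 p" "pr 2 q" "pr 2 r"] unfolding J_def by blast
    moreover have "\<not> J p p" for p unfolding J_def using Q(2) by blast
    ultimately show ?l by blast
  qed
  then show ?thesis unfolding branch_iff_order[OF fin sub] .
qed

theorem valid_iff: "(\<exists>F J. valid k life U I C B F J) \<longleftrightarrow> consistent_positions"
proof -
  let ?V = "(\<lambda>p. val 0 p 0) ` {p. I 0 p}" and ?E = "pr 1 ` {p. I 1 p}" and ?Y = "ed ` {p. I 3 p}"
    and ?R = "\<lambda>i. pr (i + 4) ` {p. I (i + 4) p}"
  let ?inj = "inj_on (\<lambda>p. val 0 p 0) {p. I 0 p} \<and> inj_on (pr 1) {p. I 1 p} \<and> inj_on (pr 2) {p. I 2 p} \<and>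
     inj_on ed {p. I 3 p} \<and> (\<forall>i<k. inj_on (pr (i + 4)) {p. I (i + 4) p})"
  \<comment> \<open>The conditions on the instance are split from those on the guesses. The latter
    are analysed under the former, which supply distinct items and edges between listed temporal
    vertices.\<close>
  define static where "static \<longleftrightarrow> ?inj \<and> ?E \<subseteq> ?V \<times> ?V \<and> (\<forall>x \<in> X. fst x \<in> ?V) \<and>
     (\<forall>(a, b) \<in> ?Y. (fst a, fst b) \<in> ?E \<and> snd a \<le> snd b \<and> a \<in> X \<and> b \<in> X) \<and> (\<forall>i < k. ?R i \<subseteq> X) \<and>
     (life \<longrightarrow> (\<exists>x \<in> X. snd x = 3) \<and> (\<forall>x \<in> X. snd x \<le> 3))"
  define dynamic where "dynamic F J \<longleftrightarrow> (\<forall>i<k. (\<forall>p<U. \<forall>q<U. \<forall>r<U. J i p q \<longrightarrow> J i q r \<longrightarrow> J i p r) \<and> (\<forall>p<U. \<not> J i p p) \<and>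
      (\<forall>x<U. I 2 x \<longrightarrow> step_condition (F i) (J i) i x)) \<and>
    (\<forall>i<k. \<forall>j<k. i \<noteq> j \<longrightarrow> (\<forall>p<U. \<forall>q<U. I 3 p \<longrightarrow> F i p \<longrightarrow> I 3 q \<longrightarrow> F j q \<longrightarrow> \<not> (C 1 0 p 0 q \<and> C 1 2 p 2 q)))" for F J
  have ex: "(\<exists>q<U. I l q \<and> P q) \<longleftrightarrow> (\<exists>q. I l q \<and> P q)" and all: "(\<forall>q<U. I l q \<longrightarrow> P q) \<longleftrightarrow> (\<forall>q. I l q \<longrightarrow> P q)" for l P
    using I by blast+
  have 2: "(\<forall>p<U. I 1 p \<longrightarrow> (\<exists>q<U. I 0 q \<and> C 1 0 p 0 q) \<and> (\<exists>q<U. I 0 q \<and> C 1 1 p 0 q)) \<longleftrightarrow> ?E \<subseteq> ?V \<times> ?V"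
  proof -
    have "(\<exists>q. I 0 q \<and> C 1 0 p 0 q) \<longleftrightarrow> fst (pr 1 p) \<in> ?V" "(\<exists>q. I 0 q \<and> C 1 1 p 0 q) \<longleftrightarrow> snd (pr 1 p) \<in> ?V" if "I 1 p" for p
      using cmp(1,2)[OF that] by (auto simp: image_iff)
    then show ?thesis unfolding ex all by (auto simp: image_subset_iff mem_Times_iff)
  qed
  have 3: "(\<forall>p<U. I 2 p \<longrightarrow> (\<exists>q<U. I 0 q \<and> C 1 0 p 0 q)) \<longleftrightarrow> (\<forall>x \<in> X. fst x \<in> ?V)"
  proof -
    have "(\<exists>q. I 0 q \<and> C 1 0 p 0 q) \<longleftrightarrow> fst (pr 2 p) \<in> ?V" if "I 2 p" for p
      using cmp(3)[OF that] by (auto simp: image_iff)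
    then show ?thesis unfolding ex all by auto
  qed
  have 4: "(\<forall>p<U. I 3 p \<longrightarrow> (\<exists>q<U. I 1 q \<and> C 1 0 p 0 q \<and> C 1 2 p 1 q) \<and> C 3 1 p 3 p \<and>
     (\<exists>q<U. I 2 q \<and> leaves C p q) \<and> (\<exists>q<U. I 2 q \<and> into C p q)) \<longleftrightarrow>
     (\<forall>(a, b) \<in> ?Y. (fst a, fst b) \<in> ?E \<and> snd a \<le> snd b \<and> a \<in> X \<and> b \<in> X)"
  proof -
    have "(\<exists>q. I 1 q \<and> C 1 0 p 0 q \<and> C 1 2 p 1 q) \<longleftrightarrow> (fst (fst (ed p)), fst (snd (ed p))) \<in> ?E"
      "(\<exists>q. I 2 q \<and> leaves C p q) \<longleftrightarrow> fst (ed p) \<in> X" "(\<exists>q. I 2 q \<and> into C p q) \<longleftrightarrow> snd (ed p) \<in> X" if "I 3 p" for p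
      using cmp(4,6,7)[OF that] by (auto simp: image_iff)
    then show ?thesis unfolding ex all using cmp(5) by (force simp: case_prod_beta)
  qed
  have 5: "(\<forall>i<k. \<forall>p<U. I (i + 4) p \<longrightarrow> (\<exists>q<U. I 2 q \<and> leaves C p q)) \<longleftrightarrow> (\<forall>i<k. ?R i \<subseteq> X)"
  proof -
    have "(\<exists>q. I 2 q \<and> leaves C p q) \<longleftrightarrow> pr (i + 4) p \<in> X" if "i < k" "I (i + 4) p" for i p
      using cmp(8)[OF that] by (auto simp: image_iff)
    then show ?thesis unfolding ex all by blast
  qed
  have 6: "(life \<longrightarrow> (\<exists>p<U. I 2 p \<and> B True p) \<and> (\<forall>p<U. I 2 p \<longrightarrow> B False p)) \<longleftrightarrow>
    (life \<longrightarrow> (\<exists>x \<in> X. snd x = 3) \<and> (\<forall>x \<in> X. snd x \<le> 3))"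
    unfolding ex all using B by (auto simp: pr_def)
  have "valid k life U I C B F J \<longleftrightarrow> static \<and> dynamic F J" for F J
    unfolding valid_def static_def dynamic_def step_condition_def distinct_items_iff 2 3 4 5 6
    by (simp only: conj_assoc)
  then have "(\<exists>F J. valid k life U I C B F J) \<longleftrightarrow> static \<and> (\<exists>F J. dynamic F J)" by blast
  also have "\<dots> \<longleftrightarrow> static \<and> (\<exists>F. (\<forall>i < k. F i \<subseteq> ?Y \<and> branch X (F i) (?R i)) \<and>
       (\<forall>i < k. \<forall>j < k. i \<noteq> j \<longrightarrow> arcs_of (F i) \<inter> arcs_of (F j) = {}))"
  proof (intro conj_cong refl)
    assume s: static
    then have inj: "inj_on (pr 2) {p. I 2 p}" "inj_on ed {p. I 3 p}" unfolding static_def by blast+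
    have E: "fst (ed e) \<in> X \<and> snd (ed e) \<in> X" if "I 3 e" for e
      using s that unfolding static_def by (auto simp: case_prod_beta)
    have br: "(\<exists>J. (\<forall>p<U. \<forall>q<U. \<forall>r<U. J p q \<longrightarrow> J q r \<longrightarrow> J p r) \<and> (\<forall>p<U. \<not> J p p) \<and>
        (\<forall>x<U. I 2 x \<longrightarrow> step_condition F J i x)) \<longleftrightarrow> branch X (ed ` {e. I 3 e \<and> F e}) (?R i)" if "i < k" for F i
      by (rule branching_positions_iff[OF inj that E])
    have disj: "(\<forall>p<U. \<forall>q<U. I 3 p \<longrightarrow> F p \<longrightarrow> I 3 q \<longrightarrow> F' q \<longrightarrow> \<not> (C 1 0 p 0 q \<and> C 1 2 p 2 q)) \<longleftrightarrow>
      arcs_of (ed ` {e. I 3 e \<and> F e}) \<inter> arcs_of (ed ` {e. I 3 e \<and> F' e}) = {}" for F F'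
    proof -
      have a: "arcs_of (ed ` S) = (\<lambda>e. (fst (fst (ed e)), fst (snd (ed e)))) ` S" for S
        by (simp add: arcs_of_def image_image case_prod_beta)
      have "(\<forall>p<U. \<forall>q<U. I 3 p \<longrightarrow> F p \<longrightarrow> I 3 q \<longrightarrow> F' q \<longrightarrow> \<not> (C 1 0 p 0 q \<and> C 1 2 p 2 q)) \<longleftrightarrow>
        (\<forall>p q. I 3 p \<longrightarrow> F p \<longrightarrow> I 3 q \<longrightarrow> F' q \<longrightarrow> \<not> (C 1 0 p 0 q \<and> C 1 2 p 2 q))" using I by blast
      also have "\<dots> \<longleftrightarrow> (\<forall>p q. I 3 p \<longrightarrow> F p \<longrightarrow> I 3 q \<longrightarrow> F' q \<longrightarrow>
          \<not> (fst (fst (ed p)) = fst (fst (ed q)) \<and> fst (snd (ed p)) = fst (snd (ed q))))"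
        by (intro all_cong1 imp_cong refl arg_cong[where f = Not] cmp(10); assumption)
      finally show ?thesis unfolding a by (simp add: disjoint_iff image_iff) metis
    qed
    show "(\<exists>F J. dynamic F J) \<longleftrightarrow> (\<exists>F. (\<forall>i < k. F i \<subseteq> ?Y \<and> branch X (F i) (?R i)) \<and>
       (\<forall>i < k. \<forall>j < k. i \<noteq> j \<longrightarrow> arcs_of (F i) \<inter> arcs_of (F j) = {}))"
    proof
      assume "\<exists>F J. dynamic F J"
      then obtain F J where D: "dynamic F J" by blast
      have "branch X (ed ` {e. I 3 e \<and> F i e}) (?R i)" if "i < k" for i
        by (rule iffD1[OF br[OF that]], rule exI[of _ "J i"], rule D[unfolded dynamic_def, THEN conjunct1, THEN spec, THEN mp, OF that])
      moreover have "\<forall>i < k. \<forall>j < k. i \<noteq> j \<longrightarrow> arcs_of (ed ` {e. I 3 e \<and> F i e}) \<inter> arcs_of (ed ` {e. I 3 e \<and> F j e}) = {}"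
        using D[unfolded dynamic_def disj, THEN conjunct2] .
      ultimately show "\<exists>F. (\<forall>i < k. F i \<subseteq> ?Y \<and> branch X (F i) (?R i)) \<and>
         (\<forall>i < k. \<forall>j < k. i \<noteq> j \<longrightarrow> arcs_of (F i) \<inter> arcs_of (F j) = {})"
        by (intro exI[of _ "\<lambda>i. ed ` {e. I 3 e \<and> F i e}"]) blast
    next
      assume "\<exists>F. (\<forall>i < k. F i \<subseteq> ?Y \<and> branch X (F i) (?R i)) \<and>
         (\<forall>i < k. \<forall>j < k. i \<noteq> j \<longrightarrow> arcs_of (F i) \<inter> arcs_of (F j) = {})"
      then obtain F where "(\<forall>i < k. F i \<subseteq> ?Y \<and> branch X (F i) (?R i)) \<and>
         (\<forall>i < k. \<forall>j < k. i \<noteq> j \<longrightarrow> arcs_of (F i) \<inter> arcs_of (F j) = {})" by (rule exE)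
      then have F: "\<And>i. i < k \<Longrightarrow> F i \<subseteq> ?Y" "\<And>i. i < k \<Longrightarrow> branch X (F i) (?R i)"
        "\<forall>i < k. \<forall>j < k. i \<noteq> j \<longrightarrow> arcs_of (F i) \<inter> arcs_of (F j) = {}" by simp_all
      have im: "ed ` {e. I 3 e \<and> ed e \<in> F i} = F i" if "i < k" for i using F(1)[OF that] by blast
      have "\<forall>i. \<exists>J. i < k \<longrightarrow> (\<forall>p<U. \<forall>q<U. \<forall>r<U. J p q \<longrightarrow> J q r \<longrightarrow> J p r) \<and> (\<forall>p<U. \<not> J p p) \<and>
          (\<forall>x<U. I 2 x \<longrightarrow> step_condition (\<lambda>e. ed e \<in> F i) J i x)"
        (is "\<forall>i. \<exists>J. i < k \<longrightarrow> ?D i J")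
      proof
        fix i
        have "\<exists>J. ?D i J" if "i < k"
          by (rule iffD2[OF br[OF that]], unfold im[OF that], rule F(2)[OF that])
        then show "\<exists>J. i < k \<longrightarrow> ?D i J" by blast
      qed
      then obtain J where J: "\<forall>i. i < k \<longrightarrow> (\<forall>p<U. \<forall>q<U. \<forall>r<U. J i p q \<longrightarrow> J i q r \<longrightarrow> J i p r) \<and> (\<forall>p<U. \<not> J i p p) \<and>
          (\<forall>x<U. I 2 x \<longrightarrow> step_condition (\<lambda>e. ed e \<in> F i) (J i) i x)" by (rule choice[THEN exE])
      have "\<forall>i < k. \<forall>j < k. i \<noteq> j \<longrightarrow> arcs_of (ed ` {e. I 3 e \<and> ed e \<in> F i}) \<inter> arcs_of (ed ` {e. I 3 e \<and> ed e \<in> F j}) = {}"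
        using F(3) im by simp
      then have "dynamic (\<lambda>i e. ed e \<in> F i) J" unfolding dynamic_def disj by (rule conjI[OF J])
      then show "\<exists>F J. dynamic F J" by blast
    qed
  qed
  finally show ?thesis unfolding consistent_positions_def consistent_def static_def by (simp only: conj_assoc)
qed

end

subsection \<open>Parsing words\<close>

text \<open>Letters 2 and 3 are the bits of the input; 5 and 6 are the same bits when they stand at
  the centre.\<close>

definition bit_at :: "nat list \<Rightarrow> nat \<Rightarrow> bool \<Rightarrow> bool" where
  "bit_at w p b \<longleftrightarrow> p < length w \<and> w ! p \<in> (if b then {3, 6} else {2, 5})"

section \<open>Unique readability of encoded lists\<close>

primrec reads_string :: "nat list \<Rightarrow> nat \<Rightarrow> bool list \<Rightarrow> nat \<Rightarrow> bool" where
  "reads_string w p [] q \<longleftrightarrow> q = p"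
| "reads_string w p (b # s) q \<longleftrightarrow> bit_at w p b \<and> reads_string w (Suc p) s q"

abbreviation "rd \<equiv> reads_string"

lemma rd_append: "rd w p (s @ t) q \<longleftrightarrow> (\<exists>r. rd w p s r \<and> rd w r t q)"
  by (induction s arbitrary: p) auto

lemma rd_length: "rd w p s q \<Longrightarrow> q = p + length s"
proof (induction s arbitrary: p)
  case (Cons b s)
  then show ?case using Cons.IH[of "Suc p"] by simp
qed simp

lemma bit_at_unique: "bit_at w p b \<Longrightarrow> bit_at w p c \<Longrightarrow> b = c"
  by (auto simp: bit_at_def split: if_splits)

text \<open>Turns prefix-freeness of the codes into uniqueness of what is read at a position: both
  strings are prefixes of a common string.\<close>

lemma rd_compare: "rd w p s q \<Longrightarrow> rd w p t r \<Longrightarrow> \<exists>s' t'. s @ s' = t @ t'"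
proof (induction s arbitrary: p t)
  case Nil
  then show ?case by auto
next
  case (Cons b s)
  show ?case
  proof (cases t)
    case Nil
    then show ?thesis by auto
  next
    case (Cons c t')
    then have "b = c" "rd w (Suc p) s q" "rd w (Suc p) t' r" using Cons.prems bit_at_unique by auto
    then show ?thesis using Cons.IH Cons by fastforce
  qed
qed

lemma rd_word_drop:
  assumes "length x < Z" "i \<le> length x"
  shows "rd (word Z x) (Z + i) (drop i x) (Z + length x)"
  using assms(2)
proof (induction rule: inc_induct)
  case (step i)
  have l: "letter x i = Suc (bit_symbol (x ! i))" using step by (simp add: letter_def)
  have "word Z x ! (Z + i) = letter x i + (if i = 0 then 3 else 0)" using step assms by (simp add: word_nth)
  then have "bit_at (word Z x) (Z + i) (x ! i)" unfolding l using step assms by (simp add: bit_at_def bit_symbol_def)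
  then show ?case using step by (simp add: Cons_nth_drop_Suc[symmetric])
qed simp

lemma bit_at_word:
  assumes "length x < Z" "bit_at (word Z x) p b"
  shows "Z \<le> p \<and> p < Z + length x"
proof -
  have "p < 2 * Z + 1" using assms by (simp add: bit_at_def)
  then have "word Z x ! p = (if p < Z then 1 else letter x (p - Z) + (if p = Z then 3 else 0))" by (rule word_nth)
  then show ?thesis using assms by (auto simp: bit_at_def letter_def split: if_splits)
qed

lemma enc_nat_rec: "enc_nat n = (if n = 0 then [True, False] else False # odd n # enc_nat (n div 2))"
  by (simp add: enc_nat_def binary_digits.simps[of n])

lemma enc_nat_nonempty: "enc_nat n \<noteq> []"
  by (simp add: enc_nat_def)

lemma enc_tuple_Nil [simp]: "enc_tuple [] = []" and enc_tuple_Cons [simp]: "enc_tuple (n # e) = enc_nat n @ enc_tuple e"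
  by (simp_all add: enc_tuple_def)

lemma enc_tuple_append: "enc_tuple (e @ e') = enc_tuple e @ enc_tuple e'"
  by (simp add: enc_tuple_def)

lemma enc_tuple_nonempty: "e \<noteq> [] \<Longrightarrow> enc_tuple e \<noteq> []"
  by (cases e) (simp_all add: enc_nat_nonempty)

lemma tuple_code: "length e = length e' \<Longrightarrow> enc_tuple e @ s = enc_tuple e' @ t \<Longrightarrow> e = e' \<and> s = t"
proof (induction e e' rule: list_induct2)
  case (Cons n e n' e')
  then have "enc_nat n @ (enc_tuple e @ s) = enc_nat n' @ (enc_tuple e' @ t)" by simp
  from prefix_codeD[OF prefix_code_nat this] Cons.IH show ?case by simp
qed simp

lemma enc_tuple_no_end: "e \<noteq> [] \<Longrightarrow> enc_tuple e @ s \<noteq> True # True # t"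
  by (cases e) (simp_all add: enc_nat_no_end)

abbreviation enc_items :: "nat list list \<Rightarrow> bool list" where
  "enc_items es \<equiv> concat (map enc_tuple es)"

text \<open>A partial reading of a list follows the complete list: tuples of equal length form a
  prefix code, and a nonempty tuple never starts like the terminator.\<close>

lemma items_code:
  assumes "enc_items es @ s = enc_list enc_tuple l @ t" "\<forall>e \<in> set es \<union> set l. length e = n" "n > 0"
  shows "length es \<le> length l \<and> es = take (length es) l"
  using assms(1,2)
proof (induction es arbitrary: l)
  case (Cons e es)
  have e: "e \<noteq> []" using Cons.prems(2) assms(3) by auto
  show ?case
  proof (cases l)
    case Nil
    then show ?thesis using Cons.prems(1) enc_tuple_no_end[OF e, of "enc_items es @ s" t] by (simp add: enc_list_def)
  next
    case l: (Cons e' l')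
    then have "enc_tuple e @ (enc_items es @ s) = enc_tuple e' @ (enc_list enc_tuple l' @ t)"
      using Cons.prems(1) by (simp add: enc_list_def)
    then have "e = e'" "enc_items es @ s = enc_list enc_tuple l' @ t"
      using tuple_code[of e e' "enc_items es @ s" "enc_list enc_tuple l' @ t"] Cons.prems(2) l by simp_all
    then show ?thesis using Cons.IH[of l'] Cons.prems(2) l by simp
  qed
qed simp

lemma list_code:
  assumes "enc_list enc_tuple l @ s = enc_list enc_tuple l' @ t" "\<forall>e \<in> set l \<union> set l'. length e = n" "n > 0"
  shows "l = l' \<and> s = t"
proof -
  have "enc_items l @ ([True, True] @ s) = enc_list enc_tuple l' @ t"
    "enc_items l' @ ([True, True] @ t) = enc_list enc_tuple l @ s" using assms(1) by (simp_all add: enc_list_def)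
  from items_code[OF this(1), of n] items_code[OF this(2), of n] assms(2,3) have "l = l'" by auto
  then show ?thesis using assms(1) by simp
qed

lemma enc_lists_Nil [simp]: "enc_lists [] = []" and enc_lists_Cons [simp]: "enc_lists (l # LL) = enc_list enc_tuple l @ enc_lists LL"
  and enc_lists_append: "enc_lists (LL @ LL') = enc_lists LL @ enc_lists LL'"
  by (simp_all add: enc_lists_def)

lemma lists_code:
  assumes "length LL = length LL'" "enc_lists LL @ s = enc_lists LL' @ t"
    "\<And>i. i < length LL \<Longrightarrow> \<forall>e \<in> set (LL ! i) \<union> set (LL' ! i). length e = a i" "\<And>i. a i > 0"
  shows "LL = LL' \<and> s = t"
  using assms
proof (induction LL LL' arbitrary: a rule: list_induct2)
  case (Cons l LL l' LL')
  have "enc_list enc_tuple l @ (enc_lists LL @ s) = enc_list enc_tuple l' @ (enc_lists LL' @ t)" using Cons.prems(1) by simp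
  then have l: "l = l' \<and> enc_lists LL @ s = enc_lists LL' @ t"
    by (rule list_code) (use Cons.prems(2)[of 0] Cons.prems(3)[of 0] in auto)
  have "LL = LL' \<and> s = t"
  proof (rule Cons.IH[where a = "\<lambda>i. a (Suc i)"])
    show "\<forall>e \<in> set (LL ! i) \<union> set (LL' ! i). length e = a (Suc i)" if "i < length LL" for i
      using Cons.prems(2)[of "Suc i"] that by simp
  qed (use l Cons.prems(3) in auto)
  then show ?case using l by simp
qed simp

lemma arity_pos: "arity l > 0"
  by (simp add: arity_def)

text \<open>The state of a parser: \<open>l\<close> lists have been read completely, followed by
  some items of the next one. At \<open>l = k + 4\<close> the instance is complete, so no item may
  follow.\<close>

definition reached :: "nat list \<Rightarrow> nat \<Rightarrow> nat \<Rightarrow> nat \<Rightarrow> nat \<Rightarrow> bool" where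
  "reached w z k l p \<longleftrightarrow> (\<exists>LL es. length LL = l \<and> well_shaped LL \<and> (\<forall>e \<in> set es. length e = arity l) \<and> (l = k + 4 \<longrightarrow> es = []) \<and>
     rd w z (enc_lists LL @ enc_items es) p)"

lemma well_shaped_append: "well_shaped (LL @ [es]) \<longleftrightarrow> well_shaped LL \<and> (\<forall>e \<in> set es. length e = arity (length LL))"
  by (auto simp: well_shaped_def nth_append less_Suc_eq)

text \<open>The last action of the parser was to read an item or a terminator, unless it has just
  started. Each action consumes bits, which makes these equations a recursion along the
  word.\<close>

lemma reached_iff:
  assumes "l \<le> k + 4"
  shows "reached w z k l p \<longleftrightarrow> l = 0 \<and> p = z \<or>
    l < k + 4 \<and> (\<exists>q. reached w z k l q \<and> (\<exists>e. length e = arity l \<and> rd w q (enc_tuple e) p)) \<or>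
    l > 0 \<and> (\<exists>q. reached w z k (l - 1) q \<and> rd w q [True, True] p)" (is "_ \<longleftrightarrow> ?r")
proof
  assume "reached w z k l p"
  then obtain LL es where L: "length LL = l" "well_shaped LL" "\<forall>e \<in> set es. length e = arity l" "l = k + 4 \<longrightarrow> es = []"
    "rd w z (enc_lists LL @ enc_items es) p" unfolding reached_def by blast
  show ?r
  proof (cases es rule: rev_cases)
    case Nil
    show ?thesis
    proof (cases LL rule: rev_cases)
      case (snoc LL' es')
      then have l: "l = Suc (length LL')" using L(1) by simp
      have "enc_lists LL = (enc_lists LL' @ enc_items es') @ [True, True]"
        by (simp add: snoc enc_lists_append enc_list_def)
      then have "rd w z ((enc_lists LL' @ enc_items es') @ [True, True]) p" using L(5) Nil by simp
      then obtain q where q: "rd w z (enc_lists LL' @ enc_items es') q" "rd w q [True, True] p"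
        using rd_append[THEN iffD1] by blast
      have "reached w z k (l - 1) q" unfolding reached_def
        by (intro exI[of _ LL'] exI[of _ es']) (use q(1) L(2) l snoc well_shaped_append assms in auto)
      then show ?thesis using q(2) l by blast
    qed (use Nil L in simp)
  next
    case (snoc es' e)
    then obtain q where q: "rd w z (enc_lists LL @ enc_items es') q" "rd w q (enc_tuple e) p"
      using L(5) by (auto simp: rd_append)
    have "l < k + 4" using L(4) snoc assms by auto
    moreover have "reached w z k l q" unfolding reached_def
      by (intro exI[of _ LL] exI[of _ es']) (use q(1) L snoc in auto)
    ultimately show ?thesis using q(2) L(3) snoc by auto
  qed
next
  assume ?r
  then consider "l = 0" "p = z" | q e where "l < k + 4" "reached w z k l q" "length e = arity l" "rd w q (enc_tuple e) p"
    | q where "l > 0" "reached w z k (l - 1) q" "rd w q [True, True] p" by blast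
  then show "reached w z k l p"
  proof cases
    case 1
    then show ?thesis unfolding reached_def by (intro exI[of _ "[]"]) (simp add: well_shaped_def)
  next
    case 2
    from 2(2) obtain LL es where L: "length LL = l" "well_shaped LL" "\<forall>e \<in> set es. length e = arity l"
      "rd w z (enc_lists LL @ enc_items es) q" unfolding reached_def by blast
    then show ?thesis unfolding reached_def
      by (intro exI[of _ LL] exI[of _ "es @ [e]"]) (use 2 in \<open>auto simp: rd_append\<close>)
  next
    case 3
    from 3(2) obtain LL es where L: "length LL = l - 1" "well_shaped LL" "\<forall>e \<in> set es. length e = arity (l - 1)"
      "rd w z (enc_lists LL @ enc_items es) q" unfolding reached_def by blast
    have "rd w z (enc_lists (LL @ [es])) p" using L(4) 3(3)
      by (auto simp: enc_lists_append enc_list_def rd_append simp del: reads_string.simps)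
    then show ?thesis unfolding reached_def
      by (intro exI[of _ "LL @ [es]"] exI[of _ "[]"]) (use L 3(1) in \<open>auto simp: well_shaped_append\<close>)
  qed
qed

subsection \<open>Describing the parse by formulas\<close>

definition token :: "nat list \<Rightarrow> nat \<Rightarrow> bool \<Rightarrow> bool \<Rightarrow> bool" where
  "token w p b c \<longleftrightarrow> (\<exists>q<length w. q = Suc p \<and> bit_at w p b \<and> bit_at w q c)"

definition skip2 :: "nat list \<Rightarrow> nat \<Rightarrow> nat \<Rightarrow> bool" where
  "skip2 w p q \<longleftrightarrow> (\<exists>r<length w. r = Suc p \<and> q = Suc r)"

text \<open>Codes consist of two-bit blocks: \<open>0b\<close> is a digit, \<open>10\<close> ends a
  number, \<open>11\<close> ends a list. As the most significant digit comes last and must be 1, the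
  end of a number may follow \<open>01\<close> but not \<open>00\<close>.\<close>

definition num_clause :: "nat list \<Rightarrow> (nat \<Rightarrow> nat \<Rightarrow> bool) \<Rightarrow> nat \<Rightarrow> nat \<Rightarrow> bool" where
  "num_clause w R p q \<longleftrightarrow> token w p True False \<and> skip2 w p q \<or>
     token w p False True \<and> (\<exists>r<length w. skip2 w p r \<and> token w r True False \<and> skip2 w r q) \<or>
     (token w p False True \<or> token w p False False) \<and>
       (\<exists>r<length w. skip2 w p r \<and> (token w r False True \<or> token w r False False) \<and> R r q)"

definition next_digits :: "nat list \<Rightarrow> (nat \<Rightarrow> nat \<Rightarrow> bool) \<Rightarrow> nat \<Rightarrow> nat \<Rightarrow> bool" where
  "next_digits w R p q \<longleftrightarrow> (\<exists>p'<length w. \<exists>q'<length w. skip2 w p p' \<and> skip2 w q q' \<and> R p' q')"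

definition eq_clause :: "nat list \<Rightarrow> (nat \<Rightarrow> nat \<Rightarrow> nat \<Rightarrow> bool) \<Rightarrow> nat \<Rightarrow> nat \<Rightarrow> bool" where
  "eq_clause w \<rho> p q \<longleftrightarrow> token w p True False \<and> token w q True False \<or>
     (token w p False False \<and> token w q False False \<or> token w p False True \<and> token w q False True) \<and>
       next_digits w (\<lambda>p q. \<rho> 1 p q) p q"

text \<open>Addition of 1 from the least significant digit: a 0 becomes 1 and the remaining digits
  agree, a 1 becomes 0 and a carry is passed on. Zero has no digits and is treated
  separately.\<close>

definition suc_clause :: "nat list \<Rightarrow> (nat \<Rightarrow> nat \<Rightarrow> nat \<Rightarrow> bool) \<Rightarrow> nat \<Rightarrow> nat \<Rightarrow> bool" where
  "suc_clause w \<rho> p q \<longleftrightarrow>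
     token w p True False \<and> token w q False True \<and> (\<exists>r<length w. skip2 w q r \<and> token w r True False) \<or>
     token w p False False \<and> token w q False True \<and> next_digits w (\<lambda>p q. \<rho> 1 p q) p q \<or>
     token w p False True \<and> token w q False False \<and> next_digits w (\<lambda>p q. \<rho> 2 p q) p q"

text \<open>Comparison by halving: if the lowest digit does not decrease from 1 to 0, compare the
  halves by \<open>\<le>\<close>; otherwise the half on the left must be strictly smaller, which is
  the negated converse comparison.\<close>

definition le_clause :: "nat list \<Rightarrow> (nat \<Rightarrow> nat \<Rightarrow> nat \<Rightarrow> bool) \<Rightarrow> nat \<Rightarrow> nat \<Rightarrow> bool" where
  "le_clause w \<rho> p q \<longleftrightarrow> token w p True False \<or>
     (token w p False False \<and> (token w q False False \<or> token w q False True) \<or> token w p False True \<and> token w q False True) \<and>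
       next_digits w (\<lambda>p q. \<rho> 3 p q) p q \<or>
     token w p False True \<and> token w q False False \<and> \<not> next_digits w (\<lambda>p q. \<rho> 3 p q) q p"

primrec component :: "nat \<Rightarrow> (nat \<Rightarrow> nat \<Rightarrow> bool) \<Rightarrow> nat \<Rightarrow> nat \<Rightarrow> nat \<Rightarrow> bool" where
  "component U R 0 p r \<longleftrightarrow> p = r"
| "component U R (Suc j) p r \<longleftrightarrow> (\<exists>q<U. R p q \<and> component U R j q r)"

definition reach_clause :: "nat \<Rightarrow> nat list \<Rightarrow> (nat \<Rightarrow> nat \<Rightarrow> nat \<Rightarrow> bool) \<Rightarrow> nat \<Rightarrow> nat \<Rightarrow> bool" where
  "reach_clause k w \<rho> l p \<longleftrightarrow> l = 0 \<and> centre w p \<or>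
     l < k + 4 \<and> (\<exists>q<length w. \<rho> (4 + l) q q \<and> component (length w) (\<lambda>p q. \<rho> 0 p q) (arity l) q p) \<or>
     l > 0 \<and> (\<exists>q<length w. \<rho> (4 + (l - 1)) q q \<and> token w q True True \<and> skip2 w q p)"

text \<open>The relations with indices 0 to 3 are the extents of numbers, and the comparison of numbers for
  equality, succession and order; index \<open>4 + l\<close> marks the positions reached when reading the \<open>l\<close>-th list.\<close>

definition decoded :: "nat \<Rightarrow> nat list \<Rightarrow> (nat \<Rightarrow> nat \<Rightarrow> nat \<Rightarrow> bool) \<Rightarrow> bool" where
  "decoded k w \<rho> \<longleftrightarrow> (\<forall>p<length w. \<forall>q<length w. \<rho> 0 p q \<longleftrightarrow> num_clause w (\<lambda>p q. \<rho> 0 p q) p q) \<and>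
     (\<forall>p<length w. \<forall>q<length w. (\<exists>r<length w. \<rho> 0 p r) \<longrightarrow> (\<exists>r<length w. \<rho> 0 q r) \<longrightarrow>
        (\<rho> 1 p q \<longleftrightarrow> eq_clause w \<rho> p q) \<and> (\<rho> 2 p q \<longleftrightarrow> suc_clause w \<rho> p q) \<and> (\<rho> 3 p q \<longleftrightarrow> le_clause w \<rho> p q)) \<and>
     (\<forall>l<k + 5. \<forall>p<length w. \<rho> (4 + l) p p \<longleftrightarrow> reach_clause k w \<rho> l p)"

definition num_at :: "nat list \<Rightarrow> nat \<Rightarrow> nat \<Rightarrow> bool" where
  "num_at w p n \<longleftrightarrow> (\<exists>q. rd w p (enc_nat n) q)"

definition truthful :: "nat \<Rightarrow> nat list \<Rightarrow> nat \<Rightarrow> (nat \<Rightarrow> nat \<Rightarrow> nat \<Rightarrow> bool) \<Rightarrow> bool" where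
  "truthful k w z \<rho> \<longleftrightarrow> (\<forall>p<length w. \<forall>q<length w. \<rho> 0 p q \<longleftrightarrow> (\<exists>n. rd w p (enc_nat n) q)) \<and>
     (\<forall>p<length w. \<forall>q<length w. \<forall>n m. num_at w p n \<longrightarrow> num_at w q m \<longrightarrow>
        (\<rho> 1 p q \<longleftrightarrow> n = m) \<and> (\<rho> 2 p q \<longleftrightarrow> m = Suc n) \<and> (\<rho> 3 p q \<longleftrightarrow> n \<le> m)) \<and>
     (\<forall>l<k + 5. \<forall>p<length w. \<rho> (4 + l) p p \<longleftrightarrow> reached w z k l p)"

text \<open>The padding ensures that the position behind every bit is still in the word, so that
  quantifiers over positions see the ends of all codes.\<close>

locale readable =
  fixes w :: "nat list" and z :: nat
  assumes bit_inside: "bit_at w p b \<Longrightarrow> Suc p < length w"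
    and z: "z < length w" "\<And>q. q < length w \<Longrightarrow> centre w q \<longleftrightarrow> q = z"
begin

lemma rd_inside: "rd w p s q \<Longrightarrow> p < length w \<Longrightarrow> q < length w"
  by (induction s arbitrary: p) (auto intro: bit_inside)

lemma token_iff: "token w p b c \<longleftrightarrow> bit_at w p b \<and> bit_at w (Suc p) c"
  unfolding token_def using bit_inside by blast

lemma token_rd: "token w p b c \<longleftrightarrow> rd w p [b, c] (p + 2)"
  by (simp add: token_iff)

lemma token_inside: "token w p b c \<Longrightarrow> p + 2 < length w"
  using token_iff bit_inside by fastforce

lemma token_unique: "token w p b c \<Longrightarrow> token w p b' c' \<Longrightarrow> b = b' \<and> c = c'"
  unfolding token_iff using bit_at_unique by blast

lemma skip2_token: "token w p b c \<Longrightarrow> skip2 w p q \<longleftrightarrow> q = p + 2"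
  unfolding skip2_def using token_inside[of p b c] by auto

lemma rd_num: "rd w p (enc_nat n) q \<longleftrightarrow>
   (if n = 0 then token w p True False \<and> q = p + 2 else token w p False (odd n) \<and> rd w (p + 2) (enc_nat (n div 2)) q)"
  by (subst enc_nat_rec) (auto simp: token_iff)

lemma num_at_iff: "num_at w p n \<longleftrightarrow> (if n = 0 then token w p True False else token w p False (odd n) \<and> num_at w (p + 2) (n div 2))"
  unfolding num_at_def by (cases "n = 0") (auto simp: rd_num[of p n] rd_num[of p 0])

lemma num_at_token:
  assumes "num_at w p n"
  shows "token w p True False \<longleftrightarrow> n = 0" "token w p False b \<longleftrightarrow> n \<noteq> 0 \<and> odd n = b"
    "n \<noteq> 0 \<Longrightarrow> num_at w (p + 2) (n div 2)" "n \<noteq> 0 \<Longrightarrow> p + 2 < length w" "n \<noteq> 0 \<Longrightarrow> skip2 w p q \<longleftrightarrow> q = p + 2"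
  using assms[unfolded num_at_iff[of p n]] token_unique[of p True False False "odd n"] token_unique[of p False b True False]
    token_unique[of p False b False "odd n"] token_inside[of p False "odd n"] skip2_token[of p False "odd n" q]
  by (auto split: if_splits)

text \<open>The relation is assumed correct to the right of \<open>p\<close> only; hence the clause
  determines it by induction from the end of the word.\<close>

lemma num_clause_iff:
  assumes q: "q < length w" and R: "\<And>r. r < length w \<Longrightarrow> r > p \<Longrightarrow> R r q \<longleftrightarrow> (\<exists>n. rd w r (enc_nat n) q)"
  shows "num_clause w R p q \<longleftrightarrow> (\<exists>n. rd w p (enc_nat n) q)"
proof
  assume "num_clause w R p q"
  then consider "token w p True False" "skip2 w p q"
    | r where "token w p False True" "skip2 w p r" "token w r True False" "skip2 w r q"
    | b c r where "token w p False b" "skip2 w p r" "token w r False c" "r < length w" "R r q"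
    unfolding num_clause_def by blast
  then show "\<exists>n. rd w p (enc_nat n) q"
  proof cases
    case 1
    then have "rd w p (enc_nat 0) q" by (subst rd_num) (simp add: skip2_token)
    then show ?thesis ..
  next
    case 2
    then have "rd w p (enc_nat 1) q" by (subst rd_num, simp, subst rd_num) (simp add: skip2_token)
    then show ?thesis ..
  next
    case 3
    then have r: "r = p + 2" using skip2_token by blast
    then obtain n where n: "rd w r (enc_nat n) q" using R[of r] 3 by auto
    have "n \<noteq> 0" using n 3(3) token_unique[of r] by (subst (asm) rd_num) (auto split: if_splits)
    \<comment> \<open>The digit \<open>b\<close> precedes the digits of \<open>n\<close>, least
      significant first; \<open>n \<noteq> 0\<close> keeps the code canonical.\<close>
    have "rd w p (enc_nat (2 * n + of_bool b)) q"
      by (subst rd_num) (use n \<open>n \<noteq> 0\<close> r 3(1) in \<open>cases b; simp\<close>)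
    then show ?thesis ..
  qed
next
  assume "\<exists>n. rd w p (enc_nat n) q"
  then obtain n where n: "rd w p (enc_nat n) q" ..
  show "num_clause w R p q"
  proof (cases "n = 0")
    case True
    then have "token w p True False" "q = p + 2" using n rd_num[of p n q] by auto
    then show ?thesis using skip2_token unfolding num_clause_def by blast
  next
    case False
    then have t: "token w p False (odd n)" and n2: "rd w (p + 2) (enc_nat (n div 2)) q" using n rd_num[of p n q] by auto
    have p2: "p + 2 < length w" "skip2 w p (p + 2)" using token_inside[OF t] skip2_token[OF t] by auto
    show ?thesis
    proof (cases "n div 2 = 0")
      case True
      then have "n = 1" using False by presburger
      then show ?thesis using t n2 p2 rd_num[of "p + 2" "n div 2" q] True skip2_token[of "p + 2" True False q]
        unfolding num_clause_def by auto
    next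
      case False
      then have "token w (p + 2) False (odd (n div 2))" using n2 rd_num[of "p + 2" "n div 2" q] by simp
      then have "token w (p + 2) False True \<or> token w (p + 2) False False" by (cases "odd (n div 2)") auto
      moreover have "token w p False True \<or> token w p False False" using t by (cases "odd n") auto
      moreover have "R (p + 2) q" using R[of "p + 2"] p2 n2 by auto
      ultimately show ?thesis unfolding num_clause_def using p2 by blast
    qed
  qed
qed

lemma next_digits_iff:
  assumes "num_at w p n" "num_at w q m" "n \<noteq> 0" "m \<noteq> 0"
  shows "next_digits w R p q \<longleftrightarrow> R (p + 2) (q + 2)"
  unfolding next_digits_def using num_at_token(4,5)[OF assms(1,3)] num_at_token(4,5)[OF assms(2,4)] by auto

lemma compare_clauses:
  assumes p: "num_at w p n" and q: "num_at w q m"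
    and IH: "n \<noteq> 0 \<Longrightarrow> m \<noteq> 0 \<Longrightarrow> (\<rho> 1 (p + 2) (q + 2) \<longleftrightarrow> n div 2 = m div 2) \<and> (\<rho> 2 (p + 2) (q + 2) \<longleftrightarrow> m div 2 = Suc (n div 2)) \<and>
      (\<rho> 3 (p + 2) (q + 2) \<longleftrightarrow> n div 2 \<le> m div 2) \<and> (\<rho> 3 (q + 2) (p + 2) \<longleftrightarrow> m div 2 \<le> n div 2)"
  shows "eq_clause w \<rho> p q \<longleftrightarrow> n = m" "suc_clause w \<rho> p q \<longleftrightarrow> m = Suc n" "le_clause w \<rho> p q \<longleftrightarrow> n \<le> m"
proof -
  have s: "m \<noteq> 0 \<Longrightarrow> (\<exists>r<length w. skip2 w q r \<and> token w r True False) \<longleftrightarrow> m div 2 = 0"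
    using num_at_token(4,5)[OF q] num_at_token(1)[OF num_at_token(3)[OF q]] by auto
  note t = num_at_token(1,2)[OF p] num_at_token(1,2)[OF q]
  have N: "next_digits w (\<lambda>p q. \<rho> 1 p q) p q \<longleftrightarrow> n div 2 = m div 2" "next_digits w (\<lambda>p q. \<rho> 2 p q) p q \<longleftrightarrow> m div 2 = Suc (n div 2)"
    "next_digits w (\<lambda>p q. \<rho> 3 p q) p q \<longleftrightarrow> n div 2 \<le> m div 2" "next_digits w (\<lambda>p q. \<rho> 3 p q) q p \<longleftrightarrow> m div 2 \<le> n div 2"
    if "n \<noteq> 0" "m \<noteq> 0" using next_digits_iff[OF p q that] next_digits_iff[OF q p that(2,1)] IH that by simp_all
  show "eq_clause w \<rho> p q \<longleftrightarrow> n = m" "suc_clause w \<rho> p q \<longleftrightarrow> m = Suc n" "le_clause w \<rho> p q \<longleftrightarrow> n \<le> m"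
  proof -
    consider "n = 0" "m = 0" | "n = 0" "m \<noteq> 0" | "n \<noteq> 0" "m = 0" | "n \<noteq> 0" "m \<noteq> 0" by blast
    then have "(eq_clause w \<rho> p q \<longleftrightarrow> n = m) \<and> (suc_clause w \<rho> p q \<longleftrightarrow> m = Suc n) \<and> (le_clause w \<rho> p q \<longleftrightarrow> n \<le> m)"
    proof cases
      case 2
      then have "m = 1 \<longleftrightarrow> odd m \<and> m div 2 = 0" by presburger
      then show ?thesis using 2 s unfolding eq_clause_def suc_clause_def le_clause_def t by (simp add: One_nat_def)
    next
      case 4
      show ?thesis unfolding eq_clause_def suc_clause_def le_clause_def t N[OF 4] using 4 by simp presburger
    qed (simp_all add: eq_clause_def suc_clause_def le_clause_def t)
    then show "eq_clause w \<rho> p q \<longleftrightarrow> n = m" "suc_clause w \<rho> p q \<longleftrightarrow> m = Suc n" "le_clause w \<rho> p q \<longleftrightarrow> n \<le> m" by blast+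
  qed
qed

lemma component_iff:
  assumes R: "\<And>p q. p < length w \<Longrightarrow> q < length w \<Longrightarrow> R p q \<longleftrightarrow> (\<exists>n. rd w p (enc_nat n) q)" and p: "p < length w"
  shows "component (length w) R j p r \<longleftrightarrow> (\<exists>e. length e = j \<and> rd w p (enc_tuple e) r)"
  using p
proof (induction j arbitrary: p)
  case (Suc j)
  have "component (length w) R (Suc j) p r \<longleftrightarrow>
      (\<exists>q<length w. (\<exists>n. rd w p (enc_nat n) q) \<and> (\<exists>e. length e = j \<and> rd w q (enc_tuple e) r))"
    using Suc.IH R Suc.prems by (simp cong: conj_cong)
  also have "\<dots> \<longleftrightarrow> (\<exists>n e. length e = j \<and> rd w p (enc_tuple (n # e)) r)"
    using rd_inside Suc.prems unfolding enc_tuple_Cons rd_append by blast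
  also have "\<dots> \<longleftrightarrow> (\<exists>e. length e = Suc j \<and> rd w p (enc_tuple e) r)" by (metis length_Suc_conv)
  finally show ?case .
qed auto

lemma reach_clause_iff:
  assumes R0: "\<And>p q. p < length w \<Longrightarrow> q < length w \<Longrightarrow> \<rho> 0 p q \<longleftrightarrow> (\<exists>n. rd w p (enc_nat n) q)"
    and l: "l < k + 5" and p: "p < length w"
    and R: "\<And>l q. l < k + 5 \<Longrightarrow> q < p \<Longrightarrow> \<rho> (4 + l) q q \<longleftrightarrow> reached w z k l q"
  shows "reach_clause k w \<rho> l p \<longleftrightarrow> reached w z k l p"
proof -
  have less: "q < p" if "rd w q s p" "s \<noteq> []" for q s using rd_length[OF that(1)] that(2) by simp
  have "(\<exists>q<length w. \<rho> (4 + l) q q \<and> component (length w) (\<lambda>p q. \<rho> 0 p q) (arity l) q p) \<longleftrightarrow>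
     (\<exists>q<length w. \<rho> (4 + l) q q \<and> (\<exists>e. length e = arity l \<and> rd w q (enc_tuple e) p))"
    using component_iff[of "\<lambda>p q. \<rho> 0 p q", OF R0] by blast
  also have "\<dots> \<longleftrightarrow> (\<exists>q. reached w z k l q \<and> (\<exists>e. length e = arity l \<and> rd w q (enc_tuple e) p))"
  proof -
    have "q < p" if "length e = arity l" "rd w q (enc_tuple e) p" for q e
    proof (rule less[OF that(2)])
      show "enc_tuple e \<noteq> []" using arity_pos[of l] that(1) by (intro enc_tuple_nonempty) auto
    qed
    then show ?thesis using R[OF l] p by (meson order.strict_trans)
  qed
  finally have 1: "(\<exists>q<length w. \<rho> (4 + l) q q \<and> component (length w) (\<lambda>p q. \<rho> 0 p q) (arity l) q p) \<longleftrightarrow>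
    (\<exists>q. reached w z k l q \<and> (\<exists>e. length e = arity l \<and> rd w q (enc_tuple e) p))" .
  have 2: "(\<exists>q<length w. \<rho> (4 + (l - 1)) q q \<and> token w q True True \<and> skip2 w q p) \<longleftrightarrow>
    (\<exists>q. reached w z k (l - 1) q \<and> rd w q [True, True] p)"
  proof -
    have "token w q True True \<and> skip2 w q p \<longleftrightarrow> rd w q [True, True] p" for q
      using skip2_token[of q True True p] token_rd[of q True True] rd_length[of w q "[True, True]" p] by auto
    moreover have "q < p" if "rd w q [True, True] p" for q using less[OF that] by simp
    ultimately show ?thesis using R[of "l - 1"] l p by (meson less_imp_diff_less order.strict_trans)
  qed
  show ?thesis unfolding reach_clause_def 1 2 using reached_iff[of l k w z p] z(2)[OF p] l by auto
qed

text \<open>The local equations have only one solution where it matters. Extents of numbers are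
  determined by induction on the distance to the end of the word, comparisons by induction on the
  sum of the numbers, and reached positions from left to right.\<close>

theorem decoded_iff: "decoded k w \<rho> \<longleftrightarrow> truthful k w z \<rho>"
proof -
  have 0: "(\<forall>p<length w. \<forall>q<length w. \<rho> 0 p q \<longleftrightarrow> num_clause w (\<lambda>p q. \<rho> 0 p q) p q) \<longleftrightarrow>
    (\<forall>p<length w. \<forall>q<length w. \<rho> 0 p q \<longleftrightarrow> (\<exists>n. rd w p (enc_nat n) q))" (is "?l \<longleftrightarrow> ?r")
  proof
    assume l: ?l
    have "\<forall>q<length w. \<rho> 0 p q \<longleftrightarrow> (\<exists>n. rd w p (enc_nat n) q)" if "p < length w" for p
      using that
    proof (induction "length w - p" arbitrary: p rule: less_induct)
      case less
      have IH: "\<rho> 0 r q \<longleftrightarrow> (\<exists>n. rd w r (enc_nat n) q)" if "r < length w" "p < r" "q < length w" for r q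
        using less.hyps[of r] less.prems that by simp
      then show ?case using l less.prems num_clause_iff[of _ p "\<lambda>p q. \<rho> 0 p q"] by simp
    qed
    then show ?r by blast
  next
    assume ?r
    then show ?l using num_clause_iff[of _ _ "\<lambda>p q. \<rho> 0 p q"] by simp
  qed
  have 1: "(\<forall>p<length w. \<forall>q<length w. (\<exists>r<length w. \<rho> 0 p r) \<longrightarrow> (\<exists>r<length w. \<rho> 0 q r) \<longrightarrow>
        (\<rho> 1 p q \<longleftrightarrow> eq_clause w \<rho> p q) \<and> (\<rho> 2 p q \<longleftrightarrow> suc_clause w \<rho> p q) \<and> (\<rho> 3 p q \<longleftrightarrow> le_clause w \<rho> p q)) \<longleftrightarrow>
    (\<forall>p<length w. \<forall>q<length w. \<forall>n m. num_at w p n \<longrightarrow> num_at w q m \<longrightarrow>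
        (\<rho> 1 p q \<longleftrightarrow> n = m) \<and> (\<rho> 2 p q \<longleftrightarrow> m = Suc n) \<and> (\<rho> 3 p q \<longleftrightarrow> n \<le> m))" (is "?l \<longleftrightarrow> ?r")
    if R0: "\<forall>p<length w. \<forall>q<length w. \<rho> 0 p q \<longleftrightarrow> (\<exists>n. rd w p (enc_nat n) q)"
  proof -
    have n: "(\<exists>r<length w. \<rho> 0 p r) \<longleftrightarrow> (\<exists>n. num_at w p n)" if "p < length w" for p
      using R0 that rd_inside unfolding num_at_def by blast
    have l: "?l \<longleftrightarrow> (\<forall>p<length w. \<forall>q<length w. \<forall>n m. num_at w p n \<longrightarrow> num_at w q m \<longrightarrow>
      (\<rho> 1 p q \<longleftrightarrow> eq_clause w \<rho> p q) \<and> (\<rho> 2 p q \<longleftrightarrow> suc_clause w \<rho> p q) \<and> (\<rho> 3 p q \<longleftrightarrow> le_clause w \<rho> p q))"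
      using n by (simp cong: imp_cong)
    show ?thesis
    proof
      assume ?l
      then have L: "\<And>p q n m. p < length w \<Longrightarrow> q < length w \<Longrightarrow> num_at w p n \<Longrightarrow> num_at w q m \<Longrightarrow>
        (\<rho> 1 p q \<longleftrightarrow> eq_clause w \<rho> p q) \<and> (\<rho> 2 p q \<longleftrightarrow> suc_clause w \<rho> p q) \<and> (\<rho> 3 p q \<longleftrightarrow> le_clause w \<rho> p q)" unfolding l by blast
      have "(\<rho> 1 p q \<longleftrightarrow> n = m) \<and> (\<rho> 2 p q \<longleftrightarrow> m = Suc n) \<and> (\<rho> 3 p q \<longleftrightarrow> n \<le> m)"
        if "p < length w" "q < length w" "num_at w p n" "num_at w q m" for p q n m
        using that
      proof (induction "n + m" arbitrary: p q n m rule: less_induct)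
        case less
        note pq = num_at_token(3,4)[OF less.prems(3)] num_at_token(3,4)[OF less.prems(4)]
        have IH: "n \<noteq> 0 \<Longrightarrow> m \<noteq> 0 \<Longrightarrow> (\<rho> 1 (p + 2) (q + 2) \<longleftrightarrow> n div 2 = m div 2) \<and> (\<rho> 2 (p + 2) (q + 2) \<longleftrightarrow> m div 2 = Suc (n div 2)) \<and>
          (\<rho> 3 (p + 2) (q + 2) \<longleftrightarrow> n div 2 \<le> m div 2) \<and> (\<rho> 3 (q + 2) (p + 2) \<longleftrightarrow> m div 2 \<le> n div 2)"
          using less.hyps[of "n div 2" "m div 2" "p + 2" "q + 2"] less.hyps[of "m div 2" "n div 2" "q + 2" "p + 2"] pq by simp
        show ?case using compare_clauses[OF less.prems(3,4) IH] L[OF less.prems] by simp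
      qed
      then show ?r by blast
    next
      assume r: ?r
      have "(\<rho> 1 p q \<longleftrightarrow> eq_clause w \<rho> p q) \<and> (\<rho> 2 p q \<longleftrightarrow> suc_clause w \<rho> p q) \<and> (\<rho> 3 p q \<longleftrightarrow> le_clause w \<rho> p q)"
        if "p < length w" "q < length w" and pq: "num_at w p n" "num_at w q m" for p q n m
      proof -
        have IH: "n \<noteq> 0 \<Longrightarrow> m \<noteq> 0 \<Longrightarrow> (\<rho> 1 (p + 2) (q + 2) \<longleftrightarrow> n div 2 = m div 2) \<and> (\<rho> 2 (p + 2) (q + 2) \<longleftrightarrow> m div 2 = Suc (n div 2)) \<and>
          (\<rho> 3 (p + 2) (q + 2) \<longleftrightarrow> n div 2 \<le> m div 2) \<and> (\<rho> 3 (q + 2) (p + 2) \<longleftrightarrow> m div 2 \<le> n div 2)"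
          using r num_at_token(3,4)[OF pq(1)] num_at_token(3,4)[OF pq(2)] by simp
        show ?thesis using compare_clauses[OF pq IH] r that by simp
      qed
      then show ?l unfolding l by blast
    qed
  qed
  have 2: "(\<forall>l<k + 5. \<forall>p<length w. \<rho> (4 + l) p p \<longleftrightarrow> reach_clause k w \<rho> l p) \<longleftrightarrow>
    (\<forall>l<k + 5. \<forall>p<length w. \<rho> (4 + l) p p \<longleftrightarrow> reached w z k l p)" (is "?l \<longleftrightarrow> ?r")
    if R0: "\<forall>p<length w. \<forall>q<length w. \<rho> 0 p q \<longleftrightarrow> (\<exists>n. rd w p (enc_nat n) q)"
  proof
    assume l: ?l
    have "\<forall>l<k + 5. \<rho> (4 + l) p p \<longleftrightarrow> reached w z k l p" if "p < length w" for p
      using that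
    proof (induction p rule: less_induct)
      case (less p)
      have "\<rho> (4 + l') q q \<longleftrightarrow> reached w z k l' q" if "l' < k + 5" "q < p" for l' q
        using less.IH[OF that(2)] less.prems that by simp
      then have "reach_clause k w \<rho> l' p \<longleftrightarrow> reached w z k l' p" if "l' < k + 5" for l'
        using that less.prems by (intro reach_clause_iff) (use R0 in auto)
      then show ?case using l less.prems by simp
    qed
    then show ?r by blast
  next
    assume r: ?r
    have "reach_clause k w \<rho> l p \<longleftrightarrow> reached w z k l p" if "l < k + 5" "p < length w" for l p
      using that by (intro reach_clause_iff) (use R0 r in auto)
    then show ?l using r by simp
  qed
  show ?thesis unfolding decoded_def truthful_def 0 by (intro conj_cong refl 1 2; assumption)
qed

end

section \<open>Items and comparisons read off the decoded relations\<close>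

definition is_item :: "nat \<Rightarrow> nat list \<Rightarrow> (nat \<Rightarrow> nat \<Rightarrow> nat \<Rightarrow> bool) \<Rightarrow> nat \<Rightarrow> nat \<Rightarrow> bool" where
  "is_item k w \<rho> l p \<longleftrightarrow> p < length w \<and> l < k + 4 \<and> \<rho> (4 + l) p p \<and>
     (\<exists>q<length w. component (length w) (\<lambda>p q. \<rho> 0 p q) (arity l) p q)"

definition compares :: "nat list \<Rightarrow> (nat \<Rightarrow> nat \<Rightarrow> nat \<Rightarrow> bool) \<Rightarrow> nat \<Rightarrow> nat \<Rightarrow> nat \<Rightarrow> nat \<Rightarrow> nat \<Rightarrow> bool" where
  "compares w \<rho> a j p j' q \<longleftrightarrow> (\<exists>r<length w. \<exists>r'<length w. component (length w) (\<lambda>p q. \<rho> 0 p q) j p r \<and>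
     component (length w) (\<lambda>p q. \<rho> 0 p q) j' q r' \<and> \<rho> a r r')"

text \<open>The second component of an item is compared with 3: the code of 3 is
  \<open>01 01 10\<close>, and the numbers up to 3 are those with at most two digits. The flag
  selects equality or the bound.\<close>

definition time_check :: "nat list \<Rightarrow> (nat \<Rightarrow> nat \<Rightarrow> nat \<Rightarrow> bool) \<Rightarrow> bool \<Rightarrow> nat \<Rightarrow> bool" where
  "time_check w \<rho> b p \<longleftrightarrow> (\<exists>r<length w. component (length w) (\<lambda>p q. \<rho> 0 p q) 1 p r \<and>
     (b \<and> token w r False True \<and> (\<exists>s<length w. skip2 w r s \<and> token w s False True \<and>
         (\<exists>s'<length w. skip2 w s s' \<and> token w s' True False)) \<or>
      \<not> b \<and> (token w r True False \<or> (\<exists>s<length w. skip2 w r s \<and> (token w s True False \<or>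
         (\<exists>s'<length w. skip2 w s s' \<and> token w s' True False))))))"

definition item_at :: "nat list \<Rightarrow> nat \<Rightarrow> nat \<Rightarrow> nat list \<Rightarrow> bool" where
  "item_at w l p e \<longleftrightarrow> length e = arity l \<and> (\<exists>q. rd w p (enc_tuple e) q)"

definition the_item :: "nat list \<Rightarrow> nat \<Rightarrow> nat \<Rightarrow> nat list" where
  "the_item w l p = (THE e. item_at w l p e)"

lemma item_at_unique: "item_at w l p e \<Longrightarrow> item_at w l p e' \<Longrightarrow> e = e'"
  unfolding item_at_def by (metis rd_compare tuple_code)

lemma the_item: "item_at w l p e \<Longrightarrow> the_item w l p = e"
  unfolding the_item_def by (rule the_equality) (auto intro: item_at_unique)

lemma nth_lists_of:
  "lists_of vs es tvs tes rs ! 0 = map (\<lambda>v. [v]) vs" "lists_of vs es tvs tes rs ! 1 = map pair_list es"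
  "lists_of vs es tvs tes rs ! 2 = map pair_list tvs"
  "lists_of vs es tvs tes rs ! 3 = map (\<lambda>(a, b). pair_list a @ pair_list b) tes"
  "i < length rs \<Longrightarrow> lists_of vs es tvs tes rs ! (i + 4) = map pair_list (rs ! i)"
  by (simp_all add: lists_of_def One_nat_def numeral_eq_Suc)

lemma well_shaped_lists_of_lists:
  assumes "length rs = k"
  shows "well_shaped (lists_of vs es tvs tes rs)"
proof -
  let ?LL = "lists_of vs es tvs tes rs"
  have p: "length (pair_list a) = 2" for a by (simp add: pair_list_def case_prod_beta)
  have "\<forall>e \<in> set (?LL ! l). length e = arity l" if "l < length ?LL" for l
  proof -
    have "l < length rs + 4" using that by (simp add: lists_of_def)
    then have "l = 0 \<or> l = 1 \<or> l = 2 \<or> l = 3 \<or> (\<exists>i < length rs. l = i + 4)"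
      using le_add_diff_inverse2[of 4 l] by (cases "l < 4") (linarith, metis add_less_cancel_right not_less)
    then show ?thesis
      by (elim disjE exE conjE) (auto simp: nth_lists_of arity_def p)
  qed
  then show ?thesis unfolding well_shaped_def by blast
qed

lemma enc_items_strict:
  assumes "i < j" "j \<le> length l" "\<And>e. e \<in> set l \<Longrightarrow> e \<noteq> []"
  shows "length (enc_items (take i l)) < length (enc_items (take j l))"
proof -
  have "take j l = take i l @ l ! i # take (j - Suc i) (drop (Suc i) l)"
    using assms(1,2) by (metis Cons_nth_drop_Suc Suc_diff_Suc le_add_diff_inverse less_imp_le_nat less_le_trans take_Suc_Cons take_add)
  moreover have "enc_tuple (l ! i) \<noteq> []" using assms by (intro enc_tuple_nonempty assms(3)) simp
  ultimately show ?thesis by simp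
qed

context readable
begin

lemma is_item_iff:
  assumes T: "truthful k w z \<rho>"
  shows "is_item k w \<rho> l p \<longleftrightarrow> p < length w \<and> l < k + 4 \<and> reached w z k l p \<and> (\<exists>e. item_at w l p e)"
proof -
  have R0: "\<And>p q. p < length w \<Longrightarrow> q < length w \<Longrightarrow> \<rho> 0 p q \<longleftrightarrow> (\<exists>n. rd w p (enc_nat n) q)"
    using T unfolding truthful_def by blast
  have "\<rho> (4 + l) p p \<longleftrightarrow> reached w z k l p" if "p < length w" "l < k + 4"
    using T that unfolding truthful_def by simp
  moreover have "(\<exists>q<length w. component (length w) (\<lambda>p q. \<rho> 0 p q) (arity l) p q) \<longleftrightarrow> (\<exists>e. item_at w l p e)" if "p < length w"
    using component_iff[of "\<lambda>p q. \<rho> 0 p q", OF R0 that] rd_inside[OF _ that] unfolding item_at_def by blast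
  ultimately show ?thesis unfolding is_item_def by blast
qed

lemma component_at:
  assumes T: "truthful k w z \<rho>" and p: "p < length w" and e: "item_at w l p e" and j: "j < arity l"
  obtains r where "r < length w" "num_at w r (e ! j)" "\<And>r'. component (length w) (\<lambda>p q. \<rho> 0 p q) j p r' \<longleftrightarrow> r' = r"
proof -
  have R0: "\<And>p q. p < length w \<Longrightarrow> q < length w \<Longrightarrow> \<rho> 0 p q \<longleftrightarrow> (\<exists>n. rd w p (enc_nat n) q)"
    using T unfolding truthful_def by blast
  have le: "length e = arity l" using e by (simp add: item_at_def)
  obtain q where "rd w p (enc_tuple e) q" using e unfolding item_at_def by blast
  moreover have "e = take j e @ e ! j # drop (Suc j) e" using j le by (intro id_take_nth_drop) simp
  then have "enc_tuple e = enc_tuple (take j e) @ enc_nat (e ! j) @ enc_tuple (drop (Suc j) e)"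
    by (metis enc_tuple_Cons enc_tuple_append)
  ultimately obtain r where r: "rd w p (enc_tuple (take j e)) r" "num_at w r (e ! j)"
    unfolding num_at_def by (auto simp: rd_append)
  have "component (length w) (\<lambda>p q. \<rho> 0 p q) j p r' \<longleftrightarrow> r' = r" for r'
  proof -
    have "r' = r" if e': "length e' = j" "rd w p (enc_tuple e') r'" for e'
    proof -
      obtain s t where st: "enc_tuple e' @ s = enc_tuple (take j e) @ t" using rd_compare[OF e'(2) r(1)] by blast
      have "length e' = length (take j e)" using e'(1) j le by simp
      from tuple_code[OF this st] have "e' = take j e" ..
      then show ?thesis using rd_length[OF e'(2)] rd_length[OF r(1)] by simp
    qed
    moreover have "length (take j e) = j" using j le by simp
    ultimately show ?thesis using component_iff[of "\<lambda>p q. \<rho> 0 p q", OF R0 p, of j r'] r(1) by blast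
  qed
  then show ?thesis using that r rd_inside[OF r(1) p] by blast
qed

lemma item_positions_truthful:
  assumes T: "truthful k w z \<rho>"
  shows "item_positions k (length w) (is_item k w \<rho>) (compares w \<rho>) (time_check w \<rho>) (\<lambda>l p j. the_item w l p ! j)"
proof -
  have C: "(compares w \<rho> 1 j p j' q \<longleftrightarrow> the_item w l p ! j = the_item w l' q ! j') \<and>
    (compares w \<rho> 2 j p j' q \<longleftrightarrow> the_item w l' q ! j' = Suc (the_item w l p ! j)) \<and>
    (compares w \<rho> 3 j p j' q \<longleftrightarrow> the_item w l p ! j \<le> the_item w l' q ! j')"
    if i: "is_item k w \<rho> l p" "is_item k w \<rho> l' q" and j: "j < arity l" "j' < arity l'" for l l' p q j j'
  proof -
    obtain e e' where e: "p < length w" "item_at w l p e" "q < length w" "item_at w l' q e'"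
      using i unfolding is_item_iff[OF T] by blast
    obtain r where r: "r < length w" "num_at w r (e ! j)" "\<And>s. component (length w) (\<lambda>p q. \<rho> 0 p q) j p s \<longleftrightarrow> s = r"
      using component_at[OF T e(1,2) j(1)] by blast
    obtain r' where r': "r' < length w" "num_at w r' (e' ! j')" "\<And>s. component (length w) (\<lambda>p q. \<rho> 0 p q) j' q s \<longleftrightarrow> s = r'"
      using component_at[OF T e(3,4) j(2)] by blast
    have "compares w \<rho> a j p j' q \<longleftrightarrow> \<rho> a r r'" for a
      unfolding compares_def r(3) r'(3) using r(1) r'(1) by blast
    moreover have "(\<rho> 1 r r' \<longleftrightarrow> e ! j = e' ! j') \<and> (\<rho> 2 r r' \<longleftrightarrow> e' ! j' = Suc (e ! j)) \<and> (\<rho> 3 r r' \<longleftrightarrow> e ! j \<le> e' ! j')"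
      using T r(1,2) r'(1,2) unfolding truthful_def by blast
    ultimately show ?thesis using the_item[OF e(2)] the_item[OF e(4)] by simp
  qed
  have B: "(time_check w \<rho> True p \<longleftrightarrow> the_item w 2 p ! 1 = 3) \<and> (time_check w \<rho> False p \<longleftrightarrow> the_item w 2 p ! 1 \<le> 3)"
    if i: "is_item k w \<rho> 2 p" for p
  proof -
    obtain e where e: "p < length w" "item_at w 2 p e" using i unfolding is_item_iff[OF T] by blast
    obtain r where r: "r < length w" "num_at w r (e ! 1)" "\<And>s. component (length w) (\<lambda>p q. \<rho> 0 p q) 1 p s \<longleftrightarrow> s = r"
      by (rule component_at[OF T e, of 1]) (simp_all add: arity_def)
    define n where "n = e ! 1"
    have n: "num_at w r n" using r(2) by (simp add: n_def)
    note t = num_at_token(1,2)[OF n]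
    have s: "(\<exists>s<length w. skip2 w r s \<and> P s) \<longleftrightarrow> P (r + 2)" if "n \<noteq> 0" for P
      using num_at_token(4,5)[OF n that] by auto
    note t2 = num_at_token(1,2)[OF num_at_token(3)[OF n]]
    have s2: "(\<exists>s<length w. skip2 w (r + 2) s \<and> P s) \<longleftrightarrow> P (r + 2 + 2)" if "n \<noteq> 0" "n div 2 \<noteq> 0" for P
      using num_at_token(4,5)[OF num_at_token(3)[OF n that(1)] that(2)] by auto
    note t3 = num_at_token(1)[OF num_at_token(3)[OF num_at_token(3)[OF n]]]
    have T: "time_check w \<rho> True p \<longleftrightarrow> token w r False True \<and> (\<exists>s<length w. skip2 w r s \<and> token w s False True \<and>
         (\<exists>s'<length w. skip2 w s s' \<and> token w s' True False))"
      and F: "time_check w \<rho> False p \<longleftrightarrow> token w r True False \<or> (\<exists>s<length w. skip2 w r s \<and> (token w s True False \<or>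
         (\<exists>s'<length w. skip2 w s s' \<and> token w s' True False)))"
      unfolding time_check_def r(3) using r(1) by simp_all
    consider "n = 0" | "n \<noteq> 0" "n div 2 = 0" | "n \<noteq> 0" "n div 2 \<noteq> 0" by blast
    then have "(time_check w \<rho> True p \<longleftrightarrow> n \<noteq> 0 \<and> odd n \<and> n div 2 \<noteq> 0 \<and> odd (n div 2) \<and> n div 2 div 2 = 0) \<and>
      (time_check w \<rho> False p \<longleftrightarrow> n = 0 \<or> n div 2 = 0 \<or> n div 2 div 2 = 0)"
    proof cases
      case 1
      then show ?thesis unfolding T F t by simp
    next
      case 2
      then show ?thesis unfolding T F t s[OF 2(1)] t2[OF 2(1)] by simp
    next
      case 3
      then show ?thesis unfolding T F t s[OF 3(1)] t2[OF 3(1)] s2[OF 3] t3[OF 3] by simp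
    qed
    note 1 = conjunct1[OF this] and 2 = conjunct2[OF this]
    have "n = 3 \<longleftrightarrow> n \<noteq> 0 \<and> odd n \<and> n div 2 \<noteq> 0 \<and> odd (n div 2) \<and> n div 2 div 2 = 0"
      "n \<le> 3 \<longleftrightarrow> n = 0 \<or> n div 2 = 0 \<or> n div 2 div 2 = 0" by presburger+
    then show ?thesis unfolding 1 2 using the_item[OF e(2)] n_def by simp
  qed
  show ?thesis
    by unfold_locales (use C B in \<open>auto simp: is_item_def\<close>)
qed

text \<open>The position \<open>ps i\<close> is the start of the \<open>i\<close>-th entry of the
  list. Entries have nonempty codes, so these positions differ, and repetitions in the list are
  exactly equal items at different positions.\<close>

lemma listed_items:
  assumes LL: "length LL = k + 4" "well_shaped LL" "rd w z (enc_lists LL) q0" and l: "l < k + 4" and T: "truthful k w z \<rho>"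
  shows "the_item w l ` {p. is_item k w \<rho> l p} = set (LL ! l)"
    "inj_on (the_item w l) {p. is_item k w \<rho> l p} \<longleftrightarrow> distinct (LL ! l)"
proof -
  define ps where "ps i = z + length (enc_lists (take l LL) @ enc_items (take i (LL ! l)))" for i
  let ?n = "length (LL ! l)"
  have ar: "\<forall>e \<in> set (LL ! l). length e = arity l" using LL(1,2) l by (simp add: well_shaped_def)
  have split: "enc_lists LL = enc_lists (take l LL) @ enc_list enc_tuple (LL ! l) @ enc_lists (drop (Suc l) LL)"
    using id_take_nth_drop[of l LL] LL(1) l by (metis enc_lists_Cons enc_lists_append)
  have at: "\<exists>i<?n. e = LL ! l ! i \<and> p = ps i" if "reached w z k l p" and e: "item_at w l p e" for p e
  proof -
    from that(1) obtain LL' es where L: "length LL' = l" "well_shaped LL'" "\<forall>e \<in> set es. length e = arity l"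
      "rd w z (enc_lists LL' @ enc_items es) p" unfolding reached_def by blast
    obtain q where "rd w p (enc_tuple e) q" using e unfolding item_at_def by blast
    then have "rd w z ((enc_lists LL' @ enc_items es) @ enc_tuple e) q" using L(4) rd_append by blast
    from rd_compare[OF this LL(3)] obtain s t where
      "enc_lists LL' @ (enc_items (es @ [e]) @ s) = enc_lists (take l LL) @ (enc_list enc_tuple (LL ! l) @ (enc_lists (drop (Suc l) LL) @ t))"
      unfolding split by auto
    then have "LL' = take l LL \<and> enc_items (es @ [e]) @ s = enc_list enc_tuple (LL ! l) @ (enc_lists (drop (Suc l) LL) @ t)"
      by (rule lists_code[where a = arity, rotated]) (use L(1,2) LL(1,2) l in \<open>auto simp: well_shaped_def arity_pos\<close>)
    then have L': "LL' = take l LL" "enc_items (es @ [e]) @ s = enc_list enc_tuple (LL ! l) @ (enc_lists (drop (Suc l) LL) @ t)" by blast+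
    have len: "\<forall>e' \<in> set (es @ [e]) \<union> set (LL ! l). length e' = arity l" using L(3) e ar by (auto simp: item_at_def)
    from items_code[OF L'(2) len arity_pos] have i: "length es < ?n" "es @ [e] = take (Suc (length es)) (LL ! l)" by auto
    then have "es = take (length es) (LL ! l)" "e = LL ! l ! length es" by (auto simp: take_Suc_conv_app_nth)
    moreover from this have "p = ps (length es)" using rd_length[OF L(4)] L'(1) by (simp add: ps_def)
    ultimately show ?thesis using i(1) by blast
  qed
  have pos: "reached w z k l (ps i) \<and> item_at w l (ps i) (LL ! l ! i) \<and> ps i < length w" if i: "i < ?n" for i
  proof -
    have "enc_items (LL ! l) = enc_items (take i (LL ! l)) @ enc_tuple (LL ! l ! i) @ enc_items (drop (Suc i) (LL ! l))"
      using id_take_nth_drop[OF i] by (metis concat.simps(2) concat_append list.simps(9) map_append)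
    then have "rd w z ((enc_lists (take l LL) @ enc_items (take i (LL ! l))) @ enc_tuple (LL ! l ! i) @
        (enc_items (drop (Suc i) (LL ! l)) @ [True, True] @ enc_lists (drop (Suc l) LL))) q0"
      using LL(3) unfolding split by (simp add: enc_list_def)
    then obtain r r' where r: "rd w z (enc_lists (take l LL) @ enc_items (take i (LL ! l))) r" "rd w r (enc_tuple (LL ! l ! i)) r'"
      unfolding rd_append[of _ _ "_ @ _" "enc_tuple _ @ _"] rd_append[of _ _ "enc_tuple (LL ! l ! i)"] by blast
    have "r = ps i" using rd_length[OF r(1)] by (simp add: ps_def)
    moreover have "reached w z k l r" unfolding reached_def
      by (intro exI[of _ "take l LL"] exI[of _ "take i (LL ! l)"])
        (use LL(1,2) l r(1) ar in \<open>auto simp: well_shaped_def dest: in_set_takeD\<close>)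
    moreover have "item_at w l r (LL ! l ! i)" unfolding item_at_def using r(2) ar i by auto
    ultimately show ?thesis using rd_inside[OF r(1) z(1)] by simp
  qed
  have I: "{p. is_item k w \<rho> l p} = ps ` {..<?n}"
    using at pos l unfolding is_item_iff[OF T] by blast
  have ps: "inj_on ps {..<?n}"
  proof (rule linorder_inj_onI')
    fix i j assume ij: "i \<in> {..<?n}" "j \<in> {..<?n}" "i < j"
    have "length (enc_items (take i (LL ! l))) < length (enc_items (take j (LL ! l)))"
      by (rule enc_items_strict) (use ij ar arity_pos[of l] in auto)
    then show "ps i \<noteq> ps j" by (simp add: ps_def)
  qed
  have it: "the_item w l (ps i) = LL ! l ! i" if "i < ?n" for i using pos[OF that] the_item by blast
  show "the_item w l ` {p. is_item k w \<rho> l p} = set (LL ! l)"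
    unfolding I image_image using it by (auto simp: in_set_conv_nth image_iff) 
  have "inj_on (the_item w l) {p. is_item k w \<rho> l p} \<longleftrightarrow> inj_on (the_item w l \<circ> ps) {..<?n}"
    unfolding I by (rule comp_inj_on_iff[OF ps])
  also have "\<dots> \<longleftrightarrow> inj_on ((!) (LL ! l)) {..<?n}" by (rule inj_on_cong) (simp add: it)
  also have "\<dots> \<longleftrightarrow> distinct (LL ! l)" by (auto simp: inj_on_def distinct_conv_nth)
  finally show "inj_on (the_item w l) {p. is_item k w \<rho> l p} \<longleftrightarrow> distinct (LL ! l)" .
qed

lemma decoded_items:
  assumes LL: "length LL = k + 4" "well_shaped LL" "rd w z (enc_lists LL) q0" and l: "l < k + 4" and T: "truthful k w z \<rho>"
    and f: "LL ! l = map f xs" "\<And>x. g (f x) = x"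
  shows "(\<lambda>p. g (the_item w l p)) ` {p. is_item k w \<rho> l p} = set xs"
    "inj_on (\<lambda>p. g (the_item w l p)) {p. is_item k w \<rho> l p} \<longleftrightarrow> distinct xs"
proof -
  note li = listed_items[OF LL l T, unfolded f(1)]
  have inj: "inj f" using f(2) by (metis injI)
  have "(\<lambda>p. g (the_item w l p)) ` {p. is_item k w \<rho> l p} = g ` (the_item w l ` {p. is_item k w \<rho> l p})" by (simp add: image_image)
  then show "(\<lambda>p. g (the_item w l p)) ` {p. is_item k w \<rho> l p} = set xs" unfolding li by (simp add: image_image f(2))
  have "inj_on g (the_item w l ` {p. is_item k w \<rho> l p})" unfolding li using f(2) by (auto simp: inj_on_def)
  then have "inj_on (g \<circ> the_item w l) {p. is_item k w \<rho> l p} \<longleftrightarrow> inj_on (the_item w l) {p. is_item k w \<rho> l p}"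
    using comp_inj_on inj_on_imageI2 by blast
  then show "inj_on (\<lambda>p. g (the_item w l p)) {p. is_item k w \<rho> l p} \<longleftrightarrow> distinct xs"
    unfolding li comp_def using inj_on_subset[OF inj subset_UNIV] by (simp add: distinct_map)
qed

lemma consistent_cong: "(\<And>i. i < k \<Longrightarrow> R i = R' i) \<Longrightarrow> consistent k life V E X Y R = consistent k life V E X Y R'"
  unfolding consistent_def by (simp cong: imp_cong)

theorem valid_iff_consistent:
  assumes rs: "length rs = k" and q0: "rd w z (enc_lists (lists_of vs es tvs tes rs)) q0" and T: "truthful k w z \<rho>"
  shows "(\<exists>F J. valid k life (length w) (is_item k w \<rho>) (compares w \<rho>) (time_check w \<rho>) F J) \<longleftrightarrow>
    distinct vs \<and> distinct es \<and> distinct tvs \<and> distinct tes \<and> list_all distinct rs \<and>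
    consistent k life (set vs) (set es) (set tvs) (set tes) (\<lambda>i. set (rs ! i))"
proof -
  interpret item_positions k "length w" life "is_item k w \<rho>" "compares w \<rho>" "time_check w \<rho>" "\<lambda>l p j. the_item w l p ! j"
    by (rule item_positions_truthful[OF T])
  let ?LL = "lists_of vs es tvs tes rs"
  have len: "length ?LL = k + 4" using rs by (simp add: lists_of_def)
  note nth = nth_lists_of[where vs = vs and es = es and tvs = tvs and tes = tes and rs = rs, unfolded rs]
  have ars: "well_shaped ?LL" by (rule well_shaped_lists_of_lists[OF rs])
  note D = decoded_items[OF len ars q0 _ T]
  have to_pair: "to_pair (pair_list a) = a" for a by (simp add: to_pair_def pair_list_def case_prod_beta)
  have V: "(\<lambda>p. the_item w 0 p ! 0) ` {p. is_item k w \<rho> 0 p} = set vs"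
    "inj_on (\<lambda>p. the_item w 0 p ! 0) {p. is_item k w \<rho> 0 p} \<longleftrightarrow> distinct vs"
    using D[OF _ nth(1), of "\<lambda>e. e ! 0"] by simp_all
  have pr: "pr l = (\<lambda>p. to_pair (the_item w l p))" for l by (simp add: fun_eq_iff pr_def to_pair_def)
  have E: "pr 1 ` {p. is_item k w \<rho> 1 p} = set es" "inj_on (pr 1) {p. is_item k w \<rho> 1 p} \<longleftrightarrow> distinct es"
    unfolding pr using D[OF _ nth(2), of to_pair] to_pair by simp_all
  have X: "pr 2 ` {p. is_item k w \<rho> 2 p} = set tvs" "inj_on (pr 2) {p. is_item k w \<rho> 2 p} \<longleftrightarrow> distinct tvs"
    unfolding pr using D[OF _ nth(3), of to_pair] to_pair by simp_all
  have R: "pr (i + 4) ` {p. is_item k w \<rho> (i + 4) p} = set (rs ! i)"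
    "inj_on (pr (i + 4)) {p. is_item k w \<rho> (i + 4) p} \<longleftrightarrow> distinct (rs ! i)" if "i < k" for i
    unfolding pr using D[OF _ nth(5)[OF that], of to_pair] to_pair that by simp_all
  have ed: "ed = (\<lambda>p. (\<lambda>e. ((e ! 0, e ! 1), (e ! 2, e ! 3))) (the_item w 3 p))" by (simp add: fun_eq_iff ed_def)
  have Y: "ed ` {p. is_item k w \<rho> 3 p} = set tes" "inj_on ed {p. is_item k w \<rho> 3 p} \<longleftrightarrow> distinct tes"
    unfolding ed using D[OF _ nth(4), of "\<lambda>e. ((e ! 0, e ! 1), (e ! 2, e ! 3))"]
    by (simp_all add: pair_list_def case_prod_beta One_nat_def numeral_eq_Suc)
  have "(\<forall>i<k. inj_on (pr (i + 4)) {p. is_item k w \<rho> (i + 4) p}) \<longleftrightarrow> list_all distinct rs"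
    using R(2) rs by (auto simp: list_all_length)
  moreover have "consistent k life (set vs) (set es) (set tvs) (set tes) (\<lambda>i. pr (i + 4) ` {p. is_item k w \<rho> (i + 4) p}) \<longleftrightarrow>
    consistent k life (set vs) (set es) (set tvs) (set tes) (\<lambda>i. set (rs ! i))" by (rule consistent_cong) (simp add: R(1))
  ultimately show ?thesis unfolding valid_iff consistent_positions_def V E X Y by simp
qed

end

lemma readable_word:
  assumes "length x < Z"
  shows "readable (word Z x) Z"
proof
  fix p b assume "bit_at (word Z x) p b"
  from bit_at_word[OF assms this] show "Suc p < length (word Z x)" using assms by simp
next
  fix q assume "q < length (word Z x)"
  then show "centre (word Z x) q \<longleftrightarrow> q = Z" using centre_word by simp
qed simp

text \<open>Two readings that stop only where no bit follows have the same extent. This identifies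
  the parsed lists with the whole input.\<close>

lemma rd_maximal:
  assumes "rd w p s q" "rd w p t r" "\<And>b. \<not> bit_at w q b" "\<And>b. \<not> bit_at w r b"
  shows "s = t"
  using assms
proof (induction s arbitrary: p t)
  case Nil
  then show ?case by (cases t) auto
next
  case (Cons b s)
  show ?case
  proof (cases t)
    case Nil
    then show ?thesis using Cons.prems by auto
  next
    case (Cons c t')
    then have "b = c" using bit_at_unique[of w p b c] Cons.prems(1,2) by simp
    then show ?thesis using Cons.IH[of "Suc p" t'] Cons.prems Cons by simp
  qed
qed

text \<open>Layout of the guess: relations 0 to \<open>k + 8\<close> describe the parse, the next
  \<open>k\<close> the chosen temporal edges on the diagonal, and the last \<open>k\<close> the
  orders; \<open>3 * k + 9\<close> in total. The second conjunct says that all lists have been read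
  exactly when the input ends.\<close>

definition certified :: "nat \<Rightarrow> bool \<Rightarrow> nat list \<Rightarrow> (nat \<Rightarrow> nat \<Rightarrow> nat \<Rightarrow> bool) \<Rightarrow> bool" where
  "certified k life w \<rho> \<longleftrightarrow> decoded k w \<rho> \<and>
     (\<exists>p<length w. \<rho> (4 + (k + 4)) p p \<and> \<not> bit_at w p True \<and> \<not> bit_at w p False) \<and>
     valid k life (length w) (is_item k w \<rho>) (compares w \<rho>) (time_check w \<rho>)
       (\<lambda>i p. \<rho> (k + 9 + i) p p) (\<lambda>i p q. \<rho> (2 * k + 9 + i) p q)"

lemma exists_rel:
  "\<exists>g. length g = length w * length w \<and> set g \<subseteq> {1..<2 ^ M + 1} \<and>
    (\<forall>a<M. \<forall>p<length w. \<forall>q<length w. rel w g a p q = \<rho> a p q)"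
proof -
  let ?U = "length w"
  let ?bs = "\<lambda>i. map (\<lambda>a. \<rho> a (i div ?U) (i mod ?U)) [0..<M]"
  define g where "g = map (\<lambda>i. 1 + horner_sum of_bool 2 (?bs i) :: nat) [0..<?U * ?U]"
  have "horner_sum of_bool 2 (?bs i) < (2::nat) ^ M" for i
    using horner_sum_of_bool_2_less[of "?bs i", where ?'a = nat] by simp
  then have "set g \<subseteq> {1..<2 ^ M + 1}" by (auto simp: g_def)
  moreover have "rel w g a p q = \<rho> a p q" if "a < M" "p < ?U" "q < ?U" for a p q
  proof -
    have "p * ?U + q < ?U * ?U"
      using that(2,3) by (metis add_less_mono1 le_trans less_le_trans mult_Suc mult_le_mono1 Suc_leI add.commute nat_add_left_cancel_less)
    moreover have "(p * ?U + q) div ?U = p" by (rule div_nat_eqI) (use that(3) in \<open>simp_all add: mult.commute\<close>)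
    moreover have "(p * ?U + q) mod ?U = q" using that(3) by simp
    ultimately show ?thesis using that(1) by (simp add: rel_def g_def bit_horner_sum_bit_iff)
  qed
  ultimately show ?thesis by (intro exI[of _ g]) (simp add: g_def)
qed

lemma valid_cong:
  assumes "valid k life U I C B F J"
    and I: "\<And>l p. l < k + 4 \<Longrightarrow> p < U \<Longrightarrow> I' l p = I l p"
    and C: "\<And>a j p j' q. a < 4 \<Longrightarrow> p < U \<Longrightarrow> q < U \<Longrightarrow> C' a j p j' q = C a j p j' q"
    and B: "\<And>b p. p < U \<Longrightarrow> B' b p = B b p"
    and F: "\<And>i p. i < k \<Longrightarrow> p < U \<Longrightarrow> F' i p = F i p"
    and J: "\<And>i p q. i < k \<Longrightarrow> p < U \<Longrightarrow> q < U \<Longrightarrow> J' i p q = J i p q"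
  shows "valid k life U I' C' B' F' J'"
proof -
  have "valid k life U I' C' B' F' J' = valid k life U I C B F J"
    unfolding valid_def leaves_def into_def waits_def
    by (intro conj_cong disj_cong imp_cong all_cong1 ex_cong1 arg_cong[where f = Not] refl I C B F J;
        (assumption | simp (no_asm); assumption?))
  then show ?thesis using assms(1) by simp
qed

lemma component_cong:
  assumes "\<And>p q. p < U \<Longrightarrow> q < U \<Longrightarrow> R p q = R' p q" "p < U"
  shows "component U R j p r = component U R' j p r"
  using assms(2) by (induction j arbitrary: p) (auto simp: assms(1))

text \<open>The parse relations of a certificate are forced by \<open>decoded_iff\<close>, so its
  only freedom is in the chosen edges and the orders. A solvable instance supplies these through
  \<open>valid_iff_consistent\<close>.\<close>

theorem problem_iff_certified:
  assumes Z: "length x < Z"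
  defines "w \<equiv> word Z x"
  shows "x \<in> problem k life \<longleftrightarrow>
    (\<exists>g. length g = length w * length w \<and> set g \<subseteq> {1..<2 ^ (3 * k + 9) + 1} \<and> certified k life w (rel w g))"
proof -
  interpret readable w Z unfolding w_def by (rule readable_word[OF Z])
  have whole: "rd w Z x (Z + length x)" using rd_word_drop[OF Z, of 0] by (simp add: w_def)
  have nobit: "\<not> bit_at w (Z + length x) b" for b using bit_at_word[OF Z] unfolding w_def by fastforce
  show ?thesis
  proof
    assume "x \<in> problem k life"
    then obtain vs es tvs tes rs where l: "length rs = k" "distinct vs" "distinct es" "distinct tvs" "distinct tes"
      "list_all distinct rs" "consistent k life (set vs) (set es) (set tvs) (set tes) (\<lambda>i. set (rs ! i))"
      "x = enc_lists (lists_of vs es tvs tes rs)" unfolding problem_iff_lists by blast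
    define tr where "tr a p q \<longleftrightarrow> (if a = 0 then \<exists>n. rd w p (enc_nat n) q
      else if a < 4 then \<exists>n m. num_at w p n \<and> num_at w q m \<and> (if a = 1 then n = m else if a = 2 then m = Suc n else n \<le> m)
      else reached w Z k (a - 4) p)" for a p q
    have num_unique: "n = m" if "num_at w p n" "num_at w p m" for p n m
      using that unfolding num_at_def by (metis rd_compare prefix_codeD[OF prefix_code_nat])
    have T: "truthful k w Z tr" unfolding truthful_def
    proof (intro conjI allI impI)
      fix p q n m assume "num_at w p n" "num_at w q m"
      then have u: "(\<exists>n' m'. num_at w p n' \<and> num_at w q m' \<and> P n' m') \<longleftrightarrow> P n m" for P using num_unique by metis
      show "tr 1 p q \<longleftrightarrow> n = m" using u[of "(=)"] by (simp add: tr_def)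
      show "tr 2 p q \<longleftrightarrow> m = Suc n" using u[of "\<lambda>n m. m = Suc n"] by (simp add: tr_def)
      show "tr 3 p q \<longleftrightarrow> n \<le> m" using u[of "(\<le>)"] by (simp add: tr_def)
    qed (simp_all add: tr_def)
    obtain F J where FJ: "valid k life (length w) (is_item k w tr) (compares w tr) (time_check w tr) F J"
      using valid_iff_consistent[OF l(1) _ T, of vs es tvs tes "Z + length x" life] whole l by auto
    define \<rho> where "\<rho> a p q = (if a < k + 9 then tr a p q else if a < 2 * k + 9 then F (a - (k + 9)) p else J (a - (2 * k + 9)) p q)" for a p q
    obtain g where g: "length g = length w * length w" "set g \<subseteq> {1..<2 ^ (3 * k + 9) + 1}"
      "\<And>a p q. a < 3 * k + 9 \<Longrightarrow> p < length w \<Longrightarrow> q < length w \<Longrightarrow> rel w g a p q = \<rho> a p q"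
      using exists_rel[of w "3 * k + 9" \<rho>] by blast
    have tr: "rel w g a p q = tr a p q" if "a < k + 9" "p < length w" "q < length w" for a p q
      using g(3)[of a p q] that by (simp add: \<rho>_def)
    have comp: "component (length w) (\<lambda>p q. rel w g 0 p q) j p r = component (length w) (\<lambda>p q. tr 0 p q) j p r" if "p < length w" for j p r
      by (rule component_cong) (use tr that in auto)
    have "truthful k w Z (rel w g)"
      using T unfolding truthful_def by (simp add: tr)
    then have "decoded k w (rel w g)" unfolding decoded_iff .
    moreover have "\<exists>p<length w. rel w g (4 + (k + 4)) p p \<and> \<not> bit_at w p True \<and> \<not> bit_at w p False"
    proof (intro exI[of _ "Z + length x"] conjI)
      show lt: "Z + length x < length w" using Z by (simp add: w_def)
      have "well_shaped (lists_of vs es tvs tes rs)"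
        by (rule well_shaped_lists_of_lists[OF l(1)])
      then have "reached w Z k (k + 4) (Z + length x)" unfolding reached_def
        by (intro exI[of _ "lists_of vs es tvs tes rs"] exI[of _ "[]"]) (use l whole in \<open>simp add: lists_of_def\<close>)
      then show "rel w g (4 + (k + 4)) (Z + length x) (Z + length x)" using tr[of "4 + (k + 4)"] lt by (simp add: tr_def add.commute)
    qed (use nobit in auto)
    moreover have "valid k life (length w) (is_item k w (rel w g)) (compares w (rel w g)) (time_check w (rel w g))
       (\<lambda>i p. rel w g (k + 9 + i) p p) (\<lambda>i p q. rel w g (2 * k + 9 + i) p q)"
      using FJ
    proof (rule valid_cong)
      show "is_item k w (rel w g) l p = is_item k w tr l p" if "p < length w" for l p
        unfolding is_item_def comp[OF that] using tr[of "4 + l" p p] that by auto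
      show "compares w (rel w g) a j p j' q = compares w tr a j p j' q" if "a < 4" "p < length w" "q < length w" for a j p j' q
        unfolding compares_def comp[OF that(2)] comp[OF that(3)] using tr[of a] that by (simp cong: conj_cong)
      show "time_check w (rel w g) b p = time_check w tr b p" if "p < length w" for b p
        unfolding time_check_def comp[OF that] ..
      show "rel w g (k + 9 + i) p p = F i p" if "i < k" "p < length w" for i p
        using g(3)[of "k + 9 + i" p p] that by (simp add: \<rho>_def)
      show "rel w g (2 * k + 9 + i) p q = J i p q" if "i < k" "p < length w" "q < length w" for i p q
        using g(3)[of "2 * k + 9 + i" p q] that by (simp add: \<rho>_def)
    qed
    ultimately show "\<exists>g. length g = length w * length w \<and> set g \<subseteq> {1..<2 ^ (3 * k + 9) + 1} \<and> certified k life w (rel w g)"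
      unfolding certified_def using g(1,2) by blast
  next
    assume "\<exists>g. length g = length w * length w \<and> set g \<subseteq> {1..<2 ^ (3 * k + 9) + 1} \<and> certified k life w (rel w g)"
    then obtain g where c: "decoded k w (rel w g)"
      "\<exists>p<length w. rel w g (4 + (k + 4)) p p \<and> \<not> bit_at w p True \<and> \<not> bit_at w p False"
      "\<exists>F J. valid k life (length w) (is_item k w (rel w g)) (compares w (rel w g)) (time_check w (rel w g)) F J"
      unfolding certified_def by blast
    have T: "truthful k w Z (rel w g)" using c(1) unfolding decoded_iff .
    obtain p where p: "p < length w" "rel w g (4 + (k + 4)) p p" "\<not> bit_at w p True" "\<not> bit_at w p False" using c(2) by blast
    have "\<forall>l<k + 5. \<forall>p<length w. rel w g (4 + l) p p \<longleftrightarrow> reached w Z k l p" using T unfolding truthful_def by (elim conjE)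
    from this[rule_format, of "k + 4" p] have "reached w Z k (k + 4) p" using p(1,2) by simp
    then obtain LL where LL: "length LL = k + 4" "well_shaped LL" "rd w Z (enc_lists LL) p" unfolding reached_def by auto
    have "\<not> bit_at w p b" for b using p by (cases b) auto
    \<comment> \<open>The lists and the input are both read from the centre up to a position without
      a bit.\<close>
    then have x: "enc_lists LL = x" using rd_maximal[OF LL(3) whole] nobit by blast
    obtain vs es tvs tes rs where l: "length rs = k" "LL = lists_of vs es tvs tes rs" using well_shaped_lists_of[OF LL(2,1)] by blast
    show "x \<in> problem k life" unfolding problem_iff_lists
      using valid_iff_consistent[OF l(1) LL(3)[unfolded l(2)] T, of life] c(3) l x by blast
  qed
qed

subsection \<open>First-order definability\<close>

lemma tm_at_less: "tm_at d t \<Longrightarrow> length e = d \<Longrightarrow> \<forall>x \<in> set e. x < n \<Longrightarrow> t e < n"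
  unfolding tm_at_def by auto

lemma FO_bit_at:
  assumes "tm_at d t"
  shows "FO d (\<lambda>w \<rho> e. bit_at w (t e) b)"
  by (rule FO_cong[OF FO_sym[OF assms, of "if b then {3, 6} else {2, 5}"]]) (use assms in \<open>auto simp: bit_at_def dest: tm_at_less\<close>)

lemma FO_token: "tm_at d t \<Longrightarrow> FO d (\<lambda>w \<rho> e. token w (t e) b c)"
  unfolding token_def by (intro FO_ex FO_and FO_Suc FO_bit_at tm_hd tm_tl)

lemma FO_skip2: "tm_at d t \<Longrightarrow> tm_at d u \<Longrightarrow> FO d (\<lambda>w \<rho> e. skip2 w (t e) (u e))"
  unfolding skip2_def by (intro FO_ex FO_and FO_Suc tm_hd tm_tl)

lemma FO_num_clause: "tm_at d t \<Longrightarrow> tm_at d u \<Longrightarrow> FO d (\<lambda>w \<rho> e. num_clause w (\<lambda>p q. \<rho> a p q) (t e) (u e))"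
  unfolding num_clause_def by (intro FO_ex FO_and FO_or FO_token FO_skip2 FO_rel tm_hd tm_tl)

lemma FO_next_digits: "tm_at d t \<Longrightarrow> tm_at d u \<Longrightarrow> FO d (\<lambda>w \<rho> e. next_digits w (\<lambda>p q. \<rho> a p q) (t e) (u e))"
  unfolding next_digits_def by (intro FO_ex FO_and FO_skip2 FO_rel tm_hd tm_tl)

lemma FO_clauses:
  assumes "tm_at d t" "tm_at d u"
  shows "FO d (\<lambda>w \<rho> e. eq_clause w \<rho> (t e) (u e))" "FO d (\<lambda>w \<rho> e. suc_clause w \<rho> (t e) (u e))"
    "FO d (\<lambda>w \<rho> e. le_clause w \<rho> (t e) (u e))"
  unfolding eq_clause_def suc_clause_def le_clause_def
  by (intro FO_ex FO_and FO_or FO_not FO_token FO_skip2 FO_next_digits tm_hd tm_tl assms)+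

lemma FO_component: "tm_at d t \<Longrightarrow> tm_at d u \<Longrightarrow> FO d (\<lambda>w \<rho> e. component (length w) (\<lambda>p q. \<rho> a p q) j (t e) (u e))"
proof (induction j arbitrary: d t u)
  case 0
  then show ?case by (simp add: FO_eq)
next
  case (Suc j)
  show ?case unfolding component.simps by (intro FO_ex FO_and FO_rel Suc.IH tm_hd tm_tl Suc.prems)
qed

lemma FO_reach_clause: "tm_at d t \<Longrightarrow> FO d (\<lambda>w \<rho> e. reach_clause k w \<rho> l (t e))"
  unfolding reach_clause_def
  by (intro FO_ex FO_and FO_or FO_const FO_centre FO_rel FO_component FO_token FO_skip2 tm_hd tm_tl)

lemma FO_decoded: "FO d (\<lambda>w \<rho> e. decoded k w \<rho>)"
  unfolding decoded_def
  by (intro FO_and FO_all FO_ex FO_imp FO_iff FO_all_static FO_rel FO_num_clause FO_clauses FO_reach_clause tm_hd tm_tl)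

lemma FO_is_item: "tm_at d t \<Longrightarrow> FO d (\<lambda>w \<rho> e. is_item k w \<rho> l (t e))"
proof -
  assume t: "tm_at d t"
  have "FO d (\<lambda>w \<rho> e. l < k + 4 \<and> \<rho> (4 + l) (t e) (t e) \<and>
     (\<exists>q<length w. component (length w) (\<lambda>p q. \<rho> 0 p q) (arity l) (t e) q))"
    by (intro FO_and FO_ex FO_const FO_rel FO_component t tm_hd tm_tl)
  then show ?thesis by (rule FO_cong) (use t in \<open>auto simp: is_item_def dest: tm_at_less\<close>)
qed

lemma FO_compares: "tm_at d t \<Longrightarrow> tm_at d u \<Longrightarrow> FO d (\<lambda>w \<rho> e. compares w \<rho> a j (t e) j' (u e))"
  unfolding compares_def by (intro FO_ex FO_and FO_rel FO_component tm_hd tm_tl)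

lemma FO_time_check: "tm_at d t \<Longrightarrow> FO d (\<lambda>w \<rho> e. time_check w \<rho> b (t e))"
  unfolding time_check_def by (intro FO_ex FO_and FO_or FO_const FO_token FO_skip2 FO_component tm_hd tm_tl)

lemma FO_certified: "FO 0 (\<lambda>w \<rho> e. certified k life w \<rho>)"
  unfolding certified_def valid_def leaves_def into_def waits_def
  by (intro FO_and FO_or FO_not FO_imp FO_all FO_ex FO_all_static FO_const FO_rel FO_decoded FO_bit_at FO_is_item FO_compares
      FO_time_check FO_eq tm_hd tm_tl)

theorem problem_in_NP: "problem k life \<in> NP"
  \<comment> \<open>Width \<open>length x + 1\<close> leaves a blank behind the input, as
    \<open>problem_iff_certified\<close> requires; the number of symbols allows for
    \<open>3 * k + 9\<close> bits per table cell.\<close>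
  by (rule FO_NP[OF FO_certified, of _ "\<lambda>x. word (length x + 1) x" "2 ^ (3 * k + 9) + 1" k life 1 0])
    (rule problem_iff_certified, simp_all)

theorem theorem2:
  fixes k :: nat
  assumes "k \<ge> 2"
  shows "NP_complete (disjoint_branchings_problem k) \<and>
         NP_complete (disjoint_branchings_problem_lifetime k 3)"
proof -
  have "disjoint_branchings_problem k = problem k False"
    by (simp add: disjoint_branchings_problem_def problem_def)
  moreover have "disjoint_branchings_problem_lifetime k 3 = problem k True"
    by (simp add: disjoint_branchings_problem_lifetime_def problem_def)
  ultimately show ?thesis
    unfolding NP_complete_def using problem_in_NP NP_reducible[OF _ assms] by simp
qed

end
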